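(* Let $s\in(0,1)$, $p>2$ and $N=sp$. Let $f:\mathbb{R}\to\mathbb{R}$ and $F(t)=\int_0^tf(\tau)d\tau$ satisfy: (f1') $f$ is continuous, odd, has subcritical exponential growth at $+\infty$, and $F(t)\ge0$ for all $t$; (f2) $\lim_{|t|\to0}\frac{f(t)}{|t|^{p-2}t}=0$; (f3) there exists $\theta>2p$ with $f(t)t\ge\theta F(t)>0$ for all $t>0$; (f4') there exist $q>2p$ and $M_1>0$ with $F(t)\ge M_1|t|^q$ for all $t\in\mathbb{R}$; (f5) $t\mapsto f(t)/t^{2p-1}$ is increasing on $(0,+\infty)$. Then the equation $(-\Delta)^s_pu+|u|^{p-2}u+(\ln|\cdot|\ast|u|^p)|u|^{p-2}u=f(u)$ in $\mathbb{R}^N$ has infinitely many solutions in $X$.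
   Context: $W^{s,p}(\mathbb{R}^N)$ is the fractional Sobolev space with norm $\|u\|=([u]_{s,p}^p+\|u\|_p^p)^{1/p}$, $[u]_{s,p}^p=\int\int\frac{|u(x)-u(y)|^p}{|x-y|^{N+sp}}dxdy$. $X=\{u\in W^{s,p}(\mathbb{R}^N):\int\ln(1+|x|)|u|^pdx<\infty\}$. With $k_p=\min\{k\in\mathbb{N}:k\ge p\}$, $R(\alpha,t)=\exp(\alpha|t|^{N/(N-s)})-\sum_{k=0}^{k_p-2}\frac{\alpha^k}{k!}|t|^{\frac{N}{N-s}k}$; $h$ has subcritical exponential growth at $+\infty$ if $\lim_{t\to+\infty}h(t)/R(\alpha,t)=0$ for all $\alpha>0$. The functional is $I(u)=\frac1p\|u\|^p+\frac1{2p}\int\int\ln(|x-y|)|u(x)|^p|u(y)|^pdxdy-\int F(u)dx$ on $X$, and a solution means a critical point of $I$ on $X$ (weak solution tested against all $v\in X$). *)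

theory Defs
  imports "HOL-Analysis.Analysis"
begin

definition gagliardo_p :: "real \<Rightarrow> real \<Rightarrow> ('a::euclidean_space \<Rightarrow> real) \<Rightarrow> ennreal" where
  "gagliardo_p s p u =
     (\<integral>\<^sup>+ x. (\<integral>\<^sup>+ y. ennreal (\<bar>u x - u y\<bar> powr p / norm (x - y) powr (real DIM('a) + s * p)) \<partial>lborel) \<partial>lborel)"

definition Lp_p :: "real \<Rightarrow> ('a::euclidean_space \<Rightarrow> real) \<Rightarrow> ennreal" where
  "Lp_p p u = (\<integral>\<^sup>+ x. ennreal (\<bar>u x\<bar> powr p) \<partial>lborel)"

definition in_Wsp :: "real \<Rightarrow> real \<Rightarrow> ('a::euclidean_space \<Rightarrow> real) \<Rightarrow> bool" where
  "in_Wsp s p u \<longleftrightarrow> u \<in> borel_measurable lborel \<and> Lp_p p u < \<infinity> \<and> gagliardo_p s p u < \<infinity>"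

definition in_X :: "real \<Rightarrow> real \<Rightarrow> ('a::euclidean_space \<Rightarrow> real) \<Rightarrow> bool" where
  "in_X s p u \<longleftrightarrow> in_Wsp s p u \<and>
     (\<integral>\<^sup>+ x. ennreal (ln (1 + norm x) * \<bar>u x\<bar> powr p) \<partial>lborel) < \<infinity>"

definition norm_p :: "real \<Rightarrow> real \<Rightarrow> ('a::euclidean_space \<Rightarrow> real) \<Rightarrow> real" where
  "norm_p s p u = enn2real (gagliardo_p s p u) + enn2real (Lp_p p u)"

definition prim :: "(real \<Rightarrow> real) \<Rightarrow> real \<Rightarrow> real" where
  "prim f t = (LBINT \<tau>=0..t. f \<tau>)"

definition energy :: "real \<Rightarrow> real \<Rightarrow> (real \<Rightarrow> real) \<Rightarrow> ('a::euclidean_space \<Rightarrow> real) \<Rightarrow> real" where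
  "energy s p f u =
     1 / p * norm_p s p u
     + 1 / (2 * p) * (\<integral>x. (\<integral>y. ln (norm (x - y)) * \<bar>u x\<bar> powr p * \<bar>u y\<bar> powr p \<partial>lborel) \<partial>lborel)
     - (\<integral>x. prim f (u x) \<partial>lborel)"

definition critical_point :: "real \<Rightarrow> real \<Rightarrow> (real \<Rightarrow> real) \<Rightarrow> ('a::euclidean_space \<Rightarrow> real) \<Rightarrow> bool" where
  "critical_point s p f u \<longleftrightarrow> in_X s p u \<and>
     (\<forall>v. in_X s p v \<longrightarrow>
        ((\<lambda>t. energy s p f (\<lambda>x. u x + t * v x)) has_real_derivative 0) (at 0))"

definition k_p :: "real \<Rightarrow> nat" where
  "k_p p = (LEAST k::nat. real k \<ge> p)"

definition R_fun :: "real \<Rightarrow> real \<Rightarrow> real \<Rightarrow> real \<Rightarrow> real \<Rightarrow> real" where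
  "R_fun N s p \<alpha> t = exp (\<alpha> * \<bar>t\<bar> powr (N / (N - s)))
     - (\<Sum>k = 0..k_p p - 2. \<alpha> ^ k / fact k * \<bar>t\<bar> powr (N / (N - s) * real k))"

definition subcritical_exp_growth :: "real \<Rightarrow> real \<Rightarrow> real \<Rightarrow> (real \<Rightarrow> real) \<Rightarrow> bool" where
  "subcritical_exp_growth N s p h \<longleftrightarrow>
     (\<forall>\<alpha>>0. ((\<lambda>t. h t / R_fun N s p \<alpha> t) \<longlongrightarrow> 0) at_top)"

end

theory Submission
  imports Defs "HOL-Complex_Analysis.Great_Picard"
begin

text \<open>
  Since \<open>N = s p\<close>, the functional is translation invariant, so the translates of one nontrivial
  critical point already give infinitely many. A nontrivial critical point is obtained as a minimizer
  \<open>w\<close> of \<open>max\<^sub>t\<^sub>\<ge>\<^sub>0 I(t u)\<close> over \<open>u \<noteq> 0\<close>. In the variable \<open>t powr (2 p)\<close> the map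
  \<open>t \<mapsto> I(t u)\<close> is strictly concave by (f5). A minimizing sequence, normalized in \<open>W\<close>, cannot vanish,
  so after translation it keeps mass in a fixed ball; the logarithmic form then bounds
  \<open>\<integral> ln (1 + |x|) |u|\<^sup>p\<close>, which makes the sequence compact in \<open>L\<^sup>p\<close>. Criticality follows by comparing
  \<open>I(t\<^sub>n (w + \<epsilon>\<^sub>n v)) \<ge> I(w) \<ge> I(t\<^sub>n w)\<close>, where \<open>t\<^sub>n \<rightarrow> 1\<close> are the maximizers along \<open>w + \<epsilon>\<^sub>n v\<close>.
  The Sobolev, Trudinger-Moser and Rellich theorems needed on the way are proved with dyadic averages:
  at level \<open>j\<close> they are bounded by \<open>C (1 + j) powr ((p - 1) / p)\<close> and approximate \<open>u\<close> in \<open>L\<^sup>p\<close>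
  up to \<open>C 2 powr (- j N / p)\<close>.
\<close>

section \<open>Averages and Jensen\<close>

text \<open>The obstacle is the logarithmic kernel: its positive part is unbounded and not
  controlled by the norm of \<open>W\<close>, its negative part is singular. In \<open>J\<close> the
  terms with a plus sign (\<open>wnorm\<close> and the form of \<open>logp\<close>) are lower
  semicontinuous by Fatou, while those with a minus sign (the form of \<open>logm\<close> and the
  integral of \<open>prim f\<close>) must be upper semicontinuous. For these the bound on the
  logarithmic moment prevents loss of mass at infinity, and the exponential integral prevents
  concentration. Semicontinuity is applied for each fixed factor \<open>t\<close> separately, so
  that the limit inherits the energy bound on its whole ray although norms may drop in the limit. On
  a set of norm at most \<open>M\<close> the Trudinger-Moser bound comes with some positive exponent
  that depends on \<open>M\<close>; it fits the nonlinearity because subcritical growth accepts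
  every positive exponent. The comparison of energies is one-sided, so it only shows that the
  derivative along \<open>v\<close> is nonnegative; the direction \<open>- v\<close> then gives
  equality.\<close>

lemma has_real_derivative_abs_powr:
  fixes p :: real
  assumes "p > 1"
  shows "((\<lambda>x. \<bar>x\<bar> powr p) has_real_derivative p * sgn x * \<bar>x\<bar> powr (p - 1)) (at x)"
proof -
  consider "x > 0" | "x < 0" | "x = 0" by linarith
  then show ?thesis
  proof cases
    case 1
    have "((\<lambda>x. x powr p) has_real_derivative p * x powr (p - 1)) (at x)"
      by (rule has_real_derivative_powr[OF 1])
    then have "((\<lambda>x. \<bar>x\<bar> powr p) has_real_derivative p * x powr (p - 1)) (at x)"
      by (rule has_field_derivative_transform_within_open[of _ _ _ "{0<..}"]) (use 1 in auto)
    then show ?thesis using 1 by simp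
  next
    case 2
    have "((\<lambda>x. (- x) powr p) has_real_derivative p * (- x) powr (p - 1) * (-1)) (at x)"
      by (rule DERIV_chain2[OF has_real_derivative_powr]) (use 2 in \<open>auto intro!: derivative_eq_intros\<close>)
    then have "((\<lambda>x. \<bar>x\<bar> powr p) has_real_derivative p * (- x) powr (p - 1) * (-1)) (at x)"
      by (rule has_field_derivative_transform_within_open[of _ _ _ "{..<0}"]) (use 2 in auto)
    then show ?thesis using 2 by simp
  next
    case 3
    have "((\<lambda>h. \<bar>h\<bar> powr (p - 1)) \<longlongrightarrow> 0) (at 0)"
    proof -
      have "((\<lambda>h::real. \<bar>h\<bar> powr (p - 1)) \<longlongrightarrow> 0 powr (p - 1)) (at 0)"
        by (intro tendsto_intros tendsto_rabs_zero) (use assms in auto)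
      then show ?thesis by simp
    qed
    then have "((\<lambda>h. \<bar>h\<bar> powr p / h) \<longlongrightarrow> 0) (at 0)"
    proof (rule tendsto_rabs_zero_cancel[OF Lim_transform_eventually[OF _ ]])
      show "\<forall>\<^sub>F h in at 0. \<bar>h\<bar> powr (p - 1) = \<bar>\<bar>h\<bar> powr p / h\<bar>"
        by (auto simp: eventually_at_filter powr_diff abs_divide)
    qed
    then show ?thesis unfolding 3 has_field_derivative_iff by simp
  qed
qed

lemma convex_on_abs_powr:
  fixes p :: real
  assumes "p > 1"
  shows "convex_on UNIV (\<lambda>x. \<bar>x\<bar> powr p)"
proof (rule convex_on_realI[where f' = "\<lambda>x. p * sgn x * \<bar>x\<bar> powr (p - 1)"])
  fix x y :: real assume "x \<le> y"
  consider "0 \<le> x" | "x < 0" "0 \<le> y" | "y < 0" using \<open>x \<le> y\<close> by linarith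
  then show "p * sgn x * \<bar>x\<bar> powr (p - 1) \<le> p * sgn y * \<bar>y\<bar> powr (p - 1)"
  proof cases
    case 1
    then have "\<bar>x\<bar> powr (p-1) \<le> \<bar>y\<bar> powr (p-1)" using \<open>x \<le> y\<close> assms by (intro powr_mono2) auto
    then show ?thesis using 1 \<open>x \<le> y\<close> assms by (cases "x = 0") (auto simp: sgn_real_def)
  next
    case 2
    have "p * sgn x * \<bar>x\<bar> powr (p - 1) \<le> 0" "0 \<le> p * sgn y * \<bar>y\<bar> powr (p - 1)"
      using 2 assms by (auto simp: sgn_real_def intro!: mult_nonneg_nonneg)
    then show ?thesis by linarith
  next
    case 3
    then have "\<bar>y\<bar> powr (p-1) \<le> \<bar>x\<bar> powr (p-1)" using \<open>x \<le> y\<close> assms by (intro powr_mono2) auto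
    then show ?thesis using 3 \<open>x \<le> y\<close> assms by (auto simp: sgn_real_def)
  qed
qed (use has_real_derivative_abs_powr[OF assms] in auto)

lemma abs_powr_above_tangent:
  fixes p m w :: real
  assumes "p > 1"
  shows "\<bar>m\<bar> powr p + p * sgn m * \<bar>m\<bar> powr (p - 1) * (w - m) \<le> \<bar>w\<bar> powr p"
  using convex_on_imp_above_tangent[OF convex_on_abs_powr[OF assms] _ _ _
      has_real_derivative_abs_powr[OF assms, of m], of w] by auto

text \<open>Jensen on \<open>S\<close>: integrate the tangent inequality at the mean
  \<open>m\<close> of \<open>u - c\<close>, whose linear part has integral 0 over \<open>S\<close>.
  An infinite right side leaves nothing to prove; a finite one gives the integrability that the
  comparison of real integrals needs.\<close>

lemma average_powr_le:
  fixes u :: "'b \<Rightarrow> real" and p c :: real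
  assumes p: "p > 1" and [measurable]: "S \<in> sets M" and fin: "emeasure M S < \<infinity>" and pos: "0 < measure M S"
    and u: "set_integrable M S u" and [measurable]: "u \<in> borel_measurable M"
  shows "ennreal (measure M S * \<bar>(LINT y:S|M. u y) / measure M S - c\<bar> powr p)
      \<le> (\<integral>\<^sup>+y\<in>S. ennreal (\<bar>u y - c\<bar> powr p) \<partial>M)"
proof (cases "(\<integral>\<^sup>+y\<in>S. ennreal (\<bar>u y - c\<bar> powr p) \<partial>M) = \<infinity>")
  case False
  define m where "m = (LINT y:S|M. u y) / measure M S - c"
  define D where "D = p * sgn m * \<bar>m\<bar> powr (p - 1)"
  have eq: "(\<integral>\<^sup>+y\<in>S. ennreal (\<bar>u y - c\<bar> powr p) \<partial>M) = (\<integral>\<^sup>+y. ennreal (indicator S y * \<bar>u y - c\<bar> powr p) \<partial>M)"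
    by (intro nn_integral_cong) (auto simp: indicator_def)
  have int: "integrable M (\<lambda>y. indicator S y * \<bar>u y - c\<bar> powr p)"
    using False unfolding eq by (intro integrableI_bounded) (auto simp: less_top[symmetric] abs_mult)
  have cint: "integrable M (\<lambda>y. indicator S y * (k::real))" for k
    using fin by (intro integrable_mult_left) auto
  have uint: "integrable M (\<lambda>y. indicator S y * u y)"
    using u by (simp add: set_integrable_def)
  have "measure M S * \<bar>m\<bar> powr p = (\<integral>y. indicator S y * (\<bar>m\<bar> powr p - D * c - D * m) + D * (indicator S y * u y) \<partial>M)"
  proof -
    have "(LINT y:S|M. u y) = (m + c) * measure M S" using pos by (simp add: m_def)
    then have "(\<integral>y. indicator S y * u y \<partial>M) = (m + c) * measure M S" by (simp add: set_lebesgue_integral_def)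
    then show ?thesis
      by (subst Bochner_Integration.integral_add) (use cint uint in \<open>auto simp: algebra_simps\<close>)
  qed
  also have "\<dots> \<le> (\<integral>y. indicator S y * \<bar>u y - c\<bar> powr p \<partial>M)"
  proof (rule integral_mono)
    show "integrable M (\<lambda>y. indicator S y * (\<bar>m\<bar> powr p - D * c - D * m) + D * (indicator S y * u y))"
      by (intro Bochner_Integration.integrable_add integrable_mult_right cint uint)
    fix y
    show "indicator S y * (\<bar>m\<bar> powr p - D * c - D * m) + D * (indicator S y * u y) \<le> indicator S y * \<bar>u y - c\<bar> powr p"
      using abs_powr_above_tangent[OF p, of m "u y - c"]
      by (auto simp: indicator_def D_def algebra_simps)
  qed fact
  finally show ?thesis unfolding eq m_def[symmetric]
    by (subst nn_integral_eq_integral[OF int]) (auto intro!: ennreal_leI)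
qed simp

text \<open>Jensen twice: over \<open>S\<close> against the constant mean over \<open>T\<close>,
  then over \<open>T\<close> against the constant \<open>u y\<close>, for each
  \<open>y\<close>.\<close>

lemma average_diff_powr_le:
  fixes u :: "'b \<Rightarrow> real" and p :: real
  assumes p: "p > 1" and [measurable]: "S \<in> sets M" "T \<in> sets M" and fin: "emeasure M S < \<infinity>" "emeasure M T < \<infinity>"
    and pos: "0 < measure M S" "0 < measure M T"
    and u: "set_integrable M S u" "set_integrable M T u" and [measurable]: "u \<in> borel_measurable M"
  shows "ennreal (measure M S * measure M T * \<bar>(LINT y:S|M. u y) / measure M S - (LINT y:T|M. u y) / measure M T\<bar> powr p)
      \<le> (\<integral>\<^sup>+y\<in>S. (\<integral>\<^sup>+z\<in>T. ennreal (\<bar>u y - u z\<bar> powr p) \<partial>M) \<partial>M)"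
proof -
  define a where "a = (LINT y:T|M. u y) / measure M T"
  have "ennreal (measure M S * measure M T * \<bar>(LINT y:S|M. u y) / measure M S - a\<bar> powr p)
     = ennreal (measure M T) * ennreal (measure M S * \<bar>(LINT y:S|M. u y) / measure M S - a\<bar> powr p)"
    by (simp add: ennreal_mult[symmetric] mult_ac)
  also have "\<dots> \<le> ennreal (measure M T) * (\<integral>\<^sup>+y\<in>S. ennreal (\<bar>u y - a\<bar> powr p) \<partial>M)"
    by (intro mult_left_mono average_powr_le p fin pos u) auto
  also have "\<dots> = (\<integral>\<^sup>+y\<in>S. ennreal (measure M T * \<bar>u y - a\<bar> powr p) \<partial>M)"
    by (subst nn_integral_cmult[symmetric]) (auto simp: ennreal_mult mult_ac)
  also have "\<dots> \<le> (\<integral>\<^sup>+y\<in>S. (\<integral>\<^sup>+z\<in>T. ennreal (\<bar>u y - u z\<bar> powr p) \<partial>M) \<partial>M)"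
  proof (intro nn_integral_mono mult_right_mono)
    fix y
    have "ennreal (measure M T * \<bar>a - u y\<bar> powr p) \<le> (\<integral>\<^sup>+z\<in>T. ennreal (\<bar>u z - u y\<bar> powr p) \<partial>M)"
      unfolding a_def by (intro average_powr_le p fin pos u) auto
    then show "ennreal (measure M T * \<bar>u y - a\<bar> powr p) \<le> (\<integral>\<^sup>+z\<in>T. ennreal (\<bar>u y - u z\<bar> powr p) \<partial>M)"
      by (simp add: abs_minus_commute)
  qed auto
  finally show ?thesis unfolding a_def .
qed

text \<open>Convexity with equal weights \<open>1 / n\<close>. The factor
  \<open>n powr (p - 1)\<close> is the origin of the growth
  \<open>(1 + j) powr ((p - 1) / p)\<close> of the dyadic averages.\<close>

lemma sum_powr_le:
  fixes a :: "nat \<Rightarrow> real" and p :: real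
  assumes "p > 1" "n > 0" "\<And>i. i < n \<Longrightarrow> 0 \<le> a i"
  shows "(\<Sum>i<n. a i) powr p \<le> real n powr (p - 1) * (\<Sum>i<n. a i powr p)"
proof -
  have "\<bar>\<Sum>i<n. (1 / real n) *\<^sub>R a i\<bar> powr p \<le> (\<Sum>i<n. (1 / real n) * \<bar>a i\<bar> powr p)"
    by (rule convex_on_sum[OF _ _ convex_on_abs_powr[OF assms(1)]]) (use assms(2) in auto)
  moreover have "(\<Sum>i<n. (1 / real n) *\<^sub>R a i) = (\<Sum>i<n. a i) / real n" by (simp add: sum_divide_distrib)
  moreover have "(\<Sum>i<n. (1 / real n) * \<bar>a i\<bar> powr p) = (\<Sum>i<n. a i powr p) / real n"
    using assms(3) by (simp add: sum_divide_distrib)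
  moreover have "0 \<le> (\<Sum>i<n. a i)" using assms(3) by (auto intro: sum_nonneg)
  ultimately have "(\<Sum>i<n. a i) powr p / real n powr p \<le> (\<Sum>i<n. a i powr p) / real n"
    by (simp add: powr_divide)
  then show ?thesis using assms(2) by (simp add: powr_diff field_simps)
qed

section \<open>Dyadic averages\<close>

text \<open>The kernel exponent is \<open>N + s p = 2 N\<close>.\<close>

definition gag :: "real \<Rightarrow> ('a::euclidean_space \<Rightarrow> real) \<Rightarrow> ennreal" where
  "gag p u = (\<integral>\<^sup>+x. (\<integral>\<^sup>+y. ennreal (\<bar>u x - u y\<bar> powr p / norm (x - y) ^ (2 * DIM('a))) \<partial>lborel) \<partial>lborel)"

definition dcell :: "nat \<Rightarrow> ('a::euclidean_space \<Rightarrow> int) \<Rightarrow> 'a set" where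
  "dcell j \<kappa> = {y. \<forall>b\<in>Basis. \<lfloor>2 ^ j * (y \<bullet> b)\<rfloor> = \<kappa> b}"

text \<open>Restricting the function to \<open>Basis\<close> gives each cell a single index and
  places all indices in a countable product, on which a diagonal sequence can be extracted.\<close>

definition dindex :: "nat \<Rightarrow> 'a::euclidean_space \<Rightarrow> 'a \<Rightarrow> int" where
  "dindex j x = (\<lambda>b\<in>Basis. \<lfloor>2 ^ j * (x \<bullet> b)\<rfloor>)"

definition dcube :: "nat \<Rightarrow> 'a::euclidean_space \<Rightarrow> 'a set" where
  "dcube j x = dcell j (dindex j x)"

definition davg :: "nat \<Rightarrow> ('a::euclidean_space \<Rightarrow> real) \<Rightarrow> 'a \<Rightarrow> real" where
  "davg j u x = (LINT y:dcube j x|lborel. u y) / measure lborel (dcube j x)"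

lemma in_dcube: "y \<in> dcube j x \<longleftrightarrow> (\<forall>b\<in>Basis. \<lfloor>2 ^ j * (y \<bullet> b)\<rfloor> = \<lfloor>2 ^ j * (x \<bullet> b)\<rfloor>)"
  by (auto simp: dcube_def dcell_def dindex_def)

lemma dcell_measurable [measurable]: "dcell j \<kappa> \<in> sets borel"
  unfolding dcell_def by measurable

lemma dcube_measurable [measurable]: "dcube j x \<in> sets borel"
  unfolding dcube_def by measurable

text \<open>The half-open cell lies between the open and the closed box with the same corners, and
  these have equal measure.\<close>

lemma dcell_emeasure: "emeasure lborel (dcell j \<kappa> :: 'a::euclidean_space set) = ennreal ((1 / 2 ^ j) ^ DIM('a))"
proof -
  define l u :: 'a where "l = (\<Sum>b\<in>Basis. (\<kappa> b / 2 ^ j) *\<^sub>R b)" and "u = (\<Sum>b\<in>Basis. ((\<kappa> b + 1) / 2 ^ j) *\<^sub>R b)"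
  have l: "l \<bullet> b = \<kappa> b / 2 ^ j" and u: "u \<bullet> b = (\<kappa> b + 1) / 2 ^ j" if "b \<in> Basis" for b
    using that by (simp_all add: l_def u_def)
  have le: "l \<bullet> b \<le> u \<bullet> b" if "b \<in> Basis" for b using that by (simp add: l u divide_right_mono)
  have prod: "(\<Prod>b\<in>Basis. (u - l) \<bullet> b) = (1 / 2 ^ j) ^ DIM('a)"
  proof -
    have "(\<Prod>b\<in>Basis. (u - l) \<bullet> b) = (\<Prod>b\<in>(Basis::'a set). 1 / 2 ^ j)"
      by (intro prod.cong refl) (simp add: inner_diff_left l u add_divide_distrib)
    then show ?thesis by simp
  qed
  have sub1: "box l u \<subseteq> dcell j \<kappa>"
  proof
    fix x assume x: "x \<in> box l u"
    show "x \<in> dcell j \<kappa>" unfolding dcell_def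
    proof (intro CollectI ballI)
      fix b :: 'a assume b: "b \<in> Basis"
      then have "\<kappa> b / 2 ^ j < x \<bullet> b" "x \<bullet> b < (\<kappa> b + 1) / 2 ^ j" using x by (auto simp: box_def l u)
      then have "\<kappa> b < 2 ^ j * (x \<bullet> b)" "2 ^ j * (x \<bullet> b) < \<kappa> b + 1" by (simp_all add: field_simps)
      then show "\<lfloor>2 ^ j * (x \<bullet> b)\<rfloor> = \<kappa> b" by (intro floor_unique) auto
    qed
  qed
  have sub2: "dcell j \<kappa> \<subseteq> cbox l u"
  proof
    fix x assume x: "x \<in> dcell j \<kappa>"
    show "x \<in> cbox l u" unfolding mem_box
    proof (intro ballI)
      fix b :: 'a assume b: "b \<in> Basis"
      then have "\<lfloor>2 ^ j * (x \<bullet> b)\<rfloor> = \<kappa> b" using x by (auto simp: dcell_def)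
      then have "\<kappa> b \<le> 2 ^ j * (x \<bullet> b)" "2 ^ j * (x \<bullet> b) \<le> \<kappa> b + 1" by linarith+
      then show "l \<bullet> b \<le> x \<bullet> b \<and> x \<bullet> b \<le> u \<bullet> b" using b by (simp add: field_simps l u)
    qed
  qed
  have "emeasure lborel (box l u) \<le> emeasure lborel (dcell j \<kappa>)"
    by (intro emeasure_mono sub1) auto
  moreover have "emeasure lborel (dcell j \<kappa>) \<le> emeasure lborel (cbox l u)"
    by (intro emeasure_mono sub2) auto
  ultimately show ?thesis using le prod by simp
qed

lemma dcube_emeasure: "emeasure lborel (dcube j x :: 'a::euclidean_space set) = ennreal ((1 / 2 ^ j) ^ DIM('a))"
  by (simp only: dcube_def dcell_emeasure)

lemma dcube_measure: "measure lborel (dcube j x :: 'a::euclidean_space set) = (1 / 2 ^ j) ^ DIM('a)"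
  by (simp add: measure_def dcube_emeasure)

lemma dcube_norm_le:
  fixes x y :: "'a::euclidean_space"
  assumes "y \<in> dcube j x"
  shows "norm (x - y) \<le> DIM('a) / 2 ^ j"
proof -
  have "norm (x - y) \<le> (\<Sum>b\<in>Basis. \<bar>(x - y) \<bullet> b\<bar>)" by (rule norm_le_l1)
  also have "\<dots> \<le> (\<Sum>b\<in>(Basis::'a set). 1 / 2 ^ j)"
  proof (rule sum_mono)
    fix b :: 'a assume "b \<in> Basis"
    then have "\<lfloor>2 ^ j * (y \<bullet> b)\<rfloor> = \<lfloor>2 ^ j * (x \<bullet> b)\<rfloor>" using assms by (simp add: in_dcube)
    then have "\<bar>2 ^ j * (x \<bullet> b) - 2 ^ j * (y \<bullet> b)\<bar> \<le> 1" by linarith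
    then have "2 ^ j * \<bar>(x - y) \<bullet> b\<bar> \<le> 1"
      by (metis abs_mult abs_numeral inner_diff_left power_abs right_diff_distrib)
    then show "\<bar>(x - y) \<bullet> b\<bar> \<le> 1 / 2 ^ j" by (simp add: field_simps)
  qed
  finally show ?thesis by simp
qed

lemma dcube_Suc_subset: "dcube (Suc j) x \<subseteq> dcube j x"
proof
  fix y assume y: "y \<in> dcube (Suc j) x"
  show "y \<in> dcube j x" unfolding in_dcube
  proof
    fix b :: 'a assume "b \<in> Basis"
    then have "\<lfloor>2 * (2 ^ j * (y \<bullet> b))\<rfloor> = \<lfloor>2 * (2 ^ j * (x \<bullet> b))\<rfloor>"
      using y by (simp add: in_dcube mult_ac)
    moreover have "\<lfloor>t\<rfloor> = \<lfloor>2 * t\<rfloor> div 2" for t :: real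
      using floor_divide_real_eq_div[of 2 "2 * t"] by simp
    ultimately show "\<lfloor>2 ^ j * (y \<bullet> b)\<rfloor> = \<lfloor>2 ^ j * (x \<bullet> b)\<rfloor>"
      by metis
  qed
qed

text \<open>On a set of finite measure \<open>|u| <= 1 + |u| powr p\<close>, so all averages over
  cubes are averages of integrable functions.\<close>

lemma set_integrable_of_Lp:
  fixes u :: "'a::euclidean_space \<Rightarrow> real"
  assumes p: "p > 1" and [measurable]: "u \<in> borel_measurable lborel" and Lp: "Lp_p p u < \<infinity>"
    and S: "S \<in> sets borel" "emeasure lborel S < \<infinity>"
  shows "set_integrable lborel S u"
  unfolding set_integrable_def
proof (rule integrableI_bounded)
  show "(\<lambda>x. indicat_real S x *\<^sub>R u x) \<in> borel_measurable lborel" using S by measurable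
  have "ennreal (norm (indicat_real S x *\<^sub>R u x)) \<le> indicator S x + ennreal (\<bar>u x\<bar> powr p)" for x
  proof (cases "\<bar>u x\<bar> \<le> 1")
    case True
    then show ?thesis by (auto simp: indicator_def intro!: add_increasing2)
  next
    case False
    then have "\<bar>u x\<bar> powr 1 \<le> \<bar>u x\<bar> powr p" using p by (intro powr_mono) auto
    then show ?thesis using False by (auto simp: indicator_def intro!: add_increasing ennreal_leI)
  qed
  then have "(\<integral>\<^sup>+x. ennreal (norm (indicat_real S x *\<^sub>R u x)) \<partial>lborel) \<le> (\<integral>\<^sup>+x. indicator S x + ennreal (\<bar>u x\<bar> powr p) \<partial>lborel)"
    by (intro nn_integral_mono) auto
  also have "\<dots> = emeasure lborel S + Lp_p p u"
    using S by (subst nn_integral_add) (auto simp: Lp_p_def)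
  also have "\<dots> < \<infinity>" using S Lp by auto
  finally show "(\<integral>\<^sup>+x. ennreal (norm (indicat_real S x *\<^sub>R u x)) \<partial>lborel) < \<infinity>" .
qed

lemma davg_measurable [measurable]:
  fixes u :: "'a::euclidean_space \<Rightarrow> real"
  assumes [measurable]: "u \<in> borel_measurable borel"
  shows "davg j u \<in> borel_measurable borel"
proof -
  \<comment> \<open>The cube moves with \<open>x\<close>. Written with a condition on floors, the
    integrand is jointly measurable in \<open>x\<close> and \<open>y\<close>, and the integral over
    \<open>y\<close> is a measurable function of \<open>x\<close>.\<close>
  have eq: "davg j u = (\<lambda>x. (\<integral>y. (if \<forall>b\<in>Basis. \<lfloor>2 ^ j * (y \<bullet> b)\<rfloor> = \<lfloor>2 ^ j * (x \<bullet> b)\<rfloor> then u y else 0) \<partial>lborel) * (2 ^ j) ^ DIM('a))"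
    unfolding davg_def dcube_measure set_lebesgue_integral_def
    by (intro ext) (auto simp: power_one_over divide_simps in_dcube indicator_def intro!: Bochner_Integration.integral_cong)
  show ?thesis unfolding eq by measurable
qed

text \<open>At distance at most \<open>r\<close> the numerator is recovered from the Gagliardo
  kernel at the price \<open>r ^ (2 * DIM('a))\<close>; on the diagonal both sides are 0.\<close>

lemma powr_le_kernel:
  fixes x y :: "'a::euclidean_space"
  assumes "norm (x - y) \<le> r"
  shows "ennreal (\<bar>u x - u y\<bar> powr p) \<le> ennreal (r ^ (2 * DIM('a))) * ennreal (\<bar>u x - u y\<bar> powr p / norm (x - y) ^ (2 * DIM('a)))"
proof (cases "x = y")
  case False
  then have "norm (x - y) ^ (2 * DIM('a)) * (\<bar>u x - u y\<bar> powr p / norm (x - y) ^ (2 * DIM('a))) = \<bar>u x - u y\<bar> powr p"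
    by simp
  moreover have "norm (x - y) ^ (2 * DIM('a)) \<le> r ^ (2 * DIM('a))"
    using assms by (intro power_mono) auto
  ultimately have "\<bar>u x - u y\<bar> powr p \<le> r ^ (2 * DIM('a)) * (\<bar>u x - u y\<bar> powr p / norm (x - y) ^ (2 * DIM('a)))"
    by (metis mult_right_mono divide_nonneg_nonneg norm_ge_zero powr_ge_zero zero_le_power)
  then show ?thesis
    using assms by (subst ennreal_mult[symmetric]) (auto intro!: ennreal_leI order_trans[OF norm_ge_zero] zero_le_power)
qed simp

text \<open>Jensen on a cube of side \<open>2 ^ (- j)\<close> loses the factor
  \<open>2 ^ (j N)\<close>, and inserting the kernel gains \<open>(N / 2 ^ j) ^ (2 N)\<close>. The
  net factor \<open>2 ^ (- j N)\<close> is the geometric decay on which all the embedding results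
  rest.\<close>

lemma nn_integral_davg_approx:
  fixes u :: "'a::euclidean_space \<Rightarrow> real"
  assumes p: "p > 1" and [measurable]: "u \<in> borel_measurable borel" and Lp: "Lp_p p u < \<infinity>"
  shows "(\<integral>\<^sup>+x. ennreal (\<bar>u x - davg j u x\<bar> powr p) \<partial>lborel)
    \<le> ennreal (real DIM('a) ^ (2 * DIM('a)) * (1 / 2 ^ j) ^ DIM('a)) * gag p u"
proof -
  define N where "N = DIM('a)"
  have pt: "ennreal (\<bar>u x - davg j u x\<bar> powr p) \<le> ennreal (real N ^ (2 * N) * (1 / 2 ^ j) ^ N)
     * (\<integral>\<^sup>+y. ennreal (\<bar>u x - u y\<bar> powr p / norm (x - y) ^ (2 * DIM('a))) \<partial>lborel)" (is "_ \<le> _ * ?I x") for x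
  proof -
    have "ennreal (measure lborel (dcube j x) * \<bar>davg j u x - u x\<bar> powr p)
        \<le> (\<integral>\<^sup>+y\<in>dcube j x. ennreal (\<bar>u y - u x\<bar> powr p) \<partial>lborel)"
      unfolding davg_def
      by (intro average_powr_le p set_integrable_of_Lp[of p] Lp) (auto simp: dcube_emeasure dcube_measure)
    also have "\<dots> \<le> (\<integral>\<^sup>+y. ennreal ((N / 2 ^ j) ^ (2 * N)) * ennreal (\<bar>u x - u y\<bar> powr p / norm (x - y) ^ (2 * DIM('a))) \<partial>lborel)"
      using powr_le_kernel[OF dcube_norm_le, of _ j x u p]
      by (intro nn_integral_mono) (auto simp: indicator_def N_def abs_minus_commute)
    also have "\<dots> = ennreal ((N / 2 ^ j) ^ (2 * N)) * ?I x"
      by (intro nn_integral_cmult) auto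
    finally have le: "ennreal ((1 / 2 ^ j) ^ N * \<bar>u x - davg j u x\<bar> powr p) \<le> ennreal ((N / 2 ^ j) ^ (2 * N)) * ?I x"
      by (simp add: dcube_measure N_def abs_minus_commute)
    have "ennreal (\<bar>u x - davg j u x\<bar> powr p) = ennreal ((2 ^ j) ^ N) * ennreal ((1 / 2 ^ j) ^ N * \<bar>u x - davg j u x\<bar> powr p)"
      by (subst ennreal_mult[symmetric]) (auto simp: power_one_over)
    also have "\<dots> \<le> ennreal ((2 ^ j) ^ N) * (ennreal ((N / 2 ^ j) ^ (2 * N)) * ?I x)"
      by (intro mult_left_mono le) auto
    also have "\<dots> = ennreal ((2 ^ j) ^ N * (N / 2 ^ j) ^ (2 * N)) * ?I x"
      by (simp add: ennreal_mult mult.assoc)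
    also have "(2 ^ j) ^ N * (N / 2 ^ j) ^ (2 * N) = real N ^ (2 * N) * (1 / 2 ^ j) ^ N"
      by (simp add: power_divide power_even_eq[of "2 ^ j"] power2_eq_square power_one_over)
    finally show ?thesis .
  qed
  have "(\<integral>\<^sup>+x. ennreal (\<bar>u x - davg j u x\<bar> powr p) \<partial>lborel)
     \<le> (\<integral>\<^sup>+x. ennreal (real N ^ (2 * N) * (1 / 2 ^ j) ^ N) * ?I x \<partial>lborel)"
    by (intro nn_integral_mono pt)
  also have "\<dots> = ennreal (real N ^ (2 * N) * (1 / 2 ^ j) ^ N) * gag p u"
    unfolding gag_def by (intro nn_integral_cmult) auto
  finally show ?thesis unfolding N_def .
qed

lemma davg_powr_le_local:
  fixes u :: "'a::euclidean_space \<Rightarrow> real"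
  assumes p: "p > 1" and [measurable]: "u \<in> borel_measurable borel" and Lp: "Lp_p p u < \<infinity>"
  shows "ennreal (\<bar>davg j u x\<bar> powr p)
    \<le> ennreal ((2 ^ j) ^ DIM('a)) * (\<integral>\<^sup>+y\<in>dcube j x. ennreal (\<bar>u y\<bar> powr p) \<partial>lborel)"
proof -
  have le: "ennreal (measure lborel (dcube j x) * \<bar>davg j u x - 0\<bar> powr p)
      \<le> (\<integral>\<^sup>+y\<in>dcube j x. ennreal (\<bar>u y - 0\<bar> powr p) \<partial>lborel)"
    unfolding davg_def
    by (intro average_powr_le p set_integrable_of_Lp[of p] Lp) (auto simp: dcube_emeasure dcube_measure)
  have "ennreal (\<bar>davg j u x\<bar> powr p) = ennreal ((2 ^ j) ^ DIM('a)) * ennreal (measure lborel (dcube j x) * \<bar>davg j u x - 0\<bar> powr p)"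
    by (subst ennreal_mult[symmetric]) (auto simp: power_one_over dcube_measure)
  also have "\<dots> \<le> ennreal ((2 ^ j) ^ DIM('a)) * (\<integral>\<^sup>+y\<in>dcube j x. ennreal (\<bar>u y - 0\<bar> powr p) \<partial>lborel)"
    by (intro mult_left_mono le) auto
  finally show ?thesis by simp
qed

text \<open>The small cube is compared with the rest of its parent, not with the whole parent. The
  outer integral then runs over the shell between consecutive cubes; shells of different levels are
  disjoint, so the sum over all levels costs the seminorm only once.\<close>

lemma davg_step_powr_le:
  fixes u :: "'a::euclidean_space \<Rightarrow> real"
  assumes p: "p > 1" and [measurable]: "u \<in> borel_measurable borel" and Lp: "Lp_p p u < \<infinity>"
  shows "ennreal (\<bar>davg (Suc i) u x - davg i u x\<bar> powr p)
    \<le> ennreal (2 ^ (DIM('a) + 1) * real DIM('a) ^ (2 * DIM('a))) *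
      (\<integral>\<^sup>+y\<in>dcube i x - dcube (Suc i) x.
        (\<integral>\<^sup>+z. ennreal (\<bar>u y - u z\<bar> powr p / norm (y - z) ^ (2 * DIM('a))) \<partial>lborel) \<partial>lborel)"
proof -
  define N where "N = DIM('a)"
  define S where "S = dcube (Suc i) x"
  define D where "D = dcube i x - S"
  have [measurable]: "S \<in> sets borel" "D \<in> sets borel" by (auto simp: S_def D_def)
  have disj: "S \<inter> D = {}" "dcube i x = S \<union> D" using dcube_Suc_subset[of i x] by (auto simp: S_def D_def)
  have mS: "measure lborel S = (1 / 2 ^ Suc i) ^ N" by (simp only: S_def dcube_measure N_def)
  have Sfin: "emeasure lborel S < \<infinity>" by (simp add: S_def dcube_emeasure)
  have Dfin: "emeasure lborel D < \<infinity>"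
    by (rule order.strict_trans1[OF emeasure_mono[of _ "dcube i x"]]) (auto simp: D_def dcube_emeasure)
  have mSD: "(1 / 2 ^ i) ^ N = measure lborel S + measure lborel D"
  proof -
    have "measure lborel (S \<union> D) = (1 / 2 ^ i) ^ N"
      by (simp only: disj(2)[symmetric] dcube_measure N_def)
    then show ?thesis using measure_Union[of lborel S D] Sfin Dfin disj(1) by simp
  qed
  have N1: "N \<ge> 1" by (simp add: N_def DIM_positive Suc_leI)
  have mS': "measure lborel S = (1 / 2 ^ i) ^ N * (1 / 2) ^ N"
    unfolding mS by (simp add: power_mult_distrib power_one_over)
  have half: "(1 / 2 :: real) ^ N \<le> 1 / 2"
    using power_decreasing[OF N1, of "1/2::real"] by simp
  \<comment> \<open>A child takes the fraction \<open>2 ^ (- N)\<close> of its parent, which is at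
    most one half.\<close>
  have mD: "measure lborel D \<ge> (1 / 2 ^ i) ^ N / 2"
  proof -
    have "measure lborel S \<le> (1 / 2 ^ i) ^ N * (1 / 2)"
      unfolding mS' by (intro mult_left_mono half) auto
    then show ?thesis using mSD by linarith
  qed
  have mSpos: "measure lborel S > 0" unfolding mS by simp
  have "(1 / 2 ^ i) ^ N / 2 > (0::real)" by simp
  then have mDpos: "measure lborel D > 0" using mD by linarith
  have uS: "set_integrable lborel S u" and uD: "set_integrable lborel D u"
    by (auto intro!: set_integrable_of_Lp[OF p _ Lp] Sfin Dfin)
  define aS where "aS = (LINT y:S|lborel. u y) / measure lborel S"
  define aD where "aD = (LINT y:D|lborel. u y) / measure lborel D"
  have "(LINT y:dcube i x|lborel. u y) = (LINT y:S|lborel. u y) + (LINT y:D|lborel. u y)"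
    unfolding disj(2) by (rule set_integral_Un[OF disj(1) uS uD])
  then have dav: "davg i u x = (aS * measure lborel S + aD * measure lborel D) / (measure lborel S + measure lborel D)"
    using mSpos mDpos mSD unfolding davg_def aS_def aD_def by (simp add: dcube_measure N_def)
  \<comment> \<open>The parent average is the weighted mean of \<open>aS\<close> and
    \<open>aD\<close>, so the step between the levels is a fraction, at most 1, of the gap between
    these two.\<close>
  have "davg (Suc i) u x - davg i u x = measure lborel D / (measure lborel S + measure lborel D) * (aS - aD)"
    unfolding dav using mSpos mDpos by (simp add: davg_def S_def[symmetric] aS_def[symmetric] field_simps)
  then have "\<bar>davg (Suc i) u x - davg i u x\<bar> = measure lborel D / (measure lborel S + measure lborel D) * \<bar>aS - aD\<bar>"
    using mSpos mDpos by (simp add: abs_mult)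
  also have "\<dots> \<le> 1 * \<bar>aS - aD\<bar>"
    using mSpos mDpos by (intro mult_right_mono) (auto simp: field_simps)
  finally have le1: "\<bar>davg (Suc i) u x - davg i u x\<bar> powr p \<le> \<bar>aD - aS\<bar> powr p"
    using p by (intro powr_mono2) auto
  \<comment> \<open>A lower bound for the product of the two measures. Against the kernel price
    \<open>(N / 2 ^ i) ^ (2 * N)\<close> all powers of \<open>2 ^ i\<close> cancel, so the final
    constant is the same for every level.\<close>
  define c where "c = ((1 / 2 ^ i) ^ N) ^ 2 * (1 / 2) ^ N / (2::real)"
  have cpos: "c > 0" by (simp add: c_def)
  have "c = ((1 / 2 ^ i) ^ N / 2) * measure lborel S" by (simp add: c_def mS' power2_eq_square)
  also have "\<dots> \<le> measure lborel D * measure lborel S"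
    using mD by (intro mult_right_mono) auto
  finally have cle: "c \<le> measure lborel D * measure lborel S" .
  define g where "g = (\<lambda>y. \<integral>\<^sup>+z. ennreal (\<bar>u y - u z\<bar> powr p / norm (y - z) ^ (2 * N)) \<partial>lborel)"
  have [measurable]: "g \<in> borel_measurable borel" unfolding g_def by measurable
  have close: "norm (y - z) \<le> N / 2 ^ i" if "y \<in> dcube i x" "z \<in> dcube i x" for y z
    using dcube_norm_le[of z i y] that by (auto simp: in_dcube N_def)
  have "ennreal (c * \<bar>aD - aS\<bar> powr p) \<le> ennreal (measure lborel D * measure lborel S * \<bar>aD - aS\<bar> powr p)"
    by (intro ennreal_leI mult_right_mono cle) auto
  also have "\<dots> \<le> (\<integral>\<^sup>+y\<in>D. (\<integral>\<^sup>+z\<in>S. ennreal (\<bar>u y - u z\<bar> powr p) \<partial>lborel) \<partial>lborel)"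
    unfolding aD_def aS_def by (intro average_diff_powr_le p Sfin Dfin mSpos mDpos uS uD) auto
  also have "\<dots> \<le> (\<integral>\<^sup>+y. ennreal ((N / 2 ^ i) ^ (2 * N)) * (g y * indicator D y) \<partial>lborel)"
  proof (intro nn_integral_mono)
    fix y
    show "(\<integral>\<^sup>+z\<in>S. ennreal (\<bar>u y - u z\<bar> powr p) \<partial>lborel) * indicator D y \<le> ennreal ((N / 2 ^ i) ^ (2 * N)) * (g y * indicator D y)"
    proof (cases "y \<in> D")
      case True
      then have "(\<integral>\<^sup>+z\<in>S. ennreal (\<bar>u y - u z\<bar> powr p) \<partial>lborel)
         \<le> (\<integral>\<^sup>+z. ennreal ((N / 2 ^ i) ^ (2 * N)) * ennreal (\<bar>u y - u z\<bar> powr p / norm (y - z) ^ (2 * N)) \<partial>lborel)"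
        using powr_le_kernel[OF close, of y _ u p] by (intro nn_integral_mono) (auto simp: indicator_def N_def disj(2))
      also have "\<dots> = ennreal ((N / 2 ^ i) ^ (2 * N)) * g y"
        unfolding g_def by (intro nn_integral_cmult) auto
      finally show ?thesis using True by simp
    qed simp
  qed
  also have "\<dots> = ennreal ((N / 2 ^ i) ^ (2 * N)) * (\<integral>\<^sup>+y\<in>D. g y \<partial>lborel)"
    by (intro nn_integral_cmult) auto
  finally have le2: "ennreal (c * \<bar>aD - aS\<bar> powr p) \<le> ennreal ((N / 2 ^ i) ^ (2 * N)) * (\<integral>\<^sup>+y\<in>D. g y \<partial>lborel)" .
  have "ennreal (\<bar>davg (Suc i) u x - davg i u x\<bar> powr p) \<le> ennreal (1 / c) * ennreal (c * \<bar>aD - aS\<bar> powr p)"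
    using cpos le1 by (subst ennreal_mult[symmetric]) (auto intro!: ennreal_leI)
  also have "\<dots> \<le> ennreal (1 / c) * (ennreal ((N / 2 ^ i) ^ (2 * N)) * (\<integral>\<^sup>+y\<in>D. g y \<partial>lborel))"
    by (intro mult_left_mono le2) auto
  also have "\<dots> = ennreal (1 / c * (N / 2 ^ i) ^ (2 * N)) * (\<integral>\<^sup>+y\<in>D. g y \<partial>lborel)"
    using cpos by (subst ennreal_mult) (auto simp: mult.assoc)
  also have "1 / c * (N / 2 ^ i) ^ (2 * N) = 2 ^ (N + 1) * real N ^ (2 * N)"
    unfolding c_def by (simp add: power_divide power_even_eq[of "2 ^ i"] power2_eq_square power_one_over)
  finally show ?thesis unfolding g_def N_def D_def S_def .
qed

text \<open>The average is a sum of \<open>j + 1\<close> steps whose p-th powers add up to a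
  constant times the energy, by disjointness of the shells. Passing from the sum of p-th powers to
  the p-th power of the sum costs \<open>(j + 1) powr (p - 1)\<close>.\<close>

lemma davg_powr_le:
  fixes u :: "'a::euclidean_space \<Rightarrow> real"
  assumes p: "p > 1" and [measurable]: "u \<in> borel_measurable borel" and Lp: "Lp_p p u < \<infinity>"
  shows "ennreal (\<bar>davg j u x\<bar> powr p) \<le>
    ennreal (real (Suc j) powr (p - 1) * (2 ^ (DIM('a) + 1) * real DIM('a) ^ (2 * DIM('a)))) * (Lp_p p u + gag p u)"
proof -
  define C where "C = 2 ^ (DIM('a) + 1) * real DIM('a) ^ (2 * DIM('a))"
  have C1: "C \<ge> 1" unfolding C_def
    by (intro mult_ge1_I one_le_power) (auto simp: DIM_positive Suc_leI)
  define g where "g = (\<lambda>y. \<integral>\<^sup>+z. ennreal (\<bar>u y - u z\<bar> powr p / norm (y - z) ^ (2 * DIM('a))) \<partial>lborel)"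
  have [measurable]: "g \<in> borel_measurable borel" unfolding g_def by measurable
  \<comment> \<open>The average of level 0 counts as the first step; its cube has measure 1, so it
    is bounded by the p-norm.\<close>
  define d where "d = (\<lambda>i. if i = 0 then \<bar>davg 0 u x\<bar> else \<bar>davg i u x - davg (i - 1) u x\<bar>)"
  have tele: "\<bar>davg j u x\<bar> \<le> (\<Sum>i<Suc j. d i)" for j
  proof (induction j)
    case (Suc j)
    have "\<bar>davg (Suc j) u x\<bar> \<le> \<bar>davg j u x\<bar> + d (Suc j)" by (simp add: d_def)
    with Suc show ?case by simp
  qed (simp add: d_def)
  have "ennreal (d 0 powr p) \<le> (\<integral>\<^sup>+y\<in>dcube 0 x. ennreal (\<bar>u y\<bar> powr p) \<partial>lborel)"
    using davg_powr_le_local[OF assms, of 0 x] by (simp add: d_def)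
  also have "\<dots> \<le> Lp_p p u" unfolding Lp_p_def by (intro nn_integral_mono) (auto simp: indicator_def)
  finally have d0: "ennreal (d 0 powr p) \<le> Lp_p p u" .
  have dSuc: "ennreal (d (Suc i) powr p) \<le> ennreal C * (\<integral>\<^sup>+y\<in>dcube i x - dcube (Suc i) x. g y \<partial>lborel)" for i
    using davg_step_powr_le[OF assms, of i x] by (simp add: d_def C_def g_def)
  have split: "(\<integral>\<^sup>+y\<in>dcube i x. g y \<partial>lborel) = (\<integral>\<^sup>+y\<in>dcube i x - dcube (Suc i) x. g y \<partial>lborel) + (\<integral>\<^sup>+y\<in>dcube (Suc i) x. g y \<partial>lborel)" for i
    using dcube_Suc_subset[of i x]
    by (subst nn_integral_add[symmetric]) (auto intro!: nn_integral_cong simp: indicator_def)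
  have sum: "(\<Sum>i<j. \<integral>\<^sup>+y\<in>dcube i x - dcube (Suc i) x. g y \<partial>lborel) + (\<integral>\<^sup>+y\<in>dcube j x. g y \<partial>lborel) = (\<integral>\<^sup>+y\<in>dcube 0 x. g y \<partial>lborel)" for j
  proof (induction j)
    case (Suc j)
    then show ?case using split[of j] by (simp add: add.assoc)
  qed simp
  have "(\<Sum>i<j. \<integral>\<^sup>+y\<in>dcube i x - dcube (Suc i) x. g y \<partial>lborel) \<le> (\<integral>\<^sup>+y\<in>dcube 0 x. g y \<partial>lborel)"
    unfolding sum[symmetric, of j] by simp
  also have "\<dots> \<le> (\<integral>\<^sup>+y. g y \<partial>lborel)" by (intro nn_integral_mono) (auto simp: indicator_def)
  also have "\<dots> = gag p u" by (simp add: g_def gag_def)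
  finally have sumle: "(\<Sum>i<j. \<integral>\<^sup>+y\<in>dcube i x - dcube (Suc i) x. g y \<partial>lborel) \<le> gag p u" .
  have "ennreal (\<Sum>i<Suc j. d i powr p) = (\<Sum>i<Suc j. ennreal (d i powr p))"
    by (subst sum_ennreal) auto
  also have "\<dots> = ennreal (d 0 powr p) + (\<Sum>i<j. ennreal (d (Suc i) powr p))"
    by (rule sum.lessThan_Suc_shift)
  also have "\<dots> \<le> ennreal C * Lp_p p u + (\<Sum>i<j. ennreal C * (\<integral>\<^sup>+y\<in>dcube i x - dcube (Suc i) x. g y \<partial>lborel))"
  proof (intro add_mono sum_mono dSuc)
    have "ennreal 1 * Lp_p p u \<le> ennreal C * Lp_p p u" using C1 by (intro mult_right_mono ennreal_leI) auto
    then show "ennreal (d 0 powr p) \<le> ennreal C * Lp_p p u" using d0 by simp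
  qed
  also have "\<dots> \<le> ennreal C * (Lp_p p u + gag p u)"
    unfolding sum_distrib_left[symmetric] distrib_left by (intro add_mono mult_left_mono sumle) auto
  finally have sumd: "ennreal (\<Sum>i<Suc j. d i powr p) \<le> ennreal C * (Lp_p p u + gag p u)" .
  have "\<bar>davg j u x\<bar> powr p \<le> (\<Sum>i<Suc j. d i) powr p"
    using tele p by (intro powr_mono2) auto
  also have "\<dots> \<le> real (Suc j) powr (p - 1) * (\<Sum>i<Suc j. d i powr p)"
    by (intro sum_powr_le p) (auto simp: d_def)
  finally have "ennreal (\<bar>davg j u x\<bar> powr p) \<le> ennreal (real (Suc j) powr (p - 1)) * ennreal (\<Sum>i<Suc j. d i powr p)"
    by (subst ennreal_mult[symmetric]) (auto intro!: ennreal_leI add_nonneg_nonneg sum_nonneg)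
  also have "\<dots> \<le> ennreal (real (Suc j) powr (p - 1)) * (ennreal C * (Lp_p p u + gag p u))"
    by (intro mult_left_mono sumd) auto
  also have "\<dots> = ennreal (real (Suc j) powr (p - 1) * C) * (Lp_p p u + gag p u)"
    using C1 by (subst ennreal_mult) (auto simp: mult.assoc)
  finally show ?thesis unfolding C_def .
qed

text \<open>The cut-off at \<open>1\<close> replaces the subtraction of the first Taylor terms in \<open>R_fun\<close>.\<close>

definition expw :: "real \<Rightarrow> real \<Rightarrow> real \<Rightarrow> real" where
  "expw p a t = (if \<bar>t\<bar> \<ge> 1 then exp (a * \<bar>t\<bar> powr (p / (p - 1))) else 0)"

lemma expw_nonneg [simp]: "expw p a t \<ge> 0"
  by (simp add: expw_def)

lemma expw_measurable [measurable]: "expw p a \<in> borel_measurable borel"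
  unfolding expw_def by measurable

text \<open>If \<open>|u x|\<close> is about \<open>2 B (1 + j) powr ((p - 1) / p)\<close>, the dyadic average of level \<open>j\<close> is at most
  \<open>|u x| / 2\<close>; so the exponential is dominated pointwise by a weighted sum over \<open>j\<close> of the
  approximation errors, whose integrals decay geometrically.\<close>

theorem Trudinger_Moser_expw:
  fixes M p :: real
  assumes p: "p > 1" and M: "M \<ge> 0"
  shows "\<exists>a>0. \<exists>C. \<forall>u::'a::euclidean_space \<Rightarrow> real. u \<in> borel_measurable borel \<longrightarrow> Lp_p p u + gag p u \<le> ennreal M \<longrightarrow>
     (\<integral>\<^sup>+x. ennreal (expw p a (u x)) \<partial>lborel) \<le> ennreal C"
proof -
  define N where "N = DIM('a)"
  have N1: "N \<ge> 1" by (simp add: N_def DIM_positive Suc_leI)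
  define p' where "p' = p / (p - 1)"
  have p': "p' > 0" "1 / p' = (p - 1) / p" using p by (auto simp: p'_def)
  define C where "C = 2 ^ (N + 1) * real N ^ (2 * N)"
  define C' where "C' = real N ^ (2 * N)"
  have C0: "C \<ge> 0" "C' \<ge> 0" by (auto simp: C_def C'_def)
  \<comment> \<open>For energy at most \<open>M\<close> the averages satisfy
    \<open>|davg j u x| <= B * (j + 1) powr (1 / p')\<close>. The summand 1 makes
    \<open>B >= 1\<close>, so that an approximation error of size at least \<open>B\<close> has p-th
    power at least 1.\<close>
  define B where "B = (C * M) powr (1 / p) + 1"
  have B1: "B \<ge> 1" by (simp add: B_def)
  have "C * M = ((C * M) powr (1 / p)) powr p" using p C0 M by (simp add: powr_powr)
  also have "\<dots> \<le> B powr p" using p by (intro powr_mono2) (auto simp: B_def)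
  finally have BM: "C * M \<le> B powr p" .
  define \<theta> where "\<theta> = (2 * B) powr p'"
  have \<theta>: "\<theta> > 0" using B1 by (simp add: \<theta>_def)
  \<comment> \<open>This makes \<open>exp (a * \<theta>)\<close> the square root of 2: the weights
    \<open>w j\<close> grow like \<open>2 powr (j / 2)\<close> and lose against the decay
    \<open>2 ^ (- j)\<close> of the approximation errors.\<close>
  define a where "a = ln 2 / (2 * \<theta>)"
  have a: "a > 0" "a * \<theta> = ln 2 / 2" using \<theta> by (auto simp: a_def)
  define w where "w = (\<lambda>j::nat. exp (a * \<theta> * (j + 2)))"
  define r where "r = exp (a * \<theta>) / 2"
  have r: "0 < r" "r < 1"
  proof -
    have "exp (a * \<theta>) < exp (ln 2)" unfolding a(2) by (subst exp_less_cancel_iff) simp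
    also have "exp (ln 2) = (2::real)" by simp
    finally show "r < 1" by (simp add: r_def)
  qed (simp add: r_def)
  have wr: "w j * (1 / 2 ^ j) ^ N \<le> exp (2 * a * \<theta>) * r ^ j" for j
  proof -
    have "(1 / 2 ^ j :: real) ^ N \<le> (1 / 2 ^ j) ^ 1" by (intro power_decreasing N1) auto
    then have "w j * (1 / 2 ^ j) ^ N \<le> w j * (1 / 2 ^ j)" by (intro mult_left_mono) (auto simp: w_def)
    also have "\<dots> = exp (2 * a * \<theta>) * r ^ j"
      by (simp add: w_def r_def power_divide exp_of_nat_mult[symmetric] exp_add[symmetric] algebra_simps)
    finally show ?thesis .
  qed
  define K where "K = exp (a * \<theta>) * M + exp (2 * a * \<theta>) * C' * M * (1 / (1 - r))"
  have "(\<integral>\<^sup>+x. ennreal (expw p a (u x)) \<partial>lborel) \<le> ennreal K"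
    if [measurable]: "u \<in> borel_measurable borel" and A: "Lp_p p u + gag p u \<le> ennreal M" for u :: "'a \<Rightarrow> real"
  proof -
    have LM: "Lp_p p u \<le> ennreal M" and GM: "gag p u \<le> ennreal M"
      using A by (metis add.commute le_iff_add order_trans)+
    have Lp: "Lp_p p u < \<infinity>" using LM by (simp add: order.strict_trans1)
    have bound: "\<bar>davg j u x\<bar> \<le> B * real (Suc j) powr (1 / p')" for j x
    proof -
      have "ennreal (\<bar>davg j u x\<bar> powr p) \<le> ennreal (real (Suc j) powr (p - 1) * C) * (Lp_p p u + gag p u)"
        using davg_powr_le[OF p _ Lp, of j x] by (simp add: C_def N_def)
      also have "\<dots> \<le> ennreal (real (Suc j) powr (p - 1) * C) * ennreal M"
        by (intro mult_left_mono A) auto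
      also have "\<dots> = ennreal (real (Suc j) powr (p - 1) * (C * M))"
        using C0 M by (subst ennreal_mult[symmetric]) (auto simp: mult.assoc)
      also have "\<dots> \<le> ennreal (real (Suc j) powr (p - 1) * B powr p)"
        by (intro ennreal_leI mult_left_mono BM) auto
      finally have "\<bar>davg j u x\<bar> powr p \<le> real (Suc j) powr (p - 1) * B powr p"
        by (subst (asm) ennreal_le_iff) auto
      then have "(\<bar>davg j u x\<bar> powr p) powr (1 / p) \<le> (real (Suc j) powr (p - 1) * B powr p) powr (1 / p)"
        using p by (intro powr_mono2) auto
      then show ?thesis using p B1 by (simp add: powr_powr powr_mult p'(2) mult.commute)
    qed
    have pt: "ennreal (expw p a (u x)) \<le> ennreal (exp (a * \<theta>)) * ennreal (\<bar>u x\<bar> powr p)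
       + (\<Sum>j. ennreal (w j) * ennreal (\<bar>u x - davg j u x\<bar> powr p))" for x
    proof (cases "\<bar>u x\<bar> < 1")
      case False
      then have ux: "\<bar>u x\<bar> \<ge> 1" by simp
      have e: "expw p a (u x) = exp (a * \<bar>u x\<bar> powr p')" using ux by (simp add: expw_def p'_def)
      show ?thesis
      proof (cases "\<bar>u x\<bar> < 2 * B")
        case True
        then have "\<bar>u x\<bar> powr p' \<le> \<theta>" unfolding \<theta>_def using p'(1) by (intro powr_mono2) auto
        then have "exp (a * \<bar>u x\<bar> powr p') \<le> exp (a * \<theta>)" using a by (simp add: mult_left_mono)
        \<comment> \<open>Here \<open>|u x| >= 1\<close>, so the bounded exponential is absorbed by
          the density \<open>|u x| powr p\<close>. This is the purpose of the cut-off in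
          \<open>expw\<close>.\<close>
        also have "\<dots> \<le> exp (a * \<theta>) * \<bar>u x\<bar> powr p"
          using ux p by (simp add: ge_one_powr_ge_zero)
        finally have "ennreal (expw p a (u x)) \<le> ennreal (exp (a * \<theta>)) * ennreal (\<bar>u x\<bar> powr p)"
          unfolding e by (subst ennreal_mult[symmetric]) (auto intro!: ennreal_leI)
        then show ?thesis by (rule order_trans) simp
      next
        case big: False
        define t where "t = (\<bar>u x\<bar> / (2 * B)) powr p'"
        have t1: "t \<ge> 1" unfolding t_def using big B1 p'(1) by (intro ge_one_powr_ge_zero) auto
        \<comment> \<open>The level is the floor of \<open>t\<close> minus 1: then
          \<open>j + 1 <= t\<close> keeps the average below half of \<open>|u x|\<close>, and
          \<open>t <= j + 2\<close> keeps the exponential below the weight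
          \<open>w j\<close>.\<close>
        define j where "j = nat (\<lfloor>t\<rfloor> - 1)"
        have jt: "real (Suc j) \<le> t" "t \<le> real j + 2" using t1 by (simp_all add: j_def) linarith+
        have "\<bar>davg j u x\<bar> \<le> B * real (Suc j) powr (1 / p')" by (rule bound)
        also have "\<dots> \<le> B * t powr (1 / p')"
        proof (intro mult_left_mono powr_mono2)
          show "0 \<le> 1 / p'" using p'(1) by simp
        qed (use B1 jt in auto)
        also have "\<dots> = \<bar>u x\<bar> / 2" using B1 p'(1) by (simp add: t_def powr_powr)
        finally have "\<bar>u x - davg j u x\<bar> \<ge> \<bar>u x\<bar> / 2" by linarith
        then have ge1: "\<bar>u x - davg j u x\<bar> powr p \<ge> 1" using big B1 p by (intro ge_one_powr_ge_zero) auto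
        have "\<theta> * t = \<bar>u x\<bar> powr p'"
          using B1 by (simp add: t_def \<theta>_def powr_mult[symmetric])
        then have "a * \<bar>u x\<bar> powr p' = a * \<theta> * t" by simp
        also have "\<dots> \<le> a * \<theta> * (j + 2)" using jt a \<theta> by (intro mult_left_mono) auto
        finally have "exp (a * \<bar>u x\<bar> powr p') \<le> w j" by (simp add: w_def add.commute)
        also have "\<dots> \<le> w j * \<bar>u x - davg j u x\<bar> powr p" using ge1 by (simp add: w_def)
        finally have "ennreal (expw p a (u x)) \<le> ennreal (w j) * ennreal (\<bar>u x - davg j u x\<bar> powr p)"
          unfolding e by (subst ennreal_mult[symmetric]) (auto intro!: ennreal_leI simp: w_def)
        also have "\<dots> = (\<Sum>i\<in>{j}. ennreal (w i) * ennreal (\<bar>u x - davg i u x\<bar> powr p))" by simp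
        also have "\<dots> \<le> (\<Sum>i. ennreal (w i) * ennreal (\<bar>u x - davg i u x\<bar> powr p))"
          by (intro sum_le_suminf) auto
        finally show ?thesis by (rule order_trans) simp
      qed
    qed (simp add: expw_def)
    have "(\<integral>\<^sup>+x. ennreal (expw p a (u x)) \<partial>lborel) \<le>
      (\<integral>\<^sup>+x. ennreal (exp (a * \<theta>)) * ennreal (\<bar>u x\<bar> powr p)
       + (\<Sum>j. ennreal (w j) * ennreal (\<bar>u x - davg j u x\<bar> powr p)) \<partial>lborel)"
      by (intro nn_integral_mono pt)
    also have "\<dots> = ennreal (exp (a * \<theta>)) * Lp_p p u +
       (\<Sum>j. ennreal (w j) * (\<integral>\<^sup>+x. ennreal (\<bar>u x - davg j u x\<bar> powr p) \<partial>lborel))"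
      by (simp add: nn_integral_add nn_integral_cmult nn_integral_suminf Lp_p_def)
    also have "\<dots> \<le> ennreal (exp (a * \<theta>)) * ennreal M + (\<Sum>j. ennreal (exp (2 * a * \<theta>) * C' * M * r ^ j))"
    proof (intro add_mono mult_left_mono LM suminf_le)
      fix j
      have "ennreal (w j) * (\<integral>\<^sup>+x. ennreal (\<bar>u x - davg j u x\<bar> powr p) \<partial>lborel)
         \<le> ennreal (w j) * (ennreal (C' * (1 / 2 ^ j) ^ N) * gag p u)"
        using nn_integral_davg_approx[OF p _ Lp, of j] by (intro mult_left_mono) (auto simp: C'_def N_def)
      also have "\<dots> \<le> ennreal (w j) * (ennreal (C' * (1 / 2 ^ j) ^ N) * ennreal M)"
        by (intro mult_left_mono GM) auto
      also have "\<dots> = ennreal (w j * (1 / 2 ^ j) ^ N * (C' * M))"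
        using C0 M by (simp add: ennreal_mult w_def mult.assoc mult.left_commute)
      also have "\<dots> \<le> ennreal (exp (2 * a * \<theta>) * r ^ j * (C' * M))"
        using C0 M by (intro ennreal_leI mult_right_mono wr) auto
      finally show "ennreal (w j) * (\<integral>\<^sup>+x. ennreal (\<bar>u x - davg j u x\<bar> powr p) \<partial>lborel) \<le> ennreal (exp (2 * a * \<theta>) * C' * M * r ^ j)"
        by (simp add: mult_ac)
    qed auto
    also have "(\<Sum>j. ennreal (exp (2 * a * \<theta>) * C' * M * r ^ j)) = ennreal (exp (2 * a * \<theta>) * C' * M * (1 / (1 - r)))"
    proof -
      have "(\<lambda>j. exp (2 * a * \<theta>) * C' * M * r ^ j) sums (exp (2 * a * \<theta>) * C' * M * (1 / (1 - r)))"
        using r by (intro sums_mult geometric_sums) auto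
      then have "(\<lambda>j. ennreal (exp (2 * a * \<theta>) * C' * M * r ^ j)) sums ennreal (exp (2 * a * \<theta>) * C' * M * (1 / (1 - r)))"
        using C0 M r by (subst sums_ennreal) (auto intro!: mult_nonneg_nonneg)
      then show ?thesis by (rule sums_unique[symmetric])
    qed
    also have "ennreal (exp (a * \<theta>)) * ennreal M + \<dots> = ennreal K"
    proof -
      have "0 \<le> exp (2 * a * \<theta>) * C' * M * (1 / (1 - r))"
        using C0 M r by (intro mult_nonneg_nonneg) auto
      moreover have "0 \<le> exp (a * \<theta>) * M" using M by simp
      ultimately show ?thesis
        using M unfolding K_def by (simp only: ennreal_plus ennreal_mult' exp_ge_zero)
    qed
    finally show ?thesis .
  qed
  then show ?thesis by (intro exI[of _ a] conjI exI[of _ K] allI impI a(1))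
qed

section \<open>Higher integrability and vanishing\<close>

lemma powr_le_exp_eventually:
  fixes a c e :: real
  assumes "a > 0" "e > 0"
  shows "\<exists>K\<ge>1. \<forall>t\<ge>K. t powr c \<le> e * exp (a * t)"
proof -
  obtain n :: nat where n: "c \<le> real n" using real_arch_simple by blast
  have "((\<lambda>x. x ^ n / exp x) \<longlongrightarrow> (0::real)) at_top" by (rule tendsto_power_div_exp_0)
  then have "eventually (\<lambda>x::real. x ^ n / exp x < e * a ^ n) at_top"
    by (rule order_tendstoD) (use assms in auto)
  then obtain X where X: "\<And>x. x \<ge> X \<Longrightarrow> x ^ n / exp x < e * a ^ n"
    by (auto simp: eventually_at_top_linorder)
  have "t powr c \<le> e * exp (a * t)" if t: "t \<ge> max 1 (X / a)" for t
  proof -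
    have "t powr c \<le> t powr real n" using n t by (intro powr_mono) auto
    also have "\<dots> = t ^ n" using t by (intro powr_realpow) auto
    also have "\<dots> = (a * t) ^ n / a ^ n" using assms by (simp add: power_mult_distrib)
    also have "\<dots> \<le> e * exp (a * t)"
    proof -
      have "a * t \<ge> X" using t assms by (simp add: field_simps)
      from X[OF this] show ?thesis using assms by (simp add: field_simps)
    qed
    finally show ?thesis .
  qed
  then show ?thesis by (intro exI[of _ "max 1 (X / a)"]) auto
qed

lemma powr_le_expw_eventually:
  fixes a c e p :: real
  assumes "a > 0" "e > 0" "p > 1"
  shows "\<exists>K\<ge>1. \<forall>t. \<bar>t\<bar> \<ge> K \<longrightarrow> \<bar>t\<bar> powr c \<le> e * expw p a t"
proof -
  obtain K where K: "K \<ge> 1" "\<And>t. t \<ge> K \<Longrightarrow> t powr c \<le> e * exp (a * t)"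
    using powr_le_exp_eventually[OF assms(1,2)] by blast
  have "\<bar>t\<bar> powr c \<le> e * expw p a t" if "\<bar>t\<bar> \<ge> K" for t
  proof -
    have "\<bar>t\<bar> powr 1 \<le> \<bar>t\<bar> powr (p / (p - 1))"
      using K(1) that assms by (intro powr_mono) (auto simp: field_simps)
    then have "exp (a * \<bar>t\<bar>) \<le> exp (a * \<bar>t\<bar> powr (p / (p - 1)))" using K(1) that assms by simp
    then have "e * exp (a * \<bar>t\<bar>) \<le> e * exp (a * \<bar>t\<bar> powr (p / (p - 1)))"
      using assms by (intro mult_left_mono) auto
    also have "\<dots> = e * expw p a t" using K(1) that by (simp add: expw_def)
    finally show ?thesis using K(2)[OF that] by linarith
  qed
  then show ?thesis using K(1) by blast
qed

lemma powr_2p_le: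
  fixes a e p :: real
  assumes "a > 0" "e > 0" "p > 1"
  shows "\<exists>K\<ge>1. \<forall>t. \<bar>t\<bar> powr (2 * p) \<le> K * \<bar>t\<bar> powr p + e * expw p a t"
proof -
  obtain K where K: "K \<ge> 1" "\<And>t. \<bar>t\<bar> \<ge> K \<Longrightarrow> \<bar>t\<bar> powr (2 * p) \<le> e * expw p a t"
    using powr_le_expw_eventually[OF assms, of "2 * p"] by blast
  have "\<bar>t\<bar> powr (2 * p) \<le> K powr p * \<bar>t\<bar> powr p + e * expw p a t" for t
  proof (cases "\<bar>t\<bar> \<ge> K")
    case True
    then show ?thesis using K(2)[of t] by (intro add_increasing) auto
  next
    case False
    then have "\<bar>t\<bar> powr p * \<bar>t\<bar> powr p \<le> K powr p * \<bar>t\<bar> powr p"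
      using assms by (intro mult_right_mono powr_mono2) auto
    then show ?thesis using assms by (intro add_increasing2) (auto simp: powr_add[symmetric])
  qed
  moreover have "K powr p \<ge> 1" using K assms by (intro ge_one_powr_ge_zero) auto
  ultimately show ?thesis by blast
qed

lemma energy_bounds:
  assumes "Lp_p p u + gag p u \<le> ennreal M"
  shows "Lp_p p u \<le> ennreal M" "gag p u \<le> ennreal M" "Lp_p p u < \<infinity>" "gag p u < \<infinity>"
proof -
  show a: "Lp_p p u \<le> ennreal M" and b: "gag p u \<le> ennreal M"
    using assms by (metis add.commute le_iff_add order_trans)+
  show "Lp_p p u < \<infinity>" "gag p u < \<infinity>" using a b by (auto simp: order.strict_trans1)
qed

text \<open>Powers are dominated by \<open>|t| powr p\<close> for small and by \<open>expw\<close>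
  for large arguments. The exponent \<open>2 * p\<close> is the one that the logarithmic form needs:
  its singular part is estimated with the square of the density \<open>|u| powr p\<close>.\<close>

lemma Lp_2p_bounded:
  fixes M p :: real
  assumes p: "p > 1" and M: "M \<ge> 0"
  shows "\<exists>C\<ge>0. \<forall>u::'a::euclidean_space \<Rightarrow> real. u \<in> borel_measurable borel \<longrightarrow> Lp_p p u + gag p u \<le> ennreal M \<longrightarrow>
     Lp_p (2 * p) u \<le> ennreal C"
proof -
  obtain a C where a: "a > 0" and C: "\<And>u::'a \<Rightarrow> real. u \<in> borel_measurable borel \<Longrightarrow> Lp_p p u + gag p u \<le> ennreal M \<Longrightarrow>
     (\<integral>\<^sup>+x. ennreal (expw p a (u x)) \<partial>lborel) \<le> ennreal C"
    using Trudinger_Moser_expw[OF p M, where 'a='a] by blast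
  obtain K where K: "K \<ge> 1" "\<And>t. \<bar>t\<bar> powr (2 * p) \<le> K * \<bar>t\<bar> powr p + 1 * expw p a t"
    using powr_2p_le[OF a _ p, of 1] by fastforce
  have "Lp_p (2 * p) u \<le> ennreal (K * M + \<bar>C\<bar>)"
    if [measurable]: "u \<in> borel_measurable borel" and A: "Lp_p p u + gag p u \<le> ennreal M" for u :: "'a \<Rightarrow> real"
  proof -
    have "Lp_p (2 * p) u \<le> (\<integral>\<^sup>+x. ennreal K * ennreal (\<bar>u x\<bar> powr p) + ennreal (expw p a (u x)) \<partial>lborel)"
      unfolding Lp_p_def
    proof (rule nn_integral_mono)
      fix x
      have "ennreal (\<bar>u x\<bar> powr (2 * p)) \<le> ennreal (K * \<bar>u x\<bar> powr p + expw p a (u x))"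
        using K(2)[of "u x"] by (intro ennreal_leI) simp
      then show "ennreal (\<bar>u x\<bar> powr (2 * p)) \<le> ennreal K * ennreal (\<bar>u x\<bar> powr p) + ennreal (expw p a (u x))"
        using K(1) by (simp add: ennreal_mult)
    qed
    also have "\<dots> = ennreal K * Lp_p p u + (\<integral>\<^sup>+x. ennreal (expw p a (u x)) \<partial>lborel)"
      by (simp add: nn_integral_add nn_integral_cmult Lp_p_def)
    also have "\<dots> \<le> ennreal K * ennreal M + ennreal \<bar>C\<bar>"
      using C[OF that] by (intro add_mono mult_left_mono energy_bounds[OF A]) (auto intro: order_trans ennreal_leI)
    also have "\<dots> = ennreal (K * M + \<bar>C\<bar>)" using K(1) M by (simp add: ennreal_mult)
    finally show ?thesis .
  qed
  moreover have "K * M + \<bar>C\<bar> \<ge> 0" using K(1) M by simp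
  ultimately show ?thesis by blast
qed

lemma abs_le_twice_diff:
  fixes U D r :: real
  assumes "\<bar>D\<bar> \<le> r / 2" "r < \<bar>U\<bar>"
  shows "\<bar>U\<bar> \<le> 2 * \<bar>U - D\<bar>"
proof -
  have "2 * \<bar>D\<bar> \<le> \<bar>U\<bar>" using assms by simp
  moreover have "\<bar>U\<bar> - \<bar>D\<bar> \<le> \<bar>U - D\<bar>" by (rule abs_triangle_ineq2)
  ultimately show ?thesis by argo
qed

text \<open>Three ranges of \<open>|u x|\<close>. Small values cost a small power times the p-norm,
  large values cost a small multiple of \<open>expw\<close>. In the middle range the average of a
  fixed level is at most half of the value, since its cube carries little mass; the value is then at
  most twice the approximation error, which is small in p-norm.\<close>

lemma Lions_vanishing:
  fixes M p e :: real
  assumes p: "p > 1" and M: "M \<ge> 0" and e: "e > 0"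
  shows "\<exists>\<delta>>0. \<forall>u::'a::euclidean_space \<Rightarrow> real. u \<in> borel_measurable borel \<longrightarrow> Lp_p p u + gag p u \<le> ennreal M \<longrightarrow>
     (\<forall>x. (\<integral>\<^sup>+y\<in>cball x (DIM('a)). ennreal (\<bar>u y\<bar> powr p) \<partial>lborel) \<le> ennreal \<delta>) \<longrightarrow>
     Lp_p (2 * p) u \<le> ennreal e"
proof -
  define N where "N = DIM('a)"
  have N1: "N \<ge> 1" by (simp add: N_def DIM_positive Suc_leI)
  obtain a C where a: "a > 0" and C': "\<And>u::'a \<Rightarrow> real. u \<in> borel_measurable borel \<Longrightarrow> Lp_p p u + gag p u \<le> ennreal M \<Longrightarrow>
     (\<integral>\<^sup>+x. ennreal (expw p a (u x)) \<partial>lborel) \<le> ennreal C"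
    using Trudinger_Moser_expw[OF p M, where 'a='a] by blast
  define C0 where "C0 = \<bar>C\<bar> + 1"
  have C: "(\<integral>\<^sup>+x. ennreal (expw p a (u x)) \<partial>lborel) \<le> ennreal C0"
    if "u \<in> borel_measurable borel" "Lp_p p u + gag p u \<le> ennreal M" for u :: "'a \<Rightarrow> real"
    using C'[OF that] by (rule order_trans) (rule ennreal_leI, simp add: C0_def)
  have C0: "C0 > 0" by (simp add: C0_def)
  \<comment> \<open>Values up to \<open>r\<close> contribute at most \<open>r powr p * M\<close>,
    hence at most \<open>e / 3\<close>; the values above \<open>K\<close> and the middle range
    receive \<open>e / 3\<close> each.\<close>
  define r where "r = (e / (3 * (M + 1))) powr (1 / p)"
  have r: "r > 0" "r powr p = e / (3 * (M + 1))" using e M p by (auto simp: r_def powr_powr)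
  define e' where "e' = e / (3 * C0)"
  have e': "e' > 0" using e C0 by (simp add: e'_def)
  obtain K where K: "K \<ge> 1" "\<And>t. \<bar>t\<bar> \<ge> K \<Longrightarrow> \<bar>t\<bar> powr (2 * p) \<le> e' * expw p a t"
    using powr_le_expw_eventually[OF a e' p, of "2 * p"] by blast
  define B where "B = (2 * K) powr p * (real N ^ (2 * N)) * M + 1"
  have B: "B > 0" using M by (auto simp: B_def intro!: add_nonneg_pos)
  obtain j where j: "(1/2::real) ^ j < e / (3 * B)"
    using real_arch_pow_inv[of "e / (3 * B)" "1/2"] e B by auto
  have jB: "(2 * K) powr p * (real N ^ (2 * N) * (1 / 2 ^ j) ^ N * M) \<le> e / 3"
  proof -
    have "(1 / 2 ^ j :: real) ^ N \<le> (1 / 2 ^ j) ^ 1" by (intro power_decreasing N1) auto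
    then have le: "(1 / 2 ^ j :: real) ^ N \<le> (1/2) ^ j" by (simp add: power_one_over)
    have "(2 * K) powr p * (real N ^ (2 * N) * (1 / 2 ^ j) ^ N * M) = (B - 1) * (1 / 2 ^ j) ^ N"
      by (simp add: B_def)
    also have "\<dots> \<le> (B - 1) * (1/2) ^ j"
      using M by (intro mult_left_mono le) (auto simp: B_def)
    also have "\<dots> \<le> B * (1/2) ^ j" by simp
    also have "\<dots> \<le> B * (e / (3 * B))" using j B by (intro mult_left_mono) auto
    also have "\<dots> = e / 3" using B by simp
    finally show ?thesis .
  qed
  \<comment> \<open>The level \<open>j\<close> was fixed by the approximation error alone;
    \<open>\<delta>\<close> is the local mass that forces all averages of this level below
    \<open>r / 2\<close>.\<close>
  define \<delta> where "\<delta> = (r / 2) powr p / (2 ^ j) ^ N"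
  have \<delta>: "\<delta> > 0" using r by (simp add: \<delta>_def)
  have "Lp_p (2 * p) u \<le> ennreal e"
    if [measurable]: "u \<in> borel_measurable borel" and A: "Lp_p p u + gag p u \<le> ennreal M"
      and loc: "\<And>x. (\<integral>\<^sup>+y\<in>cball x (DIM('a)). ennreal (\<bar>u y\<bar> powr p) \<partial>lborel) \<le> ennreal \<delta>" for u :: "'a \<Rightarrow> real"
  proof -
    note bd = energy_bounds[OF A]
    have small: "\<bar>davg j u x\<bar> \<le> r / 2" for x
    proof -
      \<comment> \<open>The diameter bound \<open>DIM('a) / 2 ^ j\<close> is at most
        \<open>DIM('a)\<close> at every level, which is why the radius of the balls can be fixed
        before \<open>j\<close> is known.\<close>
      have sub: "dcube j x \<subseteq> cball x (DIM('a))"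
      proof
        fix y assume "y \<in> dcube j x"
        then have "norm (x - y) \<le> DIM('a) / 2 ^ j" by (rule dcube_norm_le)
        also have "\<dots> \<le> DIM('a) / 1" by (intro divide_left_mono) auto
        finally show "y \<in> cball x (DIM('a))" by (simp add: dist_norm)
      qed
      have "ennreal (\<bar>davg j u x\<bar> powr p) \<le> ennreal ((2 ^ j) ^ N) * (\<integral>\<^sup>+y\<in>dcube j x. ennreal (\<bar>u y\<bar> powr p) \<partial>lborel)"
        unfolding N_def by (intro davg_powr_le_local p bd) auto
      also have "\<dots> \<le> ennreal ((2 ^ j) ^ N) * (\<integral>\<^sup>+y\<in>cball x (DIM('a)). ennreal (\<bar>u y\<bar> powr p) \<partial>lborel)"
        using sub by (intro mult_left_mono nn_integral_mono) (auto simp: indicator_def)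
      also have "\<dots> \<le> ennreal ((2 ^ j) ^ N) * ennreal \<delta>" by (intro mult_left_mono loc) auto
      also have "\<dots> = ennreal ((r / 2) powr p)" by (subst ennreal_mult[symmetric]) (auto simp: \<delta>_def)
      finally have "\<bar>davg j u x\<bar> powr p \<le> (r / 2) powr p" by (subst (asm) ennreal_le_iff) auto
      then show ?thesis using p r powr_mono2[of "1/p" "\<bar>davg j u x\<bar> powr p" "(r / 2) powr p"] by (simp add: powr_powr)
    qed
    have "Lp_p (2 * p) u \<le> (\<integral>\<^sup>+x. ennreal (r powr p) * ennreal (\<bar>u x\<bar> powr p) + ennreal ((2 * K) powr p) * ennreal (\<bar>u x - davg j u x\<bar> powr p)
        + ennreal e' * ennreal (expw p a (u x)) \<partial>lborel)"
      unfolding Lp_p_def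
    proof (rule nn_integral_mono)
      fix x
      have sq: "\<bar>u x\<bar> powr (2 * p) = \<bar>u x\<bar> powr p * \<bar>u x\<bar> powr p" by (simp add: powr_add[symmetric])
      have "\<bar>u x\<bar> powr (2 * p) \<le> r powr p * \<bar>u x\<bar> powr p + (2 * K) powr p * \<bar>u x - davg j u x\<bar> powr p + e' * expw p a (u x)"
      proof -
        consider "\<bar>u x\<bar> \<le> r" | "\<bar>u x\<bar> \<ge> K" | "r < \<bar>u x\<bar>" "\<bar>u x\<bar> < K" by linarith
        then show ?thesis
        proof cases
          case 1
          then have "\<bar>u x\<bar> powr (2 * p) \<le> r powr p * \<bar>u x\<bar> powr p"
            unfolding sq using p by (intro mult_right_mono powr_mono2) auto
          then show ?thesis using e' by (intro add_increasing2) auto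
        next
          case 2
          then show ?thesis using K(2)[of "u x"] by (intro add_increasing add_nonneg_nonneg) auto
        next
          case 3
          have "\<bar>u x\<bar> \<le> 2 * \<bar>u x - davg j u x\<bar>" by (rule abs_le_twice_diff[OF small 3(1)])
          then have "\<bar>u x\<bar> powr p \<le> (2 * \<bar>u x - davg j u x\<bar>) powr p" using p by (intro powr_mono2) auto
          also have "\<dots> = 2 powr p * \<bar>u x - davg j u x\<bar> powr p" by (simp add: powr_mult)
          finally have "\<bar>u x\<bar> powr (2 * p) \<le> K powr p * (2 powr p * \<bar>u x - davg j u x\<bar> powr p)"
            unfolding sq using 3 p by (intro mult_mono powr_mono2) auto
          also have "\<dots> = (2 * K) powr p * \<bar>u x - davg j u x\<bar> powr p" using K(1) by (simp add: powr_mult)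
          finally show ?thesis using e'
            by (intro add_increasing2 add_increasing) auto
        qed
      qed
      then have "ennreal (\<bar>u x\<bar> powr (2 * p)) \<le> ennreal (r powr p * \<bar>u x\<bar> powr p + (2 * K) powr p * \<bar>u x - davg j u x\<bar> powr p + e' * expw p a (u x))"
        by (rule ennreal_leI)
      then show "ennreal (\<bar>u x\<bar> powr (2 * p)) \<le> ennreal (r powr p) * ennreal (\<bar>u x\<bar> powr p) + ennreal ((2 * K) powr p) * ennreal (\<bar>u x - davg j u x\<bar> powr p)
        + ennreal e' * ennreal (expw p a (u x))"
        using e' by (simp add: ennreal_mult)
    qed
    also have "\<dots> = ennreal (r powr p) * Lp_p p u + ennreal ((2 * K) powr p) * (\<integral>\<^sup>+x. ennreal (\<bar>u x - davg j u x\<bar> powr p) \<partial>lborel)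
        + ennreal e' * (\<integral>\<^sup>+x. ennreal (expw p a (u x)) \<partial>lborel)"
      by (simp add: nn_integral_add nn_integral_cmult Lp_p_def)
    also have "\<dots> \<le> ennreal (r powr p) * ennreal M + ennreal ((2 * K) powr p) * (ennreal (real N ^ (2 * N) * (1 / 2 ^ j) ^ N) * ennreal M)
        + ennreal e' * ennreal C0"
    proof (intro add_mono mult_left_mono bd(1) C A)
      have "(\<integral>\<^sup>+x. ennreal (\<bar>u x - davg j u x\<bar> powr p) \<partial>lborel) \<le> ennreal (real N ^ (2 * N) * (1 / 2 ^ j) ^ N) * gag p u"
        unfolding N_def by (intro nn_integral_davg_approx p bd) auto
      also have "\<dots> \<le> ennreal (real N ^ (2 * N) * (1 / 2 ^ j) ^ N) * ennreal M" by (intro mult_left_mono bd) auto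
      finally show "(\<integral>\<^sup>+x. ennreal (\<bar>u x - davg j u x\<bar> powr p) \<partial>lborel) \<le> \<dots>" .
    qed auto
    also have "\<dots> = ennreal (r powr p * M + (2 * K) powr p * (real N ^ (2 * N) * (1 / 2 ^ j) ^ N * M) + e' * C0)"
      using M e' C0 by (simp add: ennreal_mult)
    also have "\<dots> \<le> ennreal e"
    proof (rule ennreal_leI)
      have "r powr p * M \<le> e / 3" unfolding r using e M by (simp add: field_simps)
      moreover have "e' * C0 = e / 3" using C0 by (simp add: e'_def)
      ultimately show "r powr p * M + (2 * K) powr p * (real N ^ (2 * N) * (1 / 2 ^ j) ^ N * M) + e' * C0 \<le> e"
        using jB by linarith
    qed
    finally show ?thesis .
  qed
  then show ?thesis using \<delta> by (intro exI[of _ \<delta>] conjI allI impI) auto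
qed

section \<open>Compactness almost everywhere\<close>

text \<open>The series of the integrals converges, so the series of the functions is finite almost
  everywhere and its terms tend to 0.\<close>

lemma AE_tendsto_0_of_geometric:
  fixes g :: "nat \<Rightarrow> 'b \<Rightarrow> real"
  assumes [measurable]: "\<And>j. g j \<in> borel_measurable M" and g0: "\<And>j x. g j x \<ge> 0"
    and r: "0 < r" "r < 1" and K: "K \<ge> 0" and le: "\<And>j. (\<integral>\<^sup>+x. ennreal (g j x) \<partial>M) \<le> ennreal (K * r ^ j)"
  shows "AE x in M. (\<lambda>j. g j x) \<longlonglongrightarrow> 0"
proof -
  have "(\<integral>\<^sup>+x. (\<Sum>j. ennreal (g j x)) \<partial>M) = (\<Sum>j. \<integral>\<^sup>+x. ennreal (g j x) \<partial>M)"
    by (intro nn_integral_suminf) auto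
  also have "\<dots> \<le> (\<Sum>j. ennreal (K * r ^ j))" by (intro suminf_le le) auto
  also have "\<dots> < \<infinity>"
    using r K by (subst suminf_ennreal2) (auto intro!: summable_mult summable_geometric)
  finally have "(\<integral>\<^sup>+x. (\<Sum>j. ennreal (g j x)) \<partial>M) \<noteq> \<infinity>" by (auto simp: top_unique)
  then have "AE x in M. (\<Sum>j. ennreal (g j x)) \<noteq> \<infinity>" by (intro nn_integral_PInf_AE) auto
  then show ?thesis
  proof eventually_elim
    case (elim x)
    then have "summable (\<lambda>j. g j x)" using g0 by (intro summable_suminf_not_top) auto
    then show ?case by (rule summable_LIMSEQ_zero)
  qed
qed

lemma dindex_PiE: "dindex j x \<in> PiE Basis (\<lambda>_. UNIV)"
  by (auto simp: dindex_def)

lemma davg_cong_dindex: "dindex j x = dindex j y \<Longrightarrow> davg j u x = davg j u y"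
  by (simp add: davg_def dcube_def)

text \<open>Averages are constant on cells. Since only finitely many cells meet a ball, their
  pointwise convergence is uniform on balls.\<close>

lemma finite_dindex_image:
  "finite (dindex j ` cball (0::'a::euclidean_space) r)"
proof (rule finite_subset)
  show "dindex j ` cball (0::'a) r \<subseteq> PiE Basis (\<lambda>_. {\<lfloor>- (2 ^ j * r)\<rfloor>..\<lfloor>2 ^ j * r\<rfloor>})"
  proof
    fix \<kappa> assume "\<kappa> \<in> dindex j ` cball (0::'a) r"
    then obtain x :: 'a where x: "norm x \<le> r" "\<kappa> = dindex j x" by auto
    have "\<lfloor>- (2 ^ j * r)\<rfloor> \<le> \<lfloor>2 ^ j * (x \<bullet> b)\<rfloor> \<and> \<lfloor>2 ^ j * (x \<bullet> b)\<rfloor> \<le> \<lfloor>2 ^ j * r\<rfloor>" if "b \<in> Basis" for b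
    proof -
      have "\<bar>x \<bullet> b\<bar> \<le> r" using Basis_le_norm[OF that, of x] x by simp
      then have "- r \<le> x \<bullet> b" "x \<bullet> b \<le> r" by linarith+
      then have "2 ^ j * (- r) \<le> 2 ^ j * (x \<bullet> b)" "2 ^ j * (x \<bullet> b) \<le> 2 ^ j * r" by (intro mult_left_mono; simp)+
      then show ?thesis by (auto intro: floor_mono)
    qed
    then show "\<kappa> \<in> PiE Basis (\<lambda>_. {\<lfloor>- (2 ^ j * r)\<rfloor>..\<lfloor>2 ^ j * r\<rfloor>})"
      by (auto simp: x dindex_def)
  qed
  show "finite (PiE (Basis::'a set) (\<lambda>_. {\<lfloor>- (2 ^ j * r)\<rfloor>..\<lfloor>2 ^ j * r\<rfloor>}))"
    by (intro finite_PiE) auto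
qed

lemma abs_powr_add_le:
  fixes x y p :: real
  assumes "p > 1"
  shows "\<bar>x + y\<bar> powr p \<le> 2 powr p * \<bar>x\<bar> powr p + 2 powr p * \<bar>y\<bar> powr p"
proof -
  have "\<bar>x + y\<bar> powr p \<le> (2 * max \<bar>x\<bar> \<bar>y\<bar>) powr p" using assms by (intro powr_mono2) auto
  also have "\<dots> = 2 powr p * max \<bar>x\<bar> \<bar>y\<bar> powr p" by (simp add: powr_mult)
  also have "max \<bar>x\<bar> \<bar>y\<bar> powr p \<le> \<bar>x\<bar> powr p + \<bar>y\<bar> powr p" by (simp add: max_def)
  finally show ?thesis by (simp add: distrib_left)
qed

text \<open>The averages converge along a subsequence by a diagonal argument; their limits \<open>e j\<close> converge
  almost everywhere because consecutive levels differ by a geometric amount in \<open>L\<^sup>p\<close>.\<close>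

theorem Rellich_AE:
  fixes u :: "nat \<Rightarrow> 'a::euclidean_space \<Rightarrow> real"
  assumes p: "p > 1" and M: "M \<ge> 0" and [measurable]: "\<And>n. u n \<in> borel_measurable borel"
    and A: "\<And>n. Lp_p p (u n) + gag p (u n) \<le> ennreal M"
  shows "\<exists>k v. (\<forall>j::nat. j \<le> k j) \<and> v \<in> borel_measurable borel \<and> (AE x in lborel. (\<lambda>j. u (k j) x) \<longlonglongrightarrow> v x)"
proof -
  define N where "N = DIM('a)"
  have N1: "N \<ge> 1" by (simp add: N_def DIM_positive Suc_leI)
  note bd = energy_bounds[OF A]
  define C where "C = 2 ^ (N + 1) * real N ^ (2 * N)"
  define C' where "C' = real N ^ (2 * N)"
  have C0: "C \<ge> 0" "C' \<ge> 0" by (auto simp: C_def C'_def)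
  define c where "c = (\<lambda>j. (real (Suc j) powr (p - 1) * C * M) powr (1 / p) + 1)"
  have c: "c j > 0" for j by (simp add: c_def add_nonneg_pos)
  have bound: "\<bar>davg j (u n) x\<bar> \<le> c j" for j n x
  proof -
    have "ennreal (\<bar>davg j (u n) x\<bar> powr p) \<le> ennreal (real (Suc j) powr (p - 1) * C) * (Lp_p p (u n) + gag p (u n))"
      using davg_powr_le[OF p _ bd(3), of n j x] by (simp add: C_def N_def)
    also have "\<dots> \<le> ennreal (real (Suc j) powr (p - 1) * C) * ennreal M" by (intro mult_left_mono A) auto
    also have "\<dots> = ennreal (real (Suc j) powr (p - 1) * C * M)" using C0 M by (simp add: ennreal_mult)
    finally have "\<bar>davg j (u n) x\<bar> powr p \<le> real (Suc j) powr (p - 1) * C * M"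
      using C0 M by (subst (asm) ennreal_le_iff) auto
    then have "(\<bar>davg j (u n) x\<bar> powr p) powr (1 / p) \<le> (real (Suc j) powr (p - 1) * C * M) powr (1 / p)"
      using p by (intro powr_mono2) auto
    then show ?thesis using p by (simp add: c_def powr_powr)
  qed
  define S where "S = {(j::nat, dindex j x) | j x. x \<in> (UNIV :: 'a set)}"
  \<comment> \<open>Division by the level bound \<open>c j\<close> puts the averages of all levels
    into one bounded interval, so a single diagonal extraction over the countable set
    \<open>S\<close> serves every level and every cell.\<close>
  define f where "f = (\<lambda>n (j, \<kappa>). (LINT y:dcell j \<kappa>|lborel. u n y) / measure lborel (dcell j \<kappa>) / c j)"
  have f: "f n (j, dindex j x) = davg j (u n) x / c j" for n j x
    by (simp add: f_def davg_def dcube_def)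
  have "countable ((UNIV :: nat set) \<times> PiE (Basis::'a set) (\<lambda>_. UNIV :: int set))"
    by (intro countable_SIGMA countable_PiE) auto
  moreover have "S \<subseteq> UNIV \<times> PiE Basis (\<lambda>_. UNIV)" using dindex_PiE by (auto simp: S_def)
  ultimately have "countable S" by (rule countable_subset[rotated])
  moreover have "norm (f n z) \<le> 1" if "z \<in> S" for n z
    using that bound c[THEN less_imp_le] c by (auto simp: S_def f abs_divide divide_simps abs_of_pos)
  ultimately obtain k0 where k0: "strict_mono (k0 :: nat \<Rightarrow> nat)" "\<And>z. z \<in> S \<Longrightarrow> \<exists>l. (\<lambda>n. f (k0 n) z) \<longlonglongrightarrow> l"
    using function_convergent_subsequence[of S f 1] by blast
  define e where "e = (\<lambda>j x. lim (\<lambda>n. davg j (u (k0 n)) x))"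
  have e: "(\<lambda>n. davg j (u (k0 n)) x) \<longlonglongrightarrow> e j x" for j x
  proof -
    obtain l where "(\<lambda>n. f (k0 n) (j, dindex j x)) \<longlonglongrightarrow> l" using k0(2) by (force simp: S_def)
    then have "(\<lambda>n. c j * f (k0 n) (j, dindex j x)) \<longlonglongrightarrow> c j * l" by (intro tendsto_intros)
    then have "(\<lambda>n. davg j (u (k0 n)) x) \<longlonglongrightarrow> c j * l" using c[of j] by (simp add: f)
    then have "convergent (\<lambda>n. davg j (u (k0 n)) x)" by (auto simp: convergent_def)
    then show ?thesis unfolding e_def by (simp add: convergent_LIMSEQ_iff)
  qed
  have [measurable]: "e j \<in> borel_measurable borel" for j unfolding e_def by measurable
  \<comment> \<open>The index is chosen so that the average of level \<open>j\<close> is within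
    \<open>(1/2) ^ j\<close> of its limit on all of \<open>cball 0 j\<close>. Every point lies in
    these balls from some \<open>j\<close> on.\<close>
  have "\<exists>m\<ge>j. \<forall>x\<in>cball 0 (real j). \<bar>davg j (u (k0 m)) x - e j x\<bar> \<le> (1/2) ^ j" for j
  proof -
    have "\<forall>\<kappa>\<in>dindex j ` cball (0::'a) (real j). \<forall>\<^sub>F m in sequentially. \<forall>x. dindex j x = \<kappa> \<longrightarrow> \<bar>davg j (u (k0 m)) x - e j x\<bar> \<le> (1/2) ^ j"
    proof
      fix \<kappa> assume "\<kappa> \<in> dindex j ` cball (0::'a) (real j)"
      then obtain y where y: "\<kappa> = dindex j y" by auto
      have "\<forall>\<^sub>F m in sequentially. dist (davg j (u (k0 m)) y) (e j y) < (1/2) ^ j" by (rule tendstoD[OF e]) simp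
      then show "\<forall>\<^sub>F m in sequentially. \<forall>x. dindex j x = \<kappa> \<longrightarrow> \<bar>davg j (u (k0 m)) x - e j x\<bar> \<le> (1/2) ^ j"
      proof eventually_elim
        case (elim m)
        show ?case
        proof (intro allI impI)
          fix x assume x: "dindex j x = \<kappa>"
          have "davg j (u i) x = davg j (u i) y" for i by (rule davg_cong_dindex) (simp add: x y)
          then show "\<bar>davg j (u (k0 m)) x - e j x\<bar> \<le> (1/2) ^ j" using elim by (simp add: e_def dist_real_def)
        qed
      qed
    qed
    then have "\<forall>\<^sub>F m in sequentially. \<forall>\<kappa>\<in>dindex j ` cball (0::'a) (real j). \<forall>x. dindex j x = \<kappa> \<longrightarrow> \<bar>davg j (u (k0 m)) x - e j x\<bar> \<le> (1/2) ^ j"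
      by (intro eventually_ball_finite finite_dindex_image)
    moreover have "\<forall>\<^sub>F m in sequentially. m \<ge> j" by (rule eventually_ge_at_top)
    ultimately have "\<forall>\<^sub>F m in sequentially. m \<ge> j \<and> (\<forall>\<kappa>\<in>dindex j ` cball (0::'a) (real j). \<forall>x. dindex j x = \<kappa> \<longrightarrow> \<bar>davg j (u (k0 m)) x - e j x\<bar> \<le> (1/2) ^ j)"
      by eventually_elim auto
    then obtain m where "m \<ge> j" "\<forall>\<kappa>\<in>dindex j ` cball (0::'a) (real j). \<forall>x. dindex j x = \<kappa> \<longrightarrow> \<bar>davg j (u (k0 m)) x - e j x\<bar> \<le> (1/2) ^ j"
      unfolding eventually_sequentially by blast
    then show ?thesis by blast
  qed
  then have "\<exists>m. \<forall>j. m j \<ge> j \<and> (\<forall>x\<in>cball 0 (real j). \<bar>davg j (u (k0 (m j))) x - e j x\<bar> \<le> (1/2) ^ j)"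
    by (intro choice) blast
  then obtain m where m': "\<And>j. m j \<ge> j \<and> (\<forall>x\<in>cball 0 (real j). \<bar>davg j (u (k0 (m j))) x - e j x\<bar> \<le> (1/2) ^ j)"
    by blast
  have m: "m j \<ge> j" "norm x \<le> real j \<Longrightarrow> \<bar>davg j (u (k0 (m j))) x - e j x\<bar> \<le> (1/2) ^ j" for j x
    using m'[of j] by auto
  have half: "(1 / 2 ^ j :: real) ^ N \<le> (1/2) ^ j" for j
  proof -
    have "(1 / 2 ^ j :: real) ^ N \<le> (1 / 2 ^ j) ^ 1" by (intro power_decreasing N1) auto
    then show ?thesis by (simp add: power_one_over)
  qed
  have approx: "(\<integral>\<^sup>+x. ennreal (\<bar>u n x - davg j (u n) x\<bar> powr p) \<partial>lborel) \<le> ennreal (C' * M * (1/2) ^ j)" for n j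
  proof -
    have "(\<integral>\<^sup>+x. ennreal (\<bar>u n x - davg j (u n) x\<bar> powr p) \<partial>lborel) \<le> ennreal (C' * (1 / 2 ^ j) ^ N) * gag p (u n)"
      unfolding C'_def N_def by (intro nn_integral_davg_approx p bd) auto
    also have "\<dots> \<le> ennreal (C' * (1 / 2 ^ j) ^ N) * ennreal M" by (intro mult_left_mono bd) auto
    also have "\<dots> = ennreal ((1 / 2 ^ j) ^ N * (C' * M))" using C0 M by (subst ennreal_mult[symmetric]) (auto simp: mult_ac)
    also have "\<dots> \<le> ennreal ((1/2) ^ j * (C' * M))" using C0 M by (intro ennreal_leI mult_right_mono half) auto
    finally show ?thesis by (simp add: mult_ac)
  qed
  define K where "K = 2 powr p * (2 * (C' * M))"
  have K0: "K \<ge> 0" using C0 M by (simp add: K_def)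
  \<comment> \<open>Fatou transfers the approximation estimates of two consecutive levels from the
    sequence to the limits of its averages.\<close>
  have ediff: "(\<integral>\<^sup>+x. ennreal (\<bar>e j x - e (Suc j) x\<bar> powr p) \<partial>lborel) \<le> ennreal (K * (1/2) ^ j)" for j
  proof -
    have lim: "(\<lambda>n. ennreal (\<bar>davg j (u (k0 n)) x - davg (Suc j) (u (k0 n)) x\<bar> powr p)) \<longlonglongrightarrow> ennreal (\<bar>e j x - e (Suc j) x\<bar> powr p)" for x
    proof (intro tendsto_ennrealI tendsto_powr2 tendsto_rabs tendsto_diff e)
    qed (use p in auto)
    have "(\<integral>\<^sup>+x. ennreal (\<bar>e j x - e (Suc j) x\<bar> powr p) \<partial>lborel)
      = (\<integral>\<^sup>+x. liminf (\<lambda>n. ennreal (\<bar>davg j (u (k0 n)) x - davg (Suc j) (u (k0 n)) x\<bar> powr p)) \<partial>lborel)"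
      by (intro nn_integral_cong lim_imp_Liminf[symmetric] lim) auto
    also have "\<dots> \<le> liminf (\<lambda>n. \<integral>\<^sup>+x. ennreal (\<bar>davg j (u (k0 n)) x - davg (Suc j) (u (k0 n)) x\<bar> powr p) \<partial>lborel)"
      by (intro nn_integral_liminf) auto
    also have "\<dots> \<le> liminf (\<lambda>n::nat. ennreal (K * (1/2) ^ j))"
    proof (intro Liminf_mono always_eventually allI)
      fix n
      let ?v = "u (k0 n)"
      have "(\<integral>\<^sup>+x. ennreal (\<bar>davg j ?v x - davg (Suc j) ?v x\<bar> powr p) \<partial>lborel)
        \<le> (\<integral>\<^sup>+x. ennreal (2 powr p) * ennreal (\<bar>?v x - davg j ?v x\<bar> powr p) + ennreal (2 powr p) * ennreal (\<bar>?v x - davg (Suc j) ?v x\<bar> powr p) \<partial>lborel)"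
      proof (rule nn_integral_mono)
        fix x
        have "\<bar>davg j ?v x - davg (Suc j) ?v x\<bar> powr p = \<bar>(davg j ?v x - ?v x) + (?v x - davg (Suc j) ?v x)\<bar> powr p" by simp
        also have "\<dots> \<le> 2 powr p * \<bar>davg j ?v x - ?v x\<bar> powr p + 2 powr p * \<bar>?v x - davg (Suc j) ?v x\<bar> powr p"
          by (rule abs_powr_add_le[OF p])
        finally have "ennreal (\<bar>davg j ?v x - davg (Suc j) ?v x\<bar> powr p) \<le> ennreal (2 powr p * \<bar>?v x - davg j ?v x\<bar> powr p + 2 powr p * \<bar>?v x - davg (Suc j) ?v x\<bar> powr p)"
          by (intro ennreal_leI) (simp add: abs_minus_commute)
        then show "ennreal (\<bar>davg j ?v x - davg (Suc j) ?v x\<bar> powr p) \<le> ennreal (2 powr p) * ennreal (\<bar>?v x - davg j ?v x\<bar> powr p) + ennreal (2 powr p) * ennreal (\<bar>?v x - davg (Suc j) ?v x\<bar> powr p)"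
          by (simp add: ennreal_mult)
      qed
      also have "\<dots> = ennreal (2 powr p) * (\<integral>\<^sup>+x. ennreal (\<bar>?v x - davg j ?v x\<bar> powr p) \<partial>lborel) + ennreal (2 powr p) * (\<integral>\<^sup>+x. ennreal (\<bar>?v x - davg (Suc j) ?v x\<bar> powr p) \<partial>lborel)"
        by (simp add: nn_integral_add nn_integral_cmult)
      also have "\<dots> \<le> ennreal (2 powr p) * ennreal (C' * M * (1/2) ^ j) + ennreal (2 powr p) * ennreal (C' * M * (1/2) ^ j)"
      proof (intro add_mono mult_left_mono approx)
        have "C' * M * (1/2) ^ Suc j \<le> C' * M * (1/2) ^ j" using C0 M by (intro mult_left_mono) auto
        then show "(\<integral>\<^sup>+x. ennreal (\<bar>?v x - davg (Suc j) ?v x\<bar> powr p) \<partial>lborel) \<le> ennreal (C' * M * (1/2) ^ j)"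
          by (intro order_trans[OF approx] ennreal_leI)
      qed auto
      also have "\<dots> = ennreal (K * (1/2) ^ j)"
      proof -
        have nn: "0 \<le> C' * M * (1/2) ^ j" using C0 M by simp
        have "ennreal (2 powr p) * ennreal (C' * M * (1/2) ^ j) = ennreal (2 powr p * (C' * M * (1/2) ^ j))"
          by (rule ennreal_mult[symmetric]) (use nn in auto)
        moreover have "K * (1/2) ^ j = 2 powr p * (C' * M * (1/2) ^ j) + 2 powr p * (C' * M * (1/2) ^ j)"
          by (simp add: K_def)
        moreover have "0 \<le> 2 powr p * (C' * M * (1/2) ^ j)" by (rule mult_nonneg_nonneg[OF powr_ge_zero nn])
        ultimately show ?thesis by (simp only: ennreal_plus)
      qed
      finally show "(\<integral>\<^sup>+x. ennreal (\<bar>davg j ?v x - davg (Suc j) ?v x\<bar> powr p) \<partial>lborel) \<le> ennreal (K * (1/2) ^ j)" .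
    qed
    finally show ?thesis by (simp add: Liminf_const)
  qed
  have AE1: "AE x in lborel. (\<lambda>j. \<bar>u (k0 (m j)) x - davg j (u (k0 (m j))) x\<bar> powr p) \<longlonglongrightarrow> 0"
    by (rule AE_tendsto_0_of_geometric[where r="1/2" and K="C' * M"]) (use C0 M approx in auto)
  \<comment> \<open>The weight \<open>(3/2) ^ j\<close> leaves a geometric bound of ratio 3/4, and
    it upgrades convergence to the pointwise rate \<open>(2/3) powr (j / p)\<close>, which is
    summable.\<close>
  have AE2: "AE x in lborel. (\<lambda>j. (3/2) ^ j * \<bar>e j x - e (Suc j) x\<bar> powr p) \<longlonglongrightarrow> 0"
  proof (rule AE_tendsto_0_of_geometric[where r="3/4" and K="K"])
    fix j
    have "(\<integral>\<^sup>+x. ennreal ((3/2) ^ j * \<bar>e j x - e (Suc j) x\<bar> powr p) \<partial>lborel) = ennreal ((3/2) ^ j) * (\<integral>\<^sup>+x. ennreal (\<bar>e j x - e (Suc j) x\<bar> powr p) \<partial>lborel)"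
      by (subst nn_integral_cmult[symmetric]) (auto simp: ennreal_mult)
    also have "\<dots> \<le> ennreal ((3/2) ^ j) * ennreal (K * (1/2) ^ j)" by (intro mult_left_mono ediff) auto
    also have "\<dots> = ennreal (K * ((3/2) ^ j * (1/2) ^ j))" using K0 by (simp add: ennreal_mult[symmetric] mult_ac)
    also have "(3/2) ^ j * (1/2) ^ j = (3/4::real) ^ j" by (simp add: power_mult_distrib[symmetric])
    finally show "(\<integral>\<^sup>+x. ennreal ((3/2) ^ j * \<bar>e j x - e (Suc j) x\<bar> powr p) \<partial>lborel) \<le> ennreal (K * (3/4) ^ j)" .
  qed (use K0 in auto)
  \<comment> \<open>Taking \<open>lim\<close> everywhere makes \<open>v\<close> Borel measurable;
    the points without a limit form a null set.\<close>
  define v where "v = (\<lambda>x. lim (\<lambda>j. u (k0 (m j)) x))"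
  have "AE x in lborel. (\<lambda>j. u (k0 (m j)) x) \<longlonglongrightarrow> v x"
    using AE1 AE2
  proof eventually_elim
    case (elim x)
    define w where "w = (\<lambda>j. u (k0 (m j)) x)"
    have "(\<lambda>j. (\<bar>w j - davg j (u (k0 (m j))) x\<bar> powr p) powr (1 / p)) \<longlonglongrightarrow> 0 powr (1 / p)"
      unfolding w_def by (rule tendsto_powr2[OF elim(1)]) (use p in auto)
    then have "(\<lambda>j. \<bar>w j - davg j (u (k0 (m j))) x\<bar>) \<longlonglongrightarrow> 0" using p by (simp add: powr_powr)
    then have l1: "(\<lambda>j. w j - davg j (u (k0 (m j))) x) \<longlonglongrightarrow> 0" by (rule tendsto_rabs_zero_cancel)
    have l2: "(\<lambda>j. davg j (u (k0 (m j))) x - e j x) \<longlonglongrightarrow> 0"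
    proof (rule Lim_null_comparison)
      show "\<forall>\<^sub>F j in sequentially. norm (davg j (u (k0 (m j))) x - e j x) \<le> (1/2) ^ j"
        unfolding eventually_sequentially
      proof (intro exI[of _ "nat \<lceil>norm x\<rceil>"] allI impI)
        fix j assume "nat \<lceil>norm x\<rceil> \<le> j"
        then have "norm x \<le> real j" by linarith
        then show "norm (davg j (u (k0 (m j))) x - e j x) \<le> (1/2) ^ j" using m(2) by simp
      qed
      show "(\<lambda>j. (1/2) ^ j) \<longlonglongrightarrow> (0::real)" by (intro LIMSEQ_power_zero) auto
    qed
    have "\<forall>\<^sub>F j in sequentially. (3/2) ^ j * \<bar>e j x - e (Suc j) x\<bar> powr p < 1"
      by (rule order_tendstoD(2)[OF elim(2)]) simp
    then have ev: "\<forall>\<^sub>F j in sequentially. norm (e (Suc j) x - e j x) \<le> ((2/3) powr (1 / p)) ^ j"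
    proof eventually_elim
      case (elim j)
      then have "\<bar>e j x - e (Suc j) x\<bar> powr p \<le> (2/3) ^ j" by (simp add: power_divide field_simps)
      then have "(\<bar>e j x - e (Suc j) x\<bar> powr p) powr (1 / p) \<le> ((2/3) ^ j) powr (1 / p)" using p by (intro powr_mono2) auto
      then have "\<bar>e j x - e (Suc j) x\<bar> \<le> ((2/3) powr real j) powr (1 / p)" using p by (simp add: powr_powr powr_realpow)
      also have "\<dots> = ((2/3) powr (1 / p)) powr real j" by (simp only: powr_powr mult.commute)
      also have "\<dots> = ((2/3) powr (1 / p)) ^ j" by (intro powr_realpow) auto
      finally show ?case by (simp add: abs_minus_commute)
    qed
    have "(2/3::real) powr (1 / p) < 1" using powr_less_mono2[of "1 / p" "2/3" 1] p by simp
    then have "summable (\<lambda>j. ((2/3) powr (1 / p)) ^ j)" by (intro summable_geometric) auto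
    then have "summable (\<lambda>j. e (Suc j) x - e j x)" by (rule summable_comparison_test_ev[OF ev])
    then have "(\<lambda>j. \<Sum>i<j. e (Suc i) x - e i x) \<longlonglongrightarrow> (\<Sum>i. e (Suc i) x - e i x)" by (rule summable_LIMSEQ)
    then have "(\<lambda>j. e j x - e 0 x) \<longlonglongrightarrow> (\<Sum>i. e (Suc i) x - e i x)" by (simp only: sum_lessThan_telescope[of "\<lambda>i. e i x"])
    from tendsto_add[OF tendsto_add[OF l1 l2] tendsto_add[OF this tendsto_const[of "e 0 x"]]]
    have "convergent w" by (auto simp: convergent_def)
    then show ?case unfolding v_def w_def by (simp add: convergent_LIMSEQ_iff)
  qed
  moreover have "v \<in> borel_measurable borel" unfolding v_def by measurable
  moreover have "j \<le> k0 (m j)" for j using m(1)[of j] seq_suble[OF k0(1), of "m j"] by linarith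
  ultimately show ?thesis by (intro exI[of _ "\<lambda>j. k0 (m j)"] exI[of _ v]) auto
qed

section \<open>Logarithmic kernels\<close>

lemma ball_sets_borel [measurable]:
  "ball (x::'a::metric_space) r \<in> sets borel" "cball (x::'a::metric_space) r \<in> sets borel"
  by simp_all

lemma nn_integral_shift:
  fixes f :: "'a::euclidean_space \<Rightarrow> ennreal"
  assumes [measurable]: "f \<in> borel_measurable borel"
  shows "(\<integral>\<^sup>+x. f (x + a) \<partial>lborel) = (\<integral>\<^sup>+x. f x \<partial>lborel)"
proof -
  have "(\<integral>\<^sup>+x. f x \<partial>lborel) = (\<integral>\<^sup>+x. f x \<partial>(distr lborel borel ((+) a)))" by (simp add: lborel_distr_plus)
  also have "\<dots> = (\<integral>\<^sup>+x. f (a + x) \<partial>lborel)" by (intro nn_integral_distr) auto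
  finally show ?thesis by (simp add: add.commute)
qed

lemma nn_integral_shift2:
  fixes H :: "'a::euclidean_space \<Rightarrow> 'a \<Rightarrow> ennreal"
  assumes [measurable]: "case_prod H \<in> borel_measurable (borel \<Otimes>\<^sub>M borel)"
  shows "(\<integral>\<^sup>+x. (\<integral>\<^sup>+y. H (x + a) (y + a) \<partial>lborel) \<partial>lborel) = (\<integral>\<^sup>+x. (\<integral>\<^sup>+y. H x y \<partial>lborel) \<partial>lborel)"
proof -
  have "(\<integral>\<^sup>+x. (\<integral>\<^sup>+y. H (x + a) (y + a) \<partial>lborel) \<partial>lborel) = (\<integral>\<^sup>+x. (\<integral>\<^sup>+y. H (x + a) y \<partial>lborel) \<partial>lborel)"
    by (intro nn_integral_cong nn_integral_shift) auto
  also have "\<dots> = (\<integral>\<^sup>+x. (\<integral>\<^sup>+y. H x y \<partial>lborel) \<partial>lborel)"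
    by (rule nn_integral_shift) measurable
  finally show ?thesis .
qed

lemma Lp_p_shift:
  fixes u :: "'a::euclidean_space \<Rightarrow> real"
  assumes [measurable]: "u \<in> borel_measurable borel"
  shows "Lp_p p (\<lambda>x. u (x + a)) = Lp_p p u"
  unfolding Lp_p_def by (rule nn_integral_shift) measurable

lemma gag_shift:
  fixes u :: "'a::euclidean_space \<Rightarrow> real"
  assumes [measurable]: "u \<in> borel_measurable borel"
  shows "gag p (\<lambda>x. u (x + a)) = gag p u"
  unfolding gag_def
  using nn_integral_shift2[of "\<lambda>x y. ennreal (\<bar>u x - u y\<bar> powr p / norm (x - y) ^ (2 * DIM('a)))" a] by simp

text \<open>Positive and negative part of the logarithm, so that each logarithmic form is an
  integral of a nonnegative function. Since \<open>ln 0 = 0\<close>, both parts vanish at 0 and the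
  diagonal contributes nothing.\<close>

definition logp :: "real \<Rightarrow> real" where "logp r = max 0 (ln r)"
definition logm :: "real \<Rightarrow> real" where "logm r = max 0 (- ln r)"

lemma logp_nonneg [simp]: "logp r \<ge> 0" and logm_nonneg [simp]: "logm r \<ge> 0"
  by (auto simp: logp_def logm_def)

lemma ln_eq_logp_logm: "ln r = logp r - logm r"
  by (auto simp: logp_def logm_def)

lemma logp_measurable [measurable]: "logp \<in> borel_measurable borel" and logm_measurable [measurable]: "logm \<in> borel_measurable borel"
  unfolding logp_def logm_def by measurable

text \<open>A bilinear form in two densities, not in \<open>u\<close>: one slot can then hold the
  difference of two densities when the form is perturbed.\<close>

definition kform :: "(real \<Rightarrow> real) \<Rightarrow> ('a::euclidean_space \<Rightarrow> real) \<Rightarrow> ('a \<Rightarrow> real) \<Rightarrow> ennreal" where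
  "kform k a b = (\<integral>\<^sup>+x. (\<integral>\<^sup>+y. ennreal (k (norm (x - y)) * a x * b y) \<partial>lborel) \<partial>lborel)"

lemma kform_shift:
  fixes f g :: "'a::euclidean_space \<Rightarrow> real"
  assumes [measurable]: "f \<in> borel_measurable borel" "g \<in> borel_measurable borel" "k \<in> borel_measurable borel"
  shows "kform k (\<lambda>x. f (x + a)) (\<lambda>x. g (x + a)) = kform k f g"
  unfolding kform_def
  using nn_integral_shift2[of "\<lambda>x y. ennreal (k (norm (x - y)) * f x * g y)" a] by simp

text \<open>Dyadic layers: on the layer of radius about \<open>2 ^ (- j)\<close> the integrand is
  about \<open>2 powr (j \<beta>)\<close>, and the ball has volume of order
  \<open>2 ^ (- j N)\<close>; the sum is geometric because \<open>\<beta> < N\<close>. The factor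
  \<open>2 powr |\<beta>|\<close> absorbs the position inside a layer for either sign of
  \<open>\<beta>\<close>.\<close>

lemma nn_integral_norm_powr_ball_finite:
  fixes \<beta> :: real
  assumes "\<beta> < DIM('a::euclidean_space)"
  shows "(\<integral>\<^sup>+z\<in>ball (0::'a) 1. ennreal (norm z powr (- \<beta>)) \<partial>lborel) < \<infinity>"
proof -
  define N where "N = DIM('a)"
  define V where "V = unit_ball_vol N"
  have V: "V \<ge> 0" by (simp add: V_def)
  define c where "c = (\<lambda>j::nat. 2 powr \<bar>\<beta>\<bar> * 2 powr (j * \<beta>))"
  have pt: "ennreal (norm z powr (- \<beta>)) * indicator (ball 0 1) z \<le> (\<Sum>j. ennreal (c j) * indicator (ball 0 ((1/2) ^ j)) z)" for z :: 'a
  proof (cases "z \<noteq> 0 \<and> norm z < 1")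
    case True
    define j where "j = nat \<lfloor>- log 2 (norm z)\<rfloor>"
    have lz: "log 2 (norm z) < 0" using True by simp
    have j: "real j \<le> - log 2 (norm z)" "- log 2 (norm z) < real j + 1" using lz by (simp_all add: j_def)
    show ?thesis
    proof (cases "real j = - log 2 (norm z)")
      \<comment> \<open>A point with norm exactly \<open>2 ^ (- j)\<close> lies outside the open
        ball of that radius, so the next larger ball, of index \<open>j - 1\<close>, has to be
        used.\<close>
      case True
      have nz: "norm z = 2 powr (- real j)" using True \<open>z \<noteq> 0 \<and> norm z < 1\<close> by simp
      have j1: "j \<ge> 1" using lz True by (cases j) auto
      define i where "i = j - 1"
      have ji: "real j = real i + 1" using j1 by (simp add: i_def)
      have "norm z = (1/2) ^ j"
        by (simp add: nz powr_minus powr_realpow power_one_over inverse_eq_divide)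
      also have "\<dots> = (1/2) ^ Suc i" using j1 by (simp add: i_def)
      also have "\<dots> < (1/2) ^ i" by simp
      finally have "norm z < (1/2) ^ i" .
      moreover have "norm z powr (- \<beta>) \<le> c i"
      proof -
        have "norm z powr (- \<beta>) = 2 powr (real i * \<beta> + \<beta>)" by (simp add: nz powr_powr ji algebra_simps)
        also have "\<dots> \<le> 2 powr (\<bar>\<beta>\<bar> + real i * \<beta>)" by (intro powr_mono) auto
        finally show ?thesis by (simp add: c_def powr_add)
      qed
      ultimately have "ennreal (norm z powr (- \<beta>)) * indicator (ball 0 1) z \<le> (\<Sum>l\<in>{i}. ennreal (c l) * indicator (ball 0 ((1/2) ^ l)) z)"
        by (auto simp: indicator_def intro!: ennreal_leI)
      also have "\<dots> \<le> (\<Sum>l. ennreal (c l) * indicator (ball 0 ((1/2) ^ l)) z)" by (intro sum_le_suminf) auto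
      finally show ?thesis .
    next
      case False
      then have lt: "log 2 (norm z) < - real j" using j by simp
      then have "norm z < 2 powr (- real j)" using \<open>z \<noteq> 0 \<and> norm z < 1\<close> by (simp add: log_less_iff)
      then have "norm z < (1/2) ^ j" by (simp add: powr_minus powr_realpow field_simps power_one_over)
      moreover have "norm z powr (- \<beta>) \<le> c j"
      proof -
        have "norm z = 2 powr (log 2 (norm z))" using \<open>z \<noteq> 0 \<and> norm z < 1\<close> by simp
        then have "norm z powr (- \<beta>) = 2 powr (- log 2 (norm z) * \<beta>)" by (metis powr_powr mult_minus_left mult_minus_right)
        also have "\<dots> = 2 powr ((- log 2 (norm z) - j) * \<beta> + j * \<beta>)" by (simp add: algebra_simps)
        also have "\<dots> \<le> 2 powr (\<bar>\<beta>\<bar> + j * \<beta>)"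
        proof (rule powr_mono)
          have "\<bar>(- log 2 (norm z) - j) * \<beta>\<bar> \<le> 1 * \<bar>\<beta>\<bar>" unfolding abs_mult
            using j by (intro mult_right_mono) auto
          then show "(- log 2 (norm z) - j) * \<beta> + j * \<beta> \<le> \<bar>\<beta>\<bar> + j * \<beta>" by linarith
        qed simp
        finally show ?thesis by (simp add: c_def powr_add)
      qed
      ultimately have "ennreal (norm z powr (- \<beta>)) * indicator (ball 0 1) z \<le> (\<Sum>l\<in>{j}. ennreal (c l) * indicator (ball 0 ((1/2) ^ l)) z)"
        by (auto simp: indicator_def intro!: ennreal_leI)
      also have "\<dots> \<le> (\<Sum>l. ennreal (c l) * indicator (ball 0 ((1/2) ^ l)) z)" by (intro sum_le_suminf) auto
      finally show ?thesis .
    qed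
  qed (auto simp: indicator_def)
  have "(\<integral>\<^sup>+z\<in>ball (0::'a) 1. ennreal (norm z powr (- \<beta>)) \<partial>lborel) \<le> (\<integral>\<^sup>+z. (\<Sum>j. ennreal (c j) * indicator (ball (0::'a) ((1/2) ^ j)) z) \<partial>lborel)"
    by (intro nn_integral_mono pt)
  also have "\<dots> = (\<Sum>j. ennreal (c j) * emeasure lborel (ball (0::'a) ((1/2) ^ j)))"
    by (subst nn_integral_suminf) (auto simp: nn_integral_cmult)
  also have "\<dots> = (\<Sum>j. ennreal (2 powr \<bar>\<beta>\<bar> * V * (2 powr (\<beta> - N)) ^ j))"
  proof (intro suminf_cong)
    fix j
    have "c j * (V * ((1/2) ^ j) ^ N) = 2 powr \<bar>\<beta>\<bar> * V * (2 powr (\<beta> - N)) ^ j"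
    proof -
      have e1: "((1/2) ^ j) ^ N = (2::real) powr (- (real j * N))"
        by (simp add: power_mult[symmetric] powr_minus powr_realpow[symmetric] powr_powr power_one_over inverse_eq_divide)
      have e2: "((2::real) powr (\<beta> - N)) ^ j = 2 powr (j * (\<beta> - N))"
        by (simp add: powr_realpow[symmetric] powr_powr mult.commute)
      have "(2::real) powr (real j * \<beta>) * 2 powr (- (real j * N)) = 2 powr (j * (\<beta> - N))"
        by (simp add: powr_add[symmetric] algebra_simps)
      then show ?thesis unfolding e1 e2 by (simp add: c_def mult_ac)
    qed
    then show "ennreal (c j) * emeasure lborel (ball (0::'a) ((1/2) ^ j)) = ennreal (2 powr \<bar>\<beta>\<bar> * V * (2 powr (\<beta> - N)) ^ j)"
      by (subst emeasure_ball) (auto simp: ennreal_mult[symmetric] c_def V_def N_def)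
  qed
  also have "\<dots> < \<infinity>"
  proof -
    have "2 powr (\<beta> - N) < (2::real) powr 0" using assms by (intro powr_less_mono) (auto simp: N_def)
    then have "summable (\<lambda>j. 2 powr \<bar>\<beta>\<bar> * V * (2 powr (\<beta> - N)) ^ j)"
      by (intro summable_mult summable_geometric) auto
    then show ?thesis using V by (subst suminf_ennreal2) auto
  qed
  finally show ?thesis .
qed

text \<open>Dyadic layers again, outwards: the weight \<open>2 ^ (- 2 j N)\<close> beats the volume
  of the ball of radius \<open>2 ^ (j + 1)\<close>.\<close>

lemma nn_integral_norm_power_outside_finite:
  "(\<integral>\<^sup>+z\<in>- ball (0::'a::euclidean_space) 1. ennreal (1 / norm z ^ (2 * DIM('a))) \<partial>lborel) < \<infinity>"
proof -
  define N where "N = DIM('a)"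
  have N1: "N \<ge> 1" by (simp add: N_def DIM_positive Suc_leI)
  define V where "V = unit_ball_vol N"
  have V: "V \<ge> 0" by (simp add: V_def)
  define c where "c = (\<lambda>j::nat. 1 / (2 ^ j) ^ (2 * N) :: real)"
  have pt: "ennreal (1 / norm z ^ (2 * N)) * indicator (- ball 0 1) z \<le> (\<Sum>j. ennreal (c j) * indicator (ball 0 (2 ^ Suc j)) z)" for z :: 'a
  proof (cases "norm z < 1")
    case False
    define j where "j = nat \<lfloor>log 2 (norm z)\<rfloor>"
    have z0: "norm z > 0" using False by linarith
    then have "log 2 (norm z) \<ge> 0" using False by (subst zero_le_log_cancel_iff) auto
    then have rj: "real j = of_int \<lfloor>log 2 (norm z)\<rfloor>" by (simp add: j_def)
    have j: "real j \<le> log 2 (norm z)" "log 2 (norm z) < real (Suc j)"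
      using floor_correct[of "log 2 (norm z)"] unfolding of_nat_Suc rj by linarith+
    have "norm z < 2 powr real (Suc j)" using j(2) z0 by (simp add: log_less_iff)
    then have lt: "norm z < 2 ^ Suc j" by (subst (asm) powr_realpow) auto
    have "2 powr real j \<le> norm z" using j(1) z0 by (simp add: le_log_iff)
    then have ge: "2 ^ j \<le> norm z" by (subst (asm) powr_realpow) auto
    have "1 / norm z ^ (2 * N) \<le> c j" unfolding c_def using z0
      by (intro divide_left_mono power_mono ge mult_pos_pos zero_less_power) auto
    then have "ennreal (1 / norm z ^ (2 * N)) * indicator (- ball 0 1) z \<le> (\<Sum>l\<in>{j}. ennreal (c l) * indicator (ball 0 (2 ^ Suc l)) z)"
      using lt by (auto simp: indicator_def intro!: ennreal_leI)
    also have "\<dots> \<le> (\<Sum>l. ennreal (c l) * indicator (ball 0 (2 ^ Suc l)) z)" by (intro sum_le_suminf) auto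
    finally show ?thesis .
  qed (auto simp: indicator_def)
  have "(\<integral>\<^sup>+z\<in>- ball (0::'a) 1. ennreal (1 / norm z ^ (2 * N)) \<partial>lborel) \<le> (\<integral>\<^sup>+z. (\<Sum>j. ennreal (c j) * indicator (ball (0::'a) (2 ^ Suc j)) z) \<partial>lborel)"
    by (intro nn_integral_mono pt)
  also have "\<dots> = (\<Sum>j. ennreal (c j) * emeasure lborel (ball (0::'a) (2 ^ Suc j)))"
    by (subst nn_integral_suminf) (auto simp: nn_integral_cmult)
  also have "\<dots> \<le> (\<Sum>j. ennreal (V * 2 ^ N * (1/2) ^ j))"
  proof (intro suminf_le)
    fix j
    have "c j * (V * (2 ^ Suc j) ^ N) = V * 2 ^ N * (1 / (2 ^ j) ^ N)"
      by (simp add: c_def power_even_eq[of "2 ^ j"] power2_eq_square power_mult_distrib)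
    also have "\<dots> \<le> V * 2 ^ N * (1 / (2 ^ j) ^ 1)"
      using V N1 by (intro mult_left_mono divide_left_mono power_increasing) auto
    finally have "c j * (V * (2 ^ Suc j) ^ N) \<le> V * 2 ^ N * (1/2) ^ j" by (simp add: power_one_over)
    then show "ennreal (c j) * emeasure lborel (ball (0::'a) (2 ^ Suc j)) \<le> ennreal (V * 2 ^ N * (1/2) ^ j)"
      by (subst emeasure_ball) (auto simp: ennreal_mult[symmetric] c_def V_def N_def intro!: ennreal_leI)
  qed auto
  also have "\<dots> < \<infinity>"
    using V by (subst suminf_ennreal2) (auto intro!: summable_mult summable_geometric)
  finally show ?thesis unfolding N_def .
qed

text \<open>Near 0, \<open>- ln r <= 4 * r powr (- 1/4)\<close>, so the square is at most
  \<open>16 * r powr (- 1/2)\<close>, which is locally integrable in every dimension.\<close>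

lemma logm_square_integrable:
  "(\<integral>\<^sup>+z. ennreal ((logm (norm (z::'a::euclidean_space)))\<^sup>2) \<partial>lborel) < \<infinity>"
proof -
  have pt: "(logm (norm z))\<^sup>2 \<le> 16 * norm z powr (- (1/2)) * indicator (ball 0 1) z" for z :: 'a
  proof (cases "z \<noteq> 0 \<and> norm z < 1")
    case True
    have "- ln (norm z) = 4 * ln (norm z powr (- (1/4)))" using True by (simp add: ln_powr)
    also have "\<dots> \<le> 4 * norm z powr (- (1/4))"
      using ln_le_minus_one[of "norm z powr (- (1/4))"] True by simp
    finally have "logm (norm z) \<le> 4 * norm z powr (- (1/4))" by (simp add: logm_def)
    then have "(logm (norm z))\<^sup>2 \<le> (4 * norm z powr (- (1/4)))\<^sup>2" by (intro power_mono) auto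
    also have "\<dots> = 16 * norm z powr (- (1/2))" by (simp add: power_mult_distrib power2_eq_square powr_add[symmetric])
    finally show ?thesis using True by simp
  next
    case False
    then have "logm (norm z) = 0" by (auto simp: logm_def)
    then show ?thesis by simp
  qed
  have "(\<integral>\<^sup>+z. ennreal ((logm (norm (z::'a)))\<^sup>2) \<partial>lborel) \<le> (\<integral>\<^sup>+z. 16 * (ennreal (norm z powr (- (1/2))) * indicator (ball (0::'a) 1) z) \<partial>lborel)"
  proof (rule nn_integral_mono)
    fix z :: 'a
    have "ennreal ((logm (norm z))\<^sup>2) \<le> ennreal (16 * (norm z powr (- (1/2)) * indicator (ball 0 1) z))"
      using pt[of z] by (intro ennreal_leI) (simp add: mult_ac)
    also have "\<dots> = 16 * (ennreal (norm z powr (- (1/2))) * indicator (ball 0 1) z)"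
      by (subst ennreal_mult) (auto simp: indicator_def)
    finally show "ennreal ((logm (norm z))\<^sup>2) \<le> 16 * (ennreal (norm z powr (- (1/2))) * indicator (ball 0 1) z)" .
  qed
  also have "\<dots> = 16 * (\<integral>\<^sup>+z\<in>ball (0::'a) 1. ennreal (norm z powr (- (1/2))) \<partial>lborel)"
  proof (rule nn_integral_cmult)
    have [measurable]: "ball (0::'a) 1 \<in> sets borel" by simp
    show "(\<lambda>z. ennreal (norm z powr (- (1/2))) * indicator (ball (0::'a) 1) z) \<in> borel_measurable lborel"
      by measurable
  qed
  also have "\<dots> < \<infinity>"
  proof -
    have "1 \<le> DIM('a)" using DIM_positive[where 'a='a] by linarith
    then have "1 \<le> real DIM('a)" by (simp only: real_of_nat_ge_one_iff)
    then have "1/2 < real DIM('a)" by linarith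
    from nn_integral_norm_powr_ball_finite[OF this] show ?thesis by (auto simp: ennreal_mult_less_top)
  qed
  finally show ?thesis .
qed

text \<open>Young's inequality \<open>k * b <= l * k\<^sup>2 + b\<^sup>2 / l\<close> in the inner
  integral, which is uniform in \<open>x\<close> by translation. The weight \<open>l\<close> stays
  free: a small \<open>l\<close> makes the kernel term small, after which a small 2p-norm makes the
  whole form small.\<close>

lemma kform_logm_le:
  fixes a b :: "'a::euclidean_space \<Rightarrow> real"
  assumes [measurable]: "a \<in> borel_measurable borel" "b \<in> borel_measurable borel"
    and nonneg: "\<And>x. a x \<ge> 0" "\<And>x. b x \<ge> 0" and l: "l > 0"
  shows "kform logm a b \<le> (\<integral>\<^sup>+x. ennreal (a x) \<partial>lborel) *
    (ennreal l * (\<integral>\<^sup>+z. ennreal ((logm (norm (z::'a)))\<^sup>2) \<partial>lborel) + ennreal (1 / l) * (\<integral>\<^sup>+y. ennreal ((b y)\<^sup>2) \<partial>lborel))"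
    (is "_ \<le> _ * ?Q")
proof -
  have inner: "(\<integral>\<^sup>+y. ennreal (logm (norm (x - y)) * b y) \<partial>lborel) \<le> ?Q" for x
  proof -
    have "(\<integral>\<^sup>+y. ennreal (logm (norm (x - y)) * b y) \<partial>lborel)
      \<le> (\<integral>\<^sup>+y. ennreal l * ennreal ((logm (norm (x - y)))\<^sup>2) + ennreal (1 / l) * ennreal ((b y)\<^sup>2) \<partial>lborel)"
    proof (rule nn_integral_mono)
      fix y
      define k where "k = logm (norm (x - y))"
      have k: "k \<ge> 0" by (simp add: k_def)
      have "0 \<le> (l * k - b y)\<^sup>2 / l" using l by simp
      also have "\<dots> = l * k\<^sup>2 - 2 * (k * b y) + 1 / l * (b y)\<^sup>2" using l by (simp add: power2_eq_square field_simps)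
      finally have "2 * (k * b y) \<le> l * k\<^sup>2 + 1 / l * (b y)\<^sup>2" by linarith
      moreover have "0 \<le> k * b y" using k nonneg by simp
      ultimately have "k * b y \<le> l * k\<^sup>2 + 1 / l * (b y)\<^sup>2" by linarith
      then have "ennreal (k * b y) \<le> ennreal (l * k\<^sup>2 + 1 / l * (b y)\<^sup>2)" by (rule ennreal_leI)
      also have "\<dots> = ennreal l * ennreal (k\<^sup>2) + ennreal (1 / l) * ennreal ((b y)\<^sup>2)"
        using l by (subst ennreal_plus) (auto simp: ennreal_mult[symmetric])
      finally show "ennreal (logm (norm (x - y)) * b y) \<le> ennreal l * ennreal ((logm (norm (x - y)))\<^sup>2) + ennreal (1 / l) * ennreal ((b y)\<^sup>2)"
        by (simp add: k_def)
    qed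
    also have "\<dots> = ennreal l * (\<integral>\<^sup>+y. ennreal ((logm (norm (x - y)))\<^sup>2) \<partial>lborel) + ennreal (1 / l) * (\<integral>\<^sup>+y. ennreal ((b y)\<^sup>2) \<partial>lborel)"
      by (simp add: nn_integral_add nn_integral_cmult)
    also have "(\<integral>\<^sup>+y. ennreal ((logm (norm (x - y)))\<^sup>2) \<partial>lborel) = (\<integral>\<^sup>+y. ennreal ((logm (norm (y + (- x))))\<^sup>2) \<partial>lborel)"
      by (simp add: norm_minus_commute)
    also have "\<dots> = (\<integral>\<^sup>+z. ennreal ((logm (norm (z::'a)))\<^sup>2) \<partial>lborel)" by (rule nn_integral_shift) measurable
    finally show ?thesis .
  qed
  have "kform logm a b = (\<integral>\<^sup>+x. ennreal (a x) * (\<integral>\<^sup>+y. ennreal (logm (norm (x - y)) * b y) \<partial>lborel) \<partial>lborel)"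
    unfolding kform_def
    by (intro nn_integral_cong) (subst nn_integral_cmult[symmetric], auto simp: ennreal_mult[symmetric] nonneg mult_ac intro!: nn_integral_cong)
  also have "\<dots> \<le> (\<integral>\<^sup>+x. ennreal (a x) * ?Q \<partial>lborel)"
    by (intro nn_integral_mono mult_left_mono inner) auto
  also have "\<dots> = (\<integral>\<^sup>+x. ennreal (a x) \<partial>lborel) * ?Q" by (rule nn_integral_multc) auto
  finally show ?thesis .
qed

section \<open>The function space\<close>

lemma ennreal_lin:
  "0 \<le> a \<Longrightarrow> 0 \<le> b \<Longrightarrow> 0 \<le> x \<Longrightarrow> 0 \<le> y \<Longrightarrow> ennreal (a * x + b * y) = ennreal a * ennreal x + ennreal b * ennreal y"
  by (simp add: ennreal_mult)

definition logmoment :: "real \<Rightarrow> ('a::euclidean_space \<Rightarrow> real) \<Rightarrow> ennreal" where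
  "logmoment p u = (\<integral>\<^sup>+x. ennreal (ln (1 + norm x) * \<bar>u x\<bar> powr p) \<partial>lborel)"

text \<open>The space \<open>X\<close> with \<open>s\<close> eliminated by \<open>N = s p\<close>;
  \<open>in_X_iff_inX\<close> leads back to the original definition.\<close>

definition inX :: "real \<Rightarrow> ('a::euclidean_space \<Rightarrow> real) \<Rightarrow> bool" where
  "inX p u \<longleftrightarrow> u \<in> borel_measurable borel \<and> Lp_p p u < \<infinity> \<and> gag p u < \<infinity> \<and> logmoment p u < \<infinity>"

lemma inX_D:
  assumes "inX p u"
  shows "u \<in> borel_measurable borel" "Lp_p p u < \<infinity>" "gag p u < \<infinity>" "logmoment p u < \<infinity>"
  using assms by (auto simp: inX_def)

lemma gagliardo_p_eq_gag:
  fixes u :: "'a::euclidean_space \<Rightarrow> real"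
  assumes "real DIM('a) = s * p"
  shows "gagliardo_p s p u = gag p u"
proof -
  have "norm z powr (real DIM('a) + s * p) = norm z ^ (2 * DIM('a))" for z :: 'a
  proof -
    \<comment> \<open>The exponent is a positive integer, so \<open>powr\<close> and
      \<open>^\<close> agree also at \<open>z = 0\<close>.\<close>
    have "real DIM('a) + s * p = real (2 * DIM('a))" using assms by simp
    then show ?thesis by (metis DIM_positive mult_eq_0_iff norm_ge_zero not_less_zero powr_realpow' zero_neq_numeral)
  qed
  then show ?thesis by (simp add: gagliardo_p_def gag_def)
qed

lemma in_X_iff_inX:
  fixes u :: "'a::euclidean_space \<Rightarrow> real"
  assumes "real DIM('a) = s * p"
  shows "in_X s p u \<longleftrightarrow> inX p u"
  by (simp add: in_X_def in_Wsp_def inX_def gagliardo_p_eq_gag[OF assms] logmoment_def)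

lemma powr_dominated:
  fixes w x y p :: real
  assumes "p > 1" "a \<ge> 0" "b \<ge> 0" "\<bar>w\<bar> \<le> a * \<bar>x\<bar> + b * \<bar>y\<bar>"
  shows "\<bar>w\<bar> powr p \<le> (2 * a) powr p * \<bar>x\<bar> powr p + (2 * b) powr p * \<bar>y\<bar> powr p"
proof -
  have "\<bar>w\<bar> powr p \<le> \<bar>a * \<bar>x\<bar> + b * \<bar>y\<bar>\<bar> powr p" using assms by (intro powr_mono2) auto
  also have "\<dots> \<le> 2 powr p * \<bar>a * \<bar>x\<bar>\<bar> powr p + 2 powr p * \<bar>b * \<bar>y\<bar>\<bar> powr p" by (rule abs_powr_add_le[OF assms(1)])
  also have "\<dots> = (2 * a) powr p * \<bar>x\<bar> powr p + (2 * b) powr p * \<bar>y\<bar> powr p"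
    using assms by (simp add: abs_mult powr_mult)
  finally show ?thesis .
qed

lemma Lp_p_dominated:
  fixes u v w :: "'a::euclidean_space \<Rightarrow> real"
  assumes p: "p > 1" and ab: "a \<ge> 0" "b \<ge> 0" and [measurable]: "u \<in> borel_measurable borel" "v \<in> borel_measurable borel" "w \<in> borel_measurable borel"
    and le: "\<And>x. \<bar>w x\<bar> \<le> a * \<bar>u x\<bar> + b * \<bar>v x\<bar>"
  shows "Lp_p p w \<le> ennreal ((2 * a) powr p) * Lp_p p u + ennreal ((2 * b) powr p) * Lp_p p v"
proof -
  have "Lp_p p w \<le> (\<integral>\<^sup>+x. ennreal ((2 * a) powr p) * ennreal (\<bar>u x\<bar> powr p) + ennreal ((2 * b) powr p) * ennreal (\<bar>v x\<bar> powr p) \<partial>lborel)"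
    unfolding Lp_p_def
    by (intro nn_integral_mono) (auto simp: ennreal_mult[symmetric] ennreal_plus[symmetric] simp del: ennreal_plus intro!: ennreal_leI powr_dominated p ab le)
  also have "\<dots> = ennreal ((2 * a) powr p) * Lp_p p u + ennreal ((2 * b) powr p) * Lp_p p v"
    by (simp add: nn_integral_add nn_integral_cmult Lp_p_def)
  finally show ?thesis .
qed

lemma gag_dominated:
  fixes u v w :: "'a::euclidean_space \<Rightarrow> real"
  assumes p: "p > 1" and ab: "a \<ge> 0" "b \<ge> 0" and [measurable]: "u \<in> borel_measurable borel" "v \<in> borel_measurable borel" "w \<in> borel_measurable borel"
    and le: "\<And>x y. \<bar>w x - w y\<bar> \<le> a * \<bar>u x - u y\<bar> + b * \<bar>v x - v y\<bar>"
  shows "gag p w \<le> ennreal ((2 * a) powr p) * gag p u + ennreal ((2 * b) powr p) * gag p v"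
proof -
  define K where "K = (\<lambda>(u::'a \<Rightarrow> real) x y. ennreal (\<bar>u x - u y\<bar> powr p / norm (x - y) ^ (2 * DIM('a))) :: ennreal)"
  have pt: "K w x y \<le> ennreal ((2 * a) powr p) * K u x y + ennreal ((2 * b) powr p) * K v x y" for x y
  proof -
    have "\<bar>w x - w y\<bar> powr p / norm (x - y) ^ (2 * DIM('a)) \<le> ((2 * a) powr p * \<bar>u x - u y\<bar> powr p + (2 * b) powr p * \<bar>v x - v y\<bar> powr p) / norm (x - y) ^ (2 * DIM('a))"
      by (intro divide_right_mono powr_dominated p ab le) auto
    also have "\<dots> = (2 * a) powr p * (\<bar>u x - u y\<bar> powr p / norm (x - y) ^ (2 * DIM('a))) + (2 * b) powr p * (\<bar>v x - v y\<bar> powr p / norm (x - y) ^ (2 * DIM('a)))"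
      by (simp add: add_divide_distrib)
    finally have "K w x y \<le> ennreal \<dots>" unfolding K_def by (rule ennreal_leI)
    then show ?thesis unfolding K_def by (subst (asm) ennreal_lin) auto
  qed
  have [measurable]: "(\<lambda>z. K u (fst z) (snd z)) \<in> borel_measurable (borel \<Otimes>\<^sub>M borel)"
    "(\<lambda>z. K v (fst z) (snd z)) \<in> borel_measurable (borel \<Otimes>\<^sub>M borel)" unfolding K_def by measurable
  have [measurable]: "K u x \<in> borel_measurable borel" "K v x \<in> borel_measurable borel" for x unfolding K_def by measurable
  have [measurable]: "(\<lambda>x. \<integral>\<^sup>+y. K u x y \<partial>lborel) \<in> borel_measurable borel" "(\<lambda>x. \<integral>\<^sup>+y. K v x y \<partial>lborel) \<in> borel_measurable borel"
    unfolding K_def by measurable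
  have "gag p w = (\<integral>\<^sup>+x. (\<integral>\<^sup>+y. K w x y \<partial>lborel) \<partial>lborel)" by (simp add: gag_def K_def)
  also have "\<dots> \<le> (\<integral>\<^sup>+x. (\<integral>\<^sup>+y. ennreal ((2 * a) powr p) * K u x y + ennreal ((2 * b) powr p) * K v x y \<partial>lborel) \<partial>lborel)"
    by (intro nn_integral_mono pt)
  also have "\<dots> = (\<integral>\<^sup>+x. ennreal ((2 * a) powr p) * (\<integral>\<^sup>+y. K u x y \<partial>lborel) + ennreal ((2 * b) powr p) * (\<integral>\<^sup>+y. K v x y \<partial>lborel) \<partial>lborel)"
    by (intro nn_integral_cong) (simp add: nn_integral_add nn_integral_cmult)
  also have "\<dots> = ennreal ((2 * a) powr p) * gag p u + ennreal ((2 * b) powr p) * gag p v"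
    by (simp add: nn_integral_add nn_integral_cmult gag_def K_def)
  finally show ?thesis .
qed

lemma logmoment_dominated:
  fixes u v w :: "'a::euclidean_space \<Rightarrow> real"
  assumes p: "p > 1" and ab: "a \<ge> 0" "b \<ge> 0" and [measurable]: "u \<in> borel_measurable borel" "v \<in> borel_measurable borel" "w \<in> borel_measurable borel"
    and le: "\<And>x. \<bar>w x\<bar> \<le> a * \<bar>u x\<bar> + b * \<bar>v x\<bar>"
  shows "logmoment p w \<le> ennreal ((2 * a) powr p) * logmoment p u + ennreal ((2 * b) powr p) * logmoment p v"
proof -
  have "logmoment p w \<le> (\<integral>\<^sup>+x. ennreal ((2 * a) powr p) * ennreal (ln (1 + norm x) * \<bar>u x\<bar> powr p) + ennreal ((2 * b) powr p) * ennreal (ln (1 + norm x) * \<bar>v x\<bar> powr p) \<partial>lborel)"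
    unfolding logmoment_def
  proof (rule nn_integral_mono)
    fix x :: 'a
    have "ln (1 + norm x) * \<bar>w x\<bar> powr p \<le> ln (1 + norm x) * ((2 * a) powr p * \<bar>u x\<bar> powr p + (2 * b) powr p * \<bar>v x\<bar> powr p)"
      by (intro mult_left_mono powr_dominated p ab le) auto
    also have "\<dots> = (2 * a) powr p * (ln (1 + norm x) * \<bar>u x\<bar> powr p) + (2 * b) powr p * (ln (1 + norm x) * \<bar>v x\<bar> powr p)"
      by (simp add: algebra_simps)
    finally have "ennreal (ln (1 + norm x) * \<bar>w x\<bar> powr p) \<le> ennreal \<dots>" by (rule ennreal_leI)
    then show "ennreal (ln (1 + norm x) * \<bar>w x\<bar> powr p) \<le> ennreal ((2 * a) powr p) * ennreal (ln (1 + norm x) * \<bar>u x\<bar> powr p) + ennreal ((2 * b) powr p) * ennreal (ln (1 + norm x) * \<bar>v x\<bar> powr p)"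
      by (subst (asm) ennreal_plus) (auto simp: ennreal_mult)
  qed
  also have "\<dots> = ennreal ((2 * a) powr p) * logmoment p u + ennreal ((2 * b) powr p) * logmoment p v"
    by (simp add: nn_integral_add nn_integral_cmult logmoment_def)
  finally show ?thesis .
qed

text \<open>One criterion covers linear combinations as well as \<open>|u| + |v|\<close>. It asks
  for domination of the values and of the differences, the latter for the seminorm.\<close>

lemma inX_dominated:
  fixes u v w :: "'a::euclidean_space \<Rightarrow> real"
  assumes p: "p > 1" and ab: "a \<ge> 0" "b \<ge> 0" and uv: "inX p u" "inX p v" and w: "w \<in> borel_measurable borel"
    and le: "\<And>x. \<bar>w x\<bar> \<le> a * \<bar>u x\<bar> + b * \<bar>v x\<bar>" "\<And>x y. \<bar>w x - w y\<bar> \<le> a * \<bar>u x - u y\<bar> + b * \<bar>v x - v y\<bar>"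
  shows "inX p w"
proof -
  note u = inX_D[OF uv(1)] and v = inX_D[OF uv(2)]
  have fin: "ennreal c * A + ennreal d * B < \<infinity>" if "A < \<infinity>" "B < \<infinity>" for A B :: ennreal and c d
    using that by (simp add: ennreal_mult_less_top)
  show ?thesis unfolding inX_def
    using w order.strict_trans1[OF Lp_p_dominated[OF p ab u(1) v(1) w le(1)] fin[OF u(2) v(2)]]
      order.strict_trans1[OF gag_dominated[OF p ab u(1) v(1) w le(2)] fin[OF u(3) v(3)]]
      order.strict_trans1[OF logmoment_dominated[OF p ab u(1) v(1) w le(1)] fin[OF u(4) v(4)]]
    by simp
qed

lemma inX_lin:
  fixes u v :: "'a::euclidean_space \<Rightarrow> real"
  assumes p: "p > 1" and uv: "inX p u" "inX p v"
  shows "inX p (\<lambda>x. a * u x + b * v x)"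
proof (rule inX_dominated[OF p _ _ uv, of "\<bar>a\<bar>" "\<bar>b\<bar>"])
  show "(\<lambda>x. a * u x + b * v x) \<in> borel_measurable borel" using inX_D(1)[OF uv(1)] inX_D(1)[OF uv(2)] by measurable
  show "\<bar>a * u x + b * v x\<bar> \<le> \<bar>a\<bar> * \<bar>u x\<bar> + \<bar>b\<bar> * \<bar>v x\<bar>" for x
    by (metis abs_mult abs_triangle_ineq)
  show "\<bar>(a * u x + b * v x) - (a * u y + b * v y)\<bar> \<le> \<bar>a\<bar> * \<bar>u x - u y\<bar> + \<bar>b\<bar> * \<bar>v x - v y\<bar>" for x y
  proof -
    have "(a * u x + b * v x) - (a * u y + b * v y) = a * (u x - u y) + b * (v x - v y)" by (simp add: algebra_simps)
    then show ?thesis by (metis abs_mult abs_triangle_ineq)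
  qed
qed auto

lemma inX_scale:
  assumes "p > 1" "inX p u"
  shows "inX p (\<lambda>x. a * u x)"
  using inX_lin[OF assms assms(2), of a 0] by simp

text \<open>The function \<open>|u| + |v|\<close> will be the majorant of the difference quotients
  at \<open>u\<close> in direction \<open>v\<close>; its membership makes these majorants
  integrable.\<close>

lemma inX_abs_add:
  fixes u v :: "'a::euclidean_space \<Rightarrow> real"
  assumes p: "p > 1" and uv: "inX p u" "inX p v"
  shows "inX p (\<lambda>x. \<bar>u x\<bar> + \<bar>v x\<bar>)"
proof (rule inX_dominated[OF p _ _ uv, of 1 1])
  show "(\<lambda>x. \<bar>u x\<bar> + \<bar>v x\<bar>) \<in> borel_measurable borel" using inX_D(1)[OF uv(1)] inX_D(1)[OF uv(2)] by measurable
  show "\<bar>\<bar>u x\<bar> + \<bar>v x\<bar> - (\<bar>u y\<bar> + \<bar>v y\<bar>)\<bar> \<le> 1 * \<bar>u x - u y\<bar> + 1 * \<bar>v x - v y\<bar>" for x y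
  proof -
    have "\<bar>u x\<bar> - \<bar>u y\<bar> \<le> \<bar>u x - u y\<bar>" "\<bar>u y\<bar> - \<bar>u x\<bar> \<le> \<bar>u x - u y\<bar>"
      "\<bar>v x\<bar> - \<bar>v y\<bar> \<le> \<bar>v x - v y\<bar>" "\<bar>v y\<bar> - \<bar>v x\<bar> \<le> \<bar>v x - v y\<bar>"
      using abs_triangle_ineq2[of "u x" "u y"] abs_triangle_ineq2[of "u y" "u x"]
        abs_triangle_ineq2[of "v x" "v y"] abs_triangle_ineq2[of "v y" "v x"]
      by (auto simp: abs_minus_commute)
    then show ?thesis unfolding abs_le_iff[of "\<bar>u x\<bar> + \<bar>v x\<bar> - (\<bar>u y\<bar> + \<bar>v y\<bar>)"] by argo
  qed
qed auto

lemma ln_triangle: "ln (1 + norm (x + y)) \<le> ln (1 + norm x) + ln (1 + norm (y::'a::real_normed_vector))"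
proof -
  have "ln (1 + norm (x + y)) \<le> ln ((1 + norm x) * (1 + norm y))"
    using norm_triangle_ineq[of x y] by (intro ln_mono) (auto simp: algebra_simps add_pos_nonneg intro: order_trans)
  also have "\<dots> = ln (1 + norm x) + ln (1 + norm y)" by (intro ln_mult_pos) (auto intro: add_pos_nonneg)
  finally show ?thesis .
qed

text \<open>Norm and seminorm are translation invariant but the logarithmic moment is not: it grows
  by at most \<open>ln (1 + norm a)\<close> times the p-norm.\<close>

lemma inX_shift:
  fixes u :: "'a::euclidean_space \<Rightarrow> real"
  assumes u: "inX p u"
  shows "inX p (\<lambda>x. u (x + a))"
proof -
  note [measurable] = inX_D(1)[OF u]
  have "logmoment p (\<lambda>x. u (x + a)) \<le> (\<integral>\<^sup>+x. ennreal (ln (1 + norm (x + a)) * \<bar>u (x + a)\<bar> powr p) + ennreal (ln (1 + norm a)) * ennreal (\<bar>u (x + a)\<bar> powr p) \<partial>lborel)"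
    unfolding logmoment_def
  proof (rule nn_integral_mono)
    fix x
    have "ln (1 + norm x) \<le> ln (1 + norm (x + a)) + ln (1 + norm a)" using ln_triangle[of "x + a" "- a"] by simp
    then have "ln (1 + norm x) * \<bar>u (x + a)\<bar> powr p \<le> ln (1 + norm (x + a)) * \<bar>u (x + a)\<bar> powr p + ln (1 + norm a) * \<bar>u (x + a)\<bar> powr p"
      by (metis distrib_right mult_right_mono powr_ge_zero)
    then have "ennreal (ln (1 + norm x) * \<bar>u (x + a)\<bar> powr p) \<le> ennreal (ln (1 + norm (x + a)) * \<bar>u (x + a)\<bar> powr p + ln (1 + norm a) * \<bar>u (x + a)\<bar> powr p)"
      by (rule ennreal_leI)
    then show "ennreal (ln (1 + norm x) * \<bar>u (x + a)\<bar> powr p) \<le> ennreal (ln (1 + norm (x + a)) * \<bar>u (x + a)\<bar> powr p) + ennreal (ln (1 + norm a)) * ennreal (\<bar>u (x + a)\<bar> powr p)"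
      by (subst (asm) ennreal_plus) (auto simp: ennreal_mult)
  qed
  also have "\<dots> = logmoment p u + ennreal (ln (1 + norm a)) * Lp_p p u"
  proof -
    have "(\<integral>\<^sup>+x. ennreal (ln (1 + norm (x + a)) * \<bar>u (x + a)\<bar> powr p) \<partial>lborel) = logmoment p u"
      unfolding logmoment_def by (rule nn_integral_shift) measurable
    moreover have "(\<integral>\<^sup>+x. ennreal (\<bar>u (x + a)\<bar> powr p) \<partial>lborel) = Lp_p p u"
      unfolding Lp_p_def by (rule nn_integral_shift) measurable
    ultimately show ?thesis by (simp add: nn_integral_add nn_integral_cmult)
  qed
  also have "\<dots> < \<infinity>" using inX_D[OF u] by (simp add: ennreal_mult_less_top)
  finally show ?thesis using inX_D[OF u] Lp_p_shift[of u p a] gag_shift[of u p a] by (auto simp: inX_def)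
qed

text \<open>The subadditivity of \<open>ln (1 + norm x)\<close> separates the variables. This is why
  finite logarithmic moment is the right condition for the form to be finite.\<close>

lemma kform_logp_le:
  fixes a b :: "'a::euclidean_space \<Rightarrow> real"
  assumes [measurable]: "a \<in> borel_measurable borel" "b \<in> borel_measurable borel"
    and nonneg: "\<And>x. a x \<ge> 0" "\<And>x. b x \<ge> 0"
  shows "kform logp a b \<le> (\<integral>\<^sup>+x. ennreal (ln (1 + norm x) * a x) \<partial>lborel) * (\<integral>\<^sup>+x. ennreal (b x) \<partial>lborel)
     + (\<integral>\<^sup>+x. ennreal (a x) \<partial>lborel) * (\<integral>\<^sup>+x. ennreal (ln (1 + norm x) * b x) \<partial>lborel)"
proof -
  have "kform logp a b \<le> (\<integral>\<^sup>+x. (\<integral>\<^sup>+y. ennreal (ln (1 + norm x) * a x) * ennreal (b y) + ennreal (a x) * ennreal (ln (1 + norm y) * b y) \<partial>lborel) \<partial>lborel)"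
    unfolding kform_def
  proof (intro nn_integral_mono)
    fix x y :: 'a
    have "logp (norm (x - y)) \<le> ln (1 + norm (x - y))"
    proof (cases "x = y")
      case False
      then show ?thesis by (auto simp: logp_def intro: ln_mono)
    qed (simp add: logp_def)
    also have "\<dots> \<le> ln (1 + norm x) + ln (1 + norm y)" using ln_triangle[of x "- y"] by simp
    finally have "logp (norm (x - y)) * (a x * b y) \<le> (ln (1 + norm x) + ln (1 + norm y)) * (a x * b y)"
      using nonneg by (intro mult_right_mono) auto
    then have "ennreal (logp (norm (x - y)) * a x * b y) \<le> ennreal (ln (1 + norm x) * a x * b y + a x * (ln (1 + norm y) * b y))"
      by (intro ennreal_leI) (simp add: algebra_simps)
    then show "ennreal (logp (norm (x - y)) * a x * b y) \<le> ennreal (ln (1 + norm x) * a x) * ennreal (b y) + ennreal (a x) * ennreal (ln (1 + norm y) * b y)"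
      using nonneg by (subst (asm) ennreal_plus) (auto simp: ennreal_mult)
  qed
  also have "\<dots> = (\<integral>\<^sup>+x. ennreal (ln (1 + norm x) * a x) * (\<integral>\<^sup>+x. ennreal (b x) \<partial>lborel) + ennreal (a x) * (\<integral>\<^sup>+x. ennreal (ln (1 + norm x) * b x) \<partial>lborel) \<partial>lborel)"
    by (intro nn_integral_cong) (simp add: nn_integral_add nn_integral_cmult)
  also have "\<dots> = (\<integral>\<^sup>+x. ennreal (ln (1 + norm x) * a x) \<partial>lborel) * (\<integral>\<^sup>+x. ennreal (b x) \<partial>lborel)
     + (\<integral>\<^sup>+x. ennreal (a x) \<partial>lborel) * (\<integral>\<^sup>+x. ennreal (ln (1 + norm x) * b x) \<partial>lborel)"
    by (simp add: nn_integral_add nn_integral_multc)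
  finally show ?thesis .
qed

text \<open>This is the source of tightness for minimizing sequences.\<close>

lemma logmoment_le_kform_logp:
  fixes g :: "'a::euclidean_space \<Rightarrow> real"
  assumes [measurable]: "g \<in> borel_measurable borel" and nonneg: "\<And>x. g x \<ge> 0" and R: "R \<ge> 0"
  shows "(\<integral>\<^sup>+x. ennreal (ln (1 + norm x) * g x) \<partial>lborel) * (\<integral>\<^sup>+y\<in>cball 0 R. ennreal (g y) \<partial>lborel)
    \<le> kform logp g g + ennreal (ln (2 + R)) * ((\<integral>\<^sup>+x. ennreal (g x) \<partial>lborel) * (\<integral>\<^sup>+x. ennreal (g x) \<partial>lborel))"
proof -
  have "(\<integral>\<^sup>+x. ennreal (ln (1 + norm x) * g x) \<partial>lborel) * (\<integral>\<^sup>+y\<in>cball 0 R. ennreal (g y) \<partial>lborel)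
    = (\<integral>\<^sup>+x. (\<integral>\<^sup>+y. ennreal (ln (1 + norm x) * g x) * (ennreal (g y) * indicator (cball 0 R) y) \<partial>lborel) \<partial>lborel)"
    by (simp add: nn_integral_cmult nn_integral_multc)
  also have "\<dots> \<le> (\<integral>\<^sup>+x. (\<integral>\<^sup>+y. ennreal (logp (norm (x - y)) * g x * g y) + ennreal (ln (2 + R)) * (ennreal (g x) * ennreal (g y)) \<partial>lborel) \<partial>lborel)"
  proof (intro nn_integral_mono)
    fix x y :: 'a
    show "ennreal (ln (1 + norm x) * g x) * (ennreal (g y) * indicator (cball 0 R) y) \<le> ennreal (logp (norm (x - y)) * g x * g y) + ennreal (ln (2 + R)) * (ennreal (g x) * ennreal (g y))"
    proof (cases "norm y \<le> R")
      case True
      \<comment> \<open>The maximum with 1 turns \<open>ln m\<close> into \<open>logp\<close>, and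
        \<open>m >= 1\<close> allows \<open>1 + R + m <= (2 + R) * m\<close>, which splits the
        logarithm into a constant and the kernel.\<close>
      define m where "m = max 1 (norm (x - y))"
      have m1: "m \<ge> 1" by (simp add: m_def)
      have "norm x \<le> norm (x - y) + norm y" using norm_triangle_ineq[of "x - y" y] by simp
      then have "1 + norm x \<le> 1 + R + m" using True by (simp add: m_def)
      also have "\<dots> \<le> (2 + R) * m"
      proof -
        have "0 \<le> (1 + R) * (m - 1)" using R m1 by (intro mult_nonneg_nonneg) auto
        then show ?thesis by (simp add: algebra_simps)
      qed
      finally have "ln (1 + norm x) \<le> ln ((2 + R) * m)" by (intro ln_mono) (auto intro: add_pos_nonneg)
      also have "\<dots> = ln (2 + R) + ln m" using R m1 by (intro ln_mult_pos) auto
      also have "ln m = logp (norm (x - y))"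
      proof (cases "norm (x - y) \<le> 1")
        case True
        then show ?thesis by (cases "x = y") (auto simp: m_def logp_def max_def)
      qed (auto simp: m_def logp_def max_def)
      finally have "ln (1 + norm x) * (g x * g y) \<le> (ln (2 + R) + logp (norm (x - y))) * (g x * g y)"
        using nonneg by (intro mult_right_mono) auto
      then have "ennreal (ln (1 + norm x) * g x * g y) \<le> ennreal (logp (norm (x - y)) * g x * g y + ln (2 + R) * (g x * g y))"
        by (intro ennreal_leI) (simp add: algebra_simps)
      then show ?thesis using True nonneg R by (subst (asm) ennreal_plus) (auto simp: ennreal_mult)
    qed auto
  qed
  also have "\<dots> = (\<integral>\<^sup>+x. (\<integral>\<^sup>+y. ennreal (logp (norm (x - y)) * g x * g y) \<partial>lborel) + ennreal (ln (2 + R)) * (ennreal (g x) * (\<integral>\<^sup>+x. ennreal (g x) \<partial>lborel)) \<partial>lborel)"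
    by (intro nn_integral_cong) (simp add: nn_integral_add nn_integral_cmult)
  also have "\<dots> = kform logp g g + ennreal (ln (2 + R)) * ((\<integral>\<^sup>+x. ennreal (g x) \<partial>lborel) * (\<integral>\<^sup>+x. ennreal (g x) \<partial>lborel))"
    by (simp add: nn_integral_add nn_integral_cmult nn_integral_multc kform_def)
  finally show ?thesis .
qed

section \<open>A nonzero element of the space\<close>

text \<open>The tent function works: near the diagonal the kernel is at most
  \<open>norm (x - y) powr (p - 2 N)\<close>, which is locally integrable exactly because
  \<open>p > N\<close>.\<close>

lemma exists_nonzero_inX:
  assumes p: "p > real DIM('a::euclidean_space)" "p > 1"
  shows "\<exists>u::'a \<Rightarrow> real. inX p u \<and> Lp_p p u \<noteq> 0"
proof -
  define N where "N = DIM('a)"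
  define b where "b = (\<lambda>x::'a. max 0 (1 - norm x))"
  have [measurable]: "b \<in> borel_measurable borel" unfolding b_def by measurable
  define B where "B = ball (0::'a) 1"
  have [measurable]: "B \<in> sets borel" by (simp add: B_def)
  have Bfin: "emeasure lborel B < \<infinity>" unfolding B_def by (rule emeasure_lborel_ball_finite)
  have b0: "b x = 0" if "x \<notin> B" for x using that by (auto simp: b_def B_def)
  have b1: "0 \<le> b x" "b x \<le> 1" for x by (auto simp: b_def)
  have lip: "\<bar>b x - b y\<bar> \<le> norm (x - y)" for x y
    using norm_triangle_ineq3[of x y] unfolding b_def by linarith
  have le1: "\<bar>b x - b y\<bar> \<le> 1" for x y using b1[of x] b1[of y] by linarith
  have Lp: "Lp_p p b < \<infinity>"
  proof -
    have "Lp_p p b \<le> (\<integral>\<^sup>+x. indicator B x \<partial>lborel)" unfolding Lp_p_def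
    proof (rule nn_integral_mono)
      fix x
      have "b x powr p \<le> 1 powr p" using b1[of x] p by (intro powr_mono2) auto
      then show "ennreal (\<bar>b x\<bar> powr p) \<le> indicator B x" using b0[of x] b1[of x] by (auto simp: indicator_def)
    qed
    then show ?thesis using Bfin by (auto simp: order.strict_trans1)
  qed
  have lm: "logmoment p b < \<infinity>"
  proof -
    have "logmoment p b \<le> (\<integral>\<^sup>+x. indicator B x \<partial>lborel)" unfolding logmoment_def
    proof (rule nn_integral_mono)
      fix x
      have "b x powr p \<le> 1 powr p" using b1[of x] p by (intro powr_mono2) auto
      moreover have "ln (1 + norm x) \<le> 1" if "x \<in> B" using that ln_add_one_self_le_self[of "norm x"] by (auto simp: B_def)
      ultimately have "ln (1 + norm x) * b x powr p \<le> 1 * 1" if "x \<in> B" using that by (intro mult_mono) auto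
      then show "ennreal (ln (1 + norm x) * \<bar>b x\<bar> powr p) \<le> indicator B x" using b0[of x] b1[of x] by (auto simp: indicator_def)
    qed
    then show ?thesis using Bfin by (auto simp: order.strict_trans1)
  qed
  \<comment> \<open>The kernel majorant for a function with Lipschitz constant 1 and oscillation at
    most 1: the Lipschitz bound inside the unit ball, the oscillation bound outside.\<close>
  define \<kappa> where "\<kappa> = (\<lambda>z::'a. ennreal (norm z powr (- (2 * N - p))) * indicator (ball 0 1) z + ennreal (1 / norm z ^ (2 * N)) * indicator (- ball 0 1) z)"
  have [measurable]: "\<kappa> \<in> borel_measurable borel" unfolding \<kappa>_def by measurable
  have \<kappa>fin: "(\<integral>\<^sup>+z. \<kappa> z \<partial>lborel) < \<infinity>"
  proof -
    have "2 * N - p < DIM('a)" using p by (simp add: N_def)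
    from nn_integral_norm_powr_ball_finite[OF this] nn_integral_norm_power_outside_finite[where 'a='a]
    show ?thesis unfolding \<kappa>_def by (subst nn_integral_add) (auto simp: N_def)
  qed
  \<comment> \<open>The difference vanishes unless \<open>x\<close> or \<open>y\<close> lies in
    \<open>B\<close>; in either case one variable is confined to \<open>B\<close> and the other is
    integrated against \<open>\<kappa>\<close>.\<close>
  have pt: "ennreal (\<bar>b x - b y\<bar> powr p / norm (x - y) ^ (2 * N)) \<le> indicator B x * \<kappa> (x - y) + indicator B y * \<kappa> (x - y)" for x y
  proof (cases "x \<in> B \<or> y \<in> B")
    case True
    have "ennreal (\<bar>b x - b y\<bar> powr p / norm (x - y) ^ (2 * N)) \<le> \<kappa> (x - y)"
    proof (cases "norm (x - y) < 1")
      case lt: True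
      show ?thesis
      proof (cases "x = y")
        case False
        then have z: "norm (x - y) > 0" by simp
        have "\<bar>b x - b y\<bar> powr p / norm (x - y) ^ (2 * N) \<le> norm (x - y) powr p / norm (x - y) ^ (2 * N)"
          using lip[of x y] p by (intro divide_right_mono powr_mono2) auto
        also have "\<dots> = norm (x - y) powr (p - real (2 * N))" using z by (subst powr_diff) (simp only: powr_realpow)
        also have "\<dots> = norm (x - y) powr (- (2 * N - p))" by simp
        finally show ?thesis using lt by (simp add: \<kappa>_def indicator_def ennreal_leI)
      qed (simp add: \<kappa>_def)
    next
      case False
      have "\<bar>b x - b y\<bar> powr p \<le> 1 powr p" using le1[of x y] p by (intro powr_mono2) auto
      then have "\<bar>b x - b y\<bar> powr p / norm (x - y) ^ (2 * N) \<le> 1 / norm (x - y) ^ (2 * N)" by (intro divide_right_mono) auto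
      then show ?thesis using False by (simp add: \<kappa>_def indicator_def ennreal_leI)
    qed
    then show ?thesis using True by (auto simp: indicator_def intro: add_increasing)
  qed (simp add: b0)
  have sh: "(\<integral>\<^sup>+y. \<kappa> (x - y) \<partial>lborel) = (\<integral>\<^sup>+z. \<kappa> z \<partial>lborel)" for x
  proof -
    have "\<kappa> (x - y) = \<kappa> (y + (- x))" for y unfolding \<kappa>_def by (simp add: norm_minus_commute indicator_def dist_norm)
    then have "(\<integral>\<^sup>+y. \<kappa> (x - y) \<partial>lborel) = (\<integral>\<^sup>+y. \<kappa> (y + (- x)) \<partial>lborel)" by simp
    also have "\<dots> = (\<integral>\<^sup>+z. \<kappa> z \<partial>lborel)" by (rule nn_integral_shift) measurable
    finally show ?thesis .
  qed
  have sh': "(\<integral>\<^sup>+x. \<kappa> (x - y) \<partial>lborel) = (\<integral>\<^sup>+z. \<kappa> z \<partial>lborel)" for y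
    using nn_integral_shift[of \<kappa> "- y"] by simp
  have "gag p b \<le> (\<integral>\<^sup>+x. (\<integral>\<^sup>+y. indicator B x * \<kappa> (x - y) + indicator B y * \<kappa> (x - y) \<partial>lborel) \<partial>lborel)"
    unfolding gag_def N_def[symmetric] by (intro nn_integral_mono pt)
  also have "\<dots> = (\<integral>\<^sup>+x. indicator B x * (\<integral>\<^sup>+z. \<kappa> z \<partial>lborel) + (\<integral>\<^sup>+y. indicator B y * \<kappa> (x - y) \<partial>lborel) \<partial>lborel)"
    by (intro nn_integral_cong) (simp add: nn_integral_add nn_integral_cmult sh)
  also have "\<dots> = (\<integral>\<^sup>+x. indicator B x * (\<integral>\<^sup>+z. \<kappa> z \<partial>lborel) \<partial>lborel) + (\<integral>\<^sup>+x. (\<integral>\<^sup>+y. indicator B y * \<kappa> (x - y) \<partial>lborel) \<partial>lborel)"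
    by (rule nn_integral_add) auto
  also have "(\<integral>\<^sup>+x. (\<integral>\<^sup>+y. indicator B y * \<kappa> (x - y) \<partial>lborel) \<partial>lborel) = (\<integral>\<^sup>+y. (\<integral>\<^sup>+x. indicator B y * \<kappa> (x - y) \<partial>lborel) \<partial>lborel)"
    by (rule lborel_pair.Fubini'[symmetric]) measurable
  also have "\<dots> = (\<integral>\<^sup>+y. indicator B y * (\<integral>\<^sup>+z. \<kappa> z \<partial>lborel) \<partial>lborel)"
    by (intro nn_integral_cong) (simp add: nn_integral_cmult sh')
  also have "(\<integral>\<^sup>+x. indicator B x * (\<integral>\<^sup>+z. \<kappa> z \<partial>lborel) \<partial>lborel) + \<dots> < \<infinity>"
    using \<kappa>fin Bfin by (simp add: nn_integral_multc ennreal_mult_less_top)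
  finally have gag: "gag p b < \<infinity>" .
  have "Lp_p p b \<noteq> 0"
  proof
    assume "Lp_p p b = 0"
    then have "AE x in lborel. ennreal (\<bar>b x\<bar> powr p) = 0" unfolding Lp_p_def by (subst (asm) nn_integral_0_iff_AE) auto
    then have "AE x in lborel. x \<notin> B" by eventually_elim (auto simp: b_def B_def)
    then have "emeasure lborel B = 0" by (subst (asm) AE_iff_measurable[of B]) (auto simp: space_borel)
    moreover have "emeasure lborel B > 0" unfolding B_def by (subst emeasure_ball) auto
    ultimately show False by simp
  qed
  then show ?thesis using Lp lm gag by (intro exI[of _ b]) (simp add: inX_def)
qed

section \<open>The nonlinearity\<close>

text \<open>\<open>R_fun\<close> is a remainder of the exponential series at a positive argument.
  Its positivity lets the quotient in the growth condition be multiplied out, and the full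
  exponential serves as upper bound.\<close>

lemma R_fun_bounds:
  assumes "\<alpha> > 0" "t > 0" "N / (N - s) = p / (p - 1)"
  shows "0 < R_fun N s p \<alpha> t" "R_fun N s p \<alpha> t \<le> exp (\<alpha> * \<bar>t\<bar> powr (p / (p - 1)))"
proof -
  define x where "x = \<alpha> * t powr (p / (p - 1))"
  have x: "x > 0" using assms by (simp add: x_def)
  define n where "n = k_p p - 2"
  have R: "R_fun N s p \<alpha> t = exp x - (\<Sum>k = 0..n. x ^ k / fact k)"
  proof -
    have "\<alpha> ^ k / fact k * \<bar>t\<bar> powr (p / (p - 1) * real k) = x ^ k / fact k" for k
    proof -
      have "t powr (p / (p - 1) * real k) = (t powr (p / (p - 1))) ^ k"
        using assms(2) by (simp only: powr_powr[symmetric]) (simp add: powr_realpow)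
      then show ?thesis using assms(2) by (simp add: x_def power_mult_distrib)
    qed
    then show ?thesis using assms(2) by (simp add: R_fun_def assms(3) n_def[symmetric] x_def)
  qed
  have e: "exp x = (\<Sum>k. x ^ k / fact k)"
    unfolding exp_def by (simp add: scaleR_conv_of_real field_simps)
  have sm: "summable (\<lambda>k. x ^ k / fact k)"
    using summable_exp_generic[of x] by (simp add: scaleR_conv_of_real field_simps)
  have "(\<Sum>k<n+2. x ^ k / fact k) \<le> exp x" unfolding e
    by (rule sum_le_suminf[OF sm]) (use x in auto)
  moreover have "(\<Sum>k<n+2. x ^ k / fact k) = (\<Sum>k=0..n. x ^ k / fact k) + x ^ Suc n / fact (Suc n)"
    by (simp add: atLeast0AtMost lessThan_Suc_atMost[symmetric])
  moreover have "x ^ Suc n / fact (Suc n) > 0" using x by simp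
  ultimately show "0 < R_fun N s p \<alpha> t" unfolding R by linarith
  have "0 \<le> (\<Sum>k = 0..n. x ^ k / fact k)" using x by (intro sum_nonneg) auto
  then show "R_fun N s p \<alpha> t \<le> exp (\<alpha> * \<bar>t\<bar> powr (p / (p - 1)))" unfolding R using assms(2) by (simp add: x_def)
qed

lemma subcritical_exp_growth_D:
  assumes "subcritical_exp_growth N s p f" "N / (N - s) = p / (p - 1)" "\<alpha> > 0"
  shows "\<exists>T. \<forall>t\<ge>T. \<bar>f t\<bar> \<le> exp (\<alpha> * \<bar>t\<bar> powr (p / (p - 1)))"
proof -
  have "((\<lambda>t. f t / R_fun N s p \<alpha> t) \<longlongrightarrow> 0) at_top" using assms by (auto simp: subcritical_exp_growth_def)
  then have "\<forall>\<^sub>F t in at_top. dist (f t / R_fun N s p \<alpha> t) 0 < 1" by (rule tendstoD) simp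
  then have "\<forall>\<^sub>F t in at_top. \<bar>f t\<bar> \<le> exp (\<alpha> * \<bar>t\<bar> powr (p / (p - 1)))"
    using eventually_gt_at_top[of 0]
  proof eventually_elim
    case (elim t)
    have "\<bar>f t\<bar> < R_fun N s p \<alpha> t"
      using elim R_fun_bounds(1)[OF assms(3) elim(2) assms(2)] by (simp add: abs_divide divide_less_eq)
    then show ?case using R_fun_bounds(2)[OF assms(3) elim(2) assms(2)] by linarith
  qed
  then show ?thesis by (auto simp: eventually_at_top_linorder)
qed

lemma prim_0: "prim f 0 = 0"
  by (simp add: prim_def zero_ereal_def)

lemma prim_has_real_derivative:
  assumes "continuous_on UNIV f"
  shows "(prim f has_real_derivative f t) (at t)"
proof -
  \<comment> \<open>The interval has to contain 0 and to have \<open>t\<close> in its interior, so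
    that the one-interval derivative is the two-sided one.\<close>
  define a where "a = - \<bar>t\<bar> - 1"
  define b where "b = \<bar>t\<bar> + 1"
  have "((\<lambda>u. LBINT y=ereal 0..ereal u. f y) has_vector_derivative (f t)) (at t within {a..b})"
    by (rule interval_integral_FTC2) (auto simp: a_def b_def intro: continuous_on_subset[OF assms])
  then have "(prim f has_vector_derivative f t) (at t within {a..b})"
    by (simp add: prim_def[abs_def] zero_ereal_def)
  moreover have "at t within {a..b} = at t"
    by (rule at_within_interior) (auto simp: a_def b_def)
  ultimately show ?thesis by (simp add: has_real_derivative_iff_has_vector_derivative)
qed

text \<open>The hypotheses in the form in which they are used, without \<open>s\<close> and the
  dimension: growth is a pointwise exponential bound for every exponent, and \<open>AR\<close>
  carries the factor \<open>2 * p\<close>, which follows from \<open>\<theta> > 2 * p\<close>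
  together with \<open>prim f t >= 0\<close>.\<close>

locale nonlinearity =
  fixes p :: real and f :: "real \<Rightarrow> real"
  assumes p2: "p > 2"
    and cont: "continuous_on UNIV f"
    and odd: "\<And>t. f (- t) = - f t"
    and growth: "\<And>\<alpha>. \<alpha> > 0 \<Longrightarrow> \<exists>T. \<forall>t\<ge>T. \<bar>f t\<bar> \<le> exp (\<alpha> * \<bar>t\<bar> powr (p / (p - 1)))"
    and Fnonneg: "\<And>t. prim f t \<ge> 0"
    and small: "((\<lambda>t. f t / (\<bar>t\<bar> powr (p - 2) * t)) \<longlongrightarrow> 0) (at 0)"
    and AR: "\<And>t. t > 0 \<Longrightarrow> f t * t \<ge> 2 * p * prim f t"
    and superpower: "\<exists>q>2 * p. \<exists>M>0. \<forall>t. prim f t \<ge> M * \<bar>t\<bar> powr q"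
    and mono: "strict_mono_on {0<..} (\<lambda>t. f t / t powr (2 * p - 1))"
begin

abbreviation "F \<equiv> prim f"

lemma p1: "p > 1" using p2 by simp

lemma F_deriv: "(F has_real_derivative f t) (at t)"
  by (rule prim_has_real_derivative[OF cont])

lemma F_0: "F 0 = 0" by (rule prim_0)

lemma f_0: "f 0 = 0" using odd[of 0] by simp

lemma F_continuous: "continuous_on UNIV F"
  using F_deriv by (intro continuous_at_imp_continuous_on) (auto intro: DERIV_isCont)

lemma f_measurable [measurable]: "f \<in> borel_measurable borel"
  using cont by (rule borel_measurable_continuous_onI)

lemma F_measurable [measurable]: "F \<in> borel_measurable borel"
  using F_continuous by (rule borel_measurable_continuous_onI)

lemma f_abs: "\<bar>f \<bar>t\<bar>\<bar> = \<bar>f t\<bar>"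
  by (cases "t \<ge> 0") (auto simp: odd)

lemma F_even: "F (- t) = F t"
proof -
  have d: "((\<lambda>x. F (- x) - F x) has_real_derivative 0) (at x)" for x
  proof -
    have "((\<lambda>x. F (- x)) has_real_derivative f (- x) * (- 1)) (at x)"
      by (rule DERIV_chain2[OF F_deriv]) (auto intro!: derivative_eq_intros)
    from DERIV_diff[OF this F_deriv[of x]] show ?thesis by (simp add: odd)
  qed
  have "F (- t) - F t = F (- 0) - F 0"
    using DERIV_isconst_all[of "\<lambda>x. F (- x) - F x" t 0] d by auto
  then show ?thesis by simp
qed

lemma F_abs: "F \<bar>t\<bar> = F t"
  by (cases "t \<ge> 0") (auto simp: F_even)

lemma f_small:
  assumes "e > 0"
  shows "\<exists>r>0. \<forall>t. \<bar>t\<bar> \<le> r \<longrightarrow> \<bar>f t\<bar> \<le> e * \<bar>t\<bar> powr (p - 1)"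
proof -
  have "\<forall>\<^sub>F t in at 0. dist (f t / (\<bar>t\<bar> powr (p - 2) * t)) 0 < e" by (rule tendstoD[OF small assms])
  then obtain d where d: "d > 0" "\<And>t. t \<noteq> 0 \<Longrightarrow> \<bar>t\<bar> < d \<Longrightarrow> \<bar>f t / (\<bar>t\<bar> powr (p - 2) * t)\<bar> < e"
    unfolding eventually_at by (auto simp: dist_real_def)
  have "\<bar>f t\<bar> \<le> e * \<bar>t\<bar> powr (p - 1)" if "\<bar>t\<bar> \<le> d / 2" for t
  proof (cases "t = 0")
    case False
    have "\<bar>t\<bar> powr (p - 1) = \<bar>t\<bar> powr (p - 2) * \<bar>t\<bar>"
      using powr_add[of "\<bar>t\<bar>" "p - 2" 1] False by simp
    moreover have "\<bar>f t\<bar> / (\<bar>t\<bar> powr (p - 2) * \<bar>t\<bar>) < e"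
      using d(2)[OF False] that d(1) by (simp add: abs_mult)
    ultimately show ?thesis using False by (simp add: divide_less_eq)
  qed (simp add: f_0)
  then show ?thesis using d(1) by (intro exI[of _ "d / 2"]) auto
qed

text \<open>Reduces every bound for the primitive to a bound for \<open>f\<close>. The sign of
  \<open>f \<xi>\<close> is settled by the nonnegativity of the primitive.\<close>

lemma F_mean_value: "\<exists>\<xi>. \<bar>\<xi>\<bar> \<le> \<bar>x\<bar> \<and> F x = \<bar>x\<bar> * \<bar>f \<xi>\<bar>"
proof (cases "x = 0")
  case False
  obtain \<xi> where \<xi>: "0 < \<xi>" "\<xi> < \<bar>x\<bar>" "F \<bar>x\<bar> - F 0 = (\<bar>x\<bar> - 0) * f \<xi>"
    using MVT2[of 0 "\<bar>x\<bar>" F f] F_deriv False by auto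
  then have eq: "F x = \<bar>x\<bar> * f \<xi>" by (simp add: F_0 F_abs)
  have "f \<xi> \<ge> 0"
  proof (rule ccontr)
    assume "\<not> f \<xi> \<ge> 0"
    then have "\<bar>x\<bar> * f \<xi> < 0" using False by (simp add: mult_pos_neg)
    then show False using Fnonneg[of x] eq by simp
  qed
  then show ?thesis using \<xi> eq by (intro exI[of _ \<xi>]) auto
qed (auto simp: F_0)

lemma f_bounded_on: "\<exists>C\<ge>0. \<forall>t. \<bar>t\<bar> \<le> T \<longrightarrow> \<bar>f t\<bar> \<le> C"
proof -
  have "compact (f ` {-T..T})" by (intro compact_continuous_image continuous_on_subset[OF cont]) auto
  then obtain C where C: "\<And>t. t \<in> {-T..T} \<Longrightarrow> \<bar>f t\<bar> \<le> C"
    using compact_imp_bounded bounded_iff by (metis imageI real_norm_def)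
  have "\<bar>f t\<bar> \<le> \<bar>C\<bar>" if "\<bar>t\<bar> \<le> T" for t using C[of t] that by (auto simp: abs_le_iff)
  then show ?thesis by (intro exI[of _ "\<bar>C\<bar>"]) auto
qed

lemma powr_conj_ge: "1 \<le> x \<Longrightarrow> x \<le> x powr (p / (p - 1))"
  using powr_mono[of 1 "p / (p - 1)" x] p1 by (simp add: field_simps)

text \<open>The point \<open>\<xi>\<close> is separate from \<open>x\<close> because the same bound
  serves the primitive, through its mean value, and the difference quotients, whose intermediate
  points are only known to lie below a majorant.\<close>

lemma f_dom:
  assumes a: "a > 0"
  shows "\<exists>K\<ge>0. \<forall>x \<xi>. \<bar>\<xi>\<bar> \<le> \<bar>x\<bar> \<longrightarrow> \<bar>x\<bar> * \<bar>f \<xi>\<bar> \<le> K * (\<bar>x\<bar> powr p + expw p a x)"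
proof -
  obtain r where r: "r > 0" "\<And>t. \<bar>t\<bar> \<le> r \<Longrightarrow> \<bar>f t\<bar> \<le> 1 * \<bar>t\<bar> powr (p - 1)" using f_small[of 1] by auto
  \<comment> \<open>Growth is used with half of the exponent \<open>a\<close>; the other half of the
    exponential absorbs the factor \<open>|x|\<close>.\<close>
  obtain T0 where T0: "\<And>t. t \<ge> T0 \<Longrightarrow> \<bar>f t\<bar> \<le> exp (a / 2 * \<bar>t\<bar> powr (p / (p - 1)))" using growth[of "a / 2"] a by auto
  define T where "T = max 1 T0"
  obtain C where C: "C \<ge> 0" "\<And>t. \<bar>t\<bar> \<le> T \<Longrightarrow> \<bar>f t\<bar> \<le> C" using f_bounded_on by blast
  define K where "K = 1 + C / r powr (p - 1) + 2 / a"
  have K: "K \<ge> 1" "K \<ge> C / r powr (p - 1)" "K \<ge> 2 / a" using C(1) a r by (auto simp: K_def)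
  have px: "\<bar>x\<bar> * \<bar>x\<bar> powr (p - 1) = \<bar>x\<bar> powr p" for x :: real
    using powr_add[of "\<bar>x\<bar>" 1 "p - 1"] by (cases "x = 0") auto
  have "\<bar>x\<bar> * \<bar>f \<xi>\<bar> \<le> K * (\<bar>x\<bar> powr p + expw p a x)" if le: "\<bar>\<xi>\<bar> \<le> \<bar>x\<bar>" for x \<xi>
  proof -
    consider "\<bar>\<xi>\<bar> \<le> r" | "r < \<bar>\<xi>\<bar>" "\<bar>\<xi>\<bar> \<le> T" | "\<bar>\<xi>\<bar> > T" by linarith
    then show ?thesis
    proof cases
      case 1
      have "\<bar>x\<bar> * \<bar>f \<xi>\<bar> \<le> \<bar>x\<bar> * \<bar>\<xi>\<bar> powr (p - 1)" using r(2)[OF 1] by (intro mult_left_mono) auto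
      also have "\<dots> \<le> \<bar>x\<bar> * \<bar>x\<bar> powr (p - 1)" using le p1 by (intro mult_left_mono powr_mono2) auto
      also have "\<dots> \<le> 1 * (\<bar>x\<bar> powr p + expw p a x)" by (simp add: px)
      also have "\<dots> \<le> K * (\<bar>x\<bar> powr p + expw p a x)" using K by (intro mult_right_mono) auto
      finally show ?thesis .
    next
      case 2
      have "r powr (p - 1) \<le> \<bar>x\<bar> powr (p - 1)" using 2 le r p1 by (intro powr_mono2) auto
      then have "1 \<le> \<bar>x\<bar> powr (p - 1) / r powr (p - 1)" using r by (simp add: field_simps)
      then have "C * 1 \<le> C * (\<bar>x\<bar> powr (p - 1) / r powr (p - 1))" using C(1) by (intro mult_left_mono) auto
      then have "\<bar>f \<xi>\<bar> \<le> C * (\<bar>x\<bar> powr (p - 1) / r powr (p - 1))" using C(2)[OF 2(2)] by simp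
      then have "\<bar>x\<bar> * \<bar>f \<xi>\<bar> \<le> \<bar>x\<bar> * (C * (\<bar>x\<bar> powr (p - 1) / r powr (p - 1)))" by (rule mult_left_mono) simp
      also have "\<dots> = C / r powr (p - 1) * \<bar>x\<bar> powr p" by (simp add: px[symmetric])
      also have "\<dots> \<le> K * (\<bar>x\<bar> powr p + expw p a x)" using K by (intro mult_mono) auto
      finally show ?thesis .
    next
      case 3
      have x1: "\<bar>x\<bar> \<ge> 1" using 3 le by (simp add: T_def)
      define y where "y = \<bar>x\<bar> powr (p / (p - 1))"
      have "\<bar>f \<xi>\<bar> \<le> exp (a / 2 * \<bar>\<xi>\<bar> powr (p / (p - 1)))"
        using T0[of "\<bar>\<xi>\<bar>"] 3 by (simp add: f_abs T_def)
      also have "\<dots> \<le> exp (a / 2 * y)" unfolding y_def exp_le_cancel_iff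
        using a p1 le by (intro mult_left_mono powr_mono2) auto
      finally have "\<bar>x\<bar> * \<bar>f \<xi>\<bar> \<le> y * exp (a / 2 * y)"
        using powr_conj_ge[OF x1] unfolding y_def by (intro mult_mono) auto
      also have "y \<le> 2 / a * exp (a / 2 * y)"
      proof -
        have "a / 2 * y \<le> exp (a / 2 * y)" using exp_ge_add_one_self[of "a / 2 * y"] by linarith
        then show ?thesis using a by (simp add: field_simps)
      qed
      then have "y * exp (a / 2 * y) \<le> 2 / a * exp (a / 2 * y) * exp (a / 2 * y)" by (rule mult_right_mono) simp
      also have "\<dots> = 2 / a * expw p a x" using x1 by (simp add: expw_def y_def exp_add[symmetric])
      also have "\<dots> \<le> K * (\<bar>x\<bar> powr p + expw p a x)" using K a by (intro mult_mono) auto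
      finally show ?thesis .
    qed
  qed
  then show ?thesis using K(1) by (intro exI[of _ K]) auto
qed

lemma F_dom:
  assumes a: "a > 0"
  shows "\<exists>K\<ge>0. \<forall>x. F x \<le> K * (\<bar>x\<bar> powr p + expw p a x)"
  using f_dom[OF a] F_mean_value by metis

text \<open>Halving the exponent makes the exponential an arbitrarily small fraction for large
  arguments. This turns boundedness of the exponential integral into uniform integrability.\<close>

lemma expw_half:
  assumes "a > 0" "e > 0"
  shows "\<exists>K\<ge>1. \<forall>x. \<bar>x\<bar> \<ge> K \<longrightarrow> expw p (a / 2) x \<le> e * expw p a x"
proof -
  define K where "K = max 1 (- 2 * ln e / a)"
  have "expw p (a / 2) x \<le> e * expw p a x" if "\<bar>x\<bar> \<ge> K" for x
  proof -
    define y where "y = \<bar>x\<bar> powr (p / (p - 1))"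
    have "\<bar>x\<bar> \<le> y" using powr_conj_ge[of "\<bar>x\<bar>"] that by (simp add: y_def K_def)
    then have "- 2 * ln e / a \<le> y" using that by (simp add: K_def)
    then have "0 \<le> ln e + a / 2 * y" using assms by (simp add: field_simps)
    then have "exp (a / 2 * y) \<le> exp (ln e + a / 2 * y + a / 2 * y)" by simp
    also have "ln e + a / 2 * y + a / 2 * y = ln e + a * y" by simp
    also have "exp (ln e + a * y) = e * exp (a * y)" using assms by (simp add: exp_add)
    finally show ?thesis using that by (simp add: expw_def y_def K_def)
  qed
  then show ?thesis by (intro exI[of _ K]) (auto simp: K_def)
qed

text \<open>The large constant multiplies only the power \<open>2 * p\<close>, whose integral is
  small for vanishing functions. Small arguments use (f2), large ones subcritical growth, and the
  compact range between them goes to the power.\<close>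

lemma F_eps:
  assumes a: "a > 0" and e: "e > 0"
  shows "\<exists>K\<ge>0. \<forall>x. F x \<le> e * \<bar>x\<bar> powr p + e * expw p a x + K * \<bar>x\<bar> powr (2 * p)"
proof -
  obtain r where r: "r > 0" "\<And>t. \<bar>t\<bar> \<le> r \<Longrightarrow> \<bar>f t\<bar> \<le> e * \<bar>t\<bar> powr (p - 1)" using f_small[OF e] by auto
  have px: "\<bar>x\<bar> * \<bar>x\<bar> powr (p - 1) = \<bar>x\<bar> powr p" for x :: real
    using powr_add[of "\<bar>x\<bar>" 1 "p - 1"] by (cases "x = 0") auto
  obtain K1 where K1: "K1 \<ge> 0" "\<And>x. F x \<le> K1 * (\<bar>x\<bar> powr p + expw p (a / 2) x)" using F_dom[of "a / 2"] a by auto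
  \<comment> \<open>Both terms of the bound by \<open>K1\<close> become at most
    \<open>d * expw\<close>, and \<open>2 * d * K1 <= e\<close>.\<close>
  define d where "d = e / (2 * (K1 + 1))"
  have d: "d > 0" using e K1 by (simp add: d_def)
  obtain K2 where K2: "K2 \<ge> 1" "\<And>x. \<bar>x\<bar> \<ge> K2 \<Longrightarrow> expw p (a / 2) x \<le> d * expw p a x" using expw_half[OF a d] by auto
  obtain K3 where K3: "K3 \<ge> 1" "\<And>x. \<bar>x\<bar> \<ge> K3 \<Longrightarrow> \<bar>x\<bar> powr p \<le> d * expw p a x"
    using powr_le_expw_eventually[OF a d p1, of p] by auto
  define T where "T = max K2 K3"
  obtain C where C: "C \<ge> 0" "\<And>t. \<bar>t\<bar> \<le> T \<Longrightarrow> \<bar>f t\<bar> \<le> C" using f_bounded_on by blast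
  define K where "K = T * C / r powr (2 * p)"
  have T1: "T \<ge> 1" using K2(1) by (simp add: T_def)
  have K0: "K \<ge> 0" using C(1) T1 by (simp add: K_def)
  have "F x \<le> e * \<bar>x\<bar> powr p + e * expw p a x + K * \<bar>x\<bar> powr (2 * p)" for x
  proof -
    obtain \<xi> where \<xi>: "\<bar>\<xi>\<bar> \<le> \<bar>x\<bar>" "F x = \<bar>x\<bar> * \<bar>f \<xi>\<bar>" using F_mean_value by blast
    consider "\<bar>x\<bar> \<le> r" | "r < \<bar>x\<bar>" "\<bar>x\<bar> \<le> T" | "\<bar>x\<bar> > T" by linarith
    then show ?thesis
    proof cases
      case 1
      have "\<bar>f \<xi>\<bar> \<le> e * \<bar>\<xi>\<bar> powr (p - 1)" using r(2) \<xi>(1) 1 by simp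
      also have "\<dots> \<le> e * \<bar>x\<bar> powr (p - 1)" using e \<xi>(1) p1 by (intro mult_left_mono powr_mono2) auto
      finally have "F x \<le> \<bar>x\<bar> * (e * \<bar>x\<bar> powr (p - 1))" unfolding \<xi>(2) by (rule mult_left_mono) simp
      also have "\<dots> = e * \<bar>x\<bar> powr p" by (simp add: px[symmetric])
      finally show ?thesis using e K0 by (simp add: add_increasing2)
    next
      case 2
      have "F x \<le> T * C" unfolding \<xi>(2) using 2 C \<xi>(1) by (intro mult_mono) auto
      also have "\<dots> = K * r powr (2 * p)" using r by (simp add: K_def)
      also have "\<dots> \<le> K * \<bar>x\<bar> powr (2 * p)" using 2 r K0 p1 by (intro mult_left_mono powr_mono2) auto
      finally show ?thesis using e by (simp add: add_increasing)
    next
      case 3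
      have "F x \<le> K1 * (\<bar>x\<bar> powr p + expw p (a / 2) x)" by (rule K1(2))
      also have "\<dots> \<le> K1 * (d * expw p a x + d * expw p a x)"
        using 3 K1(1) K2(2)[of x] K3(2)[of x] by (intro mult_left_mono add_mono) (auto simp: T_def)
      also have "\<dots> = (K1 / (K1 + 1)) * (e * expw p a x)"
      proof -
        have "2 * d = e / (K1 + 1)" using K1(1) by (simp add: d_def field_simps)
        moreover have "K1 * (d * expw p a x + d * expw p a x) = K1 * (2 * d) * expw p a x" by simp
        ultimately show ?thesis by simp
      qed
      also have "\<dots> \<le> 1 * (e * expw p a x)" using K1(1) e by (intro mult_right_mono) (auto simp: field_simps)
      finally show ?thesis using e K0 by (simp add: add_increasing add_increasing2)
    qed
  qed
  then show ?thesis using K0 by blast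
qed

text \<open>The variant with the large constant on the power \<open>p\<close>, the form required by
  the semicontinuity result, where the logarithmic moment controls that power far away.\<close>

lemma F_eps':
  assumes a: "a > 0" and e: "e > 0"
  shows "\<exists>K\<ge>0. \<forall>x. F x \<le> e * expw p a x + K * \<bar>x\<bar> powr p"
proof -
  obtain K where K: "K \<ge> 0" "\<And>x. F x \<le> e / 2 * \<bar>x\<bar> powr p + e / 2 * expw p a x + K * \<bar>x\<bar> powr (2 * p)"
    using F_eps[OF a, of "e / 2"] e by auto
  have d: "e / (2 * (K + 1)) > 0" using e K by simp
  obtain K' where K': "K' \<ge> 1" "\<And>t. \<bar>t\<bar> powr (2 * p) \<le> K' * \<bar>t\<bar> powr p + e / (2 * (K + 1)) * expw p a t"
    using powr_2p_le[OF a d p1] by blast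
  have "F x \<le> e * expw p a x + (e / 2 + K * K') * \<bar>x\<bar> powr p" for x
  proof -
    have "K * \<bar>x\<bar> powr (2 * p) \<le> K * (K' * \<bar>x\<bar> powr p + e / (2 * (K + 1)) * expw p a x)" using K(1) K'(2) by (rule mult_left_mono[rotated])
    also have "\<dots> = K * K' * \<bar>x\<bar> powr p + (K / (K + 1)) * (e / 2 * expw p a x)" using K(1) by (simp add: field_simps)
    also have "(K / (K + 1)) * (e / 2 * expw p a x) \<le> 1 * (e / 2 * expw p a x)" using K(1) e by (intro mult_right_mono) (auto simp: field_simps)
    finally show ?thesis using K(2)[of x] by (simp add: algebra_simps)
  qed
  moreover have "e / 2 + K * K' \<ge> 0" using e K K' by simp
  ultimately show ?thesis by blast
qed

text \<open>By \<open>AR\<close> the function \<open>F y * y powr (- 2 p)\<close> is nondecreasing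
  for \<open>y > 0\<close>; evenness covers the other sign.\<close>

lemma F_scale_le:
  assumes "0 < t" "t \<le> 1"
  shows "F (t * x) \<le> t powr (2 * p) * F x"
proof -
  have *: "F (t * x) \<le> t powr (2 * p) * F x" if x: "x > 0" for x
  proof -
    define G where "G = (\<lambda>y. F y * y powr (- (2 * p)))"
    have "G (t * x) \<le> G x"
    proof (rule DERIV_nonneg_imp_nondecreasing[of "t * x" x G])
      show "t * x \<le> x" using assms x by simp
      fix y assume "t * x \<le> y" "y \<le> x"
      then have y: "y > 0" using assms x by (meson less_le_trans mult_pos_pos)
      have "(G has_real_derivative f y * y powr (- (2 * p)) + (- (2 * p) * y powr (- (2 * p) - 1)) * F y) (at y)"
        unfolding G_def by (rule DERIV_mult'[THEN DERIV_cong, OF F_deriv has_real_derivative_powr[OF y]]) simp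
      moreover have "y powr (- (2 * p)) = y powr (- (2 * p) - 1) * y"
        using powr_add[of y "- (2 * p) - 1" 1] y by simp
      then have "f y * y powr (- (2 * p)) + (- (2 * p) * y powr (- (2 * p) - 1)) * F y = y powr (- (2 * p) - 1) * (f y * y - 2 * p * F y)"
        by (simp add: algebra_simps)
      moreover have "\<dots> \<ge> 0" using AR[OF y] by simp
      ultimately have "\<exists>z. (G has_real_derivative z) (at y) \<and> 0 \<le> z" by metis
      then show "\<exists>z. (G has_real_derivative z) (at y) \<and> z \<ge> 0" .
    qed
    then have "F (t * x) * (t * x) powr (- (2 * p)) \<le> F x * x powr (- (2 * p))" by (simp add: G_def)
    then have "F (t * x) / t powr (2 * p) / x powr (2 * p) \<le> F x / x powr (2 * p)"
      using assms x by (simp add: powr_mult powr_minus field_simps)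
    then show ?thesis using assms x by (simp add: field_simps)
  qed
  show ?thesis
  proof (cases "x = 0")
    case False
    then have "F (t * \<bar>x\<bar>) \<le> t powr (2 * p) * F \<bar>x\<bar>" by (intro *) auto
    moreover have "t * \<bar>x\<bar> = \<bar>t * x\<bar>" using assms by (simp add: abs_mult)
    ultimately show ?thesis by (simp add: F_abs)
  qed (simp add: F_0)
qed

text \<open>In the variable \<open>\<sigma> = t powr (2 * p)\<close> the monotonicity of \<open>f t / t powr (2 * p - 1)\<close> becomes convexity.\<close>

lemma F_root_convex: "convex_on {0<..} (\<lambda>\<sigma>. F (\<sigma> powr (1 / (2 * p)) * x))"
proof -
  have *: "convex_on {0<..} (\<lambda>\<sigma>. F (\<sigma> powr (1 / (2 * p)) * x))" if x: "x > 0" for x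
  proof (rule convex_on_realI)
    \<comment> \<open>The derivative in \<open>\<sigma>\<close> arranged as the quotient of (f5),
      taken at an argument that increases with \<open>\<sigma>\<close>, times a nonnegative
      constant.\<close>
    define D where "D = (\<lambda>\<sigma>. (\<lambda>t. f t / t powr (2 * p - 1)) (\<sigma> powr (1 / (2 * p)) * x) * (x powr (2 * p) / (2 * p)))"
    show "connected {0::real<..}" by simp
    fix \<sigma> :: real assume "\<sigma> \<in> {0<..}"
    then have s: "\<sigma> > 0" by simp
    define r where "r = \<sigma> powr (1 / (2 * p)) * x"
    have r: "r > 0" using s x by (simp add: r_def)
    have "((\<lambda>\<sigma>. \<sigma> powr (1 / (2 * p)) * x) has_real_derivative (1 / (2 * p) * \<sigma> powr (1 / (2 * p) - 1)) * x) (at \<sigma>)"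
      by (intro DERIV_cmult_right has_real_derivative_powr s)
    from DERIV_chain2[OF F_deriv this]
    have "((\<lambda>\<sigma>. F (\<sigma> powr (1 / (2 * p)) * x)) has_real_derivative f r * ((1 / (2 * p) * \<sigma> powr (1 / (2 * p) - 1)) * x)) (at \<sigma>)"
      by (simp add: r_def)
    moreover have "f r * ((1 / (2 * p) * \<sigma> powr (1 / (2 * p) - 1)) * x) = D \<sigma>"
    proof -
      have "r powr (2 * p - 1) = \<sigma> powr (1 / (2 * p) * (2 * p - 1)) * x powr (2 * p - 1)"
        using s x by (simp add: r_def powr_mult powr_powr)
      also have "1 / (2 * p) * (2 * p - 1) = 1 - 1 / (2 * p)" using p1 by (simp add: field_simps)
      finally have rp: "r powr (2 * p - 1) = \<sigma> powr (1 - 1 / (2 * p)) * x powr (2 * p - 1)" .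
      have "x powr (2 * p) = x powr (2 * p - 1) * x" using powr_add[of x "2 * p - 1" 1] x by simp
      moreover have "\<sigma> powr (1 / (2 * p) - 1) * \<sigma> powr (1 - 1 / (2 * p)) = 1" using s by (simp add: powr_add[symmetric])
      then have "\<sigma> powr (1 / (2 * p) - 1) = 1 / \<sigma> powr (1 - 1 / (2 * p))" using s by (simp add: field_simps)
      ultimately show ?thesis using x s p1 by (simp add: D_def r_def[symmetric] rp)
    qed
    ultimately show "((\<lambda>\<sigma>. F (\<sigma> powr (1 / (2 * p)) * x)) has_real_derivative D \<sigma>) (at \<sigma>)" by simp
    fix \<tau> :: real assume t: "\<tau> \<in> {0<..}" "\<sigma> \<le> \<tau>"
    show "D \<sigma> \<le> D \<tau>" unfolding D_def
    proof (rule mult_right_mono)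
      have "strict_mono_on {0<..} (\<lambda>t. f t / t powr (2 * p - 1))" by (rule mono)
      then have "mono_on {0<..} (\<lambda>t. f t / t powr (2 * p - 1))" by (rule strict_mono_on_imp_mono_on)
      moreover have "\<sigma> powr (1 / (2 * p)) * x \<le> \<tau> powr (1 / (2 * p)) * x"
        using s t x p1 by (intro mult_right_mono powr_mono2) auto
      ultimately show "(\<lambda>t. f t / t powr (2 * p - 1)) (\<sigma> powr (1 / (2 * p)) * x) \<le> (\<lambda>t. f t / t powr (2 * p - 1)) (\<tau> powr (1 / (2 * p)) * x)"
        using s t x by (auto simp: mono_on_def)
    qed (use p1 in auto)
  qed
  show ?thesis
  proof (cases "x = 0")
    case True
    then show ?thesis by (simp add: F_0 convex_on_const)
  next
    case False
    have eq: "F (\<sigma> powr (1 / (2 * p)) * x) = F (\<sigma> powr (1 / (2 * p)) * \<bar>x\<bar>)" for \<sigma>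
      using F_abs[of "\<sigma> powr (1 / (2 * p)) * x"] by (simp add: abs_mult)
    show ?thesis unfolding eq using False by (intro *) auto
  qed
qed

end

section \<open>Differentiability of the functional\<close>

lemma mean_value_bound:
  fixes g g' :: "real \<Rightarrow> real"
  assumes "\<And>t. (g has_real_derivative g' t) (at t)"
  shows "\<exists>\<xi>. \<bar>\<xi> - x\<bar> \<le> \<bar>h\<bar> \<and> g (x + h) - g x = h * g' \<xi>"
proof -
  consider "h > 0" | "h = 0" | "h < 0" by linarith
  then show ?thesis
  proof cases
    case 1
    then obtain \<xi> where "x < \<xi>" "\<xi> < x + h" "g (x + h) - g x = (x + h - x) * g' \<xi>"
      using MVT2[of x "x + h" g g'] assms by auto
    then show ?thesis by (intro exI[of _ \<xi>]) auto
  next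
    case 3
    then obtain \<xi> where "x + h < \<xi>" "\<xi> < x" "g x - g (x + h) = (x - (x + h)) * g' \<xi>"
      using MVT2[of "x + h" x g g'] assms by auto
    then show ?thesis by (intro exI[of _ \<xi>]) (auto simp: algebra_simps)
  qed auto
qed

text \<open>The base point \<open>a n * \<alpha>\<close> moves with \<open>n\<close>, so
  differentiability at \<open>\<alpha>\<close> is not enough: the mean value points tend to
  \<open>\<alpha>\<close> and the derivative is continuous there.\<close>

lemma difference_quotient_tendsto:
  fixes g g' :: "real \<Rightarrow> real"
  assumes d: "\<And>t. (g has_real_derivative g' t) (at t)" and c: "isCont g' \<alpha>"
    and a: "a \<longlonglongrightarrow> 1" and b: "b \<longlonglongrightarrow> 0" "\<And>n. b n \<noteq> 0"
  shows "(\<lambda>n. (g (a n * \<alpha> + b n * \<beta>) - g (a n * \<alpha>)) / b n) \<longlonglongrightarrow> g' \<alpha> * \<beta>"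
proof -
  have "\<forall>n. \<exists>\<xi>. \<bar>\<xi> - a n * \<alpha>\<bar> \<le> \<bar>b n * \<beta>\<bar> \<and> g (a n * \<alpha> + b n * \<beta>) - g (a n * \<alpha>) = (b n * \<beta>) * g' \<xi>"
    using mean_value_bound[of g g', OF d] by blast
  then obtain \<xi> where \<xi>: "\<And>n. \<bar>\<xi> n - a n * \<alpha>\<bar> \<le> \<bar>b n * \<beta>\<bar>"
    "\<And>n. g (a n * \<alpha> + b n * \<beta>) - g (a n * \<alpha>) = (b n * \<beta>) * g' (\<xi> n)" by metis
  have "(\<lambda>n. \<bar>b n * \<beta>\<bar>) \<longlonglongrightarrow> \<bar>0 * \<beta>\<bar>" by (intro tendsto_intros b)
  then have b0: "(\<lambda>n. \<bar>b n * \<beta>\<bar>) \<longlonglongrightarrow> 0" by simp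
  have "(\<lambda>n. \<xi> n - a n * \<alpha>) \<longlonglongrightarrow> 0"
  proof (rule Lim_null_comparison[OF _ b0])
    show "\<forall>\<^sub>F n in sequentially. norm (\<xi> n - a n * \<alpha>) \<le> \<bar>b n * \<beta>\<bar>"
      unfolding real_norm_def using \<xi>(1) by (intro always_eventually allI)
  qed
  moreover have "(\<lambda>n. a n * \<alpha>) \<longlonglongrightarrow> 1 * \<alpha>" by (intro tendsto_intros a)
  ultimately have "(\<lambda>n. (\<xi> n - a n * \<alpha>) + a n * \<alpha>) \<longlonglongrightarrow> 0 + 1 * \<alpha>" by (rule tendsto_add)
  then have "\<xi> \<longlonglongrightarrow> \<alpha>" by simp
  then have "(\<lambda>n. g' (\<xi> n)) \<longlonglongrightarrow> g' \<alpha>" using c by (rule isCont_tendsto_compose[rotated])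
  then have "(\<lambda>n. g' (\<xi> n) * \<beta>) \<longlonglongrightarrow> g' \<alpha> * \<beta>" by (intro tendsto_intros)
  moreover have "(g (a n * \<alpha> + b n * \<beta>) - g (a n * \<alpha>)) / b n = g' (\<xi> n) * \<beta>" for n
    using \<xi>(2)[of n] b(2)[of n] by simp
  ultimately show ?thesis by simp
qed

lemma abs_powr_deriv_isCont:
  fixes p :: real
  assumes "p > 1"
  shows "isCont (\<lambda>x. p * sgn x * \<bar>x\<bar> powr (p - 1)) x"
proof (cases "x = 0")
  case False
  then show ?thesis by (intro continuous_intros isCont_sgn) auto
next
  case True
  have "((\<lambda>h::real. p * \<bar>h\<bar> powr (p - 1)) \<longlongrightarrow> p * 0 powr (p - 1)) (at 0)"
    by (intro tendsto_intros tendsto_rabs_zero) (use assms in auto)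
  then have lim: "((\<lambda>h::real. p * \<bar>h\<bar> powr (p - 1)) \<longlongrightarrow> 0) (at 0)" by simp
  have "((\<lambda>x. p * sgn x * \<bar>x\<bar> powr (p - 1)) \<longlongrightarrow> 0) (at (0::real))"
  proof (rule Lim_null_comparison[OF _ lim])
    have "norm (p * sgn x * \<bar>x\<bar> powr (p - 1)) \<le> p * \<bar>x\<bar> powr (p - 1)" for x :: real
      using assms by (simp add: abs_mult sgn_real_def)
    then show "\<forall>\<^sub>F x in at 0. norm (p * sgn x * \<bar>x\<bar> powr (p - 1)) \<le> p * \<bar>x\<bar> powr (p - 1)"
      by (intro always_eventually allI)
  qed
  then show ?thesis unfolding True isCont_def by simp
qed

text \<open>The bound is linear in \<open>b\<close>, so after division by \<open>b\<close> it is an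
  integrable majorant that depends on neither \<open>a\<close> nor \<open>b\<close>.\<close>

lemma abs_powr_diff_le:
  fixes p \<alpha> \<beta> a b :: real
  assumes p: "p > 1" and a: "\<bar>a\<bar> \<le> 2" and b: "\<bar>b\<bar> \<le> 1"
  shows "\<bar>\<bar>a * \<alpha> + b * \<beta>\<bar> powr p - \<bar>a * \<alpha>\<bar> powr p\<bar> \<le> \<bar>b\<bar> * (p * 2 powr p * (\<bar>\<alpha>\<bar> + \<bar>\<beta>\<bar>) powr p)"
proof -
  define h where "h = \<bar>\<alpha>\<bar> + \<bar>\<beta>\<bar>"
  obtain \<xi> where \<xi>: "\<bar>\<xi> - a * \<alpha>\<bar> \<le> \<bar>b * \<beta>\<bar>"
    "\<bar>a * \<alpha> + b * \<beta>\<bar> powr p - \<bar>a * \<alpha>\<bar> powr p = (b * \<beta>) * (p * sgn \<xi> * \<bar>\<xi>\<bar> powr (p - 1))"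
    using mean_value_bound[of "\<lambda>x. \<bar>x\<bar> powr p" "\<lambda>x. p * sgn x * \<bar>x\<bar> powr (p - 1)" "a * \<alpha>" "b * \<beta>"]
      has_real_derivative_abs_powr[OF p] by blast
  have "\<bar>a * \<alpha>\<bar> \<le> 2 * \<bar>\<alpha>\<bar>" "\<bar>b * \<beta>\<bar> \<le> 1 * \<bar>\<beta>\<bar>"    unfolding abs_mult by (rule mult_right_mono[OF a abs_ge_zero], rule mult_right_mono[OF b abs_ge_zero])
  moreover have "\<bar>\<xi>\<bar> \<le> \<bar>\<xi> - a * \<alpha>\<bar> + \<bar>a * \<alpha>\<bar>" using abs_triangle_ineq[of "\<xi> - a * \<alpha>" "a * \<alpha>"] by simp
  ultimately have "\<bar>\<xi>\<bar> \<le> 2 * h" using \<xi>(1) unfolding h_def by argo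
  then have x: "\<bar>\<xi>\<bar> powr (p - 1) \<le> (2 * h) powr (p - 1)" using p by (intro powr_mono2) auto
  have "\<bar>\<bar>a * \<alpha> + b * \<beta>\<bar> powr p - \<bar>a * \<alpha>\<bar> powr p\<bar> = \<bar>b\<bar> * (p * (\<bar>\<beta>\<bar> * (\<bar>sgn \<xi>\<bar> * \<bar>\<xi>\<bar> powr (p - 1))))"
    unfolding \<xi>(2) using p by (simp add: abs_mult)
  also have "\<dots> \<le> \<bar>b\<bar> * (p * ((2 * h) * (1 * (2 * h) powr (p - 1))))"
    using p x by (intro mult_left_mono mult_mono) (auto simp: h_def sgn_real_def)
  also have "(2 * h) * (1 * (2 * h) powr (p - 1)) = (2 * h) powr p"
    using powr_add[of "2 * h" 1 "p - 1"] by (cases "h = 0") (auto simp: h_def)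
  also have "\<dots> = 2 powr p * h powr p"
  proof -
    have "h \<ge> 0" by (simp add: h_def)
    then show ?thesis by (simp add: powr_mult)
  qed
  finally show ?thesis by (simp add: h_def mult.assoc)
qed

lemma difference_quotient_integral_tendsto:
  fixes G :: "real \<Rightarrow> real \<Rightarrow> 'b \<Rightarrow> real"
  assumes int: "\<And>a b. integrable M (G a b)" and H: "integrable M H"
    and bound: "\<And>a b x. \<bar>a\<bar> \<le> 2 \<Longrightarrow> \<bar>b\<bar> \<le> 1 \<Longrightarrow> \<bar>G a b x - G a 0 x\<bar> \<le> \<bar>b\<bar> * H x"
    and D: "D \<in> borel_measurable M"
    and ptw: "\<And>x. (\<lambda>n. (G (a n) (b n) x - G (a n) 0 x) / b n) \<longlonglongrightarrow> D x"
    and a: "a \<longlonglongrightarrow> 1" and b: "b \<longlonglongrightarrow> 0" "\<And>n. b n \<noteq> 0"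
  shows "(\<lambda>n. ((\<integral>x. G (a n) (b n) x \<partial>M) - (\<integral>x. G (a n) 0 x \<partial>M)) / b n) \<longlonglongrightarrow> (\<integral>x. D x \<partial>M)"
proof -
  have "\<forall>\<^sub>F n in sequentially. dist (a n) 1 < 1" by (rule tendstoD[OF a]) simp
  moreover have "\<forall>\<^sub>F n in sequentially. dist (b n) 0 < 1" by (rule tendstoD[OF b(1)]) simp
  ultimately have "\<forall>\<^sub>F n in sequentially. \<bar>a n\<bar> \<le> 2 \<and> \<bar>b n\<bar> \<le> 1"
    by eventually_elim (auto simp: dist_real_def)
  \<comment> \<open>The majorant is valid only for \<open>|a| <= 2\<close> and
    \<open>|b| <= 1\<close>, so the sequence is shifted past \<open>n0\<close> before dominated
    convergence applies.\<close>
  then obtain n0 where n0: "\<And>n. n \<ge> n0 \<Longrightarrow> \<bar>a n\<bar> \<le> 2 \<and> \<bar>b n\<bar> \<le> 1" unfolding eventually_sequentially by blast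
  define q where "q = (\<lambda>n x. (G (a n) (b n) x - G (a n) 0 x) / b n)"
  have "(\<lambda>n. \<integral>x. q (n + n0) x \<partial>M) \<longlonglongrightarrow> (\<integral>x. D x \<partial>M)"
  proof (rule integral_dominated_convergence)
    show "D \<in> borel_measurable M" by fact
    show "q (n + n0) \<in> borel_measurable M" for n unfolding q_def
      by (intro borel_measurable_divide borel_measurable_diff borel_measurable_integrable[OF int] borel_measurable_const)
    show "AE x in M. (\<lambda>n. q (n + n0) x) \<longlonglongrightarrow> D x"
      unfolding q_def by (intro AE_I2 LIMSEQ_ignore_initial_segment[OF ptw])
    show "AE x in M. norm (q (n + n0) x) \<le> H x" for n
    proof (rule AE_I2)
      fix x
      have "\<bar>G (a (n + n0)) (b (n + n0)) x - G (a (n + n0)) 0 x\<bar> \<le> \<bar>b (n + n0)\<bar> * H x" using n0 by (intro bound) auto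
      then show "norm (q (n + n0) x) \<le> H x" using b(2) by (simp add: q_def abs_divide divide_le_eq mult.commute)
    qed
  qed fact
  then have "(\<lambda>n. \<integral>x. q n x \<partial>M) \<longlonglongrightarrow> (\<integral>x. D x \<partial>M)" by (rule LIMSEQ_offset)
  moreover have "(\<integral>x. q n x \<partial>M) = ((\<integral>x. G (a n) (b n) x \<partial>M) - (\<integral>x. G (a n) 0 x \<partial>M)) / b n" for n
    unfolding q_def by (simp add: int)
  ultimately show ?thesis by simp
qed

text \<open>The factor \<open>a\<close> may vary so that the maximizers along a perturbation can be inserted.\<close>

definition qderiv :: "(('a \<Rightarrow> real) \<Rightarrow> real) \<Rightarrow> ('a \<Rightarrow> real) \<Rightarrow> ('a \<Rightarrow> real) \<Rightarrow> real \<Rightarrow> bool" where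
  "qderiv \<Phi> u v D \<longleftrightarrow> (\<forall>a b. a \<longlonglongrightarrow> 1 \<longrightarrow> b \<longlonglongrightarrow> 0 \<longrightarrow> (\<forall>n. b n \<noteq> 0) \<longrightarrow>
     (\<lambda>n. (\<Phi> (\<lambda>x. a n * u x + b n * v x) - \<Phi> (\<lambda>x. a n * u x)) / b n) \<longlonglongrightarrow> D)"

lemma qderivD:
  "qderiv \<Phi> u v D \<Longrightarrow> a \<longlonglongrightarrow> 1 \<Longrightarrow> b \<longlonglongrightarrow> 0 \<Longrightarrow> (\<And>n. b n \<noteq> 0) \<Longrightarrow>
     (\<lambda>n. (\<Phi> (\<lambda>x. a n * u x + b n * v x) - \<Phi> (\<lambda>x. a n * u x)) / b n) \<longlonglongrightarrow> D"
  by (auto simp: qderiv_def)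

lemma qderiv_integral:
  fixes G :: "real \<Rightarrow> real \<Rightarrow> 'b \<Rightarrow> real"
  assumes "\<And>a b. integrable M (G a b)" "integrable M H"
    and "\<And>a b x. \<bar>a\<bar> \<le> 2 \<Longrightarrow> \<bar>b\<bar> \<le> 1 \<Longrightarrow> \<bar>G a b x - G a 0 x\<bar> \<le> \<bar>b\<bar> * H x"
    and "D \<in> borel_measurable M"
    and "\<And>a b x. a \<longlonglongrightarrow> 1 \<Longrightarrow> b \<longlonglongrightarrow> 0 \<Longrightarrow> (\<And>n. b n \<noteq> 0) \<Longrightarrow> (\<lambda>n. (G (a n) (b n) x - G (a n) 0 x) / b n) \<longlonglongrightarrow> D x"
    and eq: "\<And>a b. \<Phi> (\<lambda>x. a * u x + b * v x) = (\<integral>x. G a b x \<partial>M)"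
  shows "qderiv \<Phi> u v (\<integral>x. D x \<partial>M)"
proof -
  have eq0: "\<Phi> (\<lambda>x. a * u x) = (\<integral>x. G a 0 x \<partial>M)" for a using eq[of a 0] by simp
  show ?thesis unfolding qderiv_def eq eq0
  proof (intro allI impI)
    fix a b :: "nat \<Rightarrow> real"
    assume ab: "a \<longlonglongrightarrow> 1" "b \<longlonglongrightarrow> 0" "\<forall>n. b n \<noteq> 0"
    show "(\<lambda>n. ((\<integral>x. G (a n) (b n) x \<partial>M) - (\<integral>x. G (a n) 0 x \<partial>M)) / b n) \<longlonglongrightarrow> (\<integral>x. D x \<partial>M)"
      using ab by (intro difference_quotient_integral_tendsto[where H=H] assms) auto
  qed
qed

lemma qderiv_lin:
  assumes "qderiv \<Phi> u v D" "qderiv \<Psi> u v E"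
  shows "qderiv (\<lambda>w. c * \<Phi> w + d * \<Psi> w) u v (c * D + d * E)"
  unfolding qderiv_def
proof (intro allI impI)
  fix a b :: "nat \<Rightarrow> real" assume ab: "a \<longlonglongrightarrow> 1" "b \<longlonglongrightarrow> 0" "\<forall>n. b n \<noteq> 0"
  have "(\<lambda>n. c * ((\<Phi> (\<lambda>x. a n * u x + b n * v x) - \<Phi> (\<lambda>x. a n * u x)) / b n)
     + d * ((\<Psi> (\<lambda>x. a n * u x + b n * v x) - \<Psi> (\<lambda>x. a n * u x)) / b n)) \<longlonglongrightarrow> c * D + d * E"
    using ab by (intro tendsto_intros qderivD[OF assms(1)] qderivD[OF assms(2)]) auto
  then show "(\<lambda>n. (c * \<Phi> (\<lambda>x. a n * u x + b n * v x) + d * \<Psi> (\<lambda>x. a n * u x + b n * v x)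
      - (c * \<Phi> (\<lambda>x. a n * u x) + d * \<Psi> (\<lambda>x. a n * u x))) / b n) \<longlonglongrightarrow> c * D + d * E"
    by (simp add: diff_divide_distrib add_divide_distrib right_diff_distrib algebra_simps)
qed

section \<open>Derivatives of the terms of the functional\<close>

lemma nn_integral_lborel_pair:
  fixes H :: "'a::euclidean_space \<Rightarrow> 'a \<Rightarrow> real"
  assumes [measurable]: "case_prod H \<in> borel_measurable (borel \<Otimes>\<^sub>M borel)"
  shows "(\<integral>\<^sup>+z. ennreal (case_prod H z) \<partial>(lborel \<Otimes>\<^sub>M lborel)) = (\<integral>\<^sup>+x. (\<integral>\<^sup>+y. ennreal (H x y) \<partial>lborel) \<partial>lborel)"
  using lborel.nn_integral_fst[of "\<lambda>z. ennreal (case_prod H z)" lborel] by simp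

text \<open>Tonelli turns an iterated integral into one Bochner integral over the product, where
  dominated convergence has to be applied only once.\<close>

lemma integrable_lborel_pair:
  fixes H :: "'a::euclidean_space \<Rightarrow> 'a \<Rightarrow> real"
  assumes m: "case_prod H \<in> borel_measurable (borel \<Otimes>\<^sub>M borel)" and nonneg: "\<And>x y. H x y \<ge> 0"
    and fin: "(\<integral>\<^sup>+x. (\<integral>\<^sup>+y. ennreal (H x y) \<partial>lborel) \<partial>lborel) < \<infinity>"
  shows "integrable (lborel \<Otimes>\<^sub>M lborel) (case_prod H)"
    "(\<integral>z. case_prod H z \<partial>(lborel \<Otimes>\<^sub>M lborel)) = enn2real (\<integral>\<^sup>+x. (\<integral>\<^sup>+y. ennreal (H x y) \<partial>lborel) \<partial>lborel)"
proof -
  have m': "case_prod H \<in> borel_measurable (lborel \<Otimes>\<^sub>M lborel)" using m by (simp add: measurable_def space_pair_measure sets_pair_measure)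
  show "integrable (lborel \<Otimes>\<^sub>M lborel) (case_prod H)"
    by (rule integrableI_nonneg[OF m']) (use nonneg fin in \<open>auto simp: nn_integral_lborel_pair[OF m]\<close>)
  show "(\<integral>z. case_prod H z \<partial>(lborel \<Otimes>\<^sub>M lborel)) = enn2real (\<integral>\<^sup>+x. (\<integral>\<^sup>+y. ennreal (H x y) \<partial>lborel) \<partial>lborel)"
    by (subst integral_eq_nn_integral[OF m']) (use nonneg in \<open>auto simp: nn_integral_lborel_pair[OF m]\<close>)
qed

lemma inX_expw:
  fixes u :: "'a::euclidean_space \<Rightarrow> real"
  assumes p: "p > 1" and u: "inX p u"
  shows "\<exists>a>0. (\<integral>\<^sup>+x. ennreal (expw p a (u x)) \<partial>lborel) < \<infinity>"
proof -
  define M where "M = enn2real (Lp_p p u + gag p u)"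
  have "Lp_p p u + gag p u \<le> ennreal M" using inX_D[OF u] by (simp add: M_def)
  moreover have "M \<ge> 0" by (simp add: M_def)
  ultimately obtain a C where "a > 0" "(\<integral>\<^sup>+x. ennreal (expw p a (u x)) \<partial>lborel) \<le> ennreal C"
    using Trudinger_Moser_expw[OF p, of M, where 'a='a] inX_D(1)[OF u] by blast
  then show ?thesis by (intro exI[of _ a]) (auto simp: order.strict_trans1)
qed

lemma inX_Lp_2p:
  fixes u :: "'a::euclidean_space \<Rightarrow> real"
  assumes p: "p > 1" and u: "inX p u"
  shows "Lp_p (2 * p) u < \<infinity>"
proof -
  define M where "M = enn2real (Lp_p p u + gag p u)"
  have "Lp_p p u + gag p u \<le> ennreal M" using inX_D[OF u] by (simp add: M_def)
  moreover have "M \<ge> 0" by (simp add: M_def)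
  ultimately obtain C where "Lp_p (2 * p) u \<le> ennreal C"
    using Lp_2p_bounded[OF p, of M, where 'a='a] inX_D(1)[OF u] by blast
  then show ?thesis by (auto simp: order.strict_trans1)
qed

lemma powr_square: "(\<bar>t\<bar> powr p)\<^sup>2 = \<bar>t\<bar> powr (2 * p)" for t p :: real
  by (simp add: power2_eq_square powr_add[symmetric])

lemma kform_logm_powr_le:
  fixes u :: "'a::euclidean_space \<Rightarrow> real"
  assumes "u \<in> borel_measurable borel" "l > 0"
  shows "kform logm (\<lambda>x. \<bar>u x\<bar> powr p) (\<lambda>x. \<bar>u x\<bar> powr p) \<le> Lp_p p u *
    (ennreal l * (\<integral>\<^sup>+z. ennreal ((logm (norm (z::'a)))\<^sup>2) \<partial>lborel) + ennreal (1 / l) * Lp_p (2 * p) u)"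
proof -
  have [measurable]: "u \<in> borel_measurable borel" by fact
  show ?thesis using kform_logm_le[of "\<lambda>x. \<bar>u x\<bar> powr p" "\<lambda>x. \<bar>u x\<bar> powr p" l] assms(2)
    by (simp add: Lp_p_def powr_square)
qed

lemma kform_finite:
  fixes u :: "'a::euclidean_space \<Rightarrow> real"
  assumes p: "p > 1" and u: "inX p u"
  shows "kform logp (\<lambda>x. \<bar>u x\<bar> powr p) (\<lambda>x. \<bar>u x\<bar> powr p) < \<infinity>"
    "kform logm (\<lambda>x. \<bar>u x\<bar> powr p) (\<lambda>x. \<bar>u x\<bar> powr p) < \<infinity>"
proof -
  note [measurable] = inX_D(1)[OF u]
  have "kform logp (\<lambda>x. \<bar>u x\<bar> powr p) (\<lambda>x. \<bar>u x\<bar> powr p) \<le> logmoment p u * Lp_p p u + Lp_p p u * logmoment p u"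
    unfolding Lp_p_def logmoment_def by (rule kform_logp_le) auto
  also have "\<dots> < \<infinity>" using inX_D[OF u] by (simp add: ennreal_mult_less_top)
  finally show "kform logp (\<lambda>x. \<bar>u x\<bar> powr p) (\<lambda>x. \<bar>u x\<bar> powr p) < \<infinity>" .
  have "kform logm (\<lambda>x. \<bar>u x\<bar> powr p) (\<lambda>x. \<bar>u x\<bar> powr p) \<le> Lp_p p u *
    (ennreal 1 * (\<integral>\<^sup>+z. ennreal ((logm (norm (z::'a)))\<^sup>2) \<partial>lborel) + ennreal (1 / 1) * Lp_p (2 * p) u)"
    by (rule kform_logm_powr_le) auto
  also have "\<dots> < \<infinity>"
    using inX_D[OF u] inX_Lp_2p[OF p u] logm_square_integrable[where 'a='a] by (simp add: ennreal_mult_less_top)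
  finally show "kform logm (\<lambda>x. \<bar>u x\<bar> powr p) (\<lambda>x. \<bar>u x\<bar> powr p) < \<infinity>" .
qed

text \<open>On \<open>X\<close> both forms are finite, and \<open>log_integrable\<close> identifies
  the difference with the double integral in \<open>energy\<close>.\<close>

definition logV :: "real \<Rightarrow> ('a::euclidean_space \<Rightarrow> real) \<Rightarrow> real" where
  "logV p u = enn2real (kform logp (\<lambda>x. \<bar>u x\<bar> powr p) (\<lambda>x. \<bar>u x\<bar> powr p))
     - enn2real (kform logm (\<lambda>x. \<bar>u x\<bar> powr p) (\<lambda>x. \<bar>u x\<bar> powr p))"

text \<open>Absolute integrability has two uses: Fubini for the iterated integral in
  \<open>energy\<close>, and the majorant for the derivative of the logarithmic term.\<close>

lemma log_integrable:
  fixes u :: "'a::euclidean_space \<Rightarrow> real"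
  assumes p: "p > 1" and u: "inX p u"
  shows "integrable (lborel \<Otimes>\<^sub>M lborel) (\<lambda>(x, y). ln (norm (x - y)) * \<bar>u x\<bar> powr p * \<bar>u y\<bar> powr p)"
    "integrable (lborel \<Otimes>\<^sub>M lborel) (\<lambda>(x, y). \<bar>ln (norm (x - y))\<bar> * \<bar>u x\<bar> powr p * \<bar>u y\<bar> powr p)"
    "(\<integral>(x, y). ln (norm (x - y)) * \<bar>u x\<bar> powr p * \<bar>u y\<bar> powr p \<partial>(lborel \<Otimes>\<^sub>M lborel)) = logV p u"
    "(\<integral>x. (\<integral>y. ln (norm (x - y)) * \<bar>u x\<bar> powr p * \<bar>u y\<bar> powr p \<partial>lborel) \<partial>lborel) = logV p u"
proof -
  note [measurable] = inX_D(1)[OF u]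
  define P where "P = (\<lambda>k x y. k (norm (x - y)) * \<bar>u x\<bar> powr p * \<bar>u y\<bar> powr p :: real)"
  have m: "case_prod (P logp) \<in> borel_measurable (borel \<Otimes>\<^sub>M borel)" "case_prod (P logm) \<in> borel_measurable (borel \<Otimes>\<^sub>M borel)"
    unfolding P_def by measurable
  have nn: "P logp x y \<ge> 0" "P logm x y \<ge> 0" for x y by (auto simp: P_def)
  have fin: "(\<integral>\<^sup>+x. (\<integral>\<^sup>+y. ennreal (P logp x y) \<partial>lborel) \<partial>lborel) < \<infinity>" "(\<integral>\<^sup>+x. (\<integral>\<^sup>+y. ennreal (P logm x y) \<partial>lborel) \<partial>lborel) < \<infinity>"
    using kform_finite[OF p u] by (auto simp: kform_def P_def)
  note i1 = integrable_lborel_pair[OF m(1) nn(1) fin(1)] and i2 = integrable_lborel_pair[OF m(2) nn(2) fin(2)]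
  have eq: "(\<lambda>(x, y). ln (norm (x - y)) * \<bar>u x\<bar> powr p * \<bar>u y\<bar> powr p) = (\<lambda>z. case_prod (P logp) z - case_prod (P logm) z)"
    by (auto simp: P_def ln_eq_logp_logm algebra_simps)
  have eq': "(\<lambda>(x, y). \<bar>ln (norm (x - y))\<bar> * \<bar>u x\<bar> powr p * \<bar>u y\<bar> powr p) = (\<lambda>z. case_prod (P logp) z + case_prod (P logm) z)"
    by (auto simp: P_def logp_def logm_def max_def)
  show int: "integrable (lborel \<Otimes>\<^sub>M lborel) (\<lambda>(x, y). ln (norm (x - y)) * \<bar>u x\<bar> powr p * \<bar>u y\<bar> powr p)"
    unfolding eq by (intro Bochner_Integration.integrable_diff i1(1) i2(1))
  show "integrable (lborel \<Otimes>\<^sub>M lborel) (\<lambda>(x, y). \<bar>ln (norm (x - y))\<bar> * \<bar>u x\<bar> powr p * \<bar>u y\<bar> powr p)"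
    unfolding eq' by (intro Bochner_Integration.integrable_add i1(1) i2(1))
  show v: "(\<integral>(x, y). ln (norm (x - y)) * \<bar>u x\<bar> powr p * \<bar>u y\<bar> powr p \<partial>(lborel \<Otimes>\<^sub>M lborel)) = logV p u"
    unfolding eq by (subst Bochner_Integration.integral_diff[OF i1(1) i2(1)]) (use i1(2) i2(2) in \<open>simp add: logV_def kform_def P_def\<close>)
  show "(\<integral>x. (\<integral>y. ln (norm (x - y)) * \<bar>u x\<bar> powr p * \<bar>u y\<bar> powr p \<partial>lborel) \<partial>lborel) = logV p u"
    using lborel_pair.integral_fst'[OF int] v by simp
qed

lemma gag_integrable:
  fixes u :: "'a::euclidean_space \<Rightarrow> real"
  assumes u: "inX p u"
  shows "integrable (lborel \<Otimes>\<^sub>M lborel) (\<lambda>(x, y). \<bar>u x - u y\<bar> powr p / norm (x - y) ^ (2 * DIM('a)))"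
    "(\<integral>(x, y). \<bar>u x - u y\<bar> powr p / norm (x - y) ^ (2 * DIM('a)) \<partial>(lborel \<Otimes>\<^sub>M lborel)) = enn2real (gag p u)"
proof -
  note [measurable] = inX_D(1)[OF u]
  define H where "H = (\<lambda>x y. \<bar>u x - u y\<bar> powr p / norm (x - y) ^ (2 * DIM('a)))"
  have m: "case_prod H \<in> borel_measurable (borel \<Otimes>\<^sub>M borel)" unfolding H_def by measurable
  have nn: "H x y \<ge> 0" for x y by (simp add: H_def)
  have fin: "(\<integral>\<^sup>+x. (\<integral>\<^sup>+y. ennreal (H x y) \<partial>lborel) \<partial>lborel) < \<infinity>" using inX_D(3)[OF u] by (simp add: gag_def H_def)
  show "integrable (lborel \<Otimes>\<^sub>M lborel) (\<lambda>(x, y). \<bar>u x - u y\<bar> powr p / norm (x - y) ^ (2 * DIM('a)))"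
    "(\<integral>(x, y). \<bar>u x - u y\<bar> powr p / norm (x - y) ^ (2 * DIM('a)) \<partial>(lborel \<Otimes>\<^sub>M lborel)) = enn2real (gag p u)"
    using integrable_lborel_pair[OF m nn fin] by (simp_all add: H_def gag_def)
qed

lemma Lp_integrable:
  fixes u :: "'a::euclidean_space \<Rightarrow> real"
  assumes u: "inX p u"
  shows "integrable lborel (\<lambda>x. \<bar>u x\<bar> powr p)" "(\<integral>x. \<bar>u x\<bar> powr p \<partial>lborel) = enn2real (Lp_p p u)"
proof -
  note [measurable] = inX_D(1)[OF u]
  show "integrable lborel (\<lambda>x. \<bar>u x\<bar> powr p)"
    by (rule integrableI_nonneg) (use inX_D(2)[OF u] in \<open>auto simp: Lp_p_def\<close>)
  show "(\<integral>x. \<bar>u x\<bar> powr p \<partial>lborel) = enn2real (Lp_p p u)"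
    unfolding Lp_p_def by (rule integral_eq_nn_integral) auto
qed

lemma qderiv_Lp:
  fixes u v :: "'a::euclidean_space \<Rightarrow> real"
  assumes p: "p > 1" and u: "inX p u" and v: "inX p v"
  shows "\<exists>D. qderiv (\<lambda>w. enn2real (Lp_p p w)) u v D"
proof -
  note [measurable] = inX_D(1)[OF u] inX_D(1)[OF v]
  show ?thesis
  proof (rule exI, rule qderiv_integral[where G = "\<lambda>a b x. \<bar>a * u x + b * v x\<bar> powr p"
        and H = "\<lambda>x. p * 2 powr p * \<bar>\<bar>u x\<bar> + \<bar>v x\<bar>\<bar> powr p" and D = "\<lambda>x. p * sgn (u x) * \<bar>u x\<bar> powr (p - 1) * v x"])
    show "integrable lborel (\<lambda>x. \<bar>a * u x + b * v x\<bar> powr p)" for a b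
      by (rule Lp_integrable(1)[OF inX_lin[OF p u v]])
    show "integrable lborel (\<lambda>x. p * 2 powr p * \<bar>\<bar>u x\<bar> + \<bar>v x\<bar>\<bar> powr p)"
      by (intro integrable_mult_right Lp_integrable(1)[OF inX_abs_add[OF p u v]])
    show "\<bar>\<bar>a * u x + b * v x\<bar> powr p - \<bar>a * u x + 0 * v x\<bar> powr p\<bar> \<le> \<bar>b\<bar> * (p * 2 powr p * \<bar>\<bar>u x\<bar> + \<bar>v x\<bar>\<bar> powr p)"
      if "\<bar>a\<bar> \<le> 2" "\<bar>b\<bar> \<le> 1" for a b x
      using abs_powr_diff_le[OF p that, of "u x" "v x"] by simp
    show "(\<lambda>x. p * sgn (u x) * \<bar>u x\<bar> powr (p - 1) * v x) \<in> borel_measurable lborel" by measurable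
    show "(\<lambda>n. (\<bar>a n * u x + b n * v x\<bar> powr p - \<bar>a n * u x + 0 * v x\<bar> powr p) / b n) \<longlonglongrightarrow> p * sgn (u x) * \<bar>u x\<bar> powr (p - 1) * v x"
      if "a \<longlonglongrightarrow> 1" "b \<longlonglongrightarrow> 0" "\<And>n. b n \<noteq> 0" for a b x
      using difference_quotient_tendsto[of "\<lambda>t. \<bar>t\<bar> powr p", OF has_real_derivative_abs_powr[OF p] abs_powr_deriv_isCont[OF p] that] by simp
    show "enn2real (Lp_p p (\<lambda>x. a * u x + b * v x)) = (\<integral>x. \<bar>a * u x + b * v x\<bar> powr p \<partial>lborel)" for a b
      using Lp_integrable(2)[OF inX_lin[OF p u v]] by simp
  qed
qed

lemma qderiv_gag:
  fixes u v :: "'a::euclidean_space \<Rightarrow> real"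
  assumes p: "p > 1" and u: "inX p u" and v: "inX p v"
  shows "\<exists>D. qderiv (\<lambda>w. enn2real (gag p w)) u v D"
proof -
  note [measurable] = inX_D(1)[OF u] inX_D(1)[OF v]
  define \<kappa> where "\<kappa> = (\<lambda>x y::'a. norm (x - y) ^ (2 * DIM('a)))"
  have [measurable]: "case_prod \<kappa> \<in> borel_measurable (borel \<Otimes>\<^sub>M borel)" unfolding \<kappa>_def by measurable
  have lin: "a * u x + b * v x - (a * u y + b * v y) = a * (u x - u y) + b * (v x - v y)" for a b x y
    by (simp add: algebra_simps)
  show ?thesis
  proof (rule exI, rule qderiv_integral[where M = "lborel \<Otimes>\<^sub>M lborel" and G = "\<lambda>a b (x, y). \<bar>(a * u x + b * v x) - (a * u y + b * v y)\<bar> powr p / \<kappa> x y"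
        and H = "\<lambda>z. p * 2 powr p * 2 powr p * (case z of (x, y) \<Rightarrow> \<bar>u x - u y\<bar> powr p / \<kappa> x y) + p * 2 powr p * 2 powr p * (case z of (x, y) \<Rightarrow> \<bar>v x - v y\<bar> powr p / \<kappa> x y)"
        and D = "\<lambda>(x, y). p * sgn (u x - u y) * \<bar>u x - u y\<bar> powr (p - 1) * (v x - v y) / \<kappa> x y"])
    show "integrable (lborel \<Otimes>\<^sub>M lborel) (\<lambda>(x, y). \<bar>(a * u x + b * v x) - (a * u y + b * v y)\<bar> powr p / \<kappa> x y)" for a b
      using gag_integrable(1)[OF inX_lin[OF p u v]] by (simp add: \<kappa>_def)
    show "integrable (lborel \<Otimes>\<^sub>M lborel) (\<lambda>z. p * 2 powr p * 2 powr p * (case z of (x, y) \<Rightarrow> \<bar>u x - u y\<bar> powr p / \<kappa> x y) + p * 2 powr p * 2 powr p * (case z of (x, y) \<Rightarrow> \<bar>v x - v y\<bar> powr p / \<kappa> x y))"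
      using gag_integrable(1)[OF u] gag_integrable(1)[OF v]
      by (intro Bochner_Integration.integrable_add integrable_mult_right) (simp_all add: \<kappa>_def)
    show "\<bar>(case z of (x, y) \<Rightarrow> \<bar>(a * u x + b * v x) - (a * u y + b * v y)\<bar> powr p / \<kappa> x y) - (case z of (x, y) \<Rightarrow> \<bar>(a * u x + 0 * v x) - (a * u y + 0 * v y)\<bar> powr p / \<kappa> x y)\<bar>
      \<le> \<bar>b\<bar> * (p * 2 powr p * 2 powr p * (case z of (x, y) \<Rightarrow> \<bar>u x - u y\<bar> powr p / \<kappa> x y) + p * 2 powr p * 2 powr p * (case z of (x, y) \<Rightarrow> \<bar>v x - v y\<bar> powr p / \<kappa> x y))"
      if ab: "\<bar>a\<bar> \<le> 2" "\<bar>b\<bar> \<le> 1" for a b z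
    proof (cases z)
      case (Pair x y)
      define du dv where "du = u x - u y" and "dv = v x - v y"
      have k: "\<kappa> x y \<ge> 0" by (simp add: \<kappa>_def)
      have "\<bar>\<bar>a * du + b * dv\<bar> powr p - \<bar>a * du\<bar> powr p\<bar> \<le> \<bar>b\<bar> * (p * 2 powr p * (\<bar>du\<bar> + \<bar>dv\<bar>) powr p)"
        by (rule abs_powr_diff_le[OF p ab])
      also have "\<dots> \<le> \<bar>b\<bar> * (p * 2 powr p * (2 powr p * \<bar>du\<bar> powr p + 2 powr p * \<bar>dv\<bar> powr p))"
        using abs_powr_add_le[OF p, of "\<bar>du\<bar>" "\<bar>dv\<bar>"] p by (intro mult_left_mono) auto
      finally have "\<bar>\<bar>a * du + b * dv\<bar> powr p - \<bar>a * du\<bar> powr p\<bar> / \<kappa> x y \<le> \<bar>b\<bar> * (p * 2 powr p * (2 powr p * \<bar>du\<bar> powr p + 2 powr p * \<bar>dv\<bar> powr p)) / \<kappa> x y"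
        using k by (rule divide_right_mono)
      moreover have "\<bar>\<bar>a * du + b * dv\<bar> powr p / \<kappa> x y - \<bar>a * du\<bar> powr p / \<kappa> x y\<bar> = \<bar>\<bar>a * du + b * dv\<bar> powr p - \<bar>a * du\<bar> powr p\<bar> / \<kappa> x y"
        using k by (simp add: diff_divide_distrib[symmetric] abs_divide)
      moreover have "\<bar>b\<bar> * (p * 2 powr p * (2 powr p * \<bar>du\<bar> powr p + 2 powr p * \<bar>dv\<bar> powr p)) / \<kappa> x y
        = \<bar>b\<bar> * (p * 2 powr p * 2 powr p * (\<bar>du\<bar> powr p / \<kappa> x y) + p * 2 powr p * 2 powr p * (\<bar>dv\<bar> powr p / \<kappa> x y))"
        by (simp add: algebra_simps add_divide_distrib)
      moreover have "(a * u x + 0 * v x) - (a * u y + 0 * v y) = a * du" by (simp add: du_def algebra_simps)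
      ultimately show ?thesis unfolding Pair prod.case lin du_def[symmetric] dv_def[symmetric] by simp
    qed
    show "(\<lambda>(x, y). p * sgn (u x - u y) * \<bar>u x - u y\<bar> powr (p - 1) * (v x - v y) / \<kappa> x y) \<in> borel_measurable (lborel \<Otimes>\<^sub>M lborel)"
      unfolding \<kappa>_def by measurable
    show "(\<lambda>n. ((case z of (x, y) \<Rightarrow> \<bar>(a n * u x + b n * v x) - (a n * u y + b n * v y)\<bar> powr p / \<kappa> x y) - (case z of (x, y) \<Rightarrow> \<bar>(a n * u x + 0 * v x) - (a n * u y + 0 * v y)\<bar> powr p / \<kappa> x y)) / b n)
       \<longlonglongrightarrow> (case z of (x, y) \<Rightarrow> p * sgn (u x - u y) * \<bar>u x - u y\<bar> powr (p - 1) * (v x - v y) / \<kappa> x y)"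
      if ab: "a \<longlonglongrightarrow> 1" "b \<longlonglongrightarrow> 0" "\<And>n. b n \<noteq> 0" for a b z
    proof (cases z)
      case (Pair x y)
      have "(\<lambda>n. (\<bar>a n * (u x - u y) + b n * (v x - v y)\<bar> powr p - \<bar>a n * (u x - u y)\<bar> powr p) / b n / \<kappa> x y)
         \<longlonglongrightarrow> p * sgn (u x - u y) * \<bar>u x - u y\<bar> powr (p - 1) * (v x - v y) / \<kappa> x y"
        unfolding divide_inverse[of _ "\<kappa> x y"]
        by (intro tendsto_mult_right difference_quotient_tendsto[of "\<lambda>t. \<bar>t\<bar> powr p", OF has_real_derivative_abs_powr[OF p] abs_powr_deriv_isCont[OF p] ab])
      then show ?thesis unfolding Pair prod.case lin by (simp add: diff_divide_distrib mult.commute)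
    qed
    show "enn2real (gag p (\<lambda>x. a * u x + b * v x)) = (\<integral>z. (case z of (x, y) \<Rightarrow> \<bar>(a * u x + b * v x) - (a * u y + b * v y)\<bar> powr p / \<kappa> x y) \<partial>(lborel \<Otimes>\<^sub>M lborel))" for a b
      using gag_integrable(2)[OF inX_lin[OF p u v], of a b] by (simp add: \<kappa>_def)
  qed
qed

text \<open>The product rule for the two densities in the integrand. The majorant is
  \<open>|ln|\<close> times the densities of \<open>|u| + |v|\<close>, which is integrable because
  that sum lies in \<open>X\<close>.\<close>

lemma qderiv_logV:
  fixes u v :: "'a::euclidean_space \<Rightarrow> real"
  assumes p: "p > 1" and u: "inX p u" and v: "inX p v"
  shows "\<exists>D. qderiv (logV p) u v D"
proof -
  note [measurable] = inX_D(1)[OF u] inX_D(1)[OF v]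
  define h where "h = (\<lambda>x. \<bar>u x\<bar> + \<bar>v x\<bar>)"
  have hX: "inX p h" unfolding h_def by (rule inX_abs_add[OF p u v])
  define k where "k = (\<lambda>x y::'a. ln (norm (x - y)))"
  have [measurable]: "case_prod k \<in> borel_measurable (borel \<Otimes>\<^sub>M borel)" unfolding k_def by measurable
  define g where "g = (\<lambda>a b x. \<bar>a * u x + b * v x\<bar> powr p)"
  define d where "d = (\<lambda>x. p * sgn (u x) * \<bar>u x\<bar> powr (p - 1) * v x)"
  \<comment> \<open>One factor 2 for the two terms of the product rule, one factor
    \<open>p * 2 powr p\<close> for the varied density, and \<open>2 powr p\<close> for the other
    one.\<close>
  define C where "C = 2 * (p * 2 powr p * 2 powr p)"
  have gnn: "g a b x \<ge> 0" for a b x by (simp add: g_def)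
  have gle: "g a b x \<le> 2 powr p * \<bar>h x\<bar> powr p" if "\<bar>a\<bar> \<le> 2" "\<bar>b\<bar> \<le> 1" for a b x
  proof -
    have "\<bar>a * u x + b * v x\<bar> \<le> \<bar>a\<bar> * \<bar>u x\<bar> + \<bar>b\<bar> * \<bar>v x\<bar>" by (metis abs_mult abs_triangle_ineq)
    also have "\<dots> \<le> 2 * \<bar>u x\<bar> + 2 * \<bar>v x\<bar>" using that by (intro add_mono mult_right_mono) auto
    also have "\<dots> = 2 * \<bar>h x\<bar>" by (simp add: h_def)
    finally have "g a b x \<le> (2 * \<bar>h x\<bar>) powr p" unfolding g_def using p by (intro powr_mono2) auto
    then show ?thesis by (simp add: powr_mult)
  qed
  have gdiff: "\<bar>g a b x - g a 0 x\<bar> \<le> \<bar>b\<bar> * (p * 2 powr p * \<bar>h x\<bar> powr p)" if "\<bar>a\<bar> \<le> 2" "\<bar>b\<bar> \<le> 1" for a b x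
    using abs_powr_diff_le[OF p that, of "u x" "v x"] by (simp add: g_def h_def)
  show ?thesis
  proof (rule exI, rule qderiv_integral[where M = "lborel \<Otimes>\<^sub>M lborel" and G = "\<lambda>a b (x, y). k x y * g a b x * g a b y"
        and H = "\<lambda>z. C * (case z of (x, y) \<Rightarrow> \<bar>k x y\<bar> * \<bar>h x\<bar> powr p * \<bar>h y\<bar> powr p)"
        and D = "\<lambda>(x, y). k x y * (d x * g 1 0 y + g 1 0 x * d y)"])
    show "integrable (lborel \<Otimes>\<^sub>M lborel) (\<lambda>(x, y). k x y * g a b x * g a b y)" for a b
      using log_integrable(1)[OF p inX_lin[OF p u v]] by (simp add: k_def g_def)
    show "integrable (lborel \<Otimes>\<^sub>M lborel) (\<lambda>z. C * (case z of (x, y) \<Rightarrow> \<bar>k x y\<bar> * \<bar>h x\<bar> powr p * \<bar>h y\<bar> powr p))"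
      using log_integrable(2)[OF p hX] by (intro integrable_mult_right) (simp add: k_def)
    show "\<bar>(case z of (x, y) \<Rightarrow> k x y * g a b x * g a b y) - (case z of (x, y) \<Rightarrow> k x y * g a 0 x * g a 0 y)\<bar>
      \<le> \<bar>b\<bar> * (C * (case z of (x, y) \<Rightarrow> \<bar>k x y\<bar> * \<bar>h x\<bar> powr p * \<bar>h y\<bar> powr p))"
      if ab: "\<bar>a\<bar> \<le> 2" "\<bar>b\<bar> \<le> 1" for a b z
    proof (cases z)
      case (Pair x y)
      define X where "X = \<bar>h x\<bar> powr p"
      define Y where "Y = \<bar>h y\<bar> powr p"
      have XY: "X \<ge> 0" "Y \<ge> 0" by (auto simp: X_def Y_def)
      have "\<bar>g a b x * g a b y - g a 0 x * g a 0 y\<bar> = \<bar>(g a b x - g a 0 x) * g a b y + g a 0 x * (g a b y - g a 0 y)\<bar>"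
        by (simp add: algebra_simps)
      also have "\<dots> \<le> \<bar>g a b x - g a 0 x\<bar> * g a b y + g a 0 x * \<bar>g a b y - g a 0 y\<bar>"
        using abs_triangle_ineq[of "(g a b x - g a 0 x) * g a b y" "g a 0 x * (g a b y - g a 0 y)"] gnn by (simp add: abs_mult)
      also have "\<dots> \<le> (\<bar>b\<bar> * (p * 2 powr p * X)) * (2 powr p * Y) + (2 powr p * X) * (\<bar>b\<bar> * (p * 2 powr p * Y))"
        unfolding X_def Y_def using ab gdiff[OF ab] gle gnn p by (intro add_mono mult_mono) auto
      also have "\<dots> = \<bar>b\<bar> * (C * (X * Y))" by (simp add: C_def algebra_simps)
      finally have "\<bar>k x y\<bar> * \<bar>g a b x * g a b y - g a 0 x * g a 0 y\<bar> \<le> \<bar>k x y\<bar> * (\<bar>b\<bar> * (C * (X * Y)))"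
        by (rule mult_left_mono) simp
      moreover have "k x y * g a b x * g a b y - k x y * g a 0 x * g a 0 y = k x y * (g a b x * g a b y - g a 0 x * g a 0 y)"
        by (simp add: algebra_simps)
      ultimately show ?thesis unfolding Pair prod.case X_def[symmetric] Y_def[symmetric] by (simp add: abs_mult mult_ac)
    qed
    show "(\<lambda>(x, y). k x y * (d x * g 1 0 y + g 1 0 x * d y)) \<in> borel_measurable (lborel \<Otimes>\<^sub>M lborel)"
      unfolding k_def d_def g_def by measurable
    show "(\<lambda>n. ((case z of (x, y) \<Rightarrow> k x y * g (a n) (b n) x * g (a n) (b n) y) - (case z of (x, y) \<Rightarrow> k x y * g (a n) 0 x * g (a n) 0 y)) / b n)
       \<longlonglongrightarrow> (case z of (x, y) \<Rightarrow> k x y * (d x * g 1 0 y + g 1 0 x * d y))"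
      if ab: "a \<longlonglongrightarrow> 1" "b \<longlonglongrightarrow> 0" "\<And>n. b n \<noteq> 0" for a b z
    proof (cases z)
      case (Pair x y)
      have dq: "(\<lambda>n. (g (a n) (b n) x - g (a n) 0 x) / b n) \<longlonglongrightarrow> d x" for x
        using difference_quotient_tendsto[of "\<lambda>t. \<bar>t\<bar> powr p", OF has_real_derivative_abs_powr[OF p] abs_powr_deriv_isCont[OF p] ab] by (simp add: g_def d_def)
      have g0: "(\<lambda>n. g (a n) 0 x) \<longlonglongrightarrow> g 1 0 x" for x
      proof -
        have "(\<lambda>n. \<bar>a n * u x + 0 * v x\<bar> powr p) \<longlonglongrightarrow> \<bar>1 * u x + 0 * v x\<bar> powr p"
          by (intro tendsto_powr2 tendsto_intros ab(1)) (use p in auto)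
        then show ?thesis by (simp add: g_def)
      qed
      have gb: "(\<lambda>n. g (a n) (b n) x) \<longlonglongrightarrow> g 1 0 x" for x
      proof -
        have "(\<lambda>n. \<bar>a n * u x + b n * v x\<bar> powr p) \<longlonglongrightarrow> \<bar>1 * u x + 0 * v x\<bar> powr p"
          by (intro tendsto_powr2 tendsto_intros ab(1,2)) (use p in auto)
        then show ?thesis by (simp add: g_def)
      qed
      have "(\<lambda>n. k x y * ((g (a n) (b n) x - g (a n) 0 x) / b n * g (a n) (b n) y + g (a n) 0 x * ((g (a n) (b n) y - g (a n) 0 y) / b n)))
        \<longlonglongrightarrow> k x y * (d x * g 1 0 y + g 1 0 x * d y)"
        by (intro tendsto_intros dq g0 gb)
      moreover have "k x y * ((g (a n) (b n) x - g (a n) 0 x) / b n * g (a n) (b n) y + g (a n) 0 x * ((g (a n) (b n) y - g (a n) 0 y) / b n))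
        = (k x y * g (a n) (b n) x * g (a n) (b n) y - k x y * g (a n) 0 x * g (a n) 0 y) / b n" for n
        using ab(3)[of n] by (simp add: field_simps)
      ultimately show ?thesis unfolding Pair prod.case by simp
    qed
    show "logV p (\<lambda>x. a * u x + b * v x) = (\<integral>z. (case z of (x, y) \<Rightarrow> k x y * g a b x * g a b y) \<partial>(lborel \<Otimes>\<^sub>M lborel))" for a b
      using log_integrable(3)[OF p inX_lin[OF p u v], of a b] by (simp add: k_def g_def)
  qed
qed

lemma expw_mono: "a \<ge> 0 \<Longrightarrow> p > 1 \<Longrightarrow> \<bar>s\<bar> \<le> \<bar>t\<bar> \<Longrightarrow> expw p a s \<le> expw p a t"
  by (auto simp: expw_def intro!: mult_left_mono powr_mono2)

text \<open>The p-th power of the norm of \<open>W\<close>, hence homogeneous of degree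
  \<open>p\<close>.\<close>

definition wnorm :: "real \<Rightarrow> ('a::euclidean_space \<Rightarrow> real) \<Rightarrow> real" where
  "wnorm p u = enn2real (gag p u) + enn2real (Lp_p p u)"

context nonlinearity
begin

lemma F_integrable:
  fixes u :: "'a::euclidean_space \<Rightarrow> real"
  assumes u: "inX p u"
  shows "integrable lborel (\<lambda>x. F (u x))"
proof -
  note [measurable] = inX_D(1)[OF u]
  obtain a where a: "a > 0" "(\<integral>\<^sup>+x. ennreal (expw p a (u x)) \<partial>lborel) < \<infinity>" using inX_expw[OF p1 u] by blast
  obtain K where K: "K \<ge> 0" "\<And>x. F x \<le> K * (\<bar>x\<bar> powr p + expw p a x)" using F_dom[OF a(1)] by blast
  have "integrable lborel (\<lambda>x. expw p a (u x))" by (rule integrableI_nonneg) (use a in auto)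
  then have "integrable lborel (\<lambda>x. K * (\<bar>u x\<bar> powr p + expw p a (u x)))"
    by (intro integrable_mult_right Bochner_Integration.integrable_add Lp_integrable(1)[OF u])
  then show ?thesis
    by (rule Bochner_Integration.integrable_bound) (use Fnonneg K in \<open>auto intro!: AE_I2 order_trans[OF K(2)]\<close>)
qed

lemma qderiv_F:
  fixes u v :: "'a::euclidean_space \<Rightarrow> real"
  assumes u: "inX p u" and v: "inX p v"
  shows "\<exists>D. qderiv (\<lambda>w. \<integral>x. F (w x) \<partial>lborel) u v D"
proof -
  note [measurable] = inX_D(1)[OF u] inX_D(1)[OF v]
  \<comment> \<open>The factor 2 accounts for \<open>|a| <= 2\<close>: every intermediate point
    between \<open>a * u x\<close> and \<open>a * u x + b * v x\<close> is then at most
    \<open>|h x|\<close>.\<close>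
  define h where "h = (\<lambda>x. 2 * (\<bar>u x\<bar> + \<bar>v x\<bar>))"
  have hX: "inX p h" unfolding h_def by (rule inX_scale[OF p1 inX_abs_add[OF p1 u v]])
  note [measurable] = inX_D(1)[OF hX]
  \<comment> \<open>The exponent is dictated by the energy of \<open>h\<close>; subcritical growth
    provides the bound on \<open>f\<close> for whatever exponent results.\<close>
  obtain e where e: "e > 0" "(\<integral>\<^sup>+x. ennreal (expw p e (h x)) \<partial>lborel) < \<infinity>" using inX_expw[OF p1 hX] by blast
  obtain K where K: "K \<ge> 0" "\<And>x \<xi>. \<bar>\<xi>\<bar> \<le> \<bar>x\<bar> \<Longrightarrow> \<bar>x\<bar> * \<bar>f \<xi>\<bar> \<le> K * (\<bar>x\<bar> powr p + expw p e x)" using f_dom[OF e(1)] by blast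
  show ?thesis
  proof (rule exI, rule qderiv_integral[where G = "\<lambda>a b x. F (a * u x + b * v x)"
        and H = "\<lambda>x. K * (\<bar>h x\<bar> powr p + expw p e (h x))" and D = "\<lambda>x. f (u x) * v x"])
    show "integrable lborel (\<lambda>x. F (a * u x + b * v x))" for a b by (rule F_integrable[OF inX_lin[OF p1 u v]])
    have "integrable lborel (\<lambda>x. expw p e (h x))" by (rule integrableI_nonneg) (use e in auto)
    then show "integrable lborel (\<lambda>x. K * (\<bar>h x\<bar> powr p + expw p e (h x)))"
      by (intro integrable_mult_right Bochner_Integration.integrable_add Lp_integrable(1)[OF hX])
    show "\<bar>F (a * u x + b * v x) - F (a * u x + 0 * v x)\<bar> \<le> \<bar>b\<bar> * (K * (\<bar>h x\<bar> powr p + expw p e (h x)))"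
      if ab: "\<bar>a\<bar> \<le> 2" "\<bar>b\<bar> \<le> 1" for a b x
    proof -
      obtain \<xi> where \<xi>: "\<bar>\<xi> - a * u x\<bar> \<le> \<bar>b * v x\<bar>" "F (a * u x + b * v x) - F (a * u x) = (b * v x) * f \<xi>"
        using mean_value_bound[of F f "a * u x" "b * v x"] F_deriv by blast
      have "\<bar>a * u x\<bar> \<le> 2 * \<bar>u x\<bar>" "\<bar>b * v x\<bar> \<le> 1 * \<bar>v x\<bar>"
        unfolding abs_mult by (rule mult_right_mono[OF ab(1) abs_ge_zero], rule mult_right_mono[OF ab(2) abs_ge_zero])
      moreover have "\<bar>\<xi>\<bar> \<le> \<bar>\<xi> - a * u x\<bar> + \<bar>a * u x\<bar>" using abs_triangle_ineq[of "\<xi> - a * u x" "a * u x"] by simp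
      ultimately have "\<bar>\<xi>\<bar> \<le> 2 * \<bar>u x\<bar> + 1 * \<bar>v x\<bar>" using \<xi>(1) by argo
      also have "\<dots> \<le> \<bar>h x\<bar>" by (simp add: h_def)
      finally have xh: "\<bar>\<xi>\<bar> \<le> \<bar>h x\<bar>" .
      have "\<bar>F (a * u x + b * v x) - F (a * u x)\<bar> = \<bar>b\<bar> * (\<bar>v x\<bar> * \<bar>f \<xi>\<bar>)" unfolding \<xi>(2) by (simp add: abs_mult)
      also have "\<dots> \<le> \<bar>b\<bar> * (\<bar>h x\<bar> * \<bar>f \<xi>\<bar>)" by (intro mult_left_mono mult_right_mono) (auto simp: h_def)
      also have "\<dots> \<le> \<bar>b\<bar> * (K * (\<bar>h x\<bar> powr p + expw p e (h x)))" by (intro mult_left_mono K(2) xh) auto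
      finally show ?thesis by simp
    qed
    show "(\<lambda>x. f (u x) * v x) \<in> borel_measurable lborel" by measurable
    show "(\<lambda>n. (F (a n * u x + b n * v x) - F (a n * u x + 0 * v x)) / b n) \<longlonglongrightarrow> f (u x) * v x"
      if "a \<longlonglongrightarrow> 1" "b \<longlonglongrightarrow> 0" "\<And>n. b n \<noteq> 0" for a b x
    proof -
      have "isCont f (u x)" using cont by (simp add: continuous_on_eq_continuous_at)
      from difference_quotient_tendsto[of F f, OF F_deriv this that] show ?thesis by simp
    qed
  qed auto
qed

definition J :: "('a::euclidean_space \<Rightarrow> real) \<Rightarrow> real" where
  "J u = 1 / p * wnorm p u + 1 / (2 * p) * logV p u - (\<integral>x. F (u x) \<partial>lborel)"

lemma energy_eq_J:
  fixes u :: "'a::euclidean_space \<Rightarrow> real"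
  assumes "real DIM('a) = s * p" "inX p u"
  shows "energy s p f u = J u"
  unfolding energy_def J_def norm_p_def wnorm_def gagliardo_p_eq_gag[OF assms(1)] log_integrable(4)[OF p1 assms(2)] by simp

lemma qderiv_J:
  fixes u v :: "'a::euclidean_space \<Rightarrow> real"
  assumes u: "inX p u" and v: "inX p v"
  shows "\<exists>D. qderiv J u v D"
proof -
  obtain D1 D2 D3 D4 where D: "qderiv (\<lambda>w. enn2real (Lp_p p w)) u v D1" "qderiv (\<lambda>w. enn2real (gag p w)) u v D2"
    "qderiv (logV p) u v D3" "qderiv (\<lambda>w. \<integral>x. F (w x) \<partial>lborel) u v D4"
    using qderiv_Lp[OF p1 u v] qderiv_gag[OF p1 u v] qderiv_logV[OF p1 u v] qderiv_F[OF u v] by blast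
  have "qderiv (\<lambda>w. 1 * (1 / p * (1 * enn2real (gag p w) + 1 * enn2real (Lp_p p w)) + 1 / (2 * p) * logV p w) + (- 1) * (\<integral>x. F (w x) \<partial>lborel)) u v
      (1 * (1 / p * (1 * D2 + 1 * D1) + 1 / (2 * p) * D3) + (- 1) * D4)"
    by (intro qderiv_lin D)
  moreover have "(\<lambda>w::'a \<Rightarrow> real. 1 * (1 / p * (1 * enn2real (gag p w) + 1 * enn2real (Lp_p p w)) + 1 / (2 * p) * logV p w) + (- 1) * (\<integral>x. F (w x) \<partial>lborel)) = J"
    by (simp add: J_def[abs_def] wnorm_def)
  ultimately show ?thesis by auto
qed

end

section \<open>Fibering maps\<close>

lemma Lp_p_scale:
  fixes u :: "'a::euclidean_space \<Rightarrow> real"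
  assumes [measurable]: "u \<in> borel_measurable borel"
  shows "Lp_p p (\<lambda>x. t * u x) = ennreal (\<bar>t\<bar> powr p) * Lp_p p u"
  unfolding Lp_p_def by (subst nn_integral_cmult[symmetric]) (auto simp: abs_mult powr_mult ennreal_mult)

lemma gag_scale:
  fixes u :: "'a::euclidean_space \<Rightarrow> real"
  assumes [measurable]: "u \<in> borel_measurable borel"
  shows "gag p (\<lambda>x. t * u x) = ennreal (\<bar>t\<bar> powr p) * gag p u"
proof -
  have "\<bar>t * u x - t * u y\<bar> powr p = \<bar>t\<bar> powr p * \<bar>u x - u y\<bar> powr p" for x y
    by (metis abs_ge_zero abs_mult powr_mult right_diff_distrib)
  then show ?thesis unfolding gag_def
    by (simp add: nn_integral_cmult[symmetric] ennreal_mult[symmetric])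
qed

lemma kform_scale:
  fixes u :: "'a::euclidean_space \<Rightarrow> real"
  assumes [measurable]: "u \<in> borel_measurable borel" "k \<in> borel_measurable borel" and k: "\<And>r. k r \<ge> 0"
  shows "kform k (\<lambda>x. \<bar>t * u x\<bar> powr p) (\<lambda>x. \<bar>t * u x\<bar> powr p) = ennreal (\<bar>t\<bar> powr (2 * p)) * kform k (\<lambda>x. \<bar>u x\<bar> powr p) (\<lambda>x. \<bar>u x\<bar> powr p)"
proof -
  have "ennreal (k (norm (x - y)) * \<bar>t * u x\<bar> powr p * \<bar>t * u y\<bar> powr p)
     = ennreal (\<bar>t\<bar> powr (2 * p)) * ennreal (k (norm (x - y)) * \<bar>u x\<bar> powr p * \<bar>u y\<bar> powr p)" for x y :: 'a
  proof -
    have "k (norm (x - y)) * \<bar>t * u x\<bar> powr p * \<bar>t * u y\<bar> powr p = (\<bar>t\<bar> powr p)\<^sup>2 * (k (norm (x - y)) * \<bar>u x\<bar> powr p * \<bar>u y\<bar> powr p)"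
      by (simp add: abs_mult powr_mult power2_eq_square mult_ac)
    then show ?thesis using k by (simp add: powr_square ennreal_mult[symmetric])
  qed
  then show ?thesis unfolding kform_def by (simp add: nn_integral_cmult)
qed

lemma wnorm_nonneg: "wnorm p u \<ge> 0"
  by (simp add: wnorm_def)

lemma wnorm_scale:
  fixes u :: "'a::euclidean_space \<Rightarrow> real"
  assumes "u \<in> borel_measurable borel"
  shows "wnorm p (\<lambda>x. t * u x) = \<bar>t\<bar> powr p * wnorm p u"
  by (simp add: wnorm_def Lp_p_scale[OF assms] gag_scale[OF assms] enn2real_mult distrib_left)

lemma logV_scale:
  fixes u :: "'a::euclidean_space \<Rightarrow> real"
  assumes "u \<in> borel_measurable borel"
  shows "logV p (\<lambda>x. t * u x) = \<bar>t\<bar> powr (2 * p) * logV p u"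
  by (simp add: logV_def kform_scale[OF assms] enn2real_mult right_diff_distrib)

context nonlinearity
begin

lemma J_scale:
  fixes u :: "'a::euclidean_space \<Rightarrow> real"
  assumes "inX p u"
  shows "J (\<lambda>x. t * u x) = \<bar>t\<bar> powr p * (wnorm p u / p) + \<bar>t\<bar> powr (2 * p) * (logV p u / (2 * p)) - (\<integral>x. F (t * u x) \<partial>lborel)"
  using inX_D(1)[OF assms] by (simp add: J_def wnorm_scale logV_scale)

lemma F_scaled_integrable:
  fixes u :: "'a::euclidean_space \<Rightarrow> real"
  assumes "inX p u"
  shows "integrable lborel (\<lambda>x. F (t * u x))"
  by (rule F_integrable[OF inX_scale[OF p1 assms]])

lemma F_increasing:
  assumes "\<bar>s\<bar> \<le> \<bar>t\<bar>"
  shows "F s \<le> F t"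
proof (cases "s = 0")
  case False
  then have t: "\<bar>t\<bar> > 0" using assms by auto
  have "F s = F ((\<bar>s\<bar> / \<bar>t\<bar>) * \<bar>t\<bar>)" using t F_abs[of s] by simp
  also have "\<dots> \<le> (\<bar>s\<bar> / \<bar>t\<bar>) powr (2 * p) * F \<bar>t\<bar>" by (rule F_scale_le) (use False t assms in auto)
  also have "\<dots> \<le> 1 * F \<bar>t\<bar>" using t assms p1 Fnonneg by (intro mult_right_mono powr_le1) auto
  finally show ?thesis by (simp add: F_abs)
qed (simp add: F_0 Fnonneg)

lemma J_scale_continuous:
  fixes u :: "'a::euclidean_space \<Rightarrow> real"
  assumes u: "inX p u"
  shows "continuous_on UNIV (\<lambda>t. J (\<lambda>x. t * u x))"
proof -
  note [measurable] = inX_D(1)[OF u]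
  have c: "continuous_on UNIV (\<lambda>t. \<integral>x. F (t * u x) \<partial>lborel)"
    unfolding continuous_on_sequentially comp_def
  proof (intro allI ballI impI)
    fix \<tau> :: "nat \<Rightarrow> real" and t assume lim: "(\<forall>n. \<tau> n \<in> UNIV) \<and> \<tau> \<longlonglongrightarrow> t"
    then have lim': "\<tau> \<longlonglongrightarrow> t" by simp
    then obtain B where B: "\<And>n. \<bar>\<tau> n\<bar> \<le> B" using convergent_imp_Bseq[of \<tau>] by (auto simp: convergent_def Bseq_def)
    show "(\<lambda>n. \<integral>x. F (\<tau> n * u x) \<partial>lborel) \<longlonglongrightarrow> (\<integral>x. F (t * u x) \<partial>lborel)"
    proof (rule integral_dominated_convergence)
      show "integrable lborel (\<lambda>x. F (B * u x))" by (rule F_scaled_integrable[OF u])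
      show "AE x in lborel. norm (F (\<tau> n * u x)) \<le> F (B * u x)" for n
      proof (rule AE_I2)
        fix x
        have "\<bar>\<tau> n * u x\<bar> \<le> \<bar>B * u x\<bar>" using B[of n] by (auto simp: abs_mult intro!: mult_right_mono)
        then show "norm (F (\<tau> n * u x)) \<le> F (B * u x)" using F_increasing Fnonneg by simp
      qed
      show "AE x in lborel. (\<lambda>n. F (\<tau> n * u x)) \<longlonglongrightarrow> F (t * u x)"
        by (intro AE_I2 isCont_tendsto_compose[OF DERIV_isCont[OF F_deriv]] tendsto_intros lim')
    qed measurable
  qed
  show ?thesis unfolding J_scale[OF u]
    by (intro continuous_on_add continuous_on_diff continuous_on_mult continuous_on_const c continuous_on_powr' continuous_on_rabs continuous_on_id)
       (use p1 in auto)
qed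

text \<open>The leading term is \<open>t powr p\<close>. The logarithmic term is a multiple of
  \<open>t powr (2 * p)\<close>, and by \<open>F_scale_le\<close> the integral of the primitive is
  at most such a multiple.\<close>

lemma J_scale_pos_near_0:
  fixes u :: "'a::euclidean_space \<Rightarrow> real"
  assumes u: "inX p u" and A: "wnorm p u > 0"
  shows "\<exists>t>0. J (\<lambda>x. t * u x) > 0"
proof -
  note [measurable] = inX_D(1)[OF u]
  define c where "c = \<bar>logV p u / (2 * p) - (\<integral>x. F (u x) \<partial>lborel)\<bar> + 1"
  have c: "c \<ge> 1" by (simp add: c_def)
  \<comment> \<open>Chosen so that \<open>t powr p * c <= wnorm p u / (2 * p)\<close>: the terms of
    order \<open>2 * p\<close> use up at most half of the leading one. The minimum with 1 is needed
    for \<open>F_scale_le\<close>.\<close>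
  define t where "t = min 1 ((wnorm p u / (2 * p * c)) powr (1 / p))"
  have t: "0 < t" "t \<le> 1" using A c p1 by (auto simp: t_def)
  have "t powr p \<le> ((wnorm p u / (2 * p * c)) powr (1 / p)) powr p" using t p1 by (intro powr_mono2) (auto simp: t_def)
  also have "\<dots> = wnorm p u / (2 * p * c)" using A c p1 by (simp add: powr_powr)
  finally have tp: "t powr p * c \<le> wnorm p u / (2 * p)" using c p1 by (simp add: field_simps)
  have t2: "t powr (2 * p) = t powr p * t powr p" using powr_add[of t p p] by simp
  have "(\<integral>x. F (t * u x) \<partial>lborel) \<le> (\<integral>x. t powr (2 * p) * F (u x) \<partial>lborel)"
    by (intro integral_mono F_scaled_integrable[OF u] integrable_mult_right F_integrable[OF u] F_scale_le t)
  then have "J (\<lambda>x. t * u x) \<ge> t powr p * (wnorm p u / p) + t powr (2 * p) * (logV p u / (2 * p) - (\<integral>x. F (u x) \<partial>lborel))"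
    unfolding J_scale[OF u] using t by (simp add: algebra_simps)
  moreover have "t powr (2 * p) * (logV p u / (2 * p) - (\<integral>x. F (u x) \<partial>lborel)) \<ge> t powr (2 * p) * (- c)"
    unfolding c_def by (intro mult_left_mono) auto
  moreover have "t powr (2 * p) * (- c) = - (t powr p * (t powr p * c))" 
    by (simp only: t2 mult_minus_right mult.assoc)
  moreover have "t powr p * (t powr p * c) \<le> t powr p * (wnorm p u / (2 * p))" by (rule mult_left_mono[OF tp]) simp
  moreover have "t powr p * (wnorm p u / (2 * p)) < t powr p * (wnorm p u / p)"
    using t A p1 by (intro mult_strict_left_mono) (auto simp: field_simps)
  ultimately have "J (\<lambda>x. t * u x) > 0" by argo
  then show ?thesis using t by blast
qed

text \<open>(f4') provides a power \<open>q > 2 * p\<close>, which beats the sign-indefinite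
  logarithmic term of order \<open>2 * p\<close>. Its coefficient \<open>Q\<close> is positive
  because \<open>u\<close> does not vanish almost everywhere.\<close>

lemma J_scale_neg_at_infinity:
  fixes u :: "'a::euclidean_space \<Rightarrow> real"
  assumes u: "inX p u" and L: "Lp_p p u \<noteq> 0"
  shows "\<exists>T>0. \<forall>t\<ge>T. J (\<lambda>x. t * u x) < 0"
proof -
  note [measurable] = inX_D(1)[OF u]
  obtain q M where q: "q > 2 * p" and M: "M > 0" "\<And>t. F t \<ge> M * \<bar>t\<bar> powr q" using superpower by blast
  have qint: "integrable lborel (\<lambda>x. M * \<bar>u x\<bar> powr q)"
    by (rule Bochner_Integration.integrable_bound[OF F_integrable[OF u]]) (use M Fnonneg in \<open>auto intro!: AE_I2\<close>)
  define Q where "Q = (\<integral>x. M * \<bar>u x\<bar> powr q \<partial>lborel)"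
  have "Q \<ge> 0" unfolding Q_def using M by (intro integral_nonneg_AE) auto
  moreover have "Q \<noteq> 0"
  proof
    assume "Q = 0"
    then have "AE x in lborel. M * \<bar>u x\<bar> powr q = 0"
      unfolding Q_def using M by (subst (asm) integral_nonneg_eq_0_iff_AE[OF qint]) auto
    then have "AE x in lborel. ennreal (\<bar>u x\<bar> powr p) = 0" by eventually_elim (use M in auto)
    then have "Lp_p p u = 0" unfolding Lp_p_def by (subst nn_integral_0_iff_AE) auto
    then show False using L by simp
  qed
  ultimately have Q: "Q > 0" by simp
  define C where "C = wnorm p u / p + \<bar>logV p u / (2 * p)\<bar> + 1"
  have C: "C > 0" using wnorm_nonneg[of p u] p1 by (auto simp: C_def intro!: add_nonneg_pos)
  define T where "T = max 1 ((C / Q) powr (1 / (q - 2 * p)))"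
  have "J (\<lambda>x. t * u x) < 0" if t: "t \<ge> T" for t
  proof -
    have t1: "t \<ge> 1" using t by (simp add: T_def)
    have "C / Q = ((C / Q) powr (1 / (q - 2 * p))) powr (q - 2 * p)" using C Q q by (simp add: powr_powr)
    also have "\<dots> \<le> t powr (q - 2 * p)" using t q by (intro powr_mono2) (auto simp: T_def)
    finally have CQ: "C \<le> t powr (q - 2 * p) * Q" using Q by (simp add: field_simps)
    have tq: "t powr (2 * p) * t powr (q - 2 * p) = t powr q" by (simp add: powr_add[symmetric])
    have "t powr q * Q = (\<integral>x. t powr q * (M * \<bar>u x\<bar> powr q) \<partial>lborel)" unfolding Q_def by simp
    also have "\<dots> \<le> (\<integral>x. F (t * u x) \<partial>lborel)"
    proof (intro integral_mono F_scaled_integrable[OF u] integrable_mult_right[OF qint])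
      fix x
      have "t powr q * (M * \<bar>u x\<bar> powr q) = M * \<bar>t * u x\<bar> powr q" using t1 by (simp add: abs_mult powr_mult)
      then show "t powr q * (M * \<bar>u x\<bar> powr q) \<le> F (t * u x)" using M(2)[of "t * u x"] by linarith
    qed
    finally have F: "t powr (2 * p) * (t powr (q - 2 * p) * Q) \<le> (\<integral>x. F (t * u x) \<partial>lborel)" by (simp add: tq[symmetric] mult.assoc)
    have "t powr (2 * p) * C \<le> t powr (2 * p) * (t powr (q - 2 * p) * Q)" by (rule mult_left_mono[OF CQ]) simp
    moreover have "t powr p * (wnorm p u / p) \<le> t powr (2 * p) * (wnorm p u / p)"
      using t1 p1 wnorm_nonneg[of p u] by (intro mult_right_mono powr_mono) auto
    moreover have "t powr (2 * p) * (logV p u / (2 * p)) \<le> t powr (2 * p) * \<bar>logV p u / (2 * p)\<bar>"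
      by (rule mult_left_mono[OF abs_ge_self]) simp
    moreover have "t powr (2 * p) * C = t powr (2 * p) * (wnorm p u / p) + t powr (2 * p) * \<bar>logV p u / (2 * p)\<bar> + t powr (2 * p)"
      by (simp add: C_def algebra_simps)
    moreover have "t powr (2 * p) > 0" using t1 by simp
    ultimately have neg: "t powr p * (wnorm p u / p) + t powr (2 * p) * (logV p u / (2 * p)) - (\<integral>x. F (t * u x) \<partial>lborel) < 0"
      using F by linarith
    have at: "\<bar>t\<bar> = t" using t1 by simp
    show ?thesis unfolding J_scale[OF u] at by (rule neg)
  qed
  then show ?thesis by (intro exI[of _ T]) (auto simp: T_def)
qed

text \<open>Beyond some \<open>T\<close> the energy is negative and somewhere before it is positive,
  so the maximum over the compact interval is the maximum over the whole ray and is not attained at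
  0.\<close>

lemma J_scale_attains_max:
  fixes u :: "'a::euclidean_space \<Rightarrow> real"
  assumes u: "inX p u" and L: "Lp_p p u \<noteq> 0"
  shows "\<exists>t>0. J (\<lambda>x. t * u x) > 0 \<and> (\<forall>s\<ge>0. J (\<lambda>x. s * u x) \<le> J (\<lambda>x. t * u x))"
proof -
  have "enn2real (Lp_p p u) > 0" using L inX_D(2)[OF u] by (simp add: enn2real_positive_iff zero_less_iff_neq_zero)
  then have A: "wnorm p u > 0" by (simp add: wnorm_def add_nonneg_pos)
  obtain t0 where t0: "t0 > 0" "J (\<lambda>x. t0 * u x) > 0" using J_scale_pos_near_0[OF u A] by blast
  obtain T where T: "T > 0" "\<And>t. t \<ge> T \<Longrightarrow> J (\<lambda>x. t * u x) < 0" using J_scale_neg_at_infinity[OF u L] by blast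
  have "\<exists>t\<in>{0..T}. \<forall>s\<in>{0..T}. J (\<lambda>x. s * u x) \<le> J (\<lambda>x. t * u x)"
    using T(1) by (intro continuous_attains_sup continuous_on_subset[OF J_scale_continuous[OF u]]) auto
  then obtain t where t: "0 \<le> t" "t \<le> T" "\<And>s. 0 \<le> s \<Longrightarrow> s \<le> T \<Longrightarrow> J (\<lambda>x. s * u x) \<le> J (\<lambda>x. t * u x)" by auto
  have "t0 \<le> T" using T(2)[of t0] t0 by (cases "t0 \<le> T") auto
  then have pos: "J (\<lambda>x. t * u x) > 0" using t(3)[of t0] t0 by simp
  moreover have "J (\<lambda>x. 0 * u x) = 0" unfolding J_scale[OF u] by (simp add: F_0)
  then have "t \<noteq> 0" using pos by (metis less_irrefl)
  moreover have "J (\<lambda>x. s * u x) \<le> J (\<lambda>x. t * u x)" if "s \<ge> 0" for s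
    using t(3)[of s] T(2)[of s] pos that by (cases "s \<le> T") auto
  ultimately show ?thesis using t(1) by (intro exI[of _ t]) auto
qed

text \<open>In \<open>\<sigma>\<close> the logarithmic term is linear and the primitive convex.
  Strictness comes from the norm term, which is a positive multiple of the square root of
  \<open>\<sigma>\<close>.\<close>

lemma J_scale_strict_quasiconcave:
  fixes u :: "'a::euclidean_space \<Rightarrow> real"
  assumes u: "inX p u" and A: "wnorm p u > 0" and t: "0 < t1" "t1 < t2" "t2 < t3"
  shows "min (J (\<lambda>x. t1 * u x)) (J (\<lambda>x. t3 * u x)) < J (\<lambda>x. t2 * u x)"
proof -
  define r where "r = 1 / (2 * p)"
  define \<sigma> where "\<sigma> = (\<lambda>t. t powr (2 * p))"
  have root: "\<sigma> t powr r = t" if "t > 0" for t using that p1 by (simp add: \<sigma>_def r_def powr_powr)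
  have \<sigma>pos: "\<sigma> t > 0" if "t > 0" for t using that by (simp add: \<sigma>_def)
  have \<sigma>less: "\<sigma> s < \<sigma> t" if "0 < s" "s < t" for s t using that p1 by (simp add: \<sigma>_def powr_less_mono2)
  define \<mu> where "\<mu> = (\<sigma> t2 - \<sigma> t1) / (\<sigma> t3 - \<sigma> t1)"
  have s12: "\<sigma> t1 < \<sigma> t2" and s23: "\<sigma> t2 < \<sigma> t3" using \<sigma>less t by auto
  have l: "0 < \<mu>" "\<mu> < 1" using s12 s23 by (auto simp: \<mu>_def)
  have comb: "\<sigma> t2 = (1 - \<mu>) * \<sigma> t1 + \<mu> * \<sigma> t3"
  proof -
    have "\<mu> * (\<sigma> t3 - \<sigma> t1) = \<sigma> t2 - \<sigma> t1" using s12 s23 by (simp add: \<mu>_def)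
    then show ?thesis by (simp add: algebra_simps)
  qed
  have pt: "F (t2 * y) \<le> (1 - \<mu>) * F (t1 * y) + \<mu> * F (t3 * y)" for y
  proof -
    have "F (((1 - \<mu>) *\<^sub>R \<sigma> t1 + \<mu> *\<^sub>R \<sigma> t3) powr r * y) \<le> (1 - \<mu>) * F (\<sigma> t1 powr r * y) + \<mu> * F (\<sigma> t3 powr r * y)"
      unfolding r_def using l t \<sigma>pos by (intro convex_onD[OF F_root_convex]) auto
    then show ?thesis using root t comb[symmetric] by simp
  qed
  have "(\<integral>x. F (t2 * u x) \<partial>lborel) \<le> (\<integral>x. (1 - \<mu>) * F (t1 * u x) + \<mu> * F (t3 * u x) \<partial>lborel)"
    by (intro integral_mono Bochner_Integration.integrable_add integrable_mult_right F_scaled_integrable[OF u] pt)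
  also have "\<dots> = (1 - \<mu>) * (\<integral>x. F (t1 * u x) \<partial>lborel) + \<mu> * (\<integral>x. F (t3 * u x) \<partial>lborel)"
    by (simp add: F_scaled_integrable[OF u])
  finally have Fle: "(\<integral>x. F (t2 * u x) \<partial>lborel) \<le> (1 - \<mu>) * (\<integral>x. F (t1 * u x) \<partial>lborel) + \<mu> * (\<integral>x. F (t3 * u x) \<partial>lborel)" .
  \<comment> \<open>The gap between the squares is the variance
    \<open>\<mu> * (1 - \<mu>) * (t1 powr p - t3 powr p)\<^sup>2\<close> of a two-point
    distribution.\<close>
  have sq: "(1 - \<mu>) * t1 powr p + \<mu> * t3 powr p < t2 powr p"
  proof (rule power2_less_imp_less)
    have pw: "(t powr p)\<^sup>2 = \<sigma> t" for t by (simp add: \<sigma>_def power2_eq_square powr_add[symmetric])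
    have "t1 powr p < t3 powr p" using t p1 by (intro powr_less_mono2) auto
    then have "\<mu> * (1 - \<mu>) * (t1 powr p - t3 powr p)\<^sup>2 > 0" using l by (intro mult_pos_pos) auto
    moreover have "(t2 powr p)\<^sup>2 - ((1 - \<mu>) * t1 powr p + \<mu> * t3 powr p)\<^sup>2 = \<mu> * (1 - \<mu>) * (t1 powr p - t3 powr p)\<^sup>2"
      unfolding pw comb unfolding pw[symmetric] by (simp add: power2_eq_square algebra_simps)
    ultimately show "((1 - \<mu>) * t1 powr p + \<mu> * t3 powr p)\<^sup>2 < (t2 powr p)\<^sup>2" by linarith
  qed simp
  define a where "a = wnorm p u / p"
  define v where "v = logV p u / (2 * p)"
  have a: "a > 0" using A p1 by (simp add: a_def)
  have Jt: "J (\<lambda>x. t * u x) = t powr p * a + \<sigma> t * v - (\<integral>x. F (t * u x) \<partial>lborel)" if "t > 0" for t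
    using J_scale[OF u, of t] that by (simp add: a_def v_def \<sigma>_def)
  have "((1 - \<mu>) * t1 powr p + \<mu> * t3 powr p) * a < t2 powr p * a" using sq a by (rule mult_strict_right_mono)
  moreover have "(1 - \<mu>) * J (\<lambda>x. t1 * u x) + \<mu> * J (\<lambda>x. t3 * u x) = ((1 - \<mu>) * t1 powr p + \<mu> * t3 powr p) * a
      + \<sigma> t2 * v - ((1 - \<mu>) * (\<integral>x. F (t1 * u x) \<partial>lborel) + \<mu> * (\<integral>x. F (t3 * u x) \<partial>lborel))"
    using t by (simp add: Jt comb algebra_simps)
  ultimately have "(1 - \<mu>) * J (\<lambda>x. t1 * u x) + \<mu> * J (\<lambda>x. t3 * u x) < J (\<lambda>x. t2 * u x)"
    using Fle Jt[of t2] t by linarith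
  moreover have "min (J (\<lambda>x. t1 * u x)) (J (\<lambda>x. t3 * u x)) \<le> (1 - \<mu>) * J (\<lambda>x. t1 * u x) + \<mu> * J (\<lambda>x. t3 * u x)"
  proof -
    let ?m = "min (J (\<lambda>x. t1 * u x)) (J (\<lambda>x. t3 * u x))"
    have "(1 - \<mu>) * ?m + \<mu> * ?m \<le> (1 - \<mu>) * J (\<lambda>x. t1 * u x) + \<mu> * J (\<lambda>x. t3 * u x)"
      using l by (intro add_mono mult_left_mono) auto
    then show ?thesis by (simp add: algebra_simps)
  qed
  ultimately show ?thesis by linarith
qed

end

section \<open>Semicontinuity\<close>

text \<open>Fatou in \<open>y\<close> for almost every \<open>x\<close>, then in \<open>x\<close>.
  Convergence is assumed in iterated form because it comes from a sequence that converges almost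
  everywhere in one variable.\<close>

lemma Fatou_double:
  fixes H :: "nat \<Rightarrow> 'a::euclidean_space \<Rightarrow> 'a \<Rightarrow> ennreal"
  assumes m: "\<And>n. case_prod (H n) \<in> borel_measurable (borel \<Otimes>\<^sub>M borel)"
    and lim: "AE x in lborel. AE y in lborel. (\<lambda>n. H n x y) \<longlonglongrightarrow> G x y"
  shows "(\<integral>\<^sup>+x. (\<integral>\<^sup>+y. G x y \<partial>lborel) \<partial>lborel) \<le> liminf (\<lambda>n. \<integral>\<^sup>+x. (\<integral>\<^sup>+y. H n x y \<partial>lborel) \<partial>lborel)"
proof -
  note [measurable] = m
  have "(\<integral>\<^sup>+x. (\<integral>\<^sup>+y. G x y \<partial>lborel) \<partial>lborel) \<le> (\<integral>\<^sup>+x. liminf (\<lambda>n. \<integral>\<^sup>+y. H n x y \<partial>lborel) \<partial>lborel)"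
  proof (rule nn_integral_mono_AE)
    show "AE x in lborel. (\<integral>\<^sup>+y. G x y \<partial>lborel) \<le> liminf (\<lambda>n. \<integral>\<^sup>+y. H n x y \<partial>lborel)"
      using lim
    proof eventually_elim
      case (elim x)
      have "(\<integral>\<^sup>+y. G x y \<partial>lborel) = (\<integral>\<^sup>+y. liminf (\<lambda>n. H n x y) \<partial>lborel)"
        by (rule nn_integral_cong_AE) (use elim in \<open>eventually_elim, simp add: lim_imp_Liminf\<close>)
      also have "\<dots> \<le> liminf (\<lambda>n. \<integral>\<^sup>+y. H n x y \<partial>lborel)" by (rule nn_integral_liminf) measurable
      finally show ?case .
    qed
  qed
  also have "\<dots> \<le> liminf (\<lambda>n. \<integral>\<^sup>+x. (\<integral>\<^sup>+y. H n x y \<partial>lborel) \<partial>lborel)" by (rule nn_integral_liminf) measurable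
  finally show ?thesis .
qed

lemma Fatou_AE:
  fixes h :: "nat \<Rightarrow> 'a \<Rightarrow> ennreal"
  assumes m: "\<And>n. h n \<in> borel_measurable M" and lim: "AE x in M. (\<lambda>n. h n x) \<longlonglongrightarrow> g x"
  shows "(\<integral>\<^sup>+x. g x \<partial>M) \<le> liminf (\<lambda>n. \<integral>\<^sup>+x. h n x \<partial>M)"
proof -
  have "(\<integral>\<^sup>+x. g x \<partial>M) = (\<integral>\<^sup>+x. liminf (\<lambda>n. h n x) \<partial>M)"
    by (rule nn_integral_cong_AE) (use lim in \<open>eventually_elim, simp add: lim_imp_Liminf\<close>)
  also have "\<dots> \<le> liminf (\<lambda>n. \<integral>\<^sup>+x. h n x \<partial>M)" by (rule nn_integral_liminf[OF m])
  finally show ?thesis .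
qed

text \<open>A reverse Fatou lemma. Large values cost at most a small multiple of
  \<open>expw\<close>, and far points cost the logarithmic moment divided by
  \<open>ln (1 + R)\<close>. What remains is bounded and lives on a ball, where dominated
  convergence applies.\<close>

lemma limsup_nn_integral_tight:
  fixes w :: "nat \<Rightarrow> 'a::euclidean_space \<Rightarrow> real" and h :: "real \<Rightarrow> real"
  assumes p: "p > 1" and a: "a > 0" and hc: "continuous_on UNIV h" and h0: "\<And>t. h t \<ge> 0"
    and hb: "\<And>e. e > 0 \<Longrightarrow> \<exists>K\<ge>0. \<forall>t. h t \<le> e * expw p a t + K * \<bar>t\<bar> powr p"
    and [measurable]: "\<And>n. w n \<in> borel_measurable borel" "v \<in> borel_measurable borel"
    and lim: "AE x in lborel. (\<lambda>n. w n x) \<longlonglongrightarrow> v x"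
    and C: "C \<ge> 0" "\<And>n. (\<integral>\<^sup>+x. ennreal (expw p a (w n x)) \<partial>lborel) \<le> ennreal C"
    and L: "L \<ge> 0" "\<And>n. logmoment p (w n) \<le> ennreal L"
  shows "limsup (\<lambda>n. \<integral>\<^sup>+x. ennreal (h (w n x)) \<partial>lborel) \<le> (\<integral>\<^sup>+x. ennreal (h (v x)) \<partial>lborel)"
proof (rule ennreal_le_epsilon)
  fix \<eta> :: real assume \<eta>: "\<eta> > 0"
  have [measurable]: "h \<in> borel_measurable borel" by (rule borel_measurable_continuous_onI[OF hc])
  define e where "e = \<eta> / (2 * (C + 1))"
  have e: "e > 0" using \<eta> C(1) by (simp add: e_def)
  have eC: "e * C \<le> \<eta> / 2" using \<eta> C(1) by (simp add: e_def field_simps)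
  obtain K where K: "K \<ge> 0" "\<And>t. h t \<le> e / 2 * expw p a t + K * \<bar>t\<bar> powr p" using hb[of "e / 2"] e by auto
  have "e / (2 * (K + 1)) > 0" using e K by simp
  then obtain T where T: "T \<ge> 1" "\<And>t. \<bar>t\<bar> \<ge> T \<Longrightarrow> \<bar>t\<bar> powr p \<le> e / (2 * (K + 1)) * expw p a t"
    using powr_le_expw_eventually[OF a _ p, of _ p] by blast
  \<comment> \<open>\<open>B\<close> dominates \<open>h\<close> below \<open>T\<close>, and above
    \<open>T\<close> the whole of \<open>h\<close> is at most \<open>e * expw\<close>. Hence
    \<open>h\<close> exceeds its truncation at \<open>B\<close> by at most
    \<open>e * expw\<close>.\<close>
  define B where "B = e / 2 * expw p a T + K * T powr p"
  have B: "B \<ge> 0" using e K(1) by (simp add: B_def)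
  have hB: "h t \<le> min (h t) B + e * expw p a t" for t
  proof (cases "\<bar>t\<bar> \<ge> T")
    case True
    have "K * \<bar>t\<bar> powr p \<le> K * (e / (2 * (K + 1)) * expw p a t)" by (rule mult_left_mono[OF T(2)[OF True] K(1)])
    also have "\<dots> = (K / (K + 1)) * (e / 2 * expw p a t)" using K(1) by (simp add: field_simps)
    also have "\<dots> \<le> 1 * (e / 2 * expw p a t)" using K(1) e by (intro mult_right_mono) (auto simp: field_simps)
    finally have "h t \<le> e * expw p a t" using K(2)[of t] by simp
    then show ?thesis using h0[of t] B by (simp add: min_def add_increasing)
  next
    case False
    have "h t \<le> e / 2 * expw p a t + K * \<bar>t\<bar> powr p" by (rule K(2))
    also have "\<dots> \<le> B" unfolding B_def
      using False K(1) e a p T(1) by (intro add_mono mult_left_mono expw_mono powr_mono2) auto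
    finally show ?thesis using e by (simp add: min_def)
  qed
  \<comment> \<open>Makes \<open>ln (1 + R)\<close> at least \<open>2 * K * L / \<eta>\<close>, so
    that the contribution from outside the ball is at most \<open>\<eta> / 2\<close>.\<close>
  define R where "R = exp (2 * K * L / \<eta> + 1)"
  have R: "R > 0" by (simp add: R_def)
  have lnR: "ln (1 + R) > 0" using R by simp
  have "2 * K * L / \<eta> + 1 = ln R" by (simp add: R_def)
  also have "\<dots> \<le> ln (1 + R)" using R by (intro ln_mono) auto
  finally have "2 * K * L / \<eta> \<le> ln (1 + R)" by linarith
  then have KL: "K / ln (1 + R) * L \<le> \<eta> / 2" using \<eta> lnR by (simp add: field_simps)
  define I where "I = (\<lambda>n. \<integral>\<^sup>+x. ennreal (indicator (ball 0 R) x * min (h (w n x)) B) \<partial>lborel)"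
  have le: "(\<integral>\<^sup>+x. ennreal (h (w n x)) \<partial>lborel) \<le> I n + ennreal \<eta>" for n
  proof -
    have "(\<integral>\<^sup>+x. ennreal (h (w n x)) \<partial>lborel) \<le> (\<integral>\<^sup>+x. ennreal (indicator (ball 0 R) x * min (h (w n x)) B)
        + (ennreal e * ennreal (expw p a (w n x)) + ennreal (K / ln (1 + R)) * ennreal (ln (1 + norm x) * \<bar>w n x\<bar> powr p)) \<partial>lborel)"
    proof (rule nn_integral_mono)
      fix x :: 'a
      have "h (w n x) \<le> indicator (ball 0 R) x * min (h (w n x)) B + (e * expw p a (w n x) + K / ln (1 + R) * (ln (1 + norm x) * \<bar>w n x\<bar> powr p))"
      proof (cases "norm x < R")
        case True
        have "0 \<le> K / ln (1 + R) * (ln (1 + norm x) * \<bar>w n x\<bar> powr p)" using K(1) lnR by (intro mult_nonneg_nonneg) auto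
        then show ?thesis using hB[of "w n x"] True by simp
      next
        case False
        then have "1 \<le> ln (1 + norm x) / ln (1 + R)" using lnR R by (simp add: le_divide_eq)
        then have "K * \<bar>w n x\<bar> powr p * 1 \<le> K * \<bar>w n x\<bar> powr p * (ln (1 + norm x) / ln (1 + R))"
          using K(1) by (intro mult_left_mono) auto
        also have "\<dots> = K / ln (1 + R) * (ln (1 + norm x) * \<bar>w n x\<bar> powr p)" by simp
        finally have "h (w n x) \<le> e / 2 * expw p a (w n x) + K / ln (1 + R) * (ln (1 + norm x) * \<bar>w n x\<bar> powr p)"
          using K(2)[of "w n x"] by linarith
        moreover have "e / 2 * expw p a (w n x) \<le> e * expw p a (w n x)" using e by (intro mult_right_mono) auto
        ultimately show ?thesis using False by simp
      qed
      then have "ennreal (h (w n x)) \<le> ennreal (indicator (ball 0 R) x * min (h (w n x)) B + (e * expw p a (w n x) + K / ln (1 + R) * (ln (1 + norm x) * \<bar>w n x\<bar> powr p)))"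
        by (rule ennreal_leI)
      also have "\<dots> = ennreal (indicator (ball 0 R) x * min (h (w n x)) B) + ennreal (e * expw p a (w n x) + K / ln (1 + R) * (ln (1 + norm x) * \<bar>w n x\<bar> powr p))"
        using h0 B e K(1) lnR by (intro ennreal_plus) auto
      also have "ennreal (e * expw p a (w n x) + K / ln (1 + R) * (ln (1 + norm x) * \<bar>w n x\<bar> powr p)) = ennreal e * ennreal (expw p a (w n x)) + ennreal (K / ln (1 + R)) * ennreal (ln (1 + norm x) * \<bar>w n x\<bar> powr p)"
        using e K(1) lnR by (intro ennreal_lin) auto
      finally show "ennreal (h (w n x)) \<le> ennreal (indicator (ball 0 R) x * min (h (w n x)) B)
        + (ennreal e * ennreal (expw p a (w n x)) + ennreal (K / ln (1 + R)) * ennreal (ln (1 + norm x) * \<bar>w n x\<bar> powr p))" .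
    qed
    also have "\<dots> = I n + (ennreal e * (\<integral>\<^sup>+x. ennreal (expw p a (w n x)) \<partial>lborel) + ennreal (K / ln (1 + R)) * logmoment p (w n))"
      unfolding I_def logmoment_def by (simp add: nn_integral_add nn_integral_cmult)
    also have "\<dots> \<le> I n + (ennreal e * ennreal C + ennreal (K / ln (1 + R)) * ennreal L)"
      by (intro add_mono mult_left_mono C(2) L(2)) auto
    also have "ennreal e * ennreal C + ennreal (K / ln (1 + R)) * ennreal L = ennreal (e * C + K / ln (1 + R) * L)"
      using e C(1) K(1) lnR L(1) by (intro ennreal_lin[symmetric]) auto
    also have "I n + \<dots> \<le> I n + ennreal \<eta>"
    proof (intro add_mono order_refl ennreal_leI)
      show "e * C + K / ln (1 + R) * L \<le> \<eta>" using eC KL by linarith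
    qed
    finally show ?thesis .
  qed
  have "I \<longlonglongrightarrow> (\<integral>\<^sup>+x. ennreal (indicator (ball 0 R) x * min (h (v x)) B) \<partial>lborel)"
    unfolding I_def
  proof (rule nn_integral_dominated_convergence[where w = "\<lambda>x. ennreal B * indicator (ball 0 R) x"])
    show "AE x in lborel. ennreal (indicator (ball 0 R) x * min (h (w n x)) B) \<le> ennreal B * indicator (ball 0 R) x" for n
      using h0 B by (intro AE_I2) (auto simp: indicator_def intro!: ennreal_leI)
    show "(\<integral>\<^sup>+x. ennreal B * indicator (ball (0::'a) R) x \<partial>lborel) < \<infinity>"
      using emeasure_lborel_ball_finite[of "0::'a" R] by (simp add: nn_integral_cmult_indicator ennreal_mult_less_top)
    show "AE x in lborel. (\<lambda>n. ennreal (indicator (ball 0 R) x * min (h (w n x)) B)) \<longlonglongrightarrow> ennreal (indicator (ball 0 R) x * min (h (v x)) B)"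
      using lim
    proof eventually_elim
      case (elim x)
      have "isCont h (v x)" using hc by (simp add: continuous_on_eq_continuous_at)
      then have "(\<lambda>n. h (w n x)) \<longlonglongrightarrow> h (v x)" using elim by (rule isCont_tendsto_compose)
      then show ?case by (intro tendsto_ennrealI tendsto_intros)
    qed
  qed auto
  then have "(\<lambda>n. I n + ennreal \<eta>) \<longlonglongrightarrow> (\<integral>\<^sup>+x. ennreal (indicator (ball 0 R) x * min (h (v x)) B) \<partial>lborel) + ennreal \<eta>"
    by (intro tendsto_add tendsto_const)
  then have "limsup (\<lambda>n. I n + ennreal \<eta>) = (\<integral>\<^sup>+x. ennreal (indicator (ball 0 R) x * min (h (v x)) B) \<partial>lborel) + ennreal \<eta>"
    by (rule lim_imp_Limsup[rotated]) simp
  also have "\<dots> \<le> (\<integral>\<^sup>+x. ennreal (h (v x)) \<partial>lborel) + ennreal \<eta>"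
    using h0 by (intro add_mono nn_integral_mono ennreal_leI) (auto simp: indicator_def)
  finally have "limsup (\<lambda>n. I n + ennreal \<eta>) \<le> (\<integral>\<^sup>+x. ennreal (h (v x)) \<partial>lborel) + ennreal \<eta>" .
  moreover have "limsup (\<lambda>n. \<integral>\<^sup>+x. ennreal (h (w n x)) \<partial>lborel) \<le> limsup (\<lambda>n. I n + ennreal \<eta>)"
    by (intro Limsup_mono always_eventually allI le)
  ultimately show "limsup (\<lambda>n. \<integral>\<^sup>+x. ennreal (h (w n x)) \<partial>lborel) \<le> (\<integral>\<^sup>+x. ennreal (h (v x)) \<partial>lborel) + ennreal \<eta>"
    by (rule order_trans[rotated])
qed

section \<open>Upper semicontinuity of the singular logarithmic form\<close>

lemma kform_commute:
  fixes a b :: "'a::euclidean_space \<Rightarrow> real"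
  assumes [measurable]: "a \<in> borel_measurable borel" "b \<in> borel_measurable borel" "k \<in> borel_measurable borel"
  shows "kform k a b = kform k b a"
proof -
  have "kform k a b = (\<integral>\<^sup>+y. (\<integral>\<^sup>+x. ennreal (k (norm (x - y)) * a x * b y) \<partial>lborel) \<partial>lborel)"
    unfolding kform_def by (rule lborel_pair.Fubini'[symmetric]) measurable
  also have "\<dots> = kform k b a"
    unfolding kform_def by (intro nn_integral_cong) (simp add: norm_minus_commute mult_ac)
  finally show ?thesis .
qed

text \<open>The expansion of the quadratic form around \<open>c\<close>, arranged without
  subtraction so that it makes sense for values in \<open>ennreal\<close>. The error pairs the
  difference of the densities with \<open>a\<close>.\<close>

lemma kform_perturb_le:
  fixes a c :: "'a::euclidean_space \<Rightarrow> real"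
  assumes [measurable]: "a \<in> borel_measurable borel" "c \<in> borel_measurable borel" "k \<in> borel_measurable borel"
    and nn: "\<And>x. a x \<ge> 0" "\<And>x. c x \<ge> 0" "\<And>r. k r \<ge> 0"
  shows "kform k a a \<le> kform k c c + 2 * kform k (\<lambda>x. \<bar>a x - c x\<bar>) a"
proof -
  have "kform k a a \<le> (\<integral>\<^sup>+x. (\<integral>\<^sup>+y. ennreal (k (norm (x - y)) * c x * c y) + (ennreal (k (norm (x - y)) * \<bar>a x - c x\<bar> * a y) + ennreal (k (norm (x - y)) * a x * \<bar>a y - c y\<bar>)) \<partial>lborel) \<partial>lborel)"
    unfolding kform_def
  proof (intro nn_integral_mono)
    fix x y :: 'a
    have "a x * a y \<le> c x * c y + (\<bar>a x - c x\<bar> * a y + a x * \<bar>a y - c y\<bar>)"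
    proof (cases "a x \<le> c x")
      case True
      have "a x * a y \<le> a x * (c y + \<bar>a y - c y\<bar>)" using nn by (intro mult_left_mono) auto
      also have "\<dots> \<le> c x * c y + a x * \<bar>a y - c y\<bar>" using True nn by (simp add: distrib_left mult_right_mono)
      finally have "a x * a y \<le> c x * c y + a x * \<bar>a y - c y\<bar>" .
      moreover have "0 \<le> \<bar>a x - c x\<bar> * a y" using nn(1)[of y] by simp
      ultimately show ?thesis by linarith
    next
      case False
      have e: "a x * a y = c x * a y + \<bar>a x - c x\<bar> * a y" using False by (simp add: algebra_simps)
      have "c x * a y \<le> c x * (c y + \<bar>a y - c y\<bar>)" using nn by (intro mult_left_mono) auto
      also have "\<dots> \<le> c x * c y + a x * \<bar>a y - c y\<bar>" using False by (simp add: distrib_left mult_right_mono)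
      finally show ?thesis using e by linarith
    qed
    then have "k (norm (x - y)) * (a x * a y) \<le> k (norm (x - y)) * (c x * c y + (\<bar>a x - c x\<bar> * a y + a x * \<bar>a y - c y\<bar>))"
      using nn(3) by (rule mult_left_mono)
    then have "ennreal (k (norm (x - y)) * a x * a y) \<le> ennreal (k (norm (x - y)) * c x * c y + (k (norm (x - y)) * \<bar>a x - c x\<bar> * a y + k (norm (x - y)) * a x * \<bar>a y - c y\<bar>))"
      by (intro ennreal_leI) (simp add: distrib_left mult.assoc)
    then show "ennreal (k (norm (x - y)) * a x * a y) \<le> ennreal (k (norm (x - y)) * c x * c y) + (ennreal (k (norm (x - y)) * \<bar>a x - c x\<bar> * a y) + ennreal (k (norm (x - y)) * a x * \<bar>a y - c y\<bar>))"
      using nn by simp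
  qed
  also have "\<dots> = kform k c c + (kform k (\<lambda>x. \<bar>a x - c x\<bar>) a + kform k a (\<lambda>x. \<bar>a x - c x\<bar>))"
    by (simp add: nn_integral_add kform_def)
  also have "kform k a (\<lambda>x. \<bar>a x - c x\<bar>) = kform k (\<lambda>x. \<bar>a x - c x\<bar>) a"
    by (rule kform_commute) measurable
  finally show ?thesis by (simp add: mult_2)
qed

text \<open>Scheffe's lemma upgrades the upper bound on the p-norms to convergence of the densities
  in the mean. In the perturbation error this difference tends to 0 while the other factor stays
  bounded through the 2p-norm.\<close>

lemma limsup_kform_logm:
  fixes w :: "nat \<Rightarrow> 'a::euclidean_space \<Rightarrow> real"
  assumes p: "p > 1" and w: "\<And>n. inX p (w n)" and v: "inX p v"
    and lim: "AE x in lborel. (\<lambda>n. w n x) \<longlonglongrightarrow> v x"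
    and Lp: "limsup (\<lambda>n. Lp_p p (w n)) \<le> Lp_p p v"
    and C: "\<And>n. Lp_p (2 * p) (w n) \<le> ennreal C"
  shows "limsup (\<lambda>n. kform logm (\<lambda>x. \<bar>w n x\<bar> powr p) (\<lambda>x. \<bar>w n x\<bar> powr p)) \<le> kform logm (\<lambda>x. \<bar>v x\<bar> powr p) (\<lambda>x. \<bar>v x\<bar> powr p)"
proof -
  note [measurable] = inX_D(1)[OF w] inX_D(1)[OF v]
  define g where "g = (\<lambda>n x. \<bar>w n x\<bar> powr p)"
  define g0 where "g0 = (\<lambda>x. \<bar>v x\<bar> powr p)"
  have [measurable]: "g n \<in> borel_measurable borel" "g0 \<in> borel_measurable borel" for n unfolding g_def g0_def by measurable
  define Q where "Q = ennreal 1 * (\<integral>\<^sup>+z. ennreal ((logm (norm (z::'a)))\<^sup>2) \<partial>lborel) + ennreal (1 / 1) * ennreal C"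
  have Q: "Q < \<infinity>" using logm_square_integrable[where 'a='a] by (simp add: Q_def ennreal_mult_less_top)
  define d where "d = (\<lambda>n. \<integral>\<^sup>+x. ennreal (norm (g n x - g0 x)) \<partial>lborel)"
  have d: "d \<longlonglongrightarrow> 0" unfolding d_def
  proof (rule Scheffe_lemma1)
    show "integrable lborel (g n)" for n unfolding g_def by (rule Lp_integrable(1)[OF w])
    show "integrable lborel g0" unfolding g0_def by (rule Lp_integrable(1)[OF v])
    show "AE x in lborel. (\<lambda>n. g n x) \<longlonglongrightarrow> g0 x"
      using lim
    proof eventually_elim
      case (elim x)
      then show ?case unfolding g_def g0_def by (intro tendsto_powr2 tendsto_intros) (use p in auto)
    qed
    show "limsup (\<lambda>n. \<integral>\<^sup>+x. ennreal (norm (g n x)) \<partial>lborel) \<le> (\<integral>\<^sup>+x. ennreal (norm (g0 x)) \<partial>lborel)"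
      using Lp by (simp add: g_def g0_def Lp_p_def)
  qed
  have le: "kform logm (g n) (g n) \<le> kform logm g0 g0 + 2 * (d n * Q)" for n
  proof -
    have "kform logm (g n) (g n) \<le> kform logm g0 g0 + 2 * kform logm (\<lambda>x. \<bar>g n x - g0 x\<bar>) (g n)"
      by (rule kform_perturb_le) (auto simp: g_def g0_def)
    also have "kform logm (\<lambda>x. \<bar>g n x - g0 x\<bar>) (g n) \<le> d n * (ennreal 1 * (\<integral>\<^sup>+z. ennreal ((logm (norm (z::'a)))\<^sup>2) \<partial>lborel) + ennreal (1 / 1) * (\<integral>\<^sup>+y. ennreal ((g n y)\<^sup>2) \<partial>lborel))"
      unfolding d_def real_norm_def by (rule kform_logm_le) (auto simp: g_def)
    also have "\<dots> \<le> d n * Q" unfolding Q_def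
      using C[of n] by (intro mult_left_mono add_mono order_refl) (auto simp: g_def powr_square Lp_p_def)
    finally show ?thesis by (simp add: add_left_mono mult_left_mono)
  qed
  have "(\<lambda>n. kform logm g0 g0 + 2 * (d n * Q)) \<longlonglongrightarrow> kform logm g0 g0 + 2 * (0 * Q)"
    using Q by (intro tendsto_add tendsto_const ennreal_tendsto_cmult tendsto_mult_ennreal d) auto
  then have "limsup (\<lambda>n. kform logm g0 g0 + 2 * (d n * Q)) = kform logm g0 g0" by (intro lim_imp_Limsup) auto
  moreover have "limsup (\<lambda>n. kform logm (g n) (g n)) \<le> limsup (\<lambda>n. kform logm g0 g0 + 2 * (d n * Q))"
    by (intro Limsup_mono always_eventually allI le)
  ultimately show ?thesis by (simp add: g_def g0_def)
qed

lemma inX_energy_eq_wnorm: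
  assumes "inX p u"
  shows "Lp_p p u + gag p u = ennreal (wnorm p u)"
  using inX_D[OF assms] by (simp add: wnorm_def add.commute)

text \<open>Turns semicontinuity in \<open>ennreal\<close> into real inequalities with an additive
  error; these can be combined with the positive and negative coefficients of
  \<open>J\<close>.\<close>

lemma eventually_le_of_le_liminf:
  fixes X :: ennreal
  assumes "X \<le> liminf Y" "\<And>n. Y n < \<infinity>" "X < \<infinity>" "\<eta> > 0"
  shows "\<forall>\<^sub>F n in sequentially. enn2real X \<le> enn2real (Y n) + \<eta>"
proof (cases "enn2real X < \<eta>")
  case True
  then have "enn2real X \<le> enn2real (Y n) + \<eta>" for n using enn2real_nonneg[of "Y n"] by linarith
  then show ?thesis by simp
next
  case False
  have "ennreal (enn2real X - \<eta>) < X"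
  proof -
    have "ennreal (enn2real X - \<eta>) < ennreal (enn2real X)" using False assms(4) by (subst ennreal_less_iff) auto
    then show ?thesis using assms(3) by simp
  qed
  then have "ennreal (enn2real X - \<eta>) < liminf Y" using assms(1) by (rule less_le_trans)
  then have "\<forall>\<^sub>F n in sequentially. ennreal (enn2real X - \<eta>) < Y n" by (rule less_LiminfD)
  then show ?thesis
  proof eventually_elim
    case (elim n)
    then have "ennreal (enn2real X - \<eta>) < ennreal (enn2real (Y n))" using assms(2) by simp
    then show ?case using False by (subst (asm) ennreal_less_iff) auto
  qed
qed

lemma eventually_le_of_limsup_le:
  fixes X :: ennreal
  assumes "limsup Y \<le> X" "\<And>n. Y n < \<infinity>" "X < \<infinity>" "\<eta> > 0"
  shows "\<forall>\<^sub>F n in sequentially. enn2real (Y n) \<le> enn2real X + \<eta>"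
proof -
  have "X < ennreal (enn2real X + \<eta>)"
  proof -
    have "ennreal (enn2real X) < ennreal (enn2real X + \<eta>)" using assms(4) by (subst ennreal_less_iff) auto
    then show ?thesis using assms(3) by simp
  qed
  then have "limsup Y < ennreal (enn2real X + \<eta>)" using assms(1) by (rule le_less_trans[rotated])
  then have "\<forall>\<^sub>F n in sequentially. Y n < ennreal (enn2real X + \<eta>)" by (rule Limsup_lessD)
  then show ?thesis
  proof eventually_elim
    case (elim n)
    then have "ennreal (enn2real (Y n)) < ennreal (enn2real X + \<eta>)" using assms(2) by simp
    then show ?case by (subst (asm) ennreal_less_iff) auto
  qed
qed

abbreviation kpow :: "(real \<Rightarrow> real) \<Rightarrow> real \<Rightarrow> ('a::euclidean_space \<Rightarrow> real) \<Rightarrow> ennreal" where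
  "kpow k p u \<equiv> kform k (\<lambda>x. \<bar>u x\<bar> powr p) (\<lambda>x. \<bar>u x\<bar> powr p)"

lemma logm_square_obtain:
  obtains k2 where "k2 \<ge> 0" "(\<integral>\<^sup>+z. ennreal ((logm (norm (z::'a::euclidean_space)))\<^sup>2) \<partial>lborel) = ennreal k2"
proof
  show "enn2real (\<integral>\<^sup>+z. ennreal ((logm (norm (z::'a)))\<^sup>2) \<partial>lborel) \<ge> 0" by simp
  show "(\<integral>\<^sup>+z. ennreal ((logm (norm (z::'a)))\<^sup>2) \<partial>lborel) = ennreal (enn2real (\<integral>\<^sup>+z. ennreal ((logm (norm (z::'a)))\<^sup>2) \<partial>lborel))"
    using logm_square_integrable[where 'a='a] by simp
qed

lemma kpow_logm_bound:
  fixes w :: "'a::euclidean_space \<Rightarrow> real"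
  assumes p: "p > 1" and w: "inX p w" and M: "wnorm p w \<le> M"
    and k2: "k2 \<ge> 0" "(\<integral>\<^sup>+z. ennreal ((logm (norm (z::'a::euclidean_space)))\<^sup>2) \<partial>lborel) = ennreal k2"
    and l: "l > 0" and E: "E \<ge> 0" "Lp_p (2 * p) w \<le> ennreal E"
  shows "enn2real (kpow logm p w) \<le> M * (l * k2 + E / l)"
proof -
  have M0: "M \<ge> 0" using wnorm_nonneg[of p w] M by linarith
  have A: "Lp_p p w + gag p w \<le> ennreal M" using M unfolding inX_energy_eq_wnorm[OF w] by (rule ennreal_leI)
  have "kpow logm p w \<le> Lp_p p w * (ennreal l * ennreal k2 + ennreal (1 / l) * Lp_p (2 * p) w)"
    unfolding k2(2)[symmetric] by (rule kform_logm_powr_le[OF inX_D(1)[OF w] l])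
  also have "\<dots> \<le> ennreal M * (ennreal l * ennreal k2 + ennreal (1 / l) * ennreal E)"
    by (intro mult_mono add_mono mult_left_mono order_refl E(2) energy_bounds(1)[OF A]) auto
  also have "ennreal l * ennreal k2 + ennreal (1 / l) * ennreal E = ennreal (l * k2 + 1 / l * E)"
    using l k2(1) E(1) by (intro ennreal_lin[symmetric]) auto
  also have "ennreal M * \<dots> = ennreal (M * (l * k2 + E / l))"
    using M0 l k2(1) E(1) by (subst ennreal_mult[symmetric]) auto
  finally show ?thesis using M0 l k2(1) E(1) by (intro enn2real_leI) auto
qed

section \<open>Uniform bounds and exclusion of vanishing\<close>

context nonlinearity
begin

lemma F_integral_le:
  fixes w :: "'a::euclidean_space \<Rightarrow> real"
  assumes w: "inX p w" and "B \<ge> 0" "(\<integral>\<^sup>+x. ennreal (F (w x)) \<partial>lborel) \<le> ennreal B"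
  shows "(\<integral>x. F (w x) \<partial>lborel) \<le> B"
proof -
  note [measurable] = inX_D(1)[OF w]
  have "(\<integral>x. F (w x) \<partial>lborel) = enn2real (\<integral>\<^sup>+x. ennreal (F (w x)) \<partial>lborel)"
    by (rule integral_eq_nn_integral) (use Fnonneg in auto)
  also have "\<dots> \<le> B" using assms(2,3) by (rule enn2real_leI)
  finally show ?thesis .
qed

text \<open>The terms that enter \<open>J\<close> with a minus sign are bounded on bounded sets of
  \<open>W\<close>. An upper bound on \<open>J\<close> therefore becomes an upper bound on the form
  of \<open>logp\<close>.\<close>

lemma uniform_bounds:
  assumes M: "M \<ge> 0"
  shows "\<exists>B\<ge>0. \<forall>w::'a::euclidean_space \<Rightarrow> real. inX p w \<longrightarrow> wnorm p w \<le> M \<longrightarrow>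
    enn2real (kpow logm p w) \<le> B \<and> (\<integral>x. F (w x) \<partial>lborel) \<le> B \<and> Lp_p (2 * p) w \<le> ennreal B"
proof -
  obtain C2 where C2: "C2 \<ge> 0" "\<And>u::'a \<Rightarrow> real. u \<in> borel_measurable borel \<Longrightarrow> Lp_p p u + gag p u \<le> ennreal M \<Longrightarrow> Lp_p (2 * p) u \<le> ennreal C2"
    using Lp_2p_bounded[OF p1 M, where 'a='a] by blast
  obtain a C0 where a: "a > 0" "\<And>u::'a \<Rightarrow> real. u \<in> borel_measurable borel \<Longrightarrow> Lp_p p u + gag p u \<le> ennreal M \<Longrightarrow>
      (\<integral>\<^sup>+x. ennreal (expw p a (u x)) \<partial>lborel) \<le> ennreal C0"
    using Trudinger_Moser_expw[OF p1 M, where 'a='a] by blast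
  obtain K where K: "K \<ge> 0" "\<And>x. F x \<le> K * (\<bar>x\<bar> powr p + expw p a x)" using F_dom[OF a(1)] by blast
  obtain k2 where k2: "k2 \<ge> 0" "(\<integral>\<^sup>+z. ennreal ((logm (norm (z::'a)))\<^sup>2) \<partial>lborel) = ennreal k2" by (rule logm_square_obtain)
  define B where "B = M * (1 * k2 + C2 / 1) + K * (M + \<bar>C0\<bar>) + C2"
  have B: "M * (1 * k2 + C2 / 1) \<le> B" "K * (M + \<bar>C0\<bar>) \<le> B" "C2 \<le> B" "B \<ge> 0"
    using M K(1) k2(1) C2(1) by (auto simp: B_def)
  have "enn2real (kpow logm p w) \<le> B \<and> (\<integral>x. F (w x) \<partial>lborel) \<le> B \<and> Lp_p (2 * p) w \<le> ennreal B"
    if w: "inX p w" and wM: "wnorm p w \<le> M" for w :: "'a \<Rightarrow> real"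
  proof (intro conjI)
    note [measurable] = inX_D(1)[OF w]
    have A: "Lp_p p w + gag p w \<le> ennreal M" using wM unfolding inX_energy_eq_wnorm[OF w] by (rule ennreal_leI)
    have L2: "Lp_p (2 * p) w \<le> ennreal C2" by (rule C2(2)[OF _ A]) measurable
    then show "Lp_p (2 * p) w \<le> ennreal B" by (rule order_trans[OF _ ennreal_leI[OF B(3)]])
    have "enn2real (kpow logm p w) \<le> M * (1 * k2 + C2 / 1)"
      by (rule kpow_logm_bound[OF p1 w wM k2 _ C2(1) L2]) simp
    then show "enn2real (kpow logm p w) \<le> B" using B(1) by linarith
    have "(\<integral>\<^sup>+x. ennreal (F (w x)) \<partial>lborel) \<le> (\<integral>\<^sup>+x. ennreal K * (ennreal (\<bar>w x\<bar> powr p) + ennreal (expw p a (w x))) \<partial>lborel)"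
    proof (rule nn_integral_mono)
      fix x
      have "ennreal (F (w x)) \<le> ennreal (K * (\<bar>w x\<bar> powr p + expw p a (w x)))" by (intro ennreal_leI K(2))
      then show "ennreal (F (w x)) \<le> ennreal K * (ennreal (\<bar>w x\<bar> powr p) + ennreal (expw p a (w x)))"
        using K(1) by (simp add: ennreal_mult)
    qed
    also have "\<dots> = ennreal K * (Lp_p p w + (\<integral>\<^sup>+x. ennreal (expw p a (w x)) \<partial>lborel))"
      by (simp add: nn_integral_cmult nn_integral_add Lp_p_def)
    also have "\<dots> \<le> ennreal K * (ennreal M + ennreal \<bar>C0\<bar>)"
      using a(2)[OF inX_D(1)[OF w] A]
      by (intro mult_left_mono add_mono energy_bounds(1)[OF A]) (auto intro: order_trans ennreal_leI)
    also have "\<dots> = ennreal (K * (M + \<bar>C0\<bar>))" using K(1) M by (simp add: ennreal_mult)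
    finally have "(\<integral>x. F (w x) \<partial>lborel) \<le> K * (M + \<bar>C0\<bar>)"
      using K(1) M by (intro F_integral_le[OF w]) auto
    then show "(\<integral>x. F (w x) \<partial>lborel) \<le> B" using B(2) by linarith
  qed
  then show ?thesis using B(4) by blast
qed

text \<open>For small local mass the 2p-norm is small, which makes the singular form and the
  integral of the primitive at most 1 each. Together they lower the energy by at most 2.\<close>

lemma J_ge_of_vanishing:
  assumes M: "M \<ge> 0"
  shows "\<exists>\<delta>>0. \<forall>w::'a::euclidean_space \<Rightarrow> real. inX p w \<longrightarrow> wnorm p w \<le> M \<longrightarrow>
     (\<forall>x. (\<integral>\<^sup>+y\<in>cball x (DIM('a)). ennreal (\<bar>w y\<bar> powr p) \<partial>lborel) \<le> ennreal \<delta>) \<longrightarrow> wnorm p w / p - 2 \<le> J w"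
proof -
  obtain a C0 where a: "a > 0" "\<And>u::'a \<Rightarrow> real. u \<in> borel_measurable borel \<Longrightarrow> Lp_p p u + gag p u \<le> ennreal M \<Longrightarrow>
      (\<integral>\<^sup>+x. ennreal (expw p a (u x)) \<partial>lborel) \<le> ennreal C0"
    using Trudinger_Moser_expw[OF p1 M, where 'a='a] by blast
  define e where "e = 1 / (2 * (M + \<bar>C0\<bar> + 1))"
  have e: "e > 0" using M by (simp add: e_def add_nonneg_pos)
  have eM: "e * (M + \<bar>C0\<bar>) \<le> 1 / 2" using M by (simp add: e_def divide_simps)
  obtain K where K: "K \<ge> 0" "\<And>x. F x \<le> e * \<bar>x\<bar> powr p + e * expw p a x + K * \<bar>x\<bar> powr (2 * p)" using F_eps[OF a(1) e] by blast
  obtain k2 where k2: "k2 \<ge> 0" "(\<integral>\<^sup>+z. ennreal ((logm (norm (z::'a)))\<^sup>2) \<partial>lborel) = ennreal k2" by (rule logm_square_obtain)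
  define l where "l = 1 / (2 * (M + 1) * (k2 + 1))"
  have l: "l > 0" using M k2(1) by (simp add: l_def)
  \<comment> \<open>With \<open>l\<close> already giving \<open>M * l * k2 <= 1 / 2\<close>, the
    first entry makes \<open>M * E / l <= 1 / 2\<close> for the singular form, and the second makes
    \<open>K * E <= 1 / 2\<close> for the primitive.\<close>
  define E where "E = min (l / (2 * (M + 1))) (1 / (2 * (K + 1)))"
  have E: "E > 0" using l M K(1) by (simp add: E_def)
  have KE: "K * E \<le> 1 / 2"
  proof -
    have "K * E \<le> (K + 1) * (1 / (2 * (K + 1)))" using K(1) E by (intro mult_mono) (auto simp: E_def)
    also have "\<dots> = 1 / 2" using K(1) by simp
    finally show ?thesis .
  qed
  have ME: "M * (l * k2 + E / l) \<le> 1"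
  proof -
    have "M * (l * k2) = (M / (M + 1)) * (k2 / (k2 + 1)) * (1 / 2)" using M k2(1) by (simp add: l_def)
    also have "\<dots> \<le> 1 * 1 * (1 / 2)" using M k2(1) by (intro mult_mono) auto
    finally have 1: "M * (l * k2) \<le> 1 / 2" by simp
    have "E / l \<le> (l / (2 * (M + 1))) / l" using l by (intro divide_right_mono) (auto simp: E_def)
    also have "\<dots> = 1 / (2 * (M + 1))" using l by simp
    finally have "M * (E / l) \<le> M * (1 / (2 * (M + 1)))" using M by (rule mult_left_mono)
    also have "\<dots> \<le> 1 / 2" using M by (simp add: divide_simps)
    finally have 2: "M * (E / l) \<le> 1 / 2" .
    show ?thesis unfolding distrib_left using 1 2 by linarith
  qed
  obtain \<delta> where d: "\<delta> > 0" "\<And>u::'a \<Rightarrow> real. u \<in> borel_measurable borel \<Longrightarrow> Lp_p p u + gag p u \<le> ennreal M \<Longrightarrow>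
     (\<forall>x. (\<integral>\<^sup>+y\<in>cball x (DIM('a)). ennreal (\<bar>u y\<bar> powr p) \<partial>lborel) \<le> ennreal \<delta>) \<Longrightarrow> Lp_p (2 * p) u \<le> ennreal E"
    using Lions_vanishing[OF p1 M E, where 'a='a] by blast
  have "wnorm p w / p - 2 \<le> J w"
    if w: "inX p w" and wM: "wnorm p w \<le> M"
      and van: "\<forall>x. (\<integral>\<^sup>+y\<in>cball x (DIM('a)). ennreal (\<bar>w y\<bar> powr p) \<partial>lborel) \<le> ennreal \<delta>" for w :: "'a \<Rightarrow> real"
  proof -
    note [measurable] = inX_D(1)[OF w]
    have A: "Lp_p p w + gag p w \<le> ennreal M" using wM unfolding inX_energy_eq_wnorm[OF w] by (rule ennreal_leI)
    have L2: "Lp_p (2 * p) w \<le> ennreal E" by (rule d(2)[OF inX_D(1)[OF w] A van])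
    have V2: "enn2real (kpow logm p w) \<le> 1"
      using kpow_logm_bound[OF p1 w wM k2 l less_imp_le[OF E] L2] ME by linarith
    have "(\<integral>\<^sup>+x. ennreal (F (w x)) \<partial>lborel) \<le> (\<integral>\<^sup>+x. ennreal e * (ennreal (\<bar>w x\<bar> powr p) + ennreal (expw p a (w x))) + ennreal K * ennreal (\<bar>w x\<bar> powr (2 * p)) \<partial>lborel)"
    proof (rule nn_integral_mono)
      fix x
      have "ennreal (F (w x)) \<le> ennreal (e * (\<bar>w x\<bar> powr p + expw p a (w x)) + K * \<bar>w x\<bar> powr (2 * p))"
        using K(2)[of "w x"] by (intro ennreal_leI) (simp add: distrib_left)
      also have "\<dots> = ennreal e * ennreal (\<bar>w x\<bar> powr p + expw p a (w x)) + ennreal K * ennreal (\<bar>w x\<bar> powr (2 * p))"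
        using e K(1) by (intro ennreal_lin) auto
      finally show "ennreal (F (w x)) \<le> ennreal e * (ennreal (\<bar>w x\<bar> powr p) + ennreal (expw p a (w x))) + ennreal K * ennreal (\<bar>w x\<bar> powr (2 * p))"
        by simp
    qed
    also have "\<dots> = ennreal e * (Lp_p p w + (\<integral>\<^sup>+x. ennreal (expw p a (w x)) \<partial>lborel)) + ennreal K * Lp_p (2 * p) w"
      by (simp add: nn_integral_cmult nn_integral_add Lp_p_def)
    also have "\<dots> \<le> ennreal e * (ennreal M + ennreal \<bar>C0\<bar>) + ennreal K * ennreal E"
      using a(2)[OF inX_D(1)[OF w] A]
      by (intro add_mono mult_left_mono L2 energy_bounds(1)[OF A]) (auto intro: order_trans ennreal_leI)
    also have "ennreal M + ennreal \<bar>C0\<bar> = ennreal (M + \<bar>C0\<bar>)" using M by simp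
    also have "ennreal e * ennreal (M + \<bar>C0\<bar>) + ennreal K * ennreal E = ennreal (e * (M + \<bar>C0\<bar>) + K * E)"
      using e K(1) M E by (intro ennreal_lin[symmetric]) auto
    finally have "(\<integral>x. F (w x) \<partial>lborel) \<le> e * (M + \<bar>C0\<bar>) + K * E"
      using K(1) M e E by (intro F_integral_le[OF w]) auto
    then have F1: "(\<integral>x. F (w x) \<partial>lborel) \<le> 1" using KE eM by linarith
    have "- 1 \<le> logV p w" using V2 unfolding logV_def by (smt (verit) enn2real_nonneg)
    then have "1 / (2 * p) * (- 1) \<le> 1 / (2 * p) * logV p w" using p1 by (intro mult_left_mono) auto
    moreover have "1 / (2 * p) \<le> 1" using p1 by simp
    ultimately show ?thesis unfolding J_def using F1 by simp
  qed
  then show ?thesis using d(1) by blast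
qed

lemma J_shift:
  fixes u :: "'a::euclidean_space \<Rightarrow> real"
  assumes u: "inX p u"
  shows "J (\<lambda>x. u (x + a)) = J u"
proof -
  note [measurable] = inX_D(1)[OF u]
  have "(\<integral>x. F (u (x + a)) \<partial>lborel) = enn2real (\<integral>\<^sup>+x. ennreal (F (u (x + a))) \<partial>lborel)"
    by (rule integral_eq_nn_integral) (use Fnonneg in auto)
  also have "(\<integral>\<^sup>+x. ennreal (F (u (x + a))) \<partial>lborel) = (\<integral>\<^sup>+x. ennreal (F (u x)) \<partial>lborel)"
    by (rule nn_integral_shift) measurable
  also have "enn2real \<dots> = (\<integral>x. F (u x) \<partial>lborel)"
    by (rule integral_eq_nn_integral[symmetric]) (use Fnonneg in auto)
  finally have "(\<integral>x. F (u (x + a)) \<partial>lborel) = (\<integral>x. F (u x) \<partial>lborel)" .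
  moreover have "kpow k p (\<lambda>x. u (x + a)) = kpow k p u" if "k \<in> borel_measurable borel" for k
    using that kform_shift[of "\<lambda>x. \<bar>u x\<bar> powr p" "\<lambda>x. \<bar>u x\<bar> powr p" k a] by simp
  ultimately show ?thesis by (simp add: J_def wnorm_def logV_def gag_shift Lp_p_shift)
qed

end

section \<open>A ground state\<close>

context nonlinearity
begin

text \<open>The normalization of the minimizing sequence is chosen so large that vanishing, which would
  push \<open>J\<close> above \<open>wnorm / p - 2\<close>, is incompatible with the level \<open>c + 1\<close>.\<close>

lemma normalized_translate:
  fixes u :: "'a::euclidean_space \<Rightarrow> real"
  assumes u: "inX p u" and L: "Lp_p p u \<noteq> 0" and M: "M > 0" "M / p - 2 > c" and le: "\<And>t. t \<ge> 0 \<Longrightarrow> J (\<lambda>x. t * u x) \<le> c"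
    and van: "\<And>w::'a \<Rightarrow> real. inX p w \<Longrightarrow> wnorm p w \<le> M \<Longrightarrow>
       (\<forall>x. (\<integral>\<^sup>+y\<in>cball x (DIM('a)). ennreal (\<bar>w y\<bar> powr p) \<partial>lborel) \<le> ennreal \<delta>) \<Longrightarrow> wnorm p w / p - 2 \<le> J w"
  shows "\<exists>w::'a \<Rightarrow> real. inX p w \<and> wnorm p w = M \<and> (\<forall>t\<ge>0. J (\<lambda>x. t * w x) \<le> c) \<and>
    ennreal \<delta> \<le> (\<integral>\<^sup>+y\<in>cball 0 (DIM('a)). ennreal (\<bar>w y\<bar> powr p) \<partial>lborel)"
proof -
  have "enn2real (Lp_p p u) > 0" using L inX_D(2)[OF u] by (simp add: enn2real_positive_iff zero_less_iff_neq_zero)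
  then have A: "wnorm p u > 0" by (simp add: wnorm_def add_nonneg_pos)
  \<comment> \<open>A p-th root because \<open>wnorm\<close> is homogeneous of degree
    \<open>p\<close>. Rescaling stays on the same ray, so the bound \<open>c\<close> on the ray is
    kept.\<close>
  define s where "s = (M / wnorm p u) powr (1 / p)"
  have s: "s > 0" using A M by (simp add: s_def)
  define w where "w = (\<lambda>x. s * u x)"
  have w: "inX p w" unfolding w_def by (rule inX_scale[OF p1 u])
  have wn: "wnorm p w = M"
    unfolding w_def wnorm_scale[OF inX_D(1)[OF u]] using A M p1 by (simp add: s_def powr_powr)
  have wle: "J (\<lambda>x. t * w x) \<le> c" if "t \<ge> 0" for t
    using le[of "t * s"] that s by (simp add: w_def mult.assoc)
  have "\<not> (\<forall>x. (\<integral>\<^sup>+y\<in>cball x (DIM('a)). ennreal (\<bar>w y\<bar> powr p) \<partial>lborel) \<le> ennreal \<delta>)"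
  proof
    assume "\<forall>x. (\<integral>\<^sup>+y\<in>cball x (DIM('a)). ennreal (\<bar>w y\<bar> powr p) \<partial>lborel) \<le> ennreal \<delta>"
    from van[OF w _ this] have "M / p - 2 \<le> J w" by (simp add: wn)
    then show False using wle[of 1] M(2) by simp
  qed
  then obtain a where a: "ennreal \<delta> \<le> (\<integral>\<^sup>+y\<in>cball a (DIM('a)). ennreal (\<bar>w y\<bar> powr p) \<partial>lborel)"
    by (meson linear)
  define z where "z = (\<lambda>x. w (x + a))"
  note [measurable] = inX_D(1)[OF w]
  have "(\<integral>\<^sup>+y\<in>cball 0 (DIM('a)). ennreal (\<bar>z y\<bar> powr p) \<partial>lborel) = (\<integral>\<^sup>+y. (\<lambda>y. ennreal (\<bar>w y\<bar> powr p) * indicator (cball a (DIM('a))) y) (y + a) \<partial>lborel)"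
    unfolding z_def by (intro nn_integral_cong) (auto simp: indicator_def dist_norm)
  also have "\<dots> = (\<integral>\<^sup>+y\<in>cball a (DIM('a)). ennreal (\<bar>w y\<bar> powr p) \<partial>lborel)"
    by (rule nn_integral_shift) measurable
  finally have mass: "ennreal \<delta> \<le> (\<integral>\<^sup>+y\<in>cball 0 (DIM('a)). ennreal (\<bar>z y\<bar> powr p) \<partial>lborel)" using a by simp
  have "J (\<lambda>x. t * z x) = J (\<lambda>x. t * w x)" for t
    unfolding z_def using J_shift[OF inX_scale[OF p1 w, of t], of a] by simp
  moreover have "wnorm p z = M"
    unfolding z_def using wn by (simp add: wnorm_def gag_shift Lp_p_shift)
  ultimately show ?thesis using mass wle inX_shift[OF w, of a] by (intro exI[of _ z]) (auto simp: z_def)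
qed

text \<open>The chain of estimates is: energy bound, bound on \<open>logV\<close>, bound on the form
  of \<open>logp\<close>, and by \<open>logmoment_le_kform_logp\<close> a bound on the moment times
  the mass in the ball. That mass is at least \<open>\<delta>\<close>, so it can be divided
  out.\<close>

lemma logmoment_bound:
  fixes w :: "'a::euclidean_space \<Rightarrow> real"
  assumes w: "inX p w" and M: "wnorm p w \<le> M" and B: "enn2real (kpow logm p w) \<le> B" "(\<integral>x. F (w x) \<partial>lborel) \<le> B"
    and J: "J w \<le> c" "c \<ge> 0" and d: "\<delta> > 0" and mass: "ennreal \<delta> \<le> (\<integral>\<^sup>+y\<in>cball 0 R. ennreal (\<bar>w y\<bar> powr p) \<partial>lborel)" and R: "R \<ge> 0"
  shows "logmoment p w \<le> ennreal ((2 * p * (c + B) + B + ln (2 + R) * (M * M)) / \<delta>)"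
proof -
  note [measurable] = inX_D(1)[OF w]
  have M0: "M \<ge> 0" using wnorm_nonneg[of p w] M by linarith
  have B0: "B \<ge> 0" using B(1) enn2real_nonneg[of "kpow logm p w"] by linarith
  have A: "Lp_p p w + gag p w \<le> ennreal M" using M unfolding inX_energy_eq_wnorm[OF w] by (rule ennreal_leI)
  define V where "V = 2 * p * (c + B) + B"
  have V0: "V \<ge> 0" using J(2) B0 p1 by (simp add: V_def)
  have "0 \<le> 1 / p * wnorm p w" using wnorm_nonneg[of p w] p1 by simp
  then have "1 / (2 * p) * logV p w \<le> c + B" using J(1) B(2) unfolding J_def by linarith
  then have "2 * p * (1 / (2 * p) * logV p w) \<le> 2 * p * (c + B)" using p1 by (intro mult_left_mono) auto
  then have "logV p w \<le> 2 * p * (c + B)" using p1 by simp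
  then have "enn2real (kpow logp p w) \<le> V" using B(1) by (simp add: logV_def V_def)
  then have V: "kpow logp p w \<le> ennreal V" using kform_finite(1)[OF p1 w] by (metis ennreal_enn2real ennreal_leI infinity_ennreal_def)
  have "logmoment p w * ennreal \<delta> \<le> logmoment p w * (\<integral>\<^sup>+y\<in>cball 0 R. ennreal (\<bar>w y\<bar> powr p) \<partial>lborel)"
    by (intro mult_left_mono mass) auto
  also have "\<dots> \<le> kpow logp p w + ennreal (ln (2 + R)) * (Lp_p p w * Lp_p p w)"
    unfolding logmoment_def Lp_p_def by (rule logmoment_le_kform_logp) (use R in auto)
  also have "\<dots> \<le> ennreal V + ennreal (ln (2 + R)) * (ennreal M * ennreal M)"
    by (intro add_mono V mult_left_mono mult_mono energy_bounds(1)[OF A]) auto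
  also have "\<dots> = ennreal (V + ln (2 + R) * (M * M))"
    using V0 M0 R by (simp add: ennreal_mult)
  finally have le: "logmoment p w * ennreal \<delta> \<le> ennreal (V + ln (2 + R) * (M * M))" .
  have nn: "0 \<le> V + ln (2 + R) * (M * M)" using V0 M0 R by simp
  have "logmoment p w = ennreal (1 / \<delta>) * (logmoment p w * ennreal \<delta>)"
  proof -
    have "ennreal (1 / \<delta>) * ennreal \<delta> = 1" using d by (simp add: ennreal_mult[symmetric])
    then show ?thesis by (metis mult.assoc mult.commute mult_1)
  qed
  also have "\<dots> \<le> ennreal (1 / \<delta>) * ennreal (V + ln (2 + R) * (M * M))" by (intro mult_left_mono le) auto
  also have "\<dots> = ennreal ((V + ln (2 + R) * (M * M)) / \<delta>)" using d nn by (simp add: ennreal_mult[symmetric])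
  finally show ?thesis by (simp add: V_def)
qed

text \<open>Fatou for everything that enters \<open>J\<close> with a plus sign, and for the
  logarithmic moment, which is what keeps the limit inside \<open>X\<close>.\<close>

lemma limit_in_X:
  fixes z :: "nat \<Rightarrow> 'a::euclidean_space \<Rightarrow> real"
  assumes z: "\<And>n. inX p (z n)" "\<And>n. wnorm p (z n) \<le> M" and Lm: "\<And>n. logmoment p (z n) \<le> ennreal L"
    and [measurable]: "v \<in> borel_measurable borel" and lim: "AE x in lborel. (\<lambda>n. z n x) \<longlonglongrightarrow> v x"
  shows "Lp_p p v \<le> liminf (\<lambda>n. Lp_p p (z n))" "gag p v \<le> liminf (\<lambda>n. gag p (z n))"
    "kpow logp p v \<le> liminf (\<lambda>n. kpow logp p (z n))" "inX p v"
proof -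
  note [measurable] = inX_D(1)[OF z(1)]
  have A: "Lp_p p (z n) + gag p (z n) \<le> ennreal M" for n using z(2) unfolding inX_energy_eq_wnorm[OF z(1)] by (rule ennreal_leI)
  have pw: "(\<lambda>n. \<bar>a n\<bar> powr p) \<longlonglongrightarrow> \<bar>b\<bar> powr p" if "a \<longlonglongrightarrow> b" for a b
    using that by (intro tendsto_powr2 tendsto_rabs tendsto_const) (use p1 in auto)
  show 1: "Lp_p p v \<le> liminf (\<lambda>n. Lp_p p (z n))" unfolding Lp_p_def
  proof (rule Fatou_AE)
    show "AE x in lborel. (\<lambda>n. ennreal (\<bar>z n x\<bar> powr p)) \<longlonglongrightarrow> ennreal (\<bar>v x\<bar> powr p)"
      using lim by eventually_elim (intro tendsto_ennrealI pw)
  qed measurable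
  have 3: "logmoment p v \<le> liminf (\<lambda>n. logmoment p (z n))" unfolding logmoment_def
  proof (rule Fatou_AE)
    show "AE x in lborel. (\<lambda>n. ennreal (ln (1 + norm x) * \<bar>z n x\<bar> powr p)) \<longlonglongrightarrow> ennreal (ln (1 + norm x) * \<bar>v x\<bar> powr p)"
      using lim by eventually_elim (intro tendsto_ennrealI tendsto_mult tendsto_const pw)
  qed measurable
  show 2: "gag p v \<le> liminf (\<lambda>n. gag p (z n))" unfolding gag_def
  proof (rule Fatou_double)
    show "(\<lambda>(x, y). ennreal (\<bar>z n x - z n y\<bar> powr p / norm (x - y) ^ (2 * DIM('a)))) \<in> borel_measurable (borel \<Otimes>\<^sub>M borel)" for n
      by measurable
    show "AE x in lborel. AE y in lborel. (\<lambda>n. ennreal (\<bar>z n x - z n y\<bar> powr p / norm (x - y) ^ (2 * DIM('a)))) \<longlonglongrightarrow> ennreal (\<bar>v x - v y\<bar> powr p / norm (x - y) ^ (2 * DIM('a)))"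
      using lim
    proof eventually_elim
      case (elim x)
      show ?case using lim
      proof eventually_elim
        case (elim y)
        show ?case unfolding divide_inverse
          by (intro tendsto_ennrealI tendsto_mult tendsto_const pw tendsto_diff \<open>(\<lambda>n. z n x) \<longlonglongrightarrow> v x\<close> elim)
      qed
    qed
  qed
  show "kpow logp p v \<le> liminf (\<lambda>n. kpow logp p (z n))" unfolding kform_def
  proof (rule Fatou_double)
    show "(\<lambda>(x, y). ennreal (logp (norm (x - y)) * \<bar>z n x\<bar> powr p * \<bar>z n y\<bar> powr p)) \<in> borel_measurable (borel \<Otimes>\<^sub>M borel)" for n
      by measurable
    show "AE x in lborel. AE y in lborel. (\<lambda>n. ennreal (logp (norm (x - y)) * \<bar>z n x\<bar> powr p * \<bar>z n y\<bar> powr p)) \<longlonglongrightarrow> ennreal (logp (norm (x - y)) * \<bar>v x\<bar> powr p * \<bar>v y\<bar> powr p)"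
      using lim
    proof eventually_elim
      case (elim x)
      show ?case using lim
      proof eventually_elim
        case (elim y)
        show ?case
          by (intro tendsto_ennrealI tendsto_mult tendsto_const pw \<open>(\<lambda>n. z n x) \<longlonglongrightarrow> v x\<close> elim)
      qed
    qed
  qed
  have lf: "liminf Y \<le> ennreal K" if "\<And>n. Y n \<le> ennreal K" for Y :: "nat \<Rightarrow> ennreal" and K
    using Liminf_mono[of Y "\<lambda>_. ennreal K" sequentially] that by (simp add: Liminf_const)
  have fin: "X < \<infinity>" if "X \<le> liminf Y" "\<And>n. Y n \<le> ennreal K" for X :: ennreal and Y :: "nat \<Rightarrow> ennreal" and K
    using order_trans[OF that(1) lf[OF that(2)]] by (auto simp: order.strict_trans1)
  show "inX p v" unfolding inX_def
    using fin[OF 1 energy_bounds(1)[OF A]] fin[OF 2 energy_bounds(2)[OF A]] fin[OF 3 Lm] by simp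
qed

text \<open>The semicontinuity estimates are applied to \<open>t * v\<close> for every fixed
  \<open>t\<close>, so the whole ray of the limit stays below the minimal level, whichever point of
  the ray is the maximizer.\<close>

lemma ground_state:
  assumes pN: "p > real DIM('a::euclidean_space)"
  shows "\<exists>w::'a \<Rightarrow> real. inX p w \<and> Lp_p p w \<noteq> 0 \<and> (\<forall>s\<ge>0. J (\<lambda>x. s * w x) \<le> J w) \<and>
    (\<forall>v::'a \<Rightarrow> real. inX p v \<longrightarrow> Lp_p p v \<noteq> 0 \<longrightarrow> (\<exists>t>0. J w \<le> J (\<lambda>x. t * v x)))"
proof -
  \<comment> \<open>All upper bounds of \<open>J\<close> on rays of nonzero functions; the infimum
    is the smallest maximum along a ray.\<close>
  define C where "C = {c. \<exists>u::'a \<Rightarrow> real. inX p u \<and> Lp_p p u \<noteq> 0 \<and> (\<forall>t\<ge>0. J (\<lambda>x. t * u x) \<le> c)}"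
  define c0 where "c0 = Inf C"
  have Cpos: "0 \<le> c" if cC: "c \<in> C" for c
  proof -
    obtain u :: "'a \<Rightarrow> real" where u: "inX p u" "\<forall>t\<ge>0. J (\<lambda>x. t * u x) \<le> c" using cC by (auto simp: C_def)
    have "J (\<lambda>x. 0 * u x) = 0" unfolding J_scale[OF u(1)] by (simp add: F_0)
    then show ?thesis using u(2) by (metis order_refl)
  qed
  then have bdd: "bdd_below C" by (auto simp: bdd_below_def)
  obtain u0 :: "'a \<Rightarrow> real" where u0: "inX p u0" "Lp_p p u0 \<noteq> 0" using exists_nonzero_inX[OF pN p1] by blast
  obtain t0 where "\<forall>s\<ge>0. J (\<lambda>x. s * u0 x) \<le> J (\<lambda>x. t0 * u0 x)" using J_scale_attains_max[OF u0] by blast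
  then have "J (\<lambda>x. t0 * u0 x) \<in> C" using u0 by (auto simp: C_def)
  then have Cne: "C \<noteq> {}" by auto
  have c0: "c0 \<ge> 0" unfolding c0_def by (rule cInf_greatest[OF Cne Cpos])
  \<comment> \<open>Then \<open>M / p - 2 = c0 + 2\<close>, which exceeds the level
    \<open>c0 + 1\<close> that bounds the energy along the minimizing sequence.\<close>
  define M where "M = p * (c0 + 4)"
  have M: "M > 0" "M / p - 2 > c0 + 1" "M \<ge> 0" using c0 p1 by (auto simp: M_def)
  obtain \<delta> where \<delta>: "\<delta> > 0" and van: "\<And>w::'a \<Rightarrow> real. inX p w \<Longrightarrow> wnorm p w \<le> M \<Longrightarrow>
     (\<forall>x. (\<integral>\<^sup>+y\<in>cball x (DIM('a)). ennreal (\<bar>w y\<bar> powr p) \<partial>lborel) \<le> ennreal \<delta>) \<Longrightarrow> wnorm p w / p - 2 \<le> J w"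
    using J_ge_of_vanishing[OF M(3), where 'a='a] by blast
  define P where "P = (\<lambda>n (w::'a \<Rightarrow> real). inX p w \<and> wnorm p w = M \<and> (\<forall>t\<ge>0. J (\<lambda>x. t * w x) \<le> c0 + 1 / real (Suc n)) \<and>
    ennreal \<delta> \<le> (\<integral>\<^sup>+y\<in>cball 0 (DIM('a)). ennreal (\<bar>w y\<bar> powr p) \<partial>lborel))"
  have "\<exists>w. P n w" for n
  proof -
    have "Inf C < c0 + 1 / real (Suc n)" by (simp add: c0_def)
    then obtain c where c: "c \<in> C" "c < c0 + 1 / real (Suc n)" using cInf_lessD[OF Cne] by blast
    then obtain u :: "'a \<Rightarrow> real" where u: "inX p u" "Lp_p p u \<noteq> 0" "\<forall>t\<ge>0. J (\<lambda>x. t * u x) \<le> c" by (auto simp: C_def)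
    have "1 / real (Suc n) \<le> 1" by simp
    then have "M / p - 2 > c0 + 1 / real (Suc n)" using M(2) by linarith
    from normalized_translate[OF u(1,2) M(1) this _ van] u(3) c(2) show ?thesis unfolding P_def by force
  qed
  then have "\<exists>w. \<forall>n. P n (w n)" by (intro choice allI)
  then obtain w where Pw: "\<And>n. P n (w n)" by blast
  have w: "inX p (w n)" "wnorm p (w n) = M" "t \<ge> 0 \<Longrightarrow> J (\<lambda>x. t * w n x) \<le> c0 + 1 / real (Suc n)"
    "ennreal \<delta> \<le> (\<integral>\<^sup>+y\<in>cball 0 (DIM('a)). ennreal (\<bar>w n y\<bar> powr p) \<partial>lborel)" for n t
    using Pw[of n] by (auto simp: P_def)
  obtain B where B: "B \<ge> 0" "\<And>w::'a \<Rightarrow> real. inX p w \<Longrightarrow> wnorm p w \<le> M \<Longrightarrow>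
    enn2real (kpow logm p w) \<le> B \<and> (\<integral>x. F (w x) \<partial>lborel) \<le> B \<and> Lp_p (2 * p) w \<le> ennreal B"
    using uniform_bounds[OF M(3), where 'a='a] by blast
  define L where "L = (2 * p * (c0 + 1 + B) + B + ln (2 + real DIM('a)) * (M * M)) / \<delta>"
  have Lm: "logmoment p (w n) \<le> ennreal L" for n
    unfolding L_def
  proof (rule logmoment_bound[OF w(1)])
    have "1 / real (Suc n) \<le> 1" by simp
    moreover have "J (w n) \<le> c0 + 1 / real (Suc n)" using w(3)[of 1 n] by simp
    ultimately show "J (w n) \<le> c0 + 1" by linarith
  qed (use w(2) B(2)[OF w(1), of n] \<delta> w(4) c0 in auto)
  have L0: "L \<ge> 0" using \<delta> B(1) c0 p1 by (auto simp: L_def intro!: divide_nonneg_pos add_nonneg_nonneg)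
  have "Lp_p p (w n) + gag p (w n) \<le> ennreal M" for n by (simp add: inX_energy_eq_wnorm[OF w(1)] w(2))
  from Rellich_AE[where u = w, OF p1 M(3) inX_D(1)[OF w(1)] this]
  obtain k v where k: "\<And>j::nat. j \<le> k j" and v[measurable]: "v \<in> borel_measurable borel"
    and lim: "AE x in lborel. (\<lambda>j. w (k j) x) \<longlonglongrightarrow> v x" by blast
  define z where "z = (\<lambda>j. w (k j))"
  have z: "inX p (z j)" "wnorm p (z j) = M" "logmoment p (z j) \<le> ennreal L" for j using w Lm by (auto simp: z_def)
  have zJ: "J (\<lambda>x. t * z j x) \<le> c0 + 1 / real (Suc j)" if "t \<ge> 0" for t j
  proof -
    have "1 / real (Suc (k j)) \<le> 1 / real (Suc j)" using k[of j] by (intro divide_left_mono) auto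
    moreover have "J (\<lambda>x. t * z j x) \<le> c0 + 1 / real (Suc (k j))" using w(3)[OF that, of "k j"] by (simp only: z_def)
    ultimately show ?thesis by linarith
  qed
  have limz: "AE x in lborel. (\<lambda>j. z j x) \<longlonglongrightarrow> v x" using lim by (simp add: z_def)
  have zM: "wnorm p (z j) \<le> M" for j using z(2) by simp
  note lims = limit_in_X[OF z(1) zM z(3) v limz]
  have zA: "Lp_p p (z n) + gag p (z n) \<le> ennreal M" for n by (simp add: inX_energy_eq_wnorm[OF z(1)] z(2))
  have limLp: "limsup (\<lambda>n. Lp_p p (z n)) \<le> Lp_p p v"
  proof -
    obtain a C1 where a: "a > 0" "\<And>u::'a \<Rightarrow> real. u \<in> borel_measurable borel \<Longrightarrow> Lp_p p u + gag p u \<le> ennreal M \<Longrightarrow>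
        (\<integral>\<^sup>+x. ennreal (expw p a (u x)) \<partial>lborel) \<le> ennreal C1"
      using Trudinger_Moser_expw[OF p1 M(3), where 'a='a] by blast
    show ?thesis unfolding Lp_p_def
    proof (rule limsup_nn_integral_tight[OF p1 a(1), where h = "\<lambda>t. \<bar>t\<bar> powr p" and C = "\<bar>C1\<bar>" and L = L])
      show "continuous_on UNIV (\<lambda>t::real. \<bar>t\<bar> powr p)" by (intro continuous_on_powr' continuous_intros) (use p1 in auto)
      show "\<exists>K\<ge>0. \<forall>t. \<bar>t\<bar> powr p \<le> e * expw p a t + K * \<bar>t\<bar> powr p" if "e > 0" for e
        using that by (intro exI[of _ 1]) auto
      show "(\<integral>\<^sup>+x. ennreal (expw p a (z n x)) \<partial>lborel) \<le> ennreal \<bar>C1\<bar>" for n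
        using a(2)[OF inX_D(1)[OF z(1)] zA] by (rule order_trans) (simp add: ennreal_leI)
    qed (use inX_D(1)[OF z(1)] v limz L0 z(3) in auto)
  qed
  have "ennreal \<delta> \<le> Lp_p p (z n)" for n
  proof -
    have "ennreal \<delta> \<le> (\<integral>\<^sup>+y\<in>cball 0 (DIM('a)). ennreal (\<bar>z n y\<bar> powr p) \<partial>lborel)" using w(4) by (simp add: z_def)
    also have "\<dots> \<le> Lp_p p (z n)" unfolding Lp_p_def by (intro nn_integral_mono) (auto simp: indicator_def)
    finally show ?thesis .
  qed
  then have "ennreal \<delta> \<le> limsup (\<lambda>n. Lp_p p (z n))"
    using Limsup_mono[of "\<lambda>_. ennreal \<delta>" "\<lambda>n. Lp_p p (z n)" sequentially] by (simp add: Limsup_const)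
  then have "ennreal \<delta> \<le> Lp_p p v" using limLp by (rule order_trans)
  then have vL: "Lp_p p v \<noteq> 0" using \<delta> by auto
  have limV2: "limsup (\<lambda>n. kpow logm p (z n)) \<le> kpow logm p v"
    by (rule limsup_kform_logm[OF p1 z(1) lims(4) limz limLp, of B]) (use B(2)[OF z(1) zM] in auto)
  have main: "J (\<lambda>x. t * v x) \<le> c0" if t: "t \<ge> 0" for t
  proof (rule field_le_epsilon)
    fix e :: real assume e: "e > 0"
    \<comment> \<open>The sum of the coefficients with which the error \<open>\<eta>\<close> enters:
      twice through \<open>wnorm\<close>, twice through \<open>logV\<close>, once through the
      primitive and once through the level of the minimizing sequence.\<close>
    define D where "D = t powr p * (2 / p) + t powr (2 * p) * (2 / (2 * p)) + 2"
    have D: "D \<ge> 2" using p1 by (simp add: D_def)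
    define \<eta> where "\<eta> = e / D"
    have \<eta>: "\<eta> > 0" using e D by (simp add: \<eta>_def)
    have limF: "limsup (\<lambda>n. \<integral>\<^sup>+x. ennreal (F (t * z n x)) \<partial>lborel) \<le> (\<integral>\<^sup>+x. ennreal (F (t * v x)) \<partial>lborel)"
    proof -
      define M' where "M' = t powr p * M"
      have M': "M' \<ge> 0" using M by (simp add: M'_def)
      obtain a C1 where a: "a > 0" "\<And>u::'a \<Rightarrow> real. u \<in> borel_measurable borel \<Longrightarrow> Lp_p p u + gag p u \<le> ennreal M' \<Longrightarrow>
          (\<integral>\<^sup>+x. ennreal (expw p a (u x)) \<partial>lborel) \<le> ennreal C1"
        using Trudinger_Moser_expw[OF p1 M', where 'a='a] by blast
      have tz: "inX p (\<lambda>x. t * z n x)" for n by (rule inX_scale[OF p1 z(1)])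
      have tA: "Lp_p p (\<lambda>x. t * z n x) + gag p (\<lambda>x. t * z n x) \<le> ennreal M'" for n
        unfolding inX_energy_eq_wnorm[OF tz] wnorm_scale[OF inX_D(1)[OF z(1)]] z(2) using t by (simp add: M'_def)
      show ?thesis
      proof (rule limsup_nn_integral_tight[OF p1 a(1) F_continuous Fnonneg F_eps'[OF a(1)], where w = "\<lambda>n x. t * z n x" and v = "\<lambda>x. t * v x" and C = "\<bar>C1\<bar>" and L = "(2 * t) powr p * L"])
        show "(\<integral>\<^sup>+x. ennreal (expw p a (t * z n x)) \<partial>lborel) \<le> ennreal \<bar>C1\<bar>" for n
          using a(2)[OF inX_D(1)[OF tz] tA] by (rule order_trans) (simp add: ennreal_leI)
        show "(\<lambda>x. t * z n x) \<in> borel_measurable borel" for n by (rule inX_D(1)[OF tz])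
        show "AE x in lborel. (\<lambda>n. t * z n x) \<longlonglongrightarrow> t * v x" using limz by eventually_elim (intro tendsto_intros)
        show "logmoment p (\<lambda>x. t * z n x) \<le> ennreal ((2 * t) powr p * L)" for n
        proof -
          have "logmoment p (\<lambda>x. t * z n x) \<le> ennreal ((2 * t) powr p) * logmoment p (z n) + ennreal ((2 * 0) powr p) * logmoment p (z n)"
            by (rule logmoment_dominated[OF p1 t _ inX_D(1)[OF z(1)] inX_D(1)[OF z(1)] inX_D(1)[OF tz]]) (use t in \<open>auto simp: abs_mult\<close>)
          also have "\<dots> \<le> ennreal ((2 * t) powr p) * ennreal L" using z(3) by (simp add: mult_left_mono)
          also have "\<dots> = ennreal ((2 * t) powr p * L)" using L0 by (simp add: ennreal_mult)
          finally show ?thesis .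
        qed
      qed (use L0 in auto)
    qed
    have fin: "(\<integral>\<^sup>+x. ennreal (F (t * u x)) \<partial>lborel) < \<infinity>" "(\<integral>x. F (t * u x) \<partial>lborel) = enn2real (\<integral>\<^sup>+x. ennreal (F (t * u x)) \<partial>lborel)"
      if u: "inX p u" for u :: "'a \<Rightarrow> real"
    proof -
      have i: "integrable lborel (\<lambda>x. F (t * u x))" by (rule F_scaled_integrable[OF u])
      show "(\<integral>\<^sup>+x. ennreal (F (t * u x)) \<partial>lborel) < \<infinity>" by (subst nn_integral_eq_integral[OF i]) (use Fnonneg in auto)
      show "(\<integral>x. F (t * u x) \<partial>lborel) = enn2real (\<integral>\<^sup>+x. ennreal (F (t * u x)) \<partial>lborel)"
        by (rule integral_eq_nn_integral) (use Fnonneg i in auto)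
    qed
    have "\<forall>\<^sub>F j in sequentially. enn2real (Lp_p p v) \<le> enn2real (Lp_p p (z j)) + \<eta>"
      by (rule eventually_le_of_le_liminf[OF lims(1) inX_D(2)[OF z(1)] inX_D(2)[OF lims(4)] \<eta>])
    moreover have "\<forall>\<^sub>F j in sequentially. enn2real (gag p v) \<le> enn2real (gag p (z j)) + \<eta>"
      by (rule eventually_le_of_le_liminf[OF lims(2) inX_D(3)[OF z(1)] inX_D(3)[OF lims(4)] \<eta>])
    moreover have "\<forall>\<^sub>F j in sequentially. enn2real (kpow logp p v) \<le> enn2real (kpow logp p (z j)) + \<eta>"
      by (rule eventually_le_of_le_liminf[OF lims(3) kform_finite(1)[OF p1 z(1)] kform_finite(1)[OF p1 lims(4)] \<eta>])
    moreover have "\<forall>\<^sub>F j in sequentially. enn2real (kpow logm p (z j)) \<le> enn2real (kpow logm p v) + \<eta>"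
      by (rule eventually_le_of_limsup_le[OF limV2 kform_finite(2)[OF p1 z(1)] kform_finite(2)[OF p1 lims(4)] \<eta>])
    moreover have "\<forall>\<^sub>F j in sequentially. enn2real (\<integral>\<^sup>+x. ennreal (F (t * z j x)) \<partial>lborel) \<le> enn2real (\<integral>\<^sup>+x. ennreal (F (t * v x)) \<partial>lborel) + \<eta>"
      by (rule eventually_le_of_limsup_le[OF limF fin(1)[OF z(1)] fin(1)[OF lims(4)] \<eta>])
    moreover have "\<forall>\<^sub>F j in sequentially. 1 / real (Suc j) < \<eta>"
      by (rule order_tendstoD(2)[OF _ \<eta>]) (use LIMSEQ_inverse_real_of_nat in \<open>simp add: inverse_eq_divide\<close>)
    ultimately have "\<forall>\<^sub>F j in sequentially. J (\<lambda>x. t * v x) \<le> c0 + e"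
    proof eventually_elim
      case (elim j)
      have n: "wnorm p v \<le> wnorm p (z j) + 2 * \<eta>" using elim(1,2) by (simp add: wnorm_def)
      have l: "logV p v \<le> logV p (z j) + 2 * \<eta>" using elim(3,4) by (simp add: logV_def)
      have i: "(\<integral>x. F (t * z j x) \<partial>lborel) \<le> (\<integral>x. F (t * v x) \<partial>lborel) + \<eta>" using elim(5) fin(2)[OF z(1)] fin(2)[OF lims(4)] by simp
      have "t powr p * (wnorm p v / p) \<le> t powr p * ((wnorm p (z j) + 2 * \<eta>) / p)"
        using n p1 by (intro mult_left_mono divide_right_mono) auto
      also have "\<dots> = t powr p * (wnorm p (z j) / p) + t powr p * (2 / p) * \<eta>" by (simp add: add_divide_distrib distrib_left)
      finally have 1: "t powr p * (wnorm p v / p) \<le> t powr p * (wnorm p (z j) / p) + t powr p * (2 / p) * \<eta>" .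
      have "t powr (2 * p) * (logV p v / (2 * p)) \<le> t powr (2 * p) * ((logV p (z j) + 2 * \<eta>) / (2 * p))"
        using l p1 by (intro mult_left_mono divide_right_mono) auto
      also have "\<dots> = t powr (2 * p) * (logV p (z j) / (2 * p)) + t powr (2 * p) * (2 / (2 * p)) * \<eta>" by (simp add: add_divide_distrib distrib_left)
      finally have 2: "t powr (2 * p) * (logV p v / (2 * p)) \<le> t powr (2 * p) * (logV p (z j) / (2 * p)) + t powr (2 * p) * (2 / (2 * p)) * \<eta>" .
      have at: "\<bar>t\<bar> = t" using t by simp
      have "J (\<lambda>x. t * v x) \<le> J (\<lambda>x. t * z j x) + (t powr p * (2 / p) * \<eta> + t powr (2 * p) * (2 / (2 * p)) * \<eta> + \<eta>)"
        unfolding J_scale[OF lims(4)] J_scale[OF z(1)] at using 1 2 i by linarith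
      also have "\<dots> \<le> (c0 + \<eta>) + (t powr p * (2 / p) * \<eta> + t powr (2 * p) * (2 / (2 * p)) * \<eta> + \<eta>)"
        using zJ[OF t, of j] elim(6) by linarith
      also have "\<dots> = c0 + D * \<eta>" by (simp add: D_def algebra_simps)
      also have "D * \<eta> = e" using D by (simp add: \<eta>_def)
      finally show ?case .
    qed
    then show "J (\<lambda>x. t * v x) \<le> c0 + e" by (simp add: eventually_const_iff)
  qed
  obtain t where t: "t > 0" "J (\<lambda>x. t * v x) > 0" "\<And>s. s \<ge> 0 \<Longrightarrow> J (\<lambda>x. s * v x) \<le> J (\<lambda>x. t * v x)"
    using J_scale_attains_max[OF lims(4) vL] by blast
  \<comment> \<open>The limit itself need not be the maximizer on its ray, so it is rescaled to that
    point.\<close>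
  define g where "g = (\<lambda>x. t * v x)"
  have gX: "inX p g" unfolding g_def by (rule inX_scale[OF p1 lims(4)])
  have "Lp_p p g = ennreal (\<bar>t\<bar> powr p) * Lp_p p v" unfolding g_def by (rule Lp_p_scale[OF v])
  then have gL: "Lp_p p g \<noteq> 0" using vL t(1) by simp
  have gmax: "J (\<lambda>x. s * g x) \<le> J g" if "s \<ge> 0" for s
    using t(3)[of "s * t"] that t(1) by (simp add: g_def mult.assoc)
  have gc: "J g \<le> c0" using main[of t] t(1) by (simp add: g_def)
  have "\<exists>s>0. J g \<le> J (\<lambda>x. s * y x)" if y: "inX p y" "Lp_p p y \<noteq> 0" for y :: "'a \<Rightarrow> real"
  proof -
    obtain s where s: "s > 0" "\<forall>r\<ge>0. J (\<lambda>x. r * y x) \<le> J (\<lambda>x. s * y x)" using J_scale_attains_max[OF y] by blast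
    then have "J (\<lambda>x. s * y x) \<in> C" using y by (auto simp: C_def)
    then have "c0 \<le> J (\<lambda>x. s * y x)" unfolding c0_def by (rule cInf_lower[OF _ bdd])
    then show ?thesis using s(1) gc by (intro exI[of _ s]) linarith
  qed
  note gmin = this
  show ?thesis using gX gL gmax gmin by (intro exI[of _ g] conjI allI impI)
qed

end

section \<open>Criticality\<close>

lemma qderiv_uminus:
  assumes "qderiv \<Phi> u v D"
  shows "qderiv \<Phi> u (\<lambda>x. - v x) (- D)"
  unfolding qderiv_def
proof (intro allI impI)
  fix a b :: "nat \<Rightarrow> real" assume ab: "a \<longlonglongrightarrow> 1" "b \<longlonglongrightarrow> 0" "\<forall>n. b n \<noteq> 0"
  have "(\<lambda>n. - b n) \<longlonglongrightarrow> - 0" by (intro tendsto_minus ab)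
  then have "(\<lambda>n. (\<Phi> (\<lambda>x. a n * u x + - b n * v x) - \<Phi> (\<lambda>x. a n * u x)) / - b n) \<longlonglongrightarrow> D"
    using ab by (intro qderivD[OF assms]) auto
  from tendsto_minus[OF this]
  show "(\<lambda>n. (\<Phi> (\<lambda>x. a n * u x + b n * - v x) - \<Phi> (\<lambda>x. a n * u x)) / b n) \<longlonglongrightarrow> - D" by simp
qed

lemma qderiv_has_real_derivative:
  assumes "qderiv \<Phi> u v D"
  shows "((\<lambda>t. \<Phi> (\<lambda>x. u x + t * v x)) has_real_derivative D) (at 0)"
  unfolding has_field_derivative_iff tendsto_at_iff_sequentially comp_def
proof (intro allI impI)
  fix b :: "nat \<Rightarrow> real" assume b: "\<forall>i. b i \<in> UNIV - {0}" "b \<longlonglongrightarrow> 0"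
  have "(\<lambda>n. (\<Phi> (\<lambda>x. 1 * u x + b n * v x) - \<Phi> (\<lambda>x. 1 * u x)) / b n) \<longlonglongrightarrow> D"
    using b by (intro qderivD[OF assms]) auto
  then show "(\<lambda>n. (\<Phi> (\<lambda>x. u x + b n * v x) - \<Phi> (\<lambda>x. u x + 0 * v x)) / (b n - 0)) \<longlonglongrightarrow> D" by simp
qed

context nonlinearity
begin

text \<open>Continuity along a line, read off from the convergence of the difference
  quotients.\<close>

lemma J_perturb_tendsto:
  fixes w v :: "'a::euclidean_space \<Rightarrow> real"
  assumes w: "inX p w" and v: "inX p v" and e: "e \<longlonglongrightarrow> 0" "\<And>n. e n \<noteq> 0"
  shows "(\<lambda>n. J (\<lambda>x. c * (w x + e n * v x))) \<longlonglongrightarrow> J (\<lambda>x. c * w x)"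
proof -
  define u where "u = (\<lambda>x. c * w x)"
  define y where "y = (\<lambda>x. c * v x)"
  have uy: "inX p u" "inX p y" unfolding u_def y_def by (auto intro: inX_scale[OF p1] w v)
  obtain D where D: "qderiv J u y D" using qderiv_J[OF uy] by blast
  have "(\<lambda>n. (J (\<lambda>x. 1 * u x + e n * y x) - J (\<lambda>x. 1 * u x)) / e n) \<longlonglongrightarrow> D"
    by (intro qderivD[OF D] tendsto_const e)
  then have "(\<lambda>n. (J (\<lambda>x. 1 * u x + e n * y x) - J (\<lambda>x. 1 * u x)) / e n * e n + J u) \<longlonglongrightarrow> D * 0 + J u"
    by (intro tendsto_intros e)
  then have "(\<lambda>n. J (\<lambda>x. u x + e n * y x)) \<longlonglongrightarrow> J u" using e(2) by simp
  moreover have "u x + e n * y x = c * (w x + e n * v x)" for x n by (simp add: u_def y_def algebra_simps)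
  ultimately show ?thesis by (simp add: u_def)
qed

lemma ground_state_derivative_nonneg:
  fixes w v :: "'a::euclidean_space \<Rightarrow> real"
  assumes w: "inX p w" "Lp_p p w \<noteq> 0" and wmax: "\<And>s. s \<ge> 0 \<Longrightarrow> J (\<lambda>x. s * w x) \<le> J w"
    and wmin: "\<And>y::'a \<Rightarrow> real. inX p y \<Longrightarrow> Lp_p p y \<noteq> 0 \<Longrightarrow> \<exists>t>0. J w \<le> J (\<lambda>x. t * y x)"
    and v: "inX p v" and D: "qderiv J w v D"
  shows "D \<ge> 0"
proof -
  define e where "e = (\<lambda>n::nat. 1 / real (Suc n))"
  have e: "e \<longlonglongrightarrow> 0" "\<And>n. e n > 0" using LIMSEQ_inverse_real_of_nat by (simp_all add: e_def inverse_eq_divide)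
  have e0: "e n \<noteq> 0" for n using e(2)[of n] by simp
  define u where "u = (\<lambda>n x. w x + e n * v x)"
  have u: "inX p (u n)" for n unfolding u_def using inX_lin[OF p1 w(1) v, of 1 "e n"] by simp
  have wnpos: "wnorm p y > 0" if "inX p y" "Lp_p p y \<noteq> 0" for y :: "'a \<Rightarrow> real"
  proof -
    have "enn2real (Lp_p p y) > 0" using that inX_D(2)[OF that(1)] by (simp add: enn2real_positive_iff zero_less_iff_neq_zero)
    then show ?thesis by (simp add: wnorm_def add_nonneg_pos)
  qed
  \<comment> \<open>The perturbation is small in p-norm, so it cannot cancel \<open>w\<close>; only
    then does the perturbed function have a maximizer on its ray.\<close>
  have nz: "\<forall>\<^sub>F n in sequentially. Lp_p p (u n) \<noteq> 0"
  proof -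
    have "(\<lambda>n. ennreal ((2 * e n) powr p) * Lp_p p v) \<longlonglongrightarrow> ennreal ((2 * 0) powr p) * Lp_p p v"
    proof (intro tendsto_mult_ennreal tendsto_const tendsto_ennrealI tendsto_powr2 tendsto_mult e)
      show "\<forall>\<^sub>F n in sequentially. 0 \<le> 2 * e n" using e(2) by (intro always_eventually allI) (simp add: less_imp_le)
    qed (use p1 inX_D(2)[OF v] in auto)
    then have "(\<lambda>n. ennreal ((2 * e n) powr p) * Lp_p p v) \<longlonglongrightarrow> 0" by simp
    then have "\<forall>\<^sub>F n in sequentially. ennreal ((2 * e n) powr p) * Lp_p p v < Lp_p p w"
      using w(2) by (intro order_tendstoD(2)) (auto simp: zero_less_iff_neq_zero)
    then show ?thesis
    proof eventually_elim
      case (elim n)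
      have "Lp_p p w \<le> ennreal ((2 * 1) powr p) * Lp_p p (u n) + ennreal ((2 * e n) powr p) * Lp_p p v"
      proof (rule Lp_p_dominated[OF p1 _ _ inX_D(1)[OF u] inX_D(1)[OF v] inX_D(1)[OF w(1)]])
        show "\<bar>w x\<bar> \<le> 1 * \<bar>u n x\<bar> + e n * \<bar>v x\<bar>" for x
        proof -
          have "w x = u n x - e n * v x" by (simp add: u_def)
          then have "\<bar>w x\<bar> \<le> \<bar>u n x\<bar> + \<bar>e n * v x\<bar>" by (metis abs_triangle_ineq4)
          then show ?thesis using e(2)[of n] by (simp add: abs_mult)
        qed
      qed (use e(2)[of n] in auto)
      then show ?case using elim by auto
    qed
  qed
  \<comment> \<open>Where \<open>u n\<close> is null any positive number serves as a placeholder; by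
    \<open>nz\<close> this happens for finitely many \<open>n\<close> only.\<close>
  have "\<exists>t>0. Lp_p p (u n) \<noteq> 0 \<longrightarrow> J w \<le> J (\<lambda>x. t * u n x) \<and> (\<forall>s\<ge>0. J (\<lambda>x. s * u n x) \<le> J (\<lambda>x. t * u n x))" for n
  proof (cases "Lp_p p (u n) = 0")
    case False
    obtain t where t: "t > 0" "\<forall>s\<ge>0. J (\<lambda>x. s * u n x) \<le> J (\<lambda>x. t * u n x)" using J_scale_attains_max[OF u False] by blast
    obtain s where "s > 0" "J w \<le> J (\<lambda>x. s * u n x)" using wmin[OF u False] by blast
    then have "J w \<le> J (\<lambda>x. t * u n x)" using t(2) by (meson less_imp_le order_trans)
    then show ?thesis using t by blast
  qed (use zero_less_one in blast)
  then have "\<exists>t. \<forall>n. t n > 0 \<and> (Lp_p p (u n) \<noteq> 0 \<longrightarrow> J w \<le> J (\<lambda>x. t n * u n x) \<and> (\<forall>s\<ge>0. J (\<lambda>x. s * u n x) \<le> J (\<lambda>x. t n * u n x)))"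
    by (intro choice allI) blast
  then obtain t where t: "\<And>n. t n > 0" "\<And>n. Lp_p p (u n) \<noteq> 0 \<Longrightarrow> J w \<le> J (\<lambda>x. t n * u n x)"
    "\<And>n s. Lp_p p (u n) \<noteq> 0 \<Longrightarrow> s \<ge> 0 \<Longrightarrow> J (\<lambda>x. s * u n x) \<le> J (\<lambda>x. t n * u n x)" by blast
  have strict: "J (\<lambda>x. c * w x) < J w" if c: "c > 0" "c \<noteq> 1" for c
  proof -
    define m where "m = (c + 1) / 2"
    have qc: "min (J (\<lambda>x. min c 1 * w x)) (J (\<lambda>x. max c 1 * w x)) < J (\<lambda>x. m * w x)"
      by (rule J_scale_strict_quasiconcave[OF w(1) wnpos[OF w]]) (use c in \<open>auto simp: m_def min_def max_def\<close>)
    have "min (J (\<lambda>x. min c 1 * w x)) (J (\<lambda>x. max c 1 * w x)) = min (J (\<lambda>x. c * w x)) (J w)"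
      by (cases "c \<le> 1") (simp_all add: min.commute)
    moreover have "J (\<lambda>x. m * w x) \<le> J w" using c by (intro wmax) (auto simp: m_def)
    ultimately show ?thesis using qc by linarith
  qed
  \<comment> \<open>Applied with \<open>1 + d\<close> and \<open>1 - d\<close>: if a maximizer lay
    beyond such a point, the value there would exceed the smaller of the values at 1 and at the
    maximizer, hence the value at 1, against this inequality.\<close>
  have side: "\<forall>\<^sub>F n in sequentially. J (\<lambda>x. c * u n x) < J (u n)" if c: "c > 0" "c \<noteq> 1" for c
  proof -
    obtain r where r: "J (\<lambda>x. c * w x) < r" "r < J w" using dense[OF strict[OF c]] by blast
    have "(\<lambda>n. J (\<lambda>x. c * u n x)) \<longlonglongrightarrow> J (\<lambda>x. c * w x)" unfolding u_def by (rule J_perturb_tendsto[OF w(1) v e(1) e0])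
    then have "\<forall>\<^sub>F n in sequentially. J (\<lambda>x. c * u n x) < r" by (rule order_tendstoD(2)[OF _ r(1)])
    moreover have "(\<lambda>n. J (\<lambda>x. 1 * u n x)) \<longlonglongrightarrow> J (\<lambda>x. 1 * w x)" unfolding u_def by (rule J_perturb_tendsto[OF w(1) v e(1) e0])
    then have "(\<lambda>n. J (u n)) \<longlonglongrightarrow> J w" by simp
    then have "\<forall>\<^sub>F n in sequentially. r < J (u n)" by (rule order_tendstoD(1)[OF _ r(2)])
    ultimately show ?thesis by eventually_elim linarith
  qed
  have tlim: "t \<longlonglongrightarrow> 1"
  proof (rule LIMSEQ_I)
    fix r :: real assume r: "r > 0"
    define d where "d = min (r / 2) (1 / 2)"
    have d: "d > 0" "d < 1" "d < r" using r by (auto simp: d_def)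
    have "\<forall>\<^sub>F n in sequentially. J (\<lambda>x. (1 + d) * u n x) < J (u n)" by (rule side) (use d in auto)
    moreover have "\<forall>\<^sub>F n in sequentially. J (\<lambda>x. (1 - d) * u n x) < J (u n)" by (rule side) (use d in auto)
    ultimately have "\<forall>\<^sub>F n in sequentially. norm (t n - 1) < r" using nz
    proof eventually_elim
      case (elim n)
      have m: "J (u n) \<le> J (\<lambda>x. t n * u n x)" using t(3)[OF elim(3), of 1] by simp
      have wn: "wnorm p (u n) > 0" by (rule wnpos[OF u elim(3)])
      have "t n \<le> 1 + d"
      proof (rule ccontr)
        assume "\<not> t n \<le> 1 + d"
        then have "min (J (\<lambda>x. 1 * u n x)) (J (\<lambda>x. t n * u n x)) < J (\<lambda>x. (1 + d) * u n x)"
          using d by (intro J_scale_strict_quasiconcave[OF u wn]) auto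
        then show False using m elim(1) by simp
      qed
      moreover have "1 - d \<le> t n"
      proof (rule ccontr)
        assume "\<not> 1 - d \<le> t n"
        then have "min (J (\<lambda>x. t n * u n x)) (J (\<lambda>x. 1 * u n x)) < J (\<lambda>x. (1 - d) * u n x)"
          using d t(1) by (intro J_scale_strict_quasiconcave[OF u wn]) auto
        then show False using m elim(2) by simp
      qed
      ultimately show ?case using d by (simp add: abs_less_iff)
    qed
    then show "\<exists>no. \<forall>n\<ge>no. norm (t n - 1) < r" by (simp add: eventually_sequentially)
  qed
  \<comment> \<open>\<open>t n * (w + e n * v) = t n * w + b n * v\<close>, the shape to which
    \<open>qderiv\<close> applies with the moving factor \<open>t n\<close>.\<close>
  define b where "b = (\<lambda>n. t n * e n)"
  have b: "b n > 0" for n using t(1) e(2) by (simp add: b_def)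
  have "b \<longlonglongrightarrow> 1 * 0" unfolding b_def by (intro tendsto_mult tlim e(1))
  then have blim: "b \<longlonglongrightarrow> 0" by simp
  have b0: "b n \<noteq> 0" for n using b[of n] by simp
  have "(\<lambda>n. (J (\<lambda>x. t n * w x + b n * v x) - J (\<lambda>x. t n * w x)) / b n) \<longlonglongrightarrow> D"
    by (rule qderivD[OF D tlim blim b0])
  moreover have "\<forall>\<^sub>F n in sequentially. 0 \<le> (J (\<lambda>x. t n * w x + b n * v x) - J (\<lambda>x. t n * w x)) / b n"
    using nz
  proof eventually_elim
    case (elim n)
    have "(\<lambda>x. t n * w x + b n * v x) = (\<lambda>x. t n * u n x)" by (auto simp: u_def b_def algebra_simps)
    then have "J w \<le> J (\<lambda>x. t n * w x + b n * v x)" using t(2)[OF elim] by simp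
    moreover have "J (\<lambda>x. t n * w x) \<le> J w" using t(1)[of n] by (intro wmax) simp
    ultimately show ?case using b[of n] by simp
  qed
  ultimately show ?thesis by (rule tendsto_lowerbound) simp
qed

lemma exists_critical:
  assumes pN: "p > real DIM('a::euclidean_space)"
  shows "\<exists>w::'a \<Rightarrow> real. inX p w \<and> Lp_p p w \<noteq> 0 \<and> (\<forall>v. inX p v \<longrightarrow> qderiv J w v 0)"
proof -
  obtain w :: "'a \<Rightarrow> real" where w: "inX p w" "Lp_p p w \<noteq> 0" "\<And>s. s \<ge> 0 \<Longrightarrow> J (\<lambda>x. s * w x) \<le> J w"
    "\<And>v::'a \<Rightarrow> real. inX p v \<Longrightarrow> Lp_p p v \<noteq> 0 \<Longrightarrow> \<exists>t>0. J w \<le> J (\<lambda>x. t * v x)"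
    using ground_state[OF pN] by blast
  have "qderiv J w v 0" if v: "inX p v" for v :: "'a \<Rightarrow> real"
  proof -
    obtain D where D: "qderiv J w v D" using qderiv_J[OF w(1) v] by blast
    have v': "inX p (\<lambda>x. - v x)" using inX_scale[OF p1 v, of "- 1"] by simp
    have "D \<ge> 0" by (rule ground_state_derivative_nonneg[OF w v D])
    moreover have "- D \<ge> 0" by (rule ground_state_derivative_nonneg[OF w v' qderiv_uminus[OF D]])
    ultimately show ?thesis using D by simp
  qed
  then show ?thesis using w by blast
qed

end

section \<open>Infinitely many distinct translates\<close>

text \<open>More than half of the mass sits in one ball. The doubled integral states this without
  division in \<open>ennreal\<close>.\<close>

lemma exists_ball_majority:
  fixes w :: "'a::euclidean_space \<Rightarrow> real"
  assumes [measurable]: "w \<in> borel_measurable borel" and L: "Lp_p p w \<noteq> 0" "Lp_p p w < \<infinity>"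
  shows "\<exists>R::nat. Lp_p p w < (\<integral>\<^sup>+x\<in>ball 0 (real R). ennreal (\<bar>w x\<bar> powr p) \<partial>lborel) + (\<integral>\<^sup>+x\<in>ball 0 (real R). ennreal (\<bar>w x\<bar> powr p) \<partial>lborel)"
proof -
  define S where "S = (\<lambda>R::nat. \<integral>\<^sup>+x\<in>ball 0 (real R). ennreal (\<bar>w x\<bar> powr p) \<partial>lborel)"
  have S: "S \<longlonglongrightarrow> Lp_p p w" unfolding S_def Lp_p_def
  proof (rule nn_integral_dominated_convergence[where w = "\<lambda>x. ennreal (\<bar>w x\<bar> powr p)"])
    show "AE x in lborel. (\<lambda>R. ennreal (\<bar>w x\<bar> powr p) * indicator (ball 0 (real R)) x) \<longlonglongrightarrow> ennreal (\<bar>w x\<bar> powr p)"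
    proof (rule AE_I2)
      fix x :: 'a
      have "\<forall>\<^sub>F R in sequentially. ennreal (\<bar>w x\<bar> powr p) * indicator (ball 0 (real R)) x = ennreal (\<bar>w x\<bar> powr p)"
        unfolding eventually_sequentially
      proof (intro exI[of _ "Suc (nat \<lceil>norm x\<rceil>)"] allI impI)
        fix R assume "Suc (nat \<lceil>norm x\<rceil>) \<le> R"
        then have "norm x < real R" by linarith
        then show "ennreal (\<bar>w x\<bar> powr p) * indicator (ball 0 (real R)) x = ennreal (\<bar>w x\<bar> powr p)" by simp
      qed
      then show "(\<lambda>R. ennreal (\<bar>w x\<bar> powr p) * indicator (ball 0 (real R)) x) \<longlonglongrightarrow> ennreal (\<bar>w x\<bar> powr p)"
        by (rule tendsto_eventually)
    qed
  qed (use L in \<open>auto simp: Lp_p_def indicator_def\<close>)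
  have "(\<lambda>R. S R + S R) \<longlonglongrightarrow> Lp_p p w + Lp_p p w" by (intro tendsto_add S)
  moreover have "Lp_p p w < Lp_p p w + Lp_p p w"
  proof -
    obtain r where r: "r \<ge> 0" "Lp_p p w = ennreal r" using L(2) by (cases "Lp_p p w") auto
    then have "r > 0" using L(1) by (cases "r = 0") auto
    then show ?thesis using r by (simp add: ennreal_plus[symmetric] ennreal_less_iff del: ennreal_plus)
  qed
  ultimately have "\<forall>\<^sub>F R in sequentially. Lp_p p w < S R + S R" by (rule order_tendstoD(1))
  then show ?thesis unfolding S_def eventually_sequentially by blast
qed

text \<open>If the two translates agreed almost everywhere, one function would carry more than half
  of its mass in each of two disjoint balls.\<close>

lemma separated_translates_distinct:
  fixes w :: "'a::euclidean_space \<Rightarrow> real"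
  assumes [measurable]: "w \<in> borel_measurable borel"
    and R: "Lp_p p w < (\<integral>\<^sup>+x\<in>ball 0 R. ennreal (\<bar>w x\<bar> powr p) \<partial>lborel) + (\<integral>\<^sup>+x\<in>ball 0 R. ennreal (\<bar>w x\<bar> powr p) \<partial>lborel)"
    and far: "norm (a - b) \<ge> 2 * R"
  shows "\<not> (AE x in lborel. w (x + a) = w (x + b))"
proof
  assume eq: "AE x in lborel. w (x + a) = w (x + b)"
  define S where "S = (\<integral>\<^sup>+x\<in>ball 0 R. ennreal (\<bar>w x\<bar> powr p) \<partial>lborel)"
  have sh: "(\<integral>\<^sup>+x. ennreal (\<bar>w (x + c)\<bar> powr p) * indicator (ball (- c) R) x \<partial>lborel) = S" for c
  proof -
    have "(\<integral>\<^sup>+x. ennreal (\<bar>w (x + c)\<bar> powr p) * indicator (ball (- c) R) x \<partial>lborel)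
      = (\<integral>\<^sup>+x. (\<lambda>x. ennreal (\<bar>w x\<bar> powr p) * indicator (ball 0 R) x) (x + c) \<partial>lborel)"
    proof (intro nn_integral_cong)
      fix x
      have "dist (- c) x = norm (x + c)" by (metis add.commute dist_norm minus_add_distrib norm_minus_cancel diff_conv_add_uminus)
      then show "ennreal (\<bar>w (x + c)\<bar> powr p) * indicator (ball (- c) R) x = (\<lambda>x. ennreal (\<bar>w x\<bar> powr p) * indicator (ball 0 R) x) (x + c)"
        by (simp add: indicator_def)
    qed
    also have "\<dots> = S" unfolding S_def by (rule nn_integral_shift) measurable
    finally show ?thesis .
  qed
  have disj: "indicator (ball (- a) R) x + indicator (ball (- b) R) x \<le> (1::ennreal)" for x
  proof -
    have "\<not> (x \<in> ball (- a) R \<and> x \<in> ball (- b) R)"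
    proof
      assume "x \<in> ball (- a) R \<and> x \<in> ball (- b) R"
      then have "dist (- a) (- b) < 2 * R" using dist_triangle2[of "- a" "- b" x] by simp
      then show False using far by (simp add: dist_norm norm_minus_commute)
    qed
    then show ?thesis by (auto simp: indicator_def)
  qed
  have "S + S = (\<integral>\<^sup>+x. ennreal (\<bar>w (x + a)\<bar> powr p) * indicator (ball (- a) R) x \<partial>lborel) + (\<integral>\<^sup>+x. ennreal (\<bar>w (x + a)\<bar> powr p) * indicator (ball (- b) R) x \<partial>lborel)"
  proof -
    have "(\<integral>\<^sup>+x. ennreal (\<bar>w (x + b)\<bar> powr p) * indicator (ball (- b) R) x \<partial>lborel) = (\<integral>\<^sup>+x. ennreal (\<bar>w (x + a)\<bar> powr p) * indicator (ball (- b) R) x \<partial>lborel)"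
      by (rule nn_integral_cong_AE) (use eq in \<open>eventually_elim, simp\<close>)
    then show ?thesis using sh[of a] sh[of b] by simp
  qed
  also have "\<dots> = (\<integral>\<^sup>+x. ennreal (\<bar>w (x + a)\<bar> powr p) * (indicator (ball (- a) R) x + indicator (ball (- b) R) x) \<partial>lborel)"
    by (simp add: nn_integral_add distrib_left)
  also have "\<dots> \<le> (\<integral>\<^sup>+x. ennreal (\<bar>w (x + a)\<bar> powr p) * 1 \<partial>lborel)" by (intro nn_integral_mono mult_left_mono disj) auto
  also have "\<dots> = Lp_p p w" using Lp_p_shift[of w p a] by (simp add: Lp_p_def)
  finally show False using R by (simp add: S_def)
qed

theorem theorem2:
  fixes s p :: real and f :: "real \<Rightarrow> real"
  assumes s: "0 < s" "s < 1" and p: "p > 2"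
    and dim: "real DIM('a::euclidean_space) = s * p"
    and f1_cont: "continuous_on UNIV f"
    and f1_odd: "\<forall>t. f (- t) = - f t"
    and f1_growth: "subcritical_exp_growth (real DIM('a)) s p f"
    and f1_Fnonneg: "\<forall>t. prim f t \<ge> 0"
    and f2: "((\<lambda>t. f t / (\<bar>t\<bar> powr (p - 2) * t)) \<longlongrightarrow> 0) (at 0)"
    and f3: "\<exists>\<theta>>2 * p. \<forall>t>0. f t * t \<ge> \<theta> * prim f t \<and> \<theta> * prim f t > 0"
    and f4: "\<exists>q>2 * p. \<exists>M1>0. \<forall>t. prim f t \<ge> M1 * \<bar>t\<bar> powr q"
    and f5: "strict_mono_on {0<..} (\<lambda>t. f t / t powr (2 * p - 1))"
  shows "\<exists>U :: nat \<Rightarrow> ('a \<Rightarrow> real).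
           (\<forall>n. critical_point s p f (U n)) \<and>
           (\<forall>m n. m \<noteq> n \<longrightarrow> \<not> (AE x in lborel. U m x = U n x))"
proof -
  have exponent: "real DIM('a) / (real DIM('a) - s) = p / (p - 1)"
  proof -
    have "real DIM('a) - s = s * (p - 1)" using dim by (simp add: algebra_simps)
    then show ?thesis using dim s by simp
  qed
  interpret nonlinearity p f
  proof
    show "\<exists>T. \<forall>t\<ge>T. \<bar>f t\<bar> \<le> exp (\<alpha> * \<bar>t\<bar> powr (p / (p - 1)))" if "\<alpha> > 0" for \<alpha>
      by (rule subcritical_exp_growth_D[OF f1_growth exponent that])
    show "2 * p * prim f t \<le> f t * t" if t: "t > 0" for t
    proof -
      obtain \<theta> where \<theta>: "\<theta> > 2 * p" "\<theta> * prim f t \<le> f t * t" using f3 t by blast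
      have "2 * p * prim f t \<le> \<theta> * prim f t" using \<theta>(1) f1_Fnonneg by (intro mult_right_mono) auto
      then show ?thesis using \<theta>(2) by linarith
    qed
  qed (use assms in auto)
  \<comment> \<open>Here \<open>s < 1\<close> gives \<open>N < p\<close>, the condition under which
    the tent function has finite seminorm.\<close>
  have "s * p < 1 * p" using s p by (intro mult_strict_right_mono) auto
  then have pN: "p > real DIM('a)" using dim by simp
  obtain w :: "'a \<Rightarrow> real" where w: "inX p w" "Lp_p p w \<noteq> 0" and crit: "\<And>v. inX p v \<Longrightarrow> qderiv J w v 0"
    using exists_critical[OF pN] by blast
  obtain R :: nat where R: "Lp_p p w < (\<integral>\<^sup>+x\<in>ball 0 (real R). ennreal (\<bar>w x\<bar> powr p) \<partial>lborel) + (\<integral>\<^sup>+x\<in>ball 0 (real R). ennreal (\<bar>w x\<bar> powr p) \<partial>lborel)"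
    using exists_ball_majority[OF inX_D(1)[OF w(1)] w(2) inX_D(2)[OF w(1)]] by blast
  have trans: "critical_point s p f (\<lambda>x. w (x + a))" for a
    unfolding critical_point_def in_X_iff_inX[OF dim]
  proof (intro conjI allI impI)
    show wa: "inX p (\<lambda>x. w (x + a))" by (rule inX_shift[OF w(1)])
    fix v :: "'a \<Rightarrow> real" assume v: "inX p v"
    \<comment> \<open>The derivative of the energy at the translate in direction \<open>v\<close> is
      the derivative of \<open>J\<close> at \<open>w\<close> in the direction translated
      back.\<close>
    define y where "y = (\<lambda>x. v (x + (- a)))"
    have y: "inX p y" unfolding y_def by (rule inX_shift[OF v])
    have "energy s p f (\<lambda>x. w (x + a) + t * v x) = J (\<lambda>x. w x + t * y x)" for t
    proof -
      have "inX p (\<lambda>x. w (x + a) + t * v x)" using inX_lin[OF p1 wa v, of 1 t] by simp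
      then have "energy s p f (\<lambda>x. w (x + a) + t * v x) = J (\<lambda>x. w (x + a) + t * v x)" by (rule energy_eq_J[OF dim])
      also have "\<dots> = J (\<lambda>x. w (x + a) + t * y (x + a))" by (simp add: y_def)
      also have "\<dots> = J (\<lambda>x. w x + t * y x)"
        using J_shift[OF inX_lin[OF p1 w(1) y, of 1 t], of a] by simp
      finally show ?thesis .
    qed
    then show "((\<lambda>t. energy s p f (\<lambda>x. w (x + a) + t * v x)) has_real_derivative 0) (at 0)"
      using qderiv_has_real_derivative[OF crit[OF y]] by simp
  qed
  obtain e :: 'a where e: "e \<in> Basis" using nonempty_Basis by blast
  \<comment> \<open>Shifts along one unit vector in steps of \<open>2 * R\<close>, so that any two
    of the translated majority balls are disjoint.\<close>
  define \<tau> where "\<tau> = (\<lambda>n::nat. (real n * (2 * real R)) *\<^sub>R e)"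
  have far: "norm (\<tau> m - \<tau> n) \<ge> 2 * real R" if "m \<noteq> n" for m n
  proof -
    have "\<tau> m - \<tau> n = ((real m - real n) * (2 * real R)) *\<^sub>R e" by (simp only: \<tau>_def scaleR_left_diff_distrib left_diff_distrib)
    then have "norm (\<tau> m - \<tau> n) = \<bar>real m - real n\<bar> * (2 * real R)" using e by (simp add: abs_mult)
    moreover have "1 \<le> \<bar>real m - real n\<bar>" using that by linarith
    then have "1 * (2 * real R) \<le> \<bar>real m - real n\<bar> * (2 * real R)" by (rule mult_right_mono) simp
    ultimately show ?thesis by simp
  qed
  show ?thesis
  proof (intro exI[of _ "\<lambda>n x. w (x + \<tau> n)"] conjI allI impI)
    show "critical_point s p f (\<lambda>x. w (x + \<tau> n))" for n by (rule trans)
    show "\<not> (AE x in lborel. w (x + \<tau> m) = w (x + \<tau> n))" if "m \<noteq> n" for m n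
      by (rule separated_translates_distinct[OF inX_D(1)[OF w(1)] R far[OF that]])
  qed
qed

end
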